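(* Let $M$ be a complete equiregular sub-Finsler manifold of homogeneous dimension $\mathcal Q$. Then a measure $\mathfrak m$ on $M$ is bounded if and only if it is locally $\mathcal Q$-Ahlfors regular (with respect to the sub-Finsler distance $\mathsf d$).
   Context: **Sub-Finsler manifolds.** Manifolds are smooth and connected; measures are Borel. A sub-Finsler structure on an $n$-dimensional manifold $M$ consists of a smooth vector bundle morphism $\xi:M\times\mathbb R^k\to TM$ (for some $k\in\mathbb N$) and, for every $q\in M$, a norm $|\cdot|_q$ on the fiber $\{q\}\times\mathbb R^k$, depending smoothly on $q$, such that the set of horizontal vector fields $\mathcal D=\{\xi\circ\sigma:\sigma \text{ smooth section of } M\times\mathbb R^k\}$ is bracket-generating: iterated Lie brackets of elements of $\mathcal D$ span $T_qM$ at every $q\in M$. Let $e_1,\dots,e_k$ be the standard basis of $\mathbb R^k$. Put $X_i(q)=\xi(q,e_i)$, $\mathcal D_q=\mathrm{span}\{X_1(q),\dots,X_k(q)\}$ and $\|v\|_q=\inf\{|w|_q: v=\xi(q,w)\}$ for $v\in\mathcal D_q$. A continuous curve $\gamma:[0,1]\to M$ is admissible if $\dot\gamma$ exists a.e. and $\dot\gamma(t)=\sum_i u_i(t)X_i(\gamma(t))$ for a.e. $t$, for some $u\in L^2([0,1];\mathbb R^k)$; its length is $\ell(\gamma)=\int_0^1\|\dot\gamma(t)\|_{\gamma(t)}\,dt$. The sub-Finsler distance $\mathsf d(q_0,q_1)$ is the infimum of $\ell(\gamma)$ over admissible curves $\gamma$ with $\gamma(0)=q_0$ and $\gamma(1)=q_1$.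 $M$ is complete if the metric space $(M,\mathsf d)$ is complete. **Equiregularity and homogeneous dimension.** Let $\mathcal D^1=\mathcal D$, $\mathcal D^{j+1}=\mathcal D^j+[\mathcal D,\mathcal D^j]$, $\mathcal D^j_q=\{X(q):X\in\mathcal D^j\}$, $n_j(q)=\dim\mathcal D^j_q$, $n_0(q)=0$, and let $s(q)$ be the least integer with $\mathcal D_q^{s(q)}=T_qM$. The growth vector at $q$ is $(n_1(q),\dots,n_{s(q)}(q))$; $M$ is equiregular if every point has a neighborhood where the growth vector is constant. The homogeneous dimension at $q$ is $\mathcal Q(q)=\sum_{i=1}^{s(q)}i\,(n_i(q)-n_{i-1}(q))$; it is a constant $\mathcal Q$ when $M$ is equiregular. **Bounded measures.** Let $\mathscr L^n$ be the Lebesgue measure on $\mathbb R^n$. A Borel measure $\mathfrak m$ on $M$ is bounded if, for every coordinate chart $\psi:U\to\mathbb R^n$ of $M$, the push-forward $\psi_\#\mathfrak m$ (of $\mathfrak m$ restricted to $U$, as a measure on $\psi(U)$) is absolutely continuous with respect to $\mathscr L^n$ and $\psi_\#\mathfrak m=\rho\,\mathscr L^n$ with $c\le\rho\le C$ $\mathscr L^n$-a.e. (on $\psi(U)$), for some positive constants $C\ge c>0$ depending on the chart. **Ahlfors regularity.** Let $(X,\mathsf d,\mathfrak m)$ be a metric measure space, let $\mathcal Q>1$, and let $B(p,r)$ denote the metric ball of center $p$ and radius $r$. The measure $\mathfrak m$ is locally $\mathcal Q$-Ahlfors regular if for every compact $A\subset X$ there are $C\ge1$ and $r_0\in(0,\mathrm{diam}\,X]$,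 depending on $A$, such that $C^{-1}r^{\mathcal Q}\le\mathfrak m(B(p,r))\le Cr^{\mathcal Q}$ for all $p\in A$, $r\in(0,r_0)$.
   Formalization: Boundedness of a measure is tested only on coordinate charts with relatively compact domain that extend past its closure (over all charts no measure is bounded), and admissible curves are also required to be absolutely continuous (otherwise the distance d vanishes). *)

theory Defs
  imports "HOL-Analysis.Analysis" "HOL-Library.Function_Algebras"
begin

primrec C_on :: "nat \<Rightarrow> 'e::real_normed_vector set \<Rightarrow> ('e \<Rightarrow> 'f::real_normed_vector) \<Rightarrow> bool"
  where
    "C_on 0 S f \<longleftrightarrow> continuous_on S f"
  | "C_on (Suc k) S f \<longleftrightarrow>
       (\<forall>x\<in>S. f differentiable (at x)) \<and> (\<forall>v. C_on k S (\<lambda>x. frechet_derivative f (at x) v))"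

text \<open>Only used for open subsets of finite-dimensional spaces, where it is the usual
  \<open>C\<^sup>\<infinity>\<close> condition.\<close>

definition smooth_on :: "'e::real_normed_vector set \<Rightarrow> ('e \<Rightarrow> 'f::real_normed_vector) \<Rightarrow> bool"
  where "smooth_on S f \<longleftrightarrow> (\<forall>k. C_on k S f)"

text \<open>The manifold \<open>M\<close> is the whole type \<open>'a\<close>, and its dimension is \<open>CARD('n)\<close>. A chart is a
  pair of a domain and a map; values of the map outside the domain are irrelevant.\<close>

type_synonym ('a, 'n) chart = "'a set \<times> ('a \<Rightarrow> real ^ 'n)"

definition chart_inv :: "('a, 'n) chart \<Rightarrow> real ^ 'n \<Rightarrow> 'a"
  where "chart_inv c = the_inv_into (fst c) (snd c)"

definition chart_image :: "('a, 'n) chart \<Rightarrow> (real ^ 'n) set"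
  where "chart_image c = snd c ` fst c"

definition is_chart :: "('a::topological_space, 'n::finite) chart \<Rightarrow> bool"
  where "is_chart c \<longleftrightarrow>
    open (fst c) \<and> open (chart_image c) \<and>
    homeomorphism (fst c) (chart_image c) (snd c) (chart_inv c)"

definition transition :: "('a, 'n) chart \<Rightarrow> ('a, 'n) chart \<Rightarrow> real ^ 'n \<Rightarrow> real ^ 'n"
  where "transition c c' = snd c' \<circ> chart_inv c"

definition compatible :: "('a, 'n::finite) chart \<Rightarrow> ('a, 'n) chart \<Rightarrow> bool"
  where "compatible c c' \<longleftrightarrow>
    smooth_on (snd c ` (fst c \<inter> fst c')) (transition c c') \<and>
    smooth_on (snd c' ` (fst c \<inter> fst c')) (transition c' c)"

definition smooth_atlas :: "('a::topological_space, 'n::finite) chart set \<Rightarrow> bool"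
  where "smooth_atlas \<A> \<longleftrightarrow>
    (\<forall>c\<in>\<A>. is_chart c) \<and> (\<Union>c\<in>\<A>. fst c) = UNIV \<and> (\<forall>c\<in>\<A>. \<forall>c'\<in>\<A>. compatible c c')"

text \<open>The coordinate charts of the manifold: the maximal atlas containing \<open>\<A>\<close>.\<close>

definition charts :: "('a::topological_space, 'n::finite) chart set \<Rightarrow> ('a, 'n) chart set"
  where "charts \<A> = {c. is_chart c \<and> (\<forall>c'\<in>\<A>. compatible c c')}"

definition charts_at :: "('a::topological_space, 'n::finite) chart set \<Rightarrow> 'a \<Rightarrow> ('a, 'n) chart set"
  where "charts_at \<A> q = {c \<in> charts \<A>. q \<in> fst c}"

definition smooth_map ::
    "('a::topological_space, 'n::finite) chart set \<Rightarrow> ('a \<Rightarrow> 'f::real_normed_vector) \<Rightarrow> bool"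
  where "smooth_map \<A> f \<longleftrightarrow> (\<forall>c\<in>charts \<A>. smooth_on (chart_image c) (f \<circ> chart_inv c))"

text \<open>A tangent vector at \<open>q\<close> is the family of its coordinate vectors in all charts around \<open>q\<close>,
  which transform by the differentials of the transition maps. The value in all other charts is
  fixed to be \<open>0\<close>, so that the linear structure of \<open>T\<^sub>qM\<close> is the pointwise one.\<close>

type_synonym ('a, 'n) tangent = "('a, 'n) chart \<Rightarrow> real ^ 'n"

definition tangent_space ::
    "('a::topological_space, 'n::finite) chart set \<Rightarrow> 'a \<Rightarrow> ('a, 'n) tangent set"
  where "tangent_space \<A> q =
    {v. (\<forall>c. c \<notin> charts_at \<A> q \<longrightarrow> v c = 0) \<and>
        (\<forall>c\<in>charts_at \<A> q. \<forall>c'\<in>charts_at \<A> q.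
           v c' = frechet_derivative (transition c c') (at (snd c q)) (v c))}"

definition tscale :: "real \<Rightarrow> ('a, 'n::finite) tangent \<Rightarrow> ('a, 'n) tangent"
  where "tscale r v = (\<lambda>c. r *\<^sub>R v c)"

lemma vector_space_tscale: "vector_space (tscale :: real \<Rightarrow> ('a, 'n::finite) tangent \<Rightarrow> _)"
  by unfold_locales (simp_all add: tscale_def fun_eq_iff algebra_simps)

abbreviation tspan :: "('a, 'n::finite) tangent set \<Rightarrow> ('a, 'n) tangent set"
  where "tspan \<equiv> module.span tscale"

abbreviation tdim :: "('a, 'n::finite) tangent set \<Rightarrow> nat"
  where "tdim \<equiv> vector_space.dim tscale"

type_synonym ('a, 'n) vfield = "'a \<Rightarrow> ('a, 'n) tangent"

definition vfscale :: "real \<Rightarrow> ('a, 'n::finite) vfield \<Rightarrow> ('a, 'n) vfield"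
  where "vfscale r X = (\<lambda>q. tscale r (X q))"

lemma vector_space_vfscale: "vector_space (vfscale :: real \<Rightarrow> ('a, 'n::finite) vfield \<Rightarrow> _)"
  by unfold_locales (simp_all add: vfscale_def tscale_def fun_eq_iff algebra_simps)

abbreviation vfspan :: "('a, 'n::finite) vfield set \<Rightarrow> ('a, 'n) vfield set"
  where "vfspan \<equiv> module.span vfscale"

text \<open>In coordinates, \<open>[X, Y] = DY \<cdot> X - DX \<cdot> Y\<close>.\<close>

definition lie_bracket ::
    "('a::topological_space, 'n::finite) chart set \<Rightarrow>
     ('a, 'n) vfield \<Rightarrow> ('a, 'n) vfield \<Rightarrow> ('a, 'n) vfield"
  where "lie_bracket \<A> X Y = (\<lambda>q c.
    if c \<in> charts_at \<A> q then
      frechet_derivative (\<lambda>x. Y (chart_inv c x) c) (at (snd c q)) (X q c) -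
      frechet_derivative (\<lambda>x. X (chart_inv c x) c) (at (snd c q)) (Y q c)
    else 0)"

inductive_set iterated_brackets ::
    "('a::topological_space, 'n::finite) chart set \<Rightarrow> ('a, 'n) vfield set \<Rightarrow> ('a, 'n) vfield set"
  for \<A> and D
  where
    base: "X \<in> D \<Longrightarrow> X \<in> iterated_brackets \<A> D"
  | bracket: "X \<in> iterated_brackets \<A> D \<Longrightarrow> Y \<in> iterated_brackets \<A> D \<Longrightarrow>
      lie_bracket \<A> X Y \<in> iterated_brackets \<A> D"

text \<open>Morphisms \<open>M \<times> \<real>\<^sup>k \<rightarrow> TM\<close> of smooth vector bundles; smoothness is read in the charts of \<open>TM\<close>
  induced by the charts of \<open>M\<close>.\<close>

definition bundle_morphism ::
    "('a::topological_space, 'n::finite) chart set \<Rightarrow>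
     ('a \<Rightarrow> real ^ 'k \<Rightarrow> ('a, 'n) tangent) \<Rightarrow> bool"
  where "bundle_morphism \<A> \<xi> \<longleftrightarrow>
    (\<forall>q. Vector_Spaces.linear scaleR tscale (\<xi> q) \<and> range (\<xi> q) \<subseteq> tangent_space \<A> q) \<and>
    (\<forall>c\<in>charts \<A>. smooth_on (chart_image c \<times> UNIV) (\<lambda>(x, w). \<xi> (chart_inv c x) w c))"

definition is_norm :: "('v::real_vector \<Rightarrow> real) \<Rightarrow> bool"
  where "is_norm N \<longleftrightarrow>
    (\<forall>v. 0 \<le> N v) \<and> (\<forall>v. N v = 0 \<longleftrightarrow> v = 0) \<and>
    (\<forall>r v. N (r *\<^sub>R v) = \<bar>r\<bar> * N v) \<and> (\<forall>v w. N (v + w) \<le> N v + N w)"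

definition horizontal_fields ::
    "('a::topological_space, 'n::finite) chart set \<Rightarrow>
     ('a \<Rightarrow> real ^ 'k \<Rightarrow> ('a, 'n) tangent) \<Rightarrow> ('a, 'n) vfield set"
  where "horizontal_fields \<A> \<xi> = {(\<lambda>q. \<xi> q (\<sigma> q)) | \<sigma>. smooth_map \<A> \<sigma>}"

definition bracket_generating ::
    "('a::topological_space, 'n::finite) chart set \<Rightarrow> ('a, 'n) vfield set \<Rightarrow> bool"
  where "bracket_generating \<A> D \<longleftrightarrow>
    (\<forall>q. tspan {X q | X. X \<in> iterated_brackets \<A> D} = tangent_space \<A> q)"

text \<open>\<open>N q\<close> is the norm \<open>|\<cdot>|\<^sub>q\<close> on the fiber over \<open>q\<close>. Smooth dependence on \<open>q\<close> means smoothness of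
  \<open>q \<mapsto> |w|\<^sub>q\<close> for each fixed \<open>w\<close>; the individual norms need not be smooth away from \<open>0\<close>.\<close>

definition sub_finsler_manifold ::
    "('a::{t2_space, second_countable_topology}, 'n::finite) chart set \<Rightarrow>
     ('a \<Rightarrow> real ^ 'k \<Rightarrow> ('a, 'n) tangent) \<Rightarrow> ('a \<Rightarrow> real ^ 'k \<Rightarrow> real) \<Rightarrow> bool"
  where "sub_finsler_manifold \<A> \<xi> N \<longleftrightarrow>
    connected (UNIV :: 'a set) \<and> smooth_atlas \<A> \<and> bundle_morphism \<A> \<xi> \<and>
    (\<forall>q. is_norm (N q)) \<and> (\<forall>w. smooth_map \<A> (\<lambda>q. N q w)) \<and>
    bracket_generating \<A> (horizontal_fields \<A> \<xi>)"

definition generating_field :: "('a \<Rightarrow> real ^ 'k \<Rightarrow> ('a, 'n) tangent) \<Rightarrow> 'k \<Rightarrow> ('a, 'n) vfield"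
  where "generating_field \<xi> i = (\<lambda>q. \<xi> q (axis i 1))"

definition horizontal_norm ::
    "('a \<Rightarrow> real ^ 'k \<Rightarrow> ('a, 'n) tangent) \<Rightarrow> ('a \<Rightarrow> real ^ 'k \<Rightarrow> real) \<Rightarrow>
     'a \<Rightarrow> ('a, 'n) tangent \<Rightarrow> real"
  where "horizontal_norm \<xi> N q v = Inf {N q w | w. v = \<xi> q w}"

definition has_velocity ::
    "('a::topological_space, 'n::finite) chart set \<Rightarrow>
     (real \<Rightarrow> 'a) \<Rightarrow> ('a, 'n) tangent \<Rightarrow> real \<Rightarrow> bool"
  where "has_velocity \<A> \<gamma> v t \<longleftrightarrow>
    v \<in> tangent_space \<A> (\<gamma> t) \<and>
    (\<forall>c\<in>charts_at \<A> (\<gamma> t). ((snd c \<circ> \<gamma>) has_vector_derivative v c) (at t within {0..1}))"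

definition velocity ::
    "('a::topological_space, 'n::finite) chart set \<Rightarrow> (real \<Rightarrow> 'a) \<Rightarrow> real \<Rightarrow> ('a, 'n) tangent"
  where "velocity \<A> \<gamma> t = (THE v. has_velocity \<A> \<gamma> v t)"

definition ac_on :: "real \<Rightarrow> real \<Rightarrow> (real \<Rightarrow> 'e::metric_space) \<Rightarrow> bool"
  where "ac_on a b g \<longleftrightarrow>
    (\<forall>\<epsilon>>0. \<exists>\<delta>>0. \<forall>I. finite I \<and> (\<forall>(s, t)\<in>I. a \<le> s \<and> s < t \<and> t \<le> b) \<and>
       disjoint_family_on (\<lambda>(s, t). {s<..<t}) I \<and> (\<Sum>(s, t)\<in>I. t - s) < \<delta> \<longrightarrow>
       (\<Sum>(s, t)\<in>I. dist (g s) (g t)) < \<epsilon>)"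

text \<open>Absolute continuity in charts is part of admissibility. A continuous curve that is only
  required to have a velocity almost everywhere could move along a flow line, parametrized by the
  Cantor function, at zero cost.\<close>

definition admissible ::
    "('a::topological_space, 'n::finite) chart set \<Rightarrow>
     ('a \<Rightarrow> real ^ 'k \<Rightarrow> ('a, 'n) tangent) \<Rightarrow> (real \<Rightarrow> 'a) \<Rightarrow> bool"
  where "admissible \<A> \<xi> \<gamma> \<longleftrightarrow>
    continuous_on {0..1} \<gamma> \<and>
    (\<forall>c\<in>charts \<A>. \<forall>a b. 0 \<le> a \<and> a \<le> b \<and> b \<le> 1 \<and> \<gamma> ` {a..b} \<subseteq> fst c \<longrightarrow>
       ac_on a b (snd c \<circ> \<gamma>)) \<and>
    (\<exists>u :: real \<Rightarrow> real ^ 'k.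
       u \<in> borel_measurable (lebesgue_on {0..1}) \<and>
       integrable (lebesgue_on {0..1}) (\<lambda>t. (norm (u t))\<^sup>2) \<and>
       (AE t in lebesgue_on {0..1}.
          has_velocity \<A> \<gamma> (\<Sum>i\<in>UNIV. tscale (u t $ i) (generating_field \<xi> i (\<gamma> t))) t))"

definition curve_length ::
    "('a::topological_space, 'n::finite) chart set \<Rightarrow>
     ('a \<Rightarrow> real ^ 'k \<Rightarrow> ('a, 'n) tangent) \<Rightarrow> ('a \<Rightarrow> real ^ 'k \<Rightarrow> real) \<Rightarrow> (real \<Rightarrow> 'a) \<Rightarrow> ennreal"
  where "curve_length \<A> \<xi> N \<gamma> =
    (\<integral>\<^sup>+t. ennreal (horizontal_norm \<xi> N (\<gamma> t) (velocity \<A> \<gamma> t)) \<partial>lebesgue_on {0..1})"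

text \<open>The infimum is finite on a sub-Finsler manifold by the Chow-Rashevskii theorem; it is
  converted to a real number to match the locale \<open>Metric_space\<close>.\<close>

definition sf_dist ::
    "('a::topological_space, 'n::finite) chart set \<Rightarrow>
     ('a \<Rightarrow> real ^ 'k \<Rightarrow> ('a, 'n) tangent) \<Rightarrow> ('a \<Rightarrow> real ^ 'k \<Rightarrow> real) \<Rightarrow> 'a \<Rightarrow> 'a \<Rightarrow> real"
  where "sf_dist \<A> \<xi> N p q = enn2real
    (INF \<gamma>\<in>{\<gamma>. admissible \<A> \<xi> \<gamma> \<and> \<gamma> 0 = p \<and> \<gamma> 1 = q}. curve_length \<A> \<xi> N \<gamma>)"

definition sf_complete ::
    "('a::topological_space, 'n::finite) chart set \<Rightarrow>
     ('a \<Rightarrow> real ^ 'k \<Rightarrow> ('a, 'n) tangent) \<Rightarrow> ('a \<Rightarrow> real ^ 'k \<Rightarrow> real) \<Rightarrow> bool"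
  where "sf_complete \<A> \<xi> N \<longleftrightarrow> Metric_space.mcomplete UNIV (sf_dist \<A> \<xi> N)"

text \<open>The value at \<open>0\<close> encodes the convention \<open>n\<^sub>0 = 0\<close>. The bracket \<open>[D, D\<^sup>j]\<close> of two spaces of
  vector fields is the linear span of the brackets of their elements.\<close>

fun flag ::
    "('a::topological_space, 'n::finite) chart set \<Rightarrow> ('a, 'n) vfield set \<Rightarrow> nat \<Rightarrow>
     ('a, 'n) vfield set"
  where
    "flag \<A> D 0 = {0}"
  | "flag \<A> D (Suc 0) = D"
  | "flag \<A> D (Suc (Suc j)) =
       {X + Y | X Y. X \<in> flag \<A> D (Suc j) \<and>
          Y \<in> vfspan {lie_bracket \<A> V W | V W. V \<in> D \<and> W \<in> flag \<A> D (Suc j)}}"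

definition flag_at ::
    "('a::topological_space, 'n::finite) chart set \<Rightarrow>
     ('a \<Rightarrow> real ^ 'k \<Rightarrow> ('a, 'n) tangent) \<Rightarrow> nat \<Rightarrow> 'a \<Rightarrow> ('a, 'n) tangent set"
  where "flag_at \<A> \<xi> j q = {X q | X. X \<in> flag \<A> (horizontal_fields \<A> \<xi>) j}"

definition flag_dim ::
    "('a::topological_space, 'n::finite) chart set \<Rightarrow>
     ('a \<Rightarrow> real ^ 'k \<Rightarrow> ('a, 'n) tangent) \<Rightarrow> nat \<Rightarrow> 'a \<Rightarrow> nat"
  where "flag_dim \<A> \<xi> j q = tdim (flag_at \<A> \<xi> j q)"

definition step ::
    "('a::topological_space, 'n::finite) chart set \<Rightarrow>
     ('a \<Rightarrow> real ^ 'k \<Rightarrow> ('a, 'n) tangent) \<Rightarrow> 'a \<Rightarrow> nat"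
  where "step \<A> \<xi> q = (LEAST j. flag_at \<A> \<xi> j q = tangent_space \<A> q)"

definition growth_vector ::
    "('a::topological_space, 'n::finite) chart set \<Rightarrow>
     ('a \<Rightarrow> real ^ 'k \<Rightarrow> ('a, 'n) tangent) \<Rightarrow> 'a \<Rightarrow> nat list"
  where "growth_vector \<A> \<xi> q = map (\<lambda>j. flag_dim \<A> \<xi> j q) [1..<Suc (step \<A> \<xi> q)]"

definition equiregular ::
    "('a::topological_space, 'n::finite) chart set \<Rightarrow>
     ('a \<Rightarrow> real ^ 'k \<Rightarrow> ('a, 'n) tangent) \<Rightarrow> bool"
  where "equiregular \<A> \<xi> \<longleftrightarrow>
    (\<forall>q. \<exists>U. open U \<and> q \<in> U \<and> (\<forall>p\<in>U. growth_vector \<A> \<xi> p = growth_vector \<A> \<xi> q))"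

definition homogeneous_dim ::
    "('a::topological_space, 'n::finite) chart set \<Rightarrow>
     ('a \<Rightarrow> real ^ 'k \<Rightarrow> ('a, 'n) tangent) \<Rightarrow> 'a \<Rightarrow> real"
  where "homogeneous_dim \<A> \<xi> q =
    (\<Sum>i = 1..step \<A> \<xi> q. real i * (real (flag_dim \<A> \<xi> i q) - real (flag_dim \<A> \<xi> (i - 1) q)))"

text \<open>Constants that are uniform over the whole domain of a chart only make sense for charts that
  extend past the closure of their domain: composing a chart with a diffeomorphism of its image
  whose Jacobian is unbounded would destroy any such bound, for every measure.\<close>

definition precompact_charts ::
    "('a::topological_space, 'n::finite) chart set \<Rightarrow> ('a, 'n) chart set"
  where "precompact_charts \<A> =
    {c \<in> charts \<A>. compact (closure (fst c)) \<and>
       (\<exists>c'\<in>charts \<A>. closure (fst c) \<subseteq> fst c' \<and> (\<forall>q\<in>fst c. snd c q = snd c' q))}"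

definition bounded_measure ::
    "('a::topological_space, 'n::finite) chart set \<Rightarrow> 'a measure \<Rightarrow> bool"
  where "bounded_measure \<A> m \<longleftrightarrow>
    (\<forall>c\<in>precompact_charts \<A>.
       let pushforward = distr (restrict_space m (fst c)) (restrict_space borel (chart_image c)) (snd c);
           leb = restrict_space lborel (chart_image c)
       in absolutely_continuous leb pushforward \<and>
          (\<exists>\<rho> \<in> borel_measurable leb.
             pushforward = density leb (\<lambda>x. ennreal (\<rho> x)) \<and>
             (\<exists>c\<^sub>0 C\<^sub>0 :: real. 0 < c\<^sub>0 \<and> c\<^sub>0 \<le> C\<^sub>0 \<and> (AE x in leb. c\<^sub>0 \<le> \<rho> x \<and> \<rho> x \<le> C\<^sub>0))))"

definition locally_ahlfors_regular ::
    "'a set \<Rightarrow> ('a \<Rightarrow> 'a \<Rightarrow> real) \<Rightarrow> real \<Rightarrow> 'a measure \<Rightarrow> bool"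
  where "locally_ahlfors_regular X d Q m \<longleftrightarrow>
    (\<forall>A. compactin (Metric_space.mtopology X d) A \<longrightarrow>
       (\<exists>C\<ge>1. \<exists>r\<^sub>0>0. ennreal r\<^sub>0 \<le> (SUP x\<in>X. SUP y\<in>X. ennreal (d x y)) \<and>
          (\<forall>p\<in>A. \<forall>r. 0 < r \<and> r < r\<^sub>0 \<longrightarrow>
             ennreal (inverse C * r powr Q) \<le> emeasure m (Metric_space.mball X d p r) \<and>
             emeasure m (Metric_space.mball X d p r) \<le> ennreal (C * r powr Q))))"

end

theory Submission
  imports Defs "HOL-Library.Sublist" "HOL-Library.Multiset"
begin

text \<open>By equiregularity, iterated brackets of the generating fields form a smooth frame near every point,
 adapted to the flag. In privileged coordinates for such a frame, whose weights are the lengths of the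
 brackets, a ball of radius \<open>r\<close> is comparable to a box with sides \<open>r ^ w j\<close>. An admissible curve of
 length \<open>r\<close> stays in such a box because a coordinate of weight \<open>w\<close> has horizontal derivatives of weight
 \<open>w - 1\<close>. Conversely, concatenated commutator paths reach every point of a box: by the Chen-Fliess
 expansion their end point map is a small perturbation of the identity in rescaled coordinates, and
 Brouwer's fixed point theorem applies. Hence the Lebesgue measures of the charts are locally
 \<open>Q\<close>-Ahlfors regular, and so is every bounded measure. Conversely, two measures that give comparable
 mass to small balls are comparable on open sets, by a Vitali covering argument. Therefore an Ahlfors
 regular measure has a Radon-Nikodym density that is bounded above and below.\<close>

section \<open>Smooth functions\<close>

text \<open>The obstacle is uniformity. Ahlfors regularity on compact sets needs constants that do
  not depend on the centre \<open>p\<close> of the ball, while privileged coordinates depend on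
  \<open>p\<close>. Hence the bracket words \<open>J\<close> are chosen once, at a single point, and
  the constant dimensions of the flag keep them adapted on a neighbourhood \<open>Om\<close>. The
  coordinates \<open>pf j p\<close> at all \<open>p\<close> come from one polynomial recipe with
  coefficients bounded for \<open>p\<close> in a compact set. The paths contain roots of their
  parameters, so the end point map is merely continuous in them. This is why a fixed point theorem
  is used rather than an inverse function theorem. The same argument shows that a box lies in the
  image of the coordinate map, which the lower volume estimate needs. The exponent arises as the sum
  of the weights \<open>length (J j)\<close>: it is the degree of the volume of a box and, after
  grouping by weight, the homogeneous dimension. The speed of an admissible curve is not known to be
  measurable, so its length is a lower integral, estimated through measurable minorants.\<close>

declare C_on.simps(2) [simp del]

lemma C_on_subset: "C_on k S f ==> T \<subseteq> S ==> C_on k T f"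
 by (induction k arbitrary: f) (auto simp: C_on.simps(2) intro: continuous_on_subset)

lemma C_on_cong:
 assumes "open S" "\<And>x. x \<in> S ==> f x = g x" "C_on k S f"
 shows "C_on k S g" using assms(2,3) proof (induction k arbitrary: f g)
 case 0
 then show ?case by simp
next
 case (Suc k)
 have d: "g differentiable (at x)" if "x \<in> S" for x proof -
  from Suc.prems(2) that obtain D where "(f has_derivative D) (at x)"
   unfolding C_on.simps(2) differentiable_def by blast
  then have "(g has_derivative D) (at x)"
   by (rule has_derivative_transform_within_open[OF _ assms(1) that]) (use Suc.prems(1) in auto)
  then show ?thesis by (auto simp: differentiable_def)
 qed
 have "frechet_derivative f (at x) = frechet_derivative g (at x)" if "x \<in> S" for x
  using Suc.prems that assms(1) unfolding C_on.simps(2)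
  by (intro frechet_derivative_transform_within_open) auto
 then show ?case
  using d Suc.prems(2) Suc.IH[of "\<lambda>x. frechet_derivative f (at x) _" "\<lambda>x. frechet_derivative g (at x) _"]
  unfolding C_on.simps(2) by simp
qed

lemma C_on_Suc_imp: "C_on (Suc k) S f ==> C_on k S f" proof (induction k arbitrary: f)
 case 0
 then show ?case unfolding C_on.simps
  by (blast intro: continuous_at_imp_continuous_on differentiable_imp_continuous_within)
next
 case (Suc k)
 from Suc.prems have "\<forall>x\<in>S. f differentiable at x"
   and "\<forall>v. C_on (Suc k) S (\<lambda>x. frechet_derivative f (at x) v)"
  unfolding C_on.simps(2)[of "Suc k"] by blast+
 then show ?case using Suc.IH unfolding C_on.simps(2)[of k] by blast
qed

text \<open>Lets the inductions over the order work with an explicit formula \<open>D\<close> for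
  the derivative; by uniqueness it agrees with \<open>frechet_derivative\<close> on the open
  set.\<close>

lemma C_on_Suc_I:
 assumes "open S" "\<And>x. x \<in> S ==> (f has_derivative D x) (at x)" "\<And>v. C_on k S (\<lambda>x. D x v)"
 shows "C_on (Suc k) S f" proof -
 have "frechet_derivative f (at x) = D x" if "x \<in> S" for x
  using assms(2)[OF that] frechet_derivative_at by metis
 then have "C_on k S (\<lambda>x. frechet_derivative f (at x) v)" for v
  by (intro C_on_cong[OF assms(1) _ assms(3)[of v]]) simp
 then show ?thesis using assms(2) unfolding C_on.simps(2) differentiable_def by blast
qed

lemma C_on_Suc_D:
 assumes "C_on (Suc k) S f"
 shows "x \<in> S ==> (f has_derivative frechet_derivative f (at x)) (at x)"
  and "C_on k S (\<lambda>x. frechet_derivative f (at x) v)" and "C_on k S f" proof -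
 show "(f has_derivative frechet_derivative f (at x)) (at x)" if "x \<in> S"
  using assms that unfolding C_on.simps(2) frechet_derivative_works by blast
qed (use assms C_on_Suc_imp[OF assms] in \<open>auto simp: C_on.simps(2)\<close>)

lemma C_on_const: "open S ==> C_on k S (\<lambda>x. a)" proof (induction k arbitrary: a)
 case (Suc k)
 then show ?case by (intro C_on_Suc_I[where D = "\<lambda>x v. 0"]) auto
qed auto

lemma C_on_bounded_linear: "bounded_linear L ==> open S ==> C_on k S L" proof (cases k)
 case (Suc j)
 assume "bounded_linear L" "open S"
 then show ?thesis unfolding Suc
  by (intro C_on_Suc_I[where D = "\<lambda>x. L"] C_on_const bounded_linear_imp_has_derivative) auto
qed (auto intro: linear_continuous_on)

lemma C_on_add: "open S ==> C_on k S f ==> C_on k S g ==> C_on k S (\<lambda>x. f x + g x)"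
proof (induction k arbitrary: f g)
 case (Suc k)
 note f = C_on_Suc_D[OF Suc.prems(2)] and g = C_on_Suc_D[OF Suc.prems(3)]
 show ?case
  by (intro C_on_Suc_I[where D = "\<lambda>x v. frechet_derivative f (at x) v + frechet_derivative g (at x) v"]
    has_derivative_add Suc.IH Suc.prems f g)
qed (simp_all add: continuous_on_add continuous_on_scaleR)

lemma C_on_sum: "open S ==> (\<And>i. i \<in> I ==> C_on k S (f i)) ==> C_on k S (\<lambda>x. \<Sum>i\<in>I. f i x)"
 by (induction I rule: infinite_finite_induct) (auto intro: C_on_const C_on_add)

lemma C_on_scaleR: "open S ==> C_on k S a ==> C_on k S f ==> C_on k S (\<lambda>x. a x *\<^sub>R f x)"
proof (induction k arbitrary: a f)
 case (Suc k)
 note f = C_on_Suc_D[OF Suc.prems(2)] and g = C_on_Suc_D[OF Suc.prems(3)]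
 show ?case
  by (intro C_on_Suc_I[where D = "\<lambda>x v. a x *\<^sub>R frechet_derivative f (at x) v + frechet_derivative a (at x) v *\<^sub>R f x"]
    has_derivative_scaleR Suc.IH Suc.prems f g C_on_add)
qed (simp_all add: continuous_on_add continuous_on_scaleR)

lemma C_on_linear_comp: "open S ==> bounded_linear L ==> C_on k S f ==> C_on k S (\<lambda>x. L (f x))"
proof (induction k arbitrary: f)
 case 0
 then show ?case using bounded_linear.continuous_on[OF 0(2)] by simp
next
 case (Suc k)
 note f = C_on_Suc_D[OF Suc.prems(3)]
 show ?case proof (rule C_on_Suc_I[where D = "\<lambda>x v. L (frechet_derivative f (at x) v)"])
  show "((\<lambda>x. L (f x)) has_derivative (\<lambda>v. L (frechet_derivative f (at x) v))) (at x)" if "x \<in> S" for x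
   by (rule bounded_linear.has_derivative[OF Suc.prems(2) f(1)[OF that]])
  show "C_on k S (\<lambda>x. L (frechet_derivative f (at x) v))" for v
   by (rule Suc.IH[OF Suc.prems(1,2) f(2)])
 qed (rule Suc.prems(1))
qed

text \<open>The derivative of the composition is again a composition with the same affine map, so
  the induction closes without a higher order chain rule. It serves to freeze the fibre variable of
  a bundle morphism.\<close>

lemma C_on_affine_comp:
 assumes "open S" "open T" "bounded_linear L" "\<And>x. x \<in> S ==> b + L x \<in> T"
 shows "C_on k T f ==> C_on k S (\<lambda>x. f (b + L x))" proof (induction k arbitrary: f)
 case 0
 have "continuous_on S (\<lambda>x. b + L x)"
  by (intro continuous_intros bounded_linear.continuous_on[OF assms(3)])
 with 0 assms(4) show ?case by (auto intro: continuous_on_compose2[of T f])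
next
 case (Suc k)
 note f = C_on_Suc_D[OF Suc.prems]
 have "((\<lambda>x. b + L x) has_derivative L) (at x)" for x
  using has_derivative_add[OF has_derivative_const bounded_linear_imp_has_derivative[OF assms(3)]] by simp
 from has_derivative_compose[OF this f(1)]
 have "((\<lambda>x. f (b + L x)) has_derivative (\<lambda>v. frechet_derivative f (at (b + L x)) (L v))) (at x)"
  if "x \<in> S" for x using that assms(4) by blast
 moreover have "C_on k S (\<lambda>x. frechet_derivative f (at (b + L x)) (L v))" for v
  by (rule Suc.IH[OF f(2)])
 ultimately show ?case
  by (rule C_on_Suc_I[where D = "\<lambda>x v. frechet_derivative f (at (b + L x)) (L v)", OF assms(1)])
qed

lemma C_on_inverse:
 fixes f :: "'e::real_normed_vector => real"
 assumes "open S" "\<And>x. x \<in> S ==> f x \<noteq> 0"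
 shows "C_on k S f ==> C_on k S (\<lambda>x. inverse (f x))" proof (induction k)
 case 0
 with assms show ?case by (simp add: continuous_on_inverse)
next
 case (Suc k)
 note f = C_on_Suc_D[OF Suc.prems]
 have i: "C_on k S (\<lambda>x. inverse (f x))" using Suc f by blast
 have "C_on k S (\<lambda>x. (inverse (f x) *\<^sub>R inverse (f x)) *\<^sub>R (- 1) *\<^sub>R frechet_derivative f (at x) v)" for v
  by (intro C_on_scaleR i assms f C_on_const)
 then show ?case using assms f(1)
  by (intro C_on_Suc_I[where D = "\<lambda>x v. (inverse (f x) *\<^sub>R inverse (f x)) *\<^sub>R (- 1) *\<^sub>R frechet_derivative f (at x) v"])
   (auto intro!: derivative_eq_intros simp: mult.assoc)
qed

lemmas smooth_onD = smooth_on_def[THEN iffD1, rule_format]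

lemma smooth_on_subset: "smooth_on S f ==> T \<subseteq> S ==> smooth_on T f"
 unfolding smooth_on_def using C_on_subset by blast

lemma smooth_on_cong: "open S ==> (\<And>x. x \<in> S ==> f x = g x) ==> smooth_on S f ==> smooth_on S g"
 unfolding smooth_on_def using C_on_cong by blast

lemma smooth_on_has_derivative:
 "smooth_on S f ==> x \<in> S ==> (f has_derivative frechet_derivative f (at x)) (at x)"
 unfolding smooth_on_def using C_on_Suc_D(1) by blast

lemma smooth_on_differentiable: "smooth_on S f ==> x \<in> S ==> f differentiable (at x)"
 using smooth_on_has_derivative differentiable_def by blast

lemma smooth_on_frechet: "smooth_on S f ==> smooth_on S (\<lambda>x. frechet_derivative f (at x) v)"
 unfolding smooth_on_def using C_on_Suc_D(2) by blast

lemma smooth_on_continuous: "smooth_on S f ==> continuous_on S f"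
 unfolding smooth_on_def using C_on.simps(1) by blast

lemma smooth_on_const [intro!]: "open S ==> smooth_on S (\<lambda>x. a)"
 by (simp add: smooth_on_def C_on_const)

lemma smooth_on_add [intro!]: "open S ==> smooth_on S f ==> smooth_on S g ==> smooth_on S (\<lambda>x. f x + g x)"
 by (simp add: smooth_on_def C_on_add)

lemma smooth_on_sum [intro!]:
 "open S ==> (\<And>i. i \<in> I ==> smooth_on S (f i)) ==> smooth_on S (\<lambda>x. \<Sum>i\<in>I. f i x)"
 by (simp add: smooth_on_def C_on_sum)

lemma smooth_on_scaleR [intro!]:
 "open S ==> smooth_on S a ==> smooth_on S f ==> smooth_on S (\<lambda>x. a x *\<^sub>R f x)"
 by (simp add: smooth_on_def C_on_scaleR)

lemma smooth_on_mult [intro!]: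
 fixes a f :: "_ => real"
 shows "open S ==> smooth_on S a ==> smooth_on S f ==> smooth_on S (\<lambda>x. a x * f x)"
 using smooth_on_scaleR[of S a f] by simp

lemma smooth_on_divide [intro!]:
 fixes f :: "_ => real"
 shows "open S ==> smooth_on S f ==> smooth_on S (\<lambda>x. f x / c)"
 unfolding divide_inverse by (intro smooth_on_mult smooth_on_const)

lemma smooth_on_linear_comp: "open S ==> bounded_linear L ==> smooth_on S f ==> smooth_on S (\<lambda>x. L (f x))"
 by (simp add: smooth_on_def C_on_linear_comp)

lemma smooth_on_uminus [intro!]: "open S ==> smooth_on S f ==> smooth_on S (\<lambda>x. - f x)"
 by (rule smooth_on_linear_comp[of S uminus]) (auto intro: bounded_linear_minus bounded_linear_ident)

lemma smooth_on_diff [intro!]: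
 "open S ==> smooth_on S f ==> smooth_on S g ==> smooth_on S (\<lambda>x. f x - g x)"
 using smooth_on_add[of S f "\<lambda>x. - g x"] by auto

lemma smooth_on_bounded_linear: "bounded_linear L ==> open S ==> smooth_on S L"
 by (simp add: smooth_on_def C_on_bounded_linear)

lemma smooth_on_inner_left: "open S ==> smooth_on S f ==> smooth_on S (\<lambda>x. f x \<bullet> b)"
 by (rule smooth_on_linear_comp) (auto intro: bounded_linear_intros)

lemma smooth_on_nth [intro!]: "open S ==> smooth_on S f ==> smooth_on S (\<lambda>x. f x $ b)"
 by (rule smooth_on_linear_comp) (auto intro: bounded_linear_intros)

lemma smooth_on_affine_comp:
 "open S ==> open T ==> bounded_linear L ==> (\<And>x. x \<in> S ==> b + L x \<in> T) ==> smooth_on T f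
  ==> smooth_on S (\<lambda>x. f (b + L x))"
 unfolding smooth_on_def using C_on_affine_comp[of S T L b _ f] by simp

lemma smooth_on_inverse:
 fixes f :: "'e::real_normed_vector => real"
 shows "open S ==> (\<And>x. x \<in> S ==> f x \<noteq> 0) ==> smooth_on S f ==> smooth_on S (\<lambda>x. inverse (f x))"
 by (simp add: smooth_on_def C_on_inverse)

lemma smooth_on_prod [intro!]:
 fixes f :: "_ => _ => real"
 shows "open S ==> (\<And>i. i \<in> I ==> smooth_on S (f i)) ==> smooth_on S (\<lambda>x. \<Prod>i\<in>I. f i x)"
 by (induction I rule: infinite_finite_induct) auto

lemma smooth_on_det:
 fixes A :: "'e::real_normed_vector => real ^ 'n ^ 'n"
 assumes "open S" "\<And>i j. smooth_on S (\<lambda>x. A x $ i $ j)"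
 shows "smooth_on S (\<lambda>x. det (A x))"
 unfolding det_def using assms by (intro smooth_on_sum smooth_on_mult smooth_on_prod smooth_on_const)

lemma smooth_on_inner [intro!]:
 fixes f g :: "'e::real_normed_vector => 'f::euclidean_space"
 assumes "open S" "smooth_on S f" "smooth_on S g"
 shows "smooth_on S (\<lambda>x. f x \<bullet> g x)" proof -
 have "(\<lambda>x. f x \<bullet> g x) = (\<lambda>x. \<Sum>b\<in>Basis. (f x \<bullet> b) * (g x \<bullet> b))"
  by (rule ext) (rule euclidean_inner)
 then show ?thesis using assms by (auto intro!: smooth_on_sum smooth_on_mult smooth_on_inner_left)
qed

text \<open>Two applications of the mean value theorem: first in the direction \<open>v\<close>, to
  the difference of \<open>f\<close> between two parallel lines, then in the direction
  \<open>u\<close>, to the derivative of \<open>f\<close> along \<open>v\<close>.\<close>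

lemma second_difference_mvt:
 fixes f :: "'e::real_normed_vector => real"
 assumes f: "\<And>x. x \<in> S ==> f differentiable (at x)"
  and fv: "\<And>x. x \<in> S ==> (\<lambda>x. frechet_derivative f (at x) v) differentiable (at x)"
  and h: "0 < h" "\<And>a b. 0 <= a ==> a <= h ==> 0 <= b ==> b <= h ==> x + a *\<^sub>R u + b *\<^sub>R v \<in> S"
 shows "\<exists>a b. 0 <= a \<and> a <= h \<and> 0 <= b \<and> b <= h \<and>
  f (x + h *\<^sub>R u + h *\<^sub>R v) - f (x + h *\<^sub>R v) - f (x + h *\<^sub>R u) + f x =
  h * h * frechet_derivative (\<lambda>x. frechet_derivative f (at x) v) (at (x + a *\<^sub>R u + b *\<^sub>R v)) u"
proof -
 have line: "((\<lambda>t. g (y + t *\<^sub>R w)) has_real_derivative frechet_derivative g (at (y + t *\<^sub>R w)) w) (at t)"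
  if "g differentiable (at (y + t *\<^sub>R w))" for g :: "'e => real" and y w t proof -
  have D: "(g has_derivative frechet_derivative g (at (y + t *\<^sub>R w))) (at (y + t *\<^sub>R w))"
   using that frechet_derivative_works by blast
  have "((\<lambda>t. y + t *\<^sub>R w) has_derivative (\<lambda>t. t *\<^sub>R w)) (at t)"
   by (auto intro!: derivative_eq_intros)
  from has_derivative_compose[OF this D] show ?thesis unfolding has_field_derivative_def
   by (rule has_derivative_eq_rhs)
     (simp add: linear_simps(5)[OF has_derivative_bounded_linear[OF D]] fun_eq_iff)
 qed
 let ?G = "\<lambda>t. f (x + h *\<^sub>R u + t *\<^sub>R v) - f (x + t *\<^sub>R v)"
 let ?g = "\<lambda>x. frechet_derivative f (at x) v"
 have "\<exists>z>0. z < h \<and> ?G h - ?G 0 = (h - 0) * (?g (x + h *\<^sub>R u + z *\<^sub>R v) - ?g (x + z *\<^sub>R v))"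
 proof (rule MVT2[OF h(1)])
  fix z assume z: "0 <= z" "z <= h"
  show "(?G has_real_derivative ?g (x + h *\<^sub>R u + z *\<^sub>R v) - ?g (x + z *\<^sub>R v)) (at z)"
   using h(2)[of h z] h(2)[of 0 z] h(1) z by (intro DERIV_diff line f) auto
 qed
 then obtain b where b: "0 < b" "b < h"
  and G: "?G h - ?G 0 = h * (?g (x + h *\<^sub>R u + b *\<^sub>R v) - ?g (x + b *\<^sub>R v))" by auto
 have "\<exists>z>0. z < h \<and> ?g (x + b *\<^sub>R v + h *\<^sub>R u) - ?g (x + b *\<^sub>R v + 0 *\<^sub>R u) =
   (h - 0) * frechet_derivative ?g (at (x + b *\<^sub>R v + z *\<^sub>R u)) u" proof (rule MVT2[OF h(1)])
  fix z assume z: "0 <= z" "z <= h"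
  show "((\<lambda>z. ?g (x + b *\<^sub>R v + z *\<^sub>R u)) has_real_derivative frechet_derivative ?g (at (x + b *\<^sub>R v + z *\<^sub>R u)) u) (at z)"
   using h(2)[of z b] z b by (intro line fv) (auto simp: algebra_simps)
 qed
 then obtain a where a: "0 < a" "a < h" and
  "?g (x + b *\<^sub>R v + h *\<^sub>R u) - ?g (x + b *\<^sub>R v) = h * frechet_derivative ?g (at (x + b *\<^sub>R v + a *\<^sub>R u)) u" by auto
 with G a b show ?thesis by (intro exI[of _ a] exI[of _ b]) (auto simp: algebra_simps)
qed

text \<open>The second difference over a parallelogram is symmetric in \<open>u\<close> and
  \<open>v\<close>. Divided by \<open>h * h\<close> it is a value of either mixed derivative near
  \<open>x\<close>, and both are continuous.\<close>

lemma second_derivative_symmetric: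
 fixes f :: "'e::real_normed_vector => real"
 assumes S: "open S" "x \<in> S" and f: "smooth_on S f"
 shows "frechet_derivative (\<lambda>x. frechet_derivative f (at x) v) (at x) u =
     frechet_derivative (\<lambda>x. frechet_derivative f (at x) u) (at x) v" proof -
 define A where "A = (\<lambda>x. frechet_derivative (\<lambda>x. frechet_derivative f (at x) v) (at x) u)"
 define B where "B = (\<lambda>x. frechet_derivative (\<lambda>x. frechet_derivative f (at x) u) (at x) v)"
 have cont: "isCont A x" "isCont B x"
  using smooth_on_continuous[OF smooth_on_frechet[OF smooth_on_frechet[OF f]]] S
  by (auto simp: A_def B_def continuous_on_eq_continuous_at)
 have "\<bar>A x - B x\<bar> <= 2 * e" if e: "e > 0" for e proof -
  from cont e obtain d1 d2 where d12: "d1 > 0" "d2 > 0" "\<And>y. dist y x < d1 ==> \<bar>A y - A x\<bar> < e"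
    "\<And>y. dist y x < d2 ==> \<bar>B y - B x\<bar> < e"
   unfolding continuous_at_eps_delta dist_real_def by blast
  define d where "d = min d1 d2"
  have d: "d > 0" "\<And>y. dist y x < d ==> \<bar>A y - A x\<bar> < e" "\<And>y. dist y x < d ==> \<bar>B y - B x\<bar> < e"
   using d12 by (auto simp: d_def)
  from S obtain r where r: "r > 0" "ball x r \<subseteq> S" by (auto simp: open_contains_ball)
  \<comment> \<open>With this side length the parallelogram lies in \<open>S\<close> and in both
    neighbourhoods of continuity; the summand 1 covers \<open>u = v = 0\<close>.\<close>
  define h where "h = min r d / (2 * (norm u + norm v + 1))"
  have h: "h > 0" using r d by (simp add: h_def add_nonneg_pos)
  have hn: "h * (norm u + norm v) < min r d" proof -
   have "h * (norm u + norm v) < h * (2 * (norm u + norm v + 1))"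
    using h by (intro mult_strict_left_mono) (simp_all add: add_nonneg_pos)
   also have "... = min r d" proof -
    have "2 * (norm u + norm v + 1) \<noteq> 0" using norm_ge_zero[of u] norm_ge_zero[of v] by argo
    from nonzero_mult_div_cancel_right[OF this] show ?thesis
     by (simp only: h_def times_divide_eq_left)
   qed
   finally show ?thesis .
  qed
  have near: "dist (x + a *\<^sub>R u + b *\<^sub>R v) x < min r d" if "0 <= a" "a <= h" "0 <= b" "b <= h" for a b
  proof -
   have "dist (x + a *\<^sub>R u + b *\<^sub>R v) x <= a * norm u + b * norm v"
    using norm_triangle_ineq[of "a *\<^sub>R u" "b *\<^sub>R v"] that by (simp add: dist_norm add.assoc)
   also have "... <= h * norm u + h * norm v" using that by (intro add_mono mult_right_mono) auto
   finally show ?thesis using hn by (simp add: algebra_simps)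
  qed
  have inS: "x + a *\<^sub>R u + b *\<^sub>R v \<in> S" if "0 <= a" "a <= h" "0 <= b" "b <= h" for a b
   using near[OF that] r by (auto simp: dist_commute)
  have inS': "x + a *\<^sub>R v + b *\<^sub>R u \<in> S" if "0 <= a" "a <= h" "0 <= b" "b <= h" for a b
   using inS[OF that(3,4) that(1,2)] by (simp add: algebra_simps)
  have df: "f differentiable (at y)" "(\<lambda>x. frechet_derivative f (at x) w) differentiable (at y)" if "y \<in> S" for y w
   using smooth_on_differentiable[OF f that] smooth_on_differentiable[OF smooth_on_frechet[OF f] that] by auto
  obtain a b where ab: "0 <= a" "a <= h" "0 <= b" "b <= h"
   "f (x + h *\<^sub>R u + h *\<^sub>R v) - f (x + h *\<^sub>R v) - f (x + h *\<^sub>R u) + f x = h * h * A (x + a *\<^sub>R u + b *\<^sub>R v)"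
   using second_difference_mvt[of S f v h x u, OF df h inS] unfolding A_def by blast
  obtain a' b' where ab': "0 <= a'" "a' <= h" "0 <= b'" "b' <= h"
   "f (x + h *\<^sub>R v + h *\<^sub>R u) - f (x + h *\<^sub>R u) - f (x + h *\<^sub>R v) + f x = h * h * B (x + a' *\<^sub>R v + b' *\<^sub>R u)"
   using second_difference_mvt[of S f u h x v, OF df h inS'] unfolding B_def by blast
  have "h * h * A (x + a *\<^sub>R u + b *\<^sub>R v) = h * h * B (x + a' *\<^sub>R v + b' *\<^sub>R u)"
   using ab(5) ab'(5) by (simp add: algebra_simps)
  then have "A (x + a *\<^sub>R u + b *\<^sub>R v) = B (x + b' *\<^sub>R u + a' *\<^sub>R v)"
   using h by (simp add: algebra_simps)
  with d(2)[of "x + a *\<^sub>R u + b *\<^sub>R v"] d(3)[of "x + b' *\<^sub>R u + a' *\<^sub>R v"] near[OF ab(1-4)] near[OF ab'(3,4,1,2)]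
  show ?thesis by auto
 qed
 from this[of "_ / 2"] have "\<bar>A x - B x\<bar> <= 0 + e" if "e > 0" for e using that by simp
 from field_le_epsilon[OF this] have "\<bar>A x - B x\<bar> <= 0" by blast
 then show ?thesis by (simp add: A_def B_def)
qed

section \<open>Iterated derivatives and privileged coordinates\<close>

definition der :: "('e::real_normed_vector => 'e) => ('e => 'f::real_normed_vector) => 'e => 'f"
 where "der X f = (\<lambda>x. frechet_derivative f (at x) (X x))"

definition lb :: "('e::real_normed_vector => 'e) => ('e => 'e) => 'e => 'e"
 where "lb X Y = (\<lambda>x. der X Y x - der Y X x)"

text \<open>The last letter of the word acts first. Concatenating words is then composing operators,
  in the order in which flows are concatenated in the Chen-Fliess expansion.\<close>

primrec ders :: "('i => 'e::real_normed_vector => 'e) => 'i list => ('e => 'f::real_normed_vector) => 'e => 'f"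
 where "ders X [] f = f" | "ders X (i # v) f = der (X i) (ders X v f)"

lemma ders_append: "ders X (u @ v) f = ders X u (ders X v f)" by (induction u) auto

lemma der_unique: "(f has_derivative D) (at x) ==> der X f x = D (X x)"
 unfolding der_def using frechet_derivative_at by metis

lemma der_eq:
 assumes "smooth_on Om f" "x \<in> Om"
 shows "der X f x = (\<Sum>b\<in>Basis. (X x \<bullet> b) *\<^sub>R frechet_derivative f (at x) b)" proof -
 interpret D: linear "frechet_derivative f (at x)"
  using smooth_on_has_derivative[OF assms] has_derivative_linear by blast
 show ?thesis unfolding der_def
  by (subst euclidean_representation[of "X x", symmetric]) (simp only: D.sum D.scaleR)
qed

lemma der_smooth [intro!]:
 fixes X :: "'e::euclidean_space => 'e"
 assumes "open Om" "smooth_on Om X" "smooth_on Om f"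
 shows "smooth_on Om (der X f)" proof -
 have "smooth_on Om (\<lambda>x. \<Sum>b\<in>Basis. (X x \<bullet> b) *\<^sub>R frechet_derivative f (at x) b)"
  using assms smooth_on_frechet by (intro smooth_on_sum smooth_on_scaleR smooth_on_inner_left) auto
 then show ?thesis by (rule smooth_on_cong[OF assms(1), rotated]) (simp add: der_eq[OF assms(3)])
qed

lemma lb_smooth [intro!]:
 fixes X :: "'e::euclidean_space => 'e"
 assumes "open Om" "smooth_on Om X" "smooth_on Om Y"
 shows "smooth_on Om (lb X Y)" unfolding lb_def using assms by auto

lemma ders_smooth [intro!]:
 fixes X :: "'i => 'e::euclidean_space => 'e"
 shows "open Om ==> (\<And>i. smooth_on Om (X i)) ==> smooth_on Om f ==> smooth_on Om (ders X v f)"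
 by (induction v) auto

lemma der_cong:
 assumes "open Om" "x \<in> Om" "\<And>y. y \<in> Om ==> f y = g y" "smooth_on Om f"
 shows "der X f x = der X g x"
 unfolding der_def using assms smooth_on_differentiable[OF assms(4,2)]
 by (subst frechet_derivative_transform_within_open[of f x Om g]) auto

lemma ders_cong:
 fixes X :: "'i => 'e::euclidean_space => 'e"
 assumes "open Om" "\<And>i. smooth_on Om (X i)" "smooth_on Om f" "\<And>y. y \<in> Om ==> f y = g y"
 shows "x \<in> Om ==> ders X v f x = ders X v g x" proof (induction v arbitrary: x)
 case (Cons i v)
 then show ?case using assms by (auto intro!: der_cong[of Om])
qed (use assms in auto)

lemma der_add:
 "smooth_on Om f ==> smooth_on Om g ==> x \<in> Om ==> der X (\<lambda>x. f x + g x) x = der X f x + der X g x"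
 by (subst der_unique[OF has_derivative_add[OF smooth_on_has_derivative smooth_on_has_derivative]])
   (auto simp: der_def)

lemma der_diff:
 "smooth_on Om f ==> smooth_on Om g ==> x \<in> Om ==> der X (\<lambda>x. f x - g x) x = der X f x - der X g x"
 by (subst der_unique[OF has_derivative_diff[OF smooth_on_has_derivative smooth_on_has_derivative]])
   (auto simp: der_def)

lemma der_const [simp]: "der X (\<lambda>x. a) x = 0" by (subst der_unique[OF has_derivative_const]) auto

lemma der_scaleR: "smooth_on Om a ==> smooth_on Om f ==> x \<in> Om ==>
  der X (\<lambda>x. a x *\<^sub>R f x) x = a x *\<^sub>R der X f x + der X a x *\<^sub>R f x"
 by (subst der_unique[OF has_derivative_scaleR[OF smooth_on_has_derivative smooth_on_has_derivative]])
   (auto simp: der_def)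

lemma der_mult:
 fixes a f :: "_ => real"
 shows "smooth_on Om a ==> smooth_on Om f ==> x \<in> Om ==>
  der X (\<lambda>x. a x * f x) x = a x * der X f x + der X a x * f x"
 using der_scaleR[of Om a f x X] by simp

lemma der_linear_comp:
 "bounded_linear L ==> smooth_on Om f ==> x \<in> Om ==> der X (\<lambda>x. L (f x)) x = L (der X f x)"
 by (subst der_unique[OF bounded_linear.has_derivative[OF _ smooth_on_has_derivative]])
   (auto simp: der_def)

lemma der_inner: "smooth_on Om f ==> x \<in> Om ==> der X (\<lambda>x. f x \<bullet> b) x = der X f x \<bullet> b"
 by (rule der_linear_comp) (auto intro: bounded_linear_intros)

lemma der_cmult:
 fixes f :: "_ => real"
 shows "smooth_on Om f ==> x \<in> Om ==> der X (\<lambda>x. a * f x) x = a * der X f x"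
 by (rule der_linear_comp) (auto intro: bounded_linear_intros)

lemma der_sum:
 assumes "open Om" "x \<in> Om" "\<And>i. i \<in> I ==> smooth_on Om (f i)"
 shows "der X (\<lambda>x. \<Sum>i\<in>I. f i x) x = (\<Sum>i\<in>I. der X (f i) x)" using assms(3)
proof (induction I rule: infinite_finite_induct)
 case (insert i I)
 then have "smooth_on Om (\<lambda>x. \<Sum>i\<in>I. f i x)" using assms(1) by auto
 then show ?case using insert der_add[of Om "f i" _ x X] assms by simp
qed auto

lemma der_field_add: "smooth_on Om f ==> x \<in> Om ==> der (\<lambda>x. X x + Y x) f x = der X f x + der Y f x"
 unfolding der_def by (rule linear_add[OF has_derivative_linear[OF smooth_on_has_derivative]])

lemma der_field_diff: "smooth_on Om f ==> x \<in> Om ==> der (\<lambda>x. X x - Y x) f x = der X f x - der Y f x"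
 unfolding der_def by (rule linear_diff[OF has_derivative_linear[OF smooth_on_has_derivative]])

lemma der_field_scaleR: "smooth_on Om f ==> x \<in> Om ==> der (\<lambda>x. a x *\<^sub>R X x) f x = a x *\<^sub>R der X f x"
 unfolding der_def by (rule linear_scale[OF has_derivative_linear[OF smooth_on_has_derivative]])

lemma der_field_sum: "smooth_on Om f ==> x \<in> Om ==> der (\<lambda>x. \<Sum>i\<in>I. X i x) f x = (\<Sum>i\<in>I. der (X i) f x)"
 unfolding der_def by (rule linear_sum[OF has_derivative_linear[OF smooth_on_has_derivative]])

lemma der_field_cong: "X x = Y x ==> der X f x = der Y f x" by (simp add: der_def)

text \<open>Each second order product splits into a derivative along \<open>der U V\<close> and a
  Hessian term. The Hessian terms cancel by symmetry, which leaves the bracket.\<close>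

lemma der_commutator:
 fixes f :: "'e::euclidean_space => real"
 assumes S: "open Om" "x \<in> Om" and f: "smooth_on Om f" and X: "smooth_on Om X" and Y: "smooth_on Om Y"
 shows "der X (der Y f) x - der Y (der X f) x = der (lb X Y) f x" proof -
 let ?D = "\<lambda>b x. frechet_derivative f (at x) b"
 have D: "smooth_on Om (?D b)" for b using smooth_on_frechet[OF f] .
 have 1: "der U (der V f) x = der (der U V) f x + (\<Sum>b\<in>Basis. \<Sum>c\<in>Basis. (V x \<bullet> b) * (U x \<bullet> c) * frechet_derivative (?D b) (at x) c)"
  if U: "smooth_on Om U" and V: "smooth_on Om V" for U V proof -
  have "der U (der V f) x = der U (\<lambda>x. \<Sum>b\<in>Basis. (V x \<bullet> b) * ?D b x) x"
   using der_eq[OF f, of _ V] S f V by (intro der_cong[of Om]) auto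
  also have "... = (\<Sum>b\<in>Basis. der U (\<lambda>x. (V x \<bullet> b) * ?D b x) x)"
   using S D V by (intro der_sum[of Om]) auto
  also have "... = (\<Sum>b\<in>Basis. (V x \<bullet> b) * der U (?D b) x + (der U V x \<bullet> b) * ?D b x)"
   using S D V der_inner[OF V S(2)] by (intro sum.cong refl) (subst der_mult[of Om], auto)
  also have "... = (\<Sum>b\<in>Basis. (V x \<bullet> b) * der U (?D b) x) + der (der U V) f x"
   using der_eq[OF f S(2), of "der U V"] by (simp add: sum.distrib)
  also have "(\<Sum>b\<in>Basis. (V x \<bullet> b) * der U (?D b) x) =
    (\<Sum>b\<in>Basis. \<Sum>c\<in>Basis. (V x \<bullet> b) * (U x \<bullet> c) * frechet_derivative (?D b) (at x) c)"
   using der_eq[OF D S(2), of U] by (simp add: sum_distrib_left mult.assoc)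
  finally show ?thesis by simp
 qed
 have "(\<Sum>b\<in>Basis. \<Sum>c\<in>Basis. (Y x \<bullet> b) * (X x \<bullet> c) * frechet_derivative (?D b) (at x) c) =
    (\<Sum>b\<in>Basis. \<Sum>c\<in>Basis. (X x \<bullet> b) * (Y x \<bullet> c) * frechet_derivative (?D b) (at x) c)"
  by (subst sum.swap) (auto intro!: sum.cong simp: second_derivative_symmetric[OF S f] mult_ac)
 then show ?thesis
  using 1[OF X Y] 1[OF Y X] der_field_diff[OF f S(2), of "der X Y" "der Y X"] by (simp add: lb_def)
qed

lemma lb_inner: "smooth_on Om X ==> smooth_on Om Y ==> x \<in> Om ==>
  lb X Y x \<bullet> b = der X (\<lambda>x. Y x \<bullet> b) x - der Y (\<lambda>x. X x \<bullet> b) x"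
 by (simp add: lb_def der_inner inner_diff_left)

text \<open>In each component a double bracket becomes a combination of third order expressions in
  the components of the fields; after expanding all three double brackets, the identity is plain
  cancellation.\<close>

lemma lb_jacobi:
 fixes X :: "'e::euclidean_space => 'e"
 assumes S: "open Om" "x \<in> Om" and X: "smooth_on Om X" and Y: "smooth_on Om Y" and Z: "smooth_on Om Z"
 shows "lb (lb X Y) Z x = lb X (lb Y Z) x - lb Y (lb X Z) x" proof (rule euclidean_eqI)
 fix b :: 'e
 have in': "smooth_on Om (\<lambda>x. U x \<bullet> b)" if "smooth_on Om U" for U using S that by auto
 have d: "der U (\<lambda>x. lb V W x \<bullet> b) x = der U (der V (\<lambda>x. W x \<bullet> b)) x - der U (der W (\<lambda>x. V x \<bullet> b)) x"
  if "smooth_on Om U" "smooth_on Om V" "smooth_on Om W" for U V W proof -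
  have "der U (\<lambda>x. lb V W x \<bullet> b) x = der U (\<lambda>x. der V (\<lambda>x. W x \<bullet> b) x - der W (\<lambda>x. V x \<bullet> b) x) x"
   using S that by (intro der_cong[of Om]) (auto simp: lb_inner[of Om])
  also have "... = der U (der V (\<lambda>x. W x \<bullet> b)) x - der U (der W (\<lambda>x. V x \<bullet> b)) x"
   using S that by (intro der_diff[of Om]) auto
  finally show ?thesis .
 qed
 have l: "lb U (lb V W) x \<bullet> b = der U (der V (\<lambda>x. W x \<bullet> b)) x - der U (der W (\<lambda>x. V x \<bullet> b)) x
   - (der V (der W (\<lambda>x. U x \<bullet> b)) x - der W (der V (\<lambda>x. U x \<bullet> b)) x)"
  if "smooth_on Om U" "smooth_on Om V" "smooth_on Om W" for U V W
  using that S by (subst lb_inner[of Om]) (auto simp: d der_commutator[of Om] in')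
 have anti: "lb (lb X Y) Z x = - lb Z (lb X Y) x" by (simp add: lb_def)
 show "lb (lb X Y) Z x \<bullet> b = (lb X (lb Y Z) x - lb Y (lb X Z) x) \<bullet> b"
  unfolding anti inner_diff_left inner_minus_left l[OF X Y Z] l[OF Y X Z] l[OF Z X Y] by simp
qed

lemma ders_add:
 fixes X :: "'i => 'e::euclidean_space => 'e"
 assumes "open Om" "\<And>i. smooth_on Om (X i)" "smooth_on Om f" "smooth_on Om g"
 shows "x \<in> Om ==> ders X v (\<lambda>x. f x + g x) x = ders X v f x + ders X v g x"
proof (induction v arbitrary: x)
 case (Cons i v)
 have "der (X i) (ders X v (\<lambda>x. f x + g x)) x = der (X i) (\<lambda>x. ders X v f x + ders X v g x) x"
  using assms Cons by (intro der_cong[of Om]) auto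
 then show ?case using assms Cons der_add[of Om "ders X v f" "ders X v g" x "X i"] by (simp add: ders_smooth)
qed auto

lemma ders_cmult:
 fixes X :: "'i => 'e::euclidean_space => 'e" and f :: "'e => real"
 assumes "open Om" "\<And>i. smooth_on Om (X i)" "smooth_on Om f"
 shows "x \<in> Om ==> ders X v (\<lambda>x. a * f x) x = a * ders X v f x" proof (induction v arbitrary: x)
 case (Cons i v)
 have "der (X i) (ders X v (\<lambda>x. a * f x)) x = der (X i) (\<lambda>x. a * ders X v f x) x"
  using assms Cons by (intro der_cong[of Om]) auto
 then show ?case using assms Cons der_cmult[of Om "ders X v f" x "X i" a] by (simp add: ders_smooth)
qed auto

lemma ders_diff:
 fixes X :: "'i => 'e::euclidean_space => 'e" and f :: "'e => real"
 assumes "open Om" "\<And>i. smooth_on Om (X i)" "smooth_on Om f" "smooth_on Om g" "x \<in> Om"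
 shows "ders X v (\<lambda>x. f x - g x) x = ders X v f x - ders X v g x" proof -
 have "ders X v (\<lambda>x. f x + (- 1) * g x) x = ders X v f x + ders X v (\<lambda>x. (- 1) * g x) x"
  using assms by (intro ders_add[of Om] smooth_on_mult smooth_on_const) auto
 then show ?thesis using ders_cmult[OF assms(1,2,4,5), where a = "- 1" and v = v] by simp
qed

lemma ders_zero [simp]: "ders X v (\<lambda>x. 0 :: 'b::real_normed_vector) x = 0" proof -
 have "ders X v (\<lambda>x. 0 :: 'b) = (\<lambda>x. 0)" by (induction v) auto
 then show ?thesis by simp
qed

lemma ders_sum:
 fixes X :: "'i => 'e::euclidean_space => 'e"
 assumes "open Om" "\<And>i. smooth_on Om (X i)" "\<And>j. j \<in> J ==> smooth_on Om (f j)" "x \<in> Om"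
 shows "ders X v (\<lambda>x. \<Sum>j\<in>J. f j x) x = (\<Sum>j\<in>J. ders X v (f j) x)" using assms(3)
proof (induction J rule: infinite_finite_induct)
 case (insert j J)
 then have "smooth_on Om (\<lambda>x. \<Sum>i\<in>J. f i x)" using assms(1) by auto
 then show ?case using insert ders_add[of Om X "f j" _ x v] assms by simp
qed auto

text \<open>By the Leibniz rule every term contains a derivative of \<open>h\<close> along a
  subsequence of \<open>aa\<close>. This is how variable coefficients are discarded when only
  vanishing matters.\<close>

lemma ders_mult_zero:
 fixes Y :: "'i => 'e::euclidean_space => 'e" and c h :: "'e => real"
 assumes "open Om" "p \<in> Om" "\<And>i. smooth_on Om (Y i)"
 shows "smooth_on Om c ==> smooth_on Om h ==> (\<And>bt. subseq bt aa ==> ders Y bt h p = 0) ==>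
  ders Y aa (\<lambda>x. c x * h x) p = 0" proof (induction aa arbitrary: c h rule: rev_induct)
 case Nil
 then show ?case using Nil(3)[of "[]"] by simp
next
 case (snoc i aa)
 have "ders Y (aa @ [i]) (\<lambda>x. c x * h x) p = ders Y aa (\<lambda>x. c x * der (Y i) h x + der (Y i) c x * h x) p"
  unfolding ders_append using assms snoc.prems
  by (intro ders_cong[of Om]) (auto simp: der_mult[of Om])
 also have "... = ders Y aa (\<lambda>x. c x * der (Y i) h x) p + ders Y aa (\<lambda>x. der (Y i) c x * h x) p"
  using assms snoc.prems by (intro ders_add[of Om]) auto
 also have "ders Y aa (\<lambda>x. c x * der (Y i) h x) p = 0" proof (rule snoc.IH)
  fix bt assume "subseq bt aa"
  then have "subseq (bt @ [i]) (aa @ [i])" by simp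
  from snoc.prems(3)[OF this] show "ders Y bt (der (Y i) h) p = 0" by (simp add: ders_append)
 qed (use assms snoc.prems in auto)
 also have "ders Y aa (\<lambda>x. der (Y i) c x * h x) p = 0"
  using assms snoc.prems by (intro snoc.IH) auto
 finally show ?case by simp
qed

text \<open>The only Leibniz term that survives is the one in which all derivatives fall on
  \<open>h\<close>; every other one contains a shorter derivative of \<open>h\<close>.\<close>

lemma ders_mult_top:
 fixes Y :: "'i => 'e::euclidean_space => 'e" and c h :: "'e => real"
 assumes "open Om" "p \<in> Om" "\<And>i. smooth_on Om (Y i)"
 shows "smooth_on Om c ==> smooth_on Om h ==> (\<And>bt. length bt < length aa ==> ders Y bt h p = 0) ==>
  ders Y aa (\<lambda>x. c x * h x) p = c p * ders Y aa h p"
proof (induction aa arbitrary: c h rule: rev_induct)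
 case Nil
 then show ?case by simp
next
 case (snoc i aa)
 have "ders Y (aa @ [i]) (\<lambda>x. c x * h x) p = ders Y aa (\<lambda>x. c x * der (Y i) h x + der (Y i) c x * h x) p"
  unfolding ders_append using assms snoc.prems
  by (intro ders_cong[of Om]) (auto simp: der_mult[of Om])
 also have "... = ders Y aa (\<lambda>x. c x * der (Y i) h x) p + ders Y aa (\<lambda>x. der (Y i) c x * h x) p"
  using assms snoc.prems by (intro ders_add[of Om]) auto
 also have "ders Y aa (\<lambda>x. c x * der (Y i) h x) p = c p * ders Y aa (der (Y i) h) p"
 proof (rule snoc.IH)
  fix bt :: "'i list" assume "length bt < length aa"
  then have "length (bt @ [i]) < length (aa @ [i])" by simp
  from snoc.prems(3)[OF this] show "ders Y bt (der (Y i) h) p = 0" by (simp add: ders_append)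
 qed (use assms snoc.prems in auto)
 also have "ders Y aa (\<lambda>x. der (Y i) c x * h x) p = 0" proof (rule ders_mult_zero[of Om])
  fix bt assume "subseq bt aa"
  then have "length bt < length (aa @ [i])" using list_emb_length by fastforce
  then show "ders Y bt h p = 0" by (rule snoc.prems(3))
 qed (use assms snoc.prems in auto)
 finally show ?case by (simp add: ders_append)
qed

text \<open>Sorting by adjacent transpositions. Since \<open>F\<close> is an arbitrary function on
  words, side conditions on the words can be built into it.\<close>

lemma swap_invariant_imp_mset_invariant:
 assumes swap: "\<And>bt i j gm. F (bt @ i # j # gm) = F (bt @ j # i # gm)" and "mset aa = mset aa'"
 shows "F aa = F aa'" proof -
 have move: "F (dl @ bt @ a # gm) = F (dl @ a # bt @ gm)" for dl bt a gm
 proof (induction bt arbitrary: gm rule: rev_induct)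
  case (snoc b bt)
  have "F (dl @ (bt @ [b]) @ a # gm) = F (dl @ bt @ a # b # gm)" using swap[of "dl @ bt" b a gm] by simp
  then show ?case using snoc[of "b # gm"] by simp
 qed simp
 have "F (dl @ aa) = F (dl @ aa')" for dl using assms(2) proof (induction aa arbitrary: aa' dl)
  case (Cons a aa)
  from Cons.prems have "a \<in> set aa'" by (metis list.set_intros(1) mset_eq_setD)
  then obtain bt gm where e: "aa' = bt @ a # gm" by (meson split_list)
  then have "mset aa = mset (bt @ gm)" using Cons.prems by simp
  from Cons.IH[OF this, of "dl @ [a]"] show ?case using move[of dl bt a gm] e by simp
 qed simp
 from this[of "[]"] show ?thesis by simp
qed

text \<open>\<open>vt\<close> is the coframe dual to \<open>Y\<close>, and \<open>w j\<close> is the weight of \<open>Y j\<close>. The last two assumptions say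
 that the frame is compatible with the flag generated by the fields \<open>X i\<close>.\<close>

locale adapted_frame =
 fixes Om :: "'e::euclidean_space set" and X :: "'k => 'e => 'e"
  and Y :: "'n::finite => 'e => 'e" and w :: "'n => nat" and vt :: "'n => 'e => 'e"
 assumes op: "open Om" and smX: "\<And>i. smooth_on Om (X i)" and smY: "\<And>i. smooth_on Om (Y i)"
  and smvt: "\<And>i. smooth_on Om (vt i)"
  and dual: "\<And>x i j. x \<in> Om ==> vt i x \<bullet> Y j x = (if i = j then 1 else 0)"
  and expand: "\<And>x v. x \<in> Om ==> v = (\<Sum>l\<in>UNIV. (vt l x \<bullet> v) *\<^sub>R Y l x)" and wpos: "\<And>i. 0 < w i"
  and filt: "\<And>x i j l. x \<in> Om ==> w i + w j < w l ==> vt l x \<bullet> lb (Y i) (Y j) x = 0"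
  and horiz: "\<And>x i l. x \<in> Om ==> 1 < w l ==> vt l x \<bullet> X i x = 0"
begin

definition wt :: "'n list => nat" where "wt aa = sum_list (map w aa)"

lemma wt_simps [simp]: "wt [] = 0" "wt (i # aa) = w i + wt aa" "wt (aa @ bt) = wt aa + wt bt"
 by (auto simp: wt_def)

lemma wt_subseq: "subseq bt aa ==> wt bt <= wt aa" by (induction rule: list_emb.induct) auto

lemma length_le_wt: "length aa <= wt aa" proof (induction aa)
 case (Cons i aa)
 then show ?case using wpos[of i] by simp
qed simp

lemma wt_mset: "mset aa = mset bt ==> wt aa = wt bt"
 unfolding wt_def by (metis mset_map sum_mset_sum_list)

text \<open>Exchanging two neighbouring letters costs a derivative along their bracket, a
  combination of frame fields of at most the joint weight. The resulting words are shorter and no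
  heavier, so they are covered by induction, and one good ordering of each multiset of letters is
  enough.\<close>

lemma ders_sort:
 fixes g :: "'e => real"
 assumes p: "p \<in> Om" and g: "smooth_on Om g"
  and can: "\<And>aa. wt aa < W ==> \<exists>bt. mset bt = mset aa \<and> ders Y bt g p = 0"
 shows "wt aa < W ==> ders Y aa g p = 0" proof (induction "length aa" arbitrary: aa rule: less_induct)
 case less
 \<comment> \<open>Truncated to the words of the current length and of weight below
   \<open>W\<close>, so that invariance under swaps holds without side condition. Both restrictions
   are themselves invariant.\<close>
 define F where "F bt = (if length bt = length aa \<and> wt bt < W then ders Y bt g p else 0)" for bt
 have "F (bt @ i # j # gm) = F (bt @ j # i # gm)" for bt i j gm
 proof (cases "length (bt @ i # j # gm) = length aa \<and> wt (bt @ i # j # gm) < W")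
  case True
  let ?h = "ders Y gm g"
  let ?L = "{l. w l <= w i + w j}"
  have h: "smooth_on Om ?h" using op smY g by blast
  have "ders Y bt (der (Y i) (der (Y j) ?h)) p - ders Y bt (der (Y j) (der (Y i) ?h)) p
    = ders Y bt (\<lambda>x. der (Y i) (der (Y j) ?h) x - der (Y j) (der (Y i) ?h) x) p"
   using op smY h p by (subst ders_diff[of Om]) auto
  also have "... = ders Y bt (\<lambda>x. \<Sum>l\<in>?L. (vt l x \<bullet> lb (Y i) (Y j) x) * der (Y l) ?h x) p"
  proof (rule ders_cong[of Om])
   fix x assume x: "x \<in> Om"
   have "der (Y i) (der (Y j) ?h) x - der (Y j) (der (Y i) ?h) x = der (lb (Y i) (Y j)) ?h x"
    using der_commutator[OF op x h smY smY, of i j] by simp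
   also have "... = der (\<lambda>y. \<Sum>l\<in>UNIV. (vt l y \<bullet> lb (Y i) (Y j) y) *\<^sub>R Y l y) ?h x"
    by (rule der_field_cong) (rule expand[OF x])
   also have "... = (\<Sum>l\<in>UNIV. (vt l x \<bullet> lb (Y i) (Y j) x) * der (Y l) ?h x)"
    using x h by (simp add: der_field_sum[of Om] der_field_scaleR[of Om])
   also have "... = (\<Sum>l\<in>?L. (vt l x \<bullet> lb (Y i) (Y j) x) * der (Y l) ?h x)"
    using filt[OF x, of i j] by (intro sum.mono_neutral_right) (auto simp: not_le)
   finally show "der (Y i) (der (Y j) ?h) x - der (Y j) (der (Y i) ?h) x =
     (\<Sum>l\<in>?L. (vt l x \<bullet> lb (Y i) (Y j) x) * der (Y l) ?h x)" .
  qed (use op smY h p in auto)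
  also have "... = (\<Sum>l\<in>?L. ders Y bt (\<lambda>x. (vt l x \<bullet> lb (Y i) (Y j) x) * der (Y l) ?h x) p)"
   using op smY h p smvt by (intro ders_sum[of Om]) auto
  also have "... = 0" proof (intro sum.neutral ballI)
   fix l assume l: "l \<in> ?L"
   show "ders Y bt (\<lambda>x. (vt l x \<bullet> lb (Y i) (Y j) x) * der (Y l) ?h x) p = 0"
   proof (rule ders_mult_zero[of Om])
    fix dl assume d: "subseq dl bt"
    \<comment> \<open>The two letters \<open>i\<close>, \<open>j\<close> have become the single
      letter \<open>l\<close>, so the word is strictly shorter.\<close>
    have "ders Y (dl @ l # gm) g p = 0"
     using l True list_emb_length[OF d] wt_subseq[OF d] by (intro less(1)) auto
    then show "ders Y dl (der (Y l) ?h) p = 0" by (simp add: ders_append)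
   qed (use op smY h p smvt in auto)
  qed
  finally show ?thesis by (auto simp: F_def ders_append)
 qed (auto simp: F_def)
 from swap_invariant_imp_mset_invariant[of F, OF this] can[OF less(2)] wt_mset less(2)
 obtain bt where "mset bt = mset aa" "ders Y bt g p = 0" "F bt = F aa" by metis
 moreover from this(1) have "length bt = length aa" "wt bt = wt aa"
  using mset_eq_length wt_mset by blast+
 ultimately show ?case using less(2) by (simp add: F_def)
qed

text \<open>A field \<open>X i\<close> is a combination of frame fields of weight one, by
  \<open>horiz\<close>. The last letter of \<open>v\<close> is traded for such a letter in front of
  \<open>aa\<close>; the total \<open>length v + wt aa\<close> does not grow, and the coefficients
  disappear by the Leibniz rule.\<close>

lemma ders_words_vanish:
 fixes g :: "'e => real"
 assumes p: "p \<in> Om" and g: "smooth_on Om g" and van: "\<And>aa. wt aa < W ==> ders Y aa g p = 0"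
 shows "length v + wt aa < W ==> ders X v (ders Y aa g) p = 0"
proof (induction "length v" arbitrary: v aa rule: less_induct)
 case less
 show ?case proof (cases v rule: rev_cases)
  case Nil
  then show ?thesis using van less(2) by simp
 next
  case (snoc u i)
  let ?h = "ders Y aa g"
  let ?L = "{l. w l <= 1}"
  have h: "smooth_on Om ?h" using op smY g by blast
  have "ders X v ?h p = ders X u (der (X i) ?h) p" by (simp add: snoc ders_append)
  also have "... = ders X u (\<lambda>x. \<Sum>l\<in>?L. (vt l x \<bullet> X i x) * der (Y l) ?h x) p"
  proof (rule ders_cong[of Om])
   fix x assume x: "x \<in> Om"
   have "der (X i) ?h x = der (\<lambda>y. \<Sum>l\<in>UNIV. (vt l y \<bullet> X i y) *\<^sub>R Y l y) ?h x"
    by (rule der_field_cong) (rule expand[OF x])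
   also have "... = (\<Sum>l\<in>UNIV. (vt l x \<bullet> X i x) * der (Y l) ?h x)"
    using x h by (simp add: der_field_sum[of Om] der_field_scaleR[of Om])
   also have "... = (\<Sum>l\<in>?L. (vt l x \<bullet> X i x) * der (Y l) ?h x)"
    using horiz[OF x, of _ i] by (intro sum.mono_neutral_right) (auto simp: not_le)
   finally show "der (X i) ?h x = (\<Sum>l\<in>?L. (vt l x \<bullet> X i x) * der (Y l) ?h x)" .
  qed (use op smX h p in auto)
  also have "... = (\<Sum>l\<in>?L. ders X u (\<lambda>x. (vt l x \<bullet> X i x) * der (Y l) ?h x) p)"
   using op smX smY h p smvt by (intro ders_sum[of Om]) auto
  also have "... = 0" proof (intro sum.neutral ballI)
   fix l assume l: "l \<in> ?L"
   show "ders X u (\<lambda>x. (vt l x \<bullet> X i x) * der (Y l) ?h x) p = 0" proof (rule ders_mult_zero[of Om])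
    fix dl assume d: "subseq dl u"
    have "ders X dl (ders Y (l # aa) g) p = 0"
     using l less(2) snoc list_emb_length[OF d] by (intro less(1)) auto
    then show "ders X dl (der (Y l) ?h) p = 0" by simp
   qed (use op smX smY h p smvt in auto)
  qed
  finally show ?thesis .
 qed
qed

section \<open>Polynomial coordinates centred at a point\<close>

definition y :: "'n => 'e => 'e => real" where "y b p x = vt b p \<bullet> (x - p)"

primrec mon :: "'e => 'n list => 'e => real"
 where "mon p [] = (\<lambda>x. 1)" | "mon p (b # aa) = (\<lambda>x. y b p x * mon p aa x)"

lemma y_smooth [intro!]: "smooth_on Om (y b p)" unfolding y_def using op
 by (intro smooth_on_inner smooth_on_const smooth_on_diff smooth_on_bounded_linear[OF bounded_linear_ident])

lemma mono_smooth [intro!]: "smooth_on Om (mon p aa)" using op by (induction aa) auto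

lemma der_y: "der Z (y b p) x = vt b p \<bullet> Z x"
 unfolding y_def by (rule der_unique) (auto intro!: derivative_eq_intros)

lemma y_self [simp]: "y b p p = 0" by (simp add: y_def)

abbreviation del :: "nat => 'i list => 'i list" where "del k aa \<equiv> take k aa @ drop (Suc k) aa"

lemma der_mono:
 assumes x: "x \<in> Om"
 shows "der Z (mon p aa) x = (\<Sum>k<length aa. der Z (y (aa ! k) p) x * mon p (del k aa) x)"
proof (induction aa)
 case (Cons b aa)
 have "der Z (mon p (b # aa)) x = y b p x * der Z (mon p aa) x + der Z (y b p) x * mon p aa x"
  using x by (simp, intro der_mult[of Om]) auto
 also have "y b p x * der Z (mon p aa) x = (\<Sum>k<length aa. der Z (y (aa ! k) p) x * (y b p x * mon p (del k aa) x))"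
  by (simp add: Cons sum_distrib_left mult_ac)
 finally show ?case by (simp add: sum.lessThan_Suc_shift del: sum.lessThan_Suc)
qed simp

lemma ders_snoc_mono:
 assumes p: "p \<in> Om"
 shows "ders Y (aa @ [a]) (mon p bt) p =
  (\<Sum>k<length bt. ders Y aa (\<lambda>x. der (Y a) (y (bt ! k) p) x * mon p (del k bt) x) p)" proof -
 have sm: "smooth_on Om (\<lambda>x. der (Y a) (y (bt ! k) p) x * mon p (del k bt) x)" for k
  using op smY by auto
 have "ders Y (aa @ [a]) (mon p bt) p =
   ders Y aa (\<lambda>x. \<Sum>k<length bt. der (Y a) (y (bt ! k) p) x * mon p (del k bt) x) p"
  unfolding ders_append using op smY p by (intro ders_cong[of Om]) (auto simp: der_mono)
 also have "... = (\<Sum>k<length bt. ders Y aa (\<lambda>x. der (Y a) (y (bt ! k) p) x * mon p (del k bt) x) p)"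
  by (rule ders_sum[of Om]) (use op smY p sm in auto)
 finally show ?thesis .
qed

text \<open>All factors of the monomial vanish at \<open>p\<close>, and fewer derivatives than
  factors leave one of them undifferentiated.\<close>

lemma ders_mono_low:
 assumes p: "p \<in> Om"
 shows "length aa < length bt ==> ders Y aa (mon p bt) p = 0"
proof (induction "length aa" arbitrary: aa bt rule: less_induct)
 case less
 show ?case proof (cases aa rule: rev_cases)
  case Nil
  with less(2) show ?thesis by (cases bt) auto
 next
  case (snoc aa' a)
  have "ders Y aa' (\<lambda>x. der (Y a) (y (bt ! k) p) x * mon p (del k bt) x) p = 0" if "k < length bt" for k
  proof (rule ders_mult_zero[of Om])
   fix dl assume "subseq dl aa'"
   then have "length dl <= length aa'" by (rule list_emb_length)
   then show "ders Y dl (mon p (del k bt)) p = 0" using less(2) snoc that by (intro less(1)) auto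
  qed (use op smY p in auto)
  then show ?thesis unfolding snoc ders_snoc_mono[OF p] by simp
 qed
qed

text \<open>Each factor must receive exactly one derivative, so the value counts the matchings of
  equal letters. The bound by 1, rather than mere positivity, later controls the denominators in
  \<open>pf\<close> uniformly in \<open>p\<close>.\<close>

lemma ders_mono_top:
 assumes p: "p \<in> Om"
 shows "length aa = length bt ==>
  (if mset aa = mset bt then ders Y aa (mon p bt) p \<ge> 1 else ders Y aa (mon p bt) p = 0)"
proof (induction aa arbitrary: bt rule: rev_induct)
 case Nil
 then show ?case by simp
next
 case (snoc a aa)
 have t: "ders Y aa (\<lambda>x. der (Y a) (y (bt ! k) p) x * mon p (del k bt) x) p =
   (if bt ! k = a then ders Y aa (mon p (del k bt)) p else 0)" if k: "k < length bt" for k proof -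
  have "ders Y aa (\<lambda>x. der (Y a) (y (bt ! k) p) x * mon p (del k bt) x) p =
    der (Y a) (y (bt ! k) p) p * ders Y aa (mon p (del k bt)) p"
   using k snoc.prems by (intro ders_mult_top[of Om] ders_mono_low) (use op smY p in auto)
  then show ?thesis by (simp add: der_y dual[OF p])
 qed
 have md: "mset bt = mset (del k bt) + {#bt ! k#}" if k: "k < length bt" for k
  by (metis id_take_nth_drop[OF k] mset.simps(2) mset_append union_mset_add_mset_right add_mset_add_single)
 let ?t = "\<lambda>k. if bt ! k = a then ders Y aa (mon p (del k bt)) p else 0"
 have eq: "ders Y (aa @ [a]) (mon p bt) p = (\<Sum>k<length bt. ?t k)"
  unfolding ders_snoc_mono[OF p] using t by simp
 have ih: "if mset aa = mset (del k bt) then ders Y aa (mon p (del k bt)) p \<ge> 1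
   else ders Y aa (mon p (del k bt)) p = 0" if k: "k < length bt" for k using snoc k by auto
 show ?case proof (cases "mset (aa @ [a]) = mset bt")
  case True
  then have "a \<in> set bt" by (metis in_set_conv_decomp mset_eq_setD)
  then obtain k where k: "k < length bt" "bt ! k = a" by (auto simp: in_set_conv_nth)
  have "1 <= ?t k" using ih[OF k(1)] md[OF k(1)] k True by simp
  also have "... <= (\<Sum>k<length bt. ?t k)" proof (rule member_le_sum)
   fix j assume "j \<in> {..<length bt} - {k}"
   then show "0 <= ?t j" using ih[of j] by (auto split: if_splits)
  qed (use k in auto)
  finally show ?thesis using True eq by simp
 next
  case False
  have "?t k = 0" if k: "k < length bt" for k using ih[OF k] md[OF k] False by auto
  then have "(\<Sum>k<length bt. ?t k) = 0" by (intro sum.neutral) auto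
  then show ?thesis using eq False by simp
 qed
qed

text \<open>Derivatives along two orderings of the same word differ by derivatives of lower order, so one
 ordering of each word is enough.\<close>

definition canon :: "'n list => bool" where "canon aa \<longleftrightarrow> aa = (SOME bt. mset bt = mset aa)"

definition CL :: "nat => 'n list set" where "CL m = {aa. length aa = m \<and> canon aa}"

lemma finite_CL: "finite (CL m)"
 by (rule finite_subset[OF _ finite_lists_length_eq[of UNIV m]]) (auto simp: CL_def)

lemma canon_ex: "\<exists>bt. mset bt = mset aa \<and> canon bt" proof -
 let ?b = "SOME bt. mset bt = mset aa"
 have "mset ?b = mset aa" by (rule someI[of "\<lambda>bt. mset bt = mset aa"]) simp
 then show ?thesis unfolding canon_def by (intro exI[of _ ?b]) simp
qed

lemma canon_unique: "canon aa ==> canon bt ==> mset aa = mset bt ==> aa = bt" unfolding canon_def by metis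

text \<open>The \<open>m\<close>-th step removes from the coordinate \<open>y j p\<close> the derivatives of order \<open>m + 2\<close> at \<open>p\<close>
 along the frame; derivatives of lower order are not affected.\<close>

primrec pf :: "'n => 'e => nat => 'e => real"
 where "pf j p 0 = y j p" | "pf j p (Suc m) = (\<lambda>x. pf j p m x -
   (\<Sum>bt\<in>CL (m + 2). (ders Y bt (pf j p m) p / ders Y bt (mon p bt) p) * mon p bt x))"

lemma pf_smooth [intro!]: "smooth_on Om (pf j p m)" using op by (induction m) auto

lemma ders_pf_Suc:
 assumes p: "p \<in> Om"
 shows "ders Y aa (pf j p (Suc m)) p = ders Y aa (pf j p m) p -
   (\<Sum>bt\<in>CL (m + 2). (ders Y bt (pf j p m) p / ders Y bt (mon p bt) p) * ders Y aa (mon p bt) p)"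
proof -
 let ?c = "\<lambda>bt. ders Y bt (pf j p m) p / ders Y bt (mon p bt) p"
 have "ders Y aa (pf j p (Suc m)) p = ders Y aa (pf j p m) p - ders Y aa (\<lambda>x. \<Sum>bt\<in>CL (m + 2). ?c bt * mon p bt x) p"
  using op smY p by (simp del: add_2_eq_Suc' add_2_eq_Suc, intro ders_diff[of Om]) auto
 also have "ders Y aa (\<lambda>x. \<Sum>bt\<in>CL (m + 2). ?c bt * mon p bt x) p = (\<Sum>bt\<in>CL (m + 2). ders Y aa (\<lambda>x. ?c bt * mon p bt x) p)"
  using op smY p by (intro ders_sum[of Om]) auto
 also have "... = (\<Sum>bt\<in>CL (m + 2). ?c bt * ders Y aa (mon p bt) p)"
  using op smY p by (intro sum.cong refl ders_cmult[of Om]) auto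
 finally show ?thesis .
qed

text \<open>The correction terms have degree at least two and are invisible to derivatives of order
  below two.\<close>

lemma pf_low:
 assumes p: "p \<in> Om"
 shows "pf j p m p = 0" "der (Y i) (pf j p m) p = (if i = j then 1 else 0)" proof -
 have low: "length aa < 2 ==> ders Y aa (pf j p m) p = ders Y aa (y j p) p" for aa proof (induction m)
  case (Suc m)
  then show ?case unfolding ders_pf_Suc[OF p]
   by (subst sum.neutral) (auto simp: CL_def intro!: ders_mono_low[OF p])
 qed simp
 show "pf j p m p = 0" using low[of "[]"] by simp
 show "der (Y i) (pf j p m) p = (if i = j then 1 else 0)" using low[of "[i]"] p by (auto simp: der_y dual)
qed

text \<open>Among canonical words of length \<open>m + 2\<close> the pairing of derivatives with
  monomials is diagonal, so each coefficient is read off directly. Canonical derivatives are removed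
  whatever their weight, which is more than privileged coordinates demand but allows one recipe for
  all \<open>j\<close>.\<close>

lemma pf_canon:
 assumes p: "p \<in> Om"
 shows "canon aa ==> 2 <= length aa ==> length aa <= m + 1 ==> ders Y aa (pf j p m) p = 0" proof (induction m)
 case (Suc m)
 show ?case proof (cases "length aa <= m + 1")
  case True
  then show ?thesis using Suc unfolding ders_pf_Suc[OF p]
   by (subst sum.neutral) (auto simp: CL_def intro!: ders_mono_low[OF p])
 next
  case False
  then have l: "length aa = m + 2" using Suc.prems by simp
  then have a: "aa \<in> CL (m + 2)" using Suc.prems by (simp add: CL_def)
  let ?c = "\<lambda>bt. ders Y bt (pf j p m) p / ders Y bt (mon p bt) p"
  have "ders Y aa (mon p bt) p = 0" if "bt \<in> CL (m + 2)" "bt \<noteq> aa" for bt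
   using ders_mono_top[OF p, of aa bt] canon_unique[of aa bt] that l Suc.prems(1)
   by (auto simp: CL_def split: if_splits)
  then have "(\<Sum>bt\<in>CL (m + 2). ?c bt * ders Y aa (mon p bt) p) = (\<Sum>bt\<in>{aa}. ?c bt * ders Y aa (mon p bt) p)"
   using a finite_CL by (intro sum.mono_neutral_right) auto
  also have "... = ders Y aa (pf j p m) p" using ders_mono_top[OF p, of aa aa] by simp
  finally show ?thesis unfolding ders_pf_Suc[OF p] by simp
 qed
qed simp

text \<open>The coordinate \<open>pf j p m\<close> has weighted order at least \<open>w j\<close> at
  \<open>p\<close>. Canonical frame words of smaller weight are treated first, then all orderings by
  \<open>ders_sort\<close>, then words in the generating fields by
  \<open>ders_words_vanish\<close>.\<close>

lemma pf_words_vanish: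
 assumes p: "p \<in> Om" and "w j <= m" "length v < w j"
 shows "ders X v (pf j p m) p = 0" proof -
 have "ders Y aa (pf j p m) p = 0" if "wt aa < w j" for aa
 proof (rule ders_sort[OF p pf_smooth _ that])
  fix aa assume a: "wt aa < w j"
  obtain bt where b: "mset bt = mset aa" "canon bt" using canon_ex by blast
  have wb: "wt bt < w j" using wt_mset b a by metis
  have "ders Y bt (pf j p m) p = 0" proof (cases "2 <= length bt")
   case True
   then show ?thesis using length_le_wt[of bt] wb assms by (intro pf_canon[OF p b(2)]) auto
  next
   \<comment> \<open>A single letter of weight below \<open>w j\<close> is different from
     \<open>j\<close>, so its derivative is an off-diagonal entry of the duality.\<close>
   case False
   then consider "bt = []" | i where "bt = [i]" by (cases bt) (auto simp: Suc_le_eq)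
   then show ?thesis using wb by cases (auto simp: pf_low[OF p])
  qed
  with b show "\<exists>bt. mset bt = mset aa \<and> ders Y bt (pf j p m) p = 0" by blast
 qed
 from ders_words_vanish[OF p pf_smooth this, where v = v and aa = "[]"] assms show ?thesis by simp
qed

end

text \<open>Families of smooth functions with a parameter in \<open>P\<close>, of the form \<open>\<Sum>k. c\<^sub>k p * h\<^sub>k x\<close> with
 bounded \<open>c\<^sub>k\<close>. Their derivatives are bounded on compact sets uniformly in \<open>p\<close>.\<close>

inductive BF :: "'e::euclidean_space set => 'p set => ('p => 'e => real) => bool" for Om P
 where atom: "smooth_on Om h ==> (\<And>p. p \<in> P ==> \<bar>c p\<bar> <= B) ==>
   (\<And>p x. p \<in> P ==> x \<in> Om ==> f p x = c p * h x) ==> BF Om P f"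
 | plus: "BF Om P f ==> BF Om P g ==> (\<And>p x. p \<in> P ==> x \<in> Om ==> u p x = f p x + g p x) ==> BF Om P u"

lemma BF_smooth:
 assumes "open Om"
 shows "BF Om P f ==> p \<in> P ==> smooth_on Om (f p)" proof (induction rule: BF.induct)
 case (atom h c B f)
 have "smooth_on Om (\<lambda>x. c p * h x)" using atom assms by auto
 then show ?case by (rule smooth_on_cong[OF assms, rotated]) (simp add: atom)
next
 case (plus f g u)
 have "smooth_on Om (\<lambda>x. f p x + g p x)" using plus assms by auto
 then show ?case by (rule smooth_on_cong[OF assms, rotated]) (simp add: plus)
qed

lemma BF_const: "open Om ==> (\<And>p. p \<in> P ==> \<bar>c p\<bar> <= B) ==> BF Om P (\<lambda>p x. c p)"
 by (rule BF.atom[where h = "\<lambda>x. 1" and c = c]) auto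

lemma BF_fun: "smooth_on Om h ==> BF Om P (\<lambda>p. h)"
 by (rule BF.atom[where h = h and c = "\<lambda>p. 1" and B = 1]) auto

lemma BF_add: "BF Om P f ==> BF Om P g ==> BF Om P (\<lambda>p x. f p x + g p x)" by (rule BF.plus) auto

lemma BF_cong: "open Om ==> BF Om P f ==> (\<And>p x. p \<in> P ==> x \<in> Om ==> g p x = f p x) ==> BF Om P g"
 by (rule BF.plus[of Om P f "\<lambda>p x. 0"]) (auto intro!: BF_const[where B = 0])

lemma BF_mult:
 assumes "open Om"
 shows "BF Om P f ==> BF Om P g ==> BF Om P (\<lambda>p x. f p x * g p x)"
proof (induction arbitrary: g rule: BF.induct)
 case f: (atom h c B f)
 from f(4) show ?case proof (induction rule: BF.induct)
  case (atom h' c' B' g)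
  have "\<bar>c p * c' p\<bar> <= B * B'" if "p \<in> P" for p
   unfolding abs_mult using f(2)[OF that] atom(2)[OF that] by (intro mult_mono) auto
  with f atom assms show ?case
   by (intro BF.atom[where h = "\<lambda>x. h x * h' x" and c = "\<lambda>p. c p * c' p" and B = "B * B'"]) auto
 next
  case (plus g g' u)
  show ?case by (rule BF.plus[OF plus(4,5)]) (simp add: plus distrib_left)
 qed
next
 case (plus f f' u)
 show ?case by (rule BF.plus[OF plus(4,5)[OF plus(6)]]) (simp add: plus(3) distrib_right)
qed

lemma BF_sum:
 assumes "open Om"
 shows "(\<And>i. i \<in> I ==> BF Om P (f i)) ==> BF Om P (\<lambda>p x. \<Sum>i\<in>I. f i p x)"
 by (induction I rule: infinite_finite_induct) (auto intro: BF_add BF_const[where B = 0] simp: assms)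

lemma BF_diff:
 assumes "open Om" "BF Om P f" "BF Om P g"
 shows "BF Om P (\<lambda>p x. f p x - g p x)" proof -
 have "BF Om P (\<lambda>p x. f p x + (- 1) * g p x)"
  using assms BF_const[of Om P "\<lambda>p. - 1" 1] by (intro BF_add BF_mult) auto
 then show ?thesis by simp
qed

lemma BF_der:
 assumes "open Om" "smooth_on Om Z"
 shows "BF Om P f ==> BF Om P (\<lambda>p. der Z (f p))" proof (induction rule: BF.induct)
 case (atom h c B f)
 have "der Z (f p) x = c p * der Z h x" if "p \<in> P" "x \<in> Om" for p x proof -
  have "der Z (f p) x = der Z (\<lambda>x. c p * h x) x"
   using assms(1) that atom(3) by (intro der_cong[of Om] BF_smooth[OF _ BF.atom[OF atom(1-3)]]) auto
  then show ?thesis using der_cmult[OF atom(1) that(2)] by simp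
 qed
 then show ?case using atom assms by (intro BF.atom[where h = "der Z h" and c = c and B = B]) auto
next
 case (plus f g u)
 have "der Z (u p) x = der Z (f p) x + der Z (g p) x" if "p \<in> P" "x \<in> Om" for p x proof -
  have sm: "smooth_on Om (f p)" "smooth_on Om (g p)"
   using BF_smooth[OF assms(1) plus(1) that(1)] BF_smooth[OF assms(1) plus(2) that(1)] .
  have "der Z (u p) x = der Z (\<lambda>x. f p x + g p x) x" using assms(1) that plus(3)
   by (intro der_cong[of Om] BF_smooth[OF _ BF.plus[OF plus(1-3)]]) auto
  then show ?thesis using der_add[OF sm that(2)] by simp
 qed
 then show ?case by (rule BF.plus[OF plus(4,5)])
qed

lemma BF_ders:
 assumes "open Om" "\<And>i. smooth_on Om (Z i)"
 shows "BF Om P f ==> BF Om P (\<lambda>p. ders Z v (f p))" by (induction v) (auto intro: BF_der assms)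

lemma BF_bounded:
 assumes "compact K" "K \<subseteq> Om"
 shows "BF Om P f ==> \<exists>C>0. \<forall>p\<in>P. \<forall>x\<in>K. \<bar>f p x\<bar> <= C" proof (induction rule: BF.induct)
 case (atom h c B f)
 have "continuous_on K h" using atom smooth_on_continuous assms continuous_on_subset by blast
 then have "bounded (h ` K)" using assms compact_continuous_image compact_imp_bounded by blast
 then obtain D where D: "\<And>x. x \<in> K ==> \<bar>h x\<bar> <= D" by (auto simp: bounded_iff)
 have "\<bar>f p x\<bar> <= \<bar>B * D\<bar> + 1" if "p \<in> P" "x \<in> K" for p x proof -
  have "\<bar>f p x\<bar> = \<bar>c p\<bar> * \<bar>h x\<bar>" using atom that assms by (auto simp: abs_mult)
  also have "... <= B * D" using atom(2)[OF that(1)] D[OF that(2)] by (intro mult_mono) auto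
  finally show ?thesis by linarith
 qed
 then show ?case by (intro exI[of _ "\<bar>B * D\<bar> + 1"]) auto
next
 case (plus f g u)
 then obtain C D where CD: "C > 0" "D > 0" "\<forall>p\<in>P. \<forall>x\<in>K. \<bar>f p x\<bar> <= C" "\<forall>p\<in>P. \<forall>x\<in>K. \<bar>g p x\<bar> <= D" by blast
 have "\<bar>u p x\<bar> <= C + D" if "p \<in> P" "x \<in> K" for p x proof -
  have "\<bar>u p x\<bar> <= \<bar>f p x\<bar> + \<bar>g p x\<bar>" using plus(3)[OF that(1)] that(2) assms by auto
  also have "... <= C + D" using CD that by (intro add_mono) auto
  finally show ?thesis .
 qed
 then show ?case using CD by (intro exI[of _ "C + D"]) auto
qed

lemma smooth_partials_bound:
 fixes f :: "'e::euclidean_space => real"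
 assumes K: "convex K" "K \<subseteq> Om" and f: "smooth_on Om f"
  and C: "\<And>b x. b \<in> Basis ==> x \<in> K ==> \<bar>der (\<lambda>x. b) f x\<bar> <= C b" and x: "x \<in> K" "z \<in> K"
 shows "\<bar>f x - f z\<bar> <= (\<Sum>b\<in>Basis. C b) * norm (x - z)" proof -
 have C0: "0 <= C b" if "b \<in> Basis" for b using C[OF that x(1)] by linarith
 have "norm (f x - f z) <= (\<Sum>b\<in>Basis. C b) * norm (x - z)"
 proof (rule differentiable_bound[OF K(1)])
  fix u assume u: "u \<in> K"
  then have D: "(f has_derivative frechet_derivative f (at u)) (at u)"
   using smooth_on_has_derivative[OF f] K by blast
  then show "(f has_derivative frechet_derivative f (at u)) (at u within K)"
   by (rule has_derivative_at_withinI)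
  show "onorm (frechet_derivative f (at u)) <= (\<Sum>b\<in>Basis. C b)" proof (rule onorm_bound)
   fix v
   have "frechet_derivative f (at u) v = (\<Sum>b\<in>Basis. (v \<bullet> b) *\<^sub>R frechet_derivative f (at u) b)"
    using der_eq[OF f, of u "\<lambda>_. v"] u K by (auto simp: der_def)
   also have "norm ... <= (\<Sum>b\<in>Basis. norm v * C b)" proof (rule sum_norm_le)
    fix b :: 'e assume b: "b \<in> Basis"
    show "norm ((v \<bullet> b) *\<^sub>R frechet_derivative f (at u) b) <= norm v * C b"
     using C[OF b u] Basis_le_norm[OF b, of v] unfolding der_def
     by (auto simp: abs_mult intro!: mult_mono)
   qed
   finally have "norm (frechet_derivative f (at u) v) <= norm v * (\<Sum>b\<in>Basis. C b)"
    by (simp only: sum_distrib_left)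
   then show "norm (frechet_derivative f (at u) v) <= (\<Sum>b\<in>Basis. C b) * norm v"
    by (simp only: mult.commute)
  qed (simp add: sum_nonneg C0)
 qed (use x in auto)
 then show ?thesis by simp
qed

text \<open>Partial derivatives of such a family form a family of the same kind, so their bounds on
  \<open>K\<close> are uniform in the parameter.\<close>

lemma BF_lipschitz:
 assumes "compact K" "convex K" "K \<subseteq> Om" "open Om" "BF Om P f"
 shows "\<exists>C>0. \<forall>p\<in>P. \<forall>x\<in>K. \<forall>z\<in>K. \<bar>f p x - f p z\<bar> <= C * norm (x - z)" proof -
 have "\<exists>C>0. \<forall>p\<in>P. \<forall>x\<in>K. \<bar>der (\<lambda>x. b) (f p) x\<bar> <= C" for b
  using assms by (intro BF_bounded[of K Om] BF_der) auto
 then obtain C where C: "\<And>b. C b > 0" "\<And>b p x. p \<in> P ==> x \<in> K ==> \<bar>der (\<lambda>x. b) (f p) x\<bar> <= C b"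
  by metis
 have "\<bar>f p x - f p z\<bar> <= (\<Sum>b\<in>Basis. C b) * norm (x - z)" if p: "p \<in> P" and x: "x \<in> K" "z \<in> K" for p x z
  by (rule smooth_partials_bound[OF assms(2,3) BF_smooth[OF assms(4,5) p] C(2)[OF p] x])
 moreover have "(\<Sum>b\<in>(Basis::'a set). C b) > 0" using C by (intro sum_pos) auto
 ultimately show ?thesis by blast
qed

context adapted_frame
begin

text \<open>Expanding the inner product over the basis separates the dependence on \<open>p\<close>
  from the dependence on \<open>x\<close>.\<close>

lemma BF_y:
 assumes P: "compact P" "P \<subseteq> Om"
 shows "BF Om P (y b)" proof -
 have bd: "\<exists>B. \<forall>p\<in>P. \<bar>h p\<bar> <= B" if "continuous_on P h" for h :: "'e => real"
  using compact_imp_bounded[OF compact_continuous_image[OF that P(1)]] by (auto simp: bounded_iff)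
 have ct: "continuous_on P (vt b)"
  using smooth_on_continuous[OF smvt] P continuous_on_subset by blast
 obtain B where B: "\<forall>p\<in>P. \<bar>vt b p \<bullet> p\<bar> <= B" using bd[OF continuous_on_inner[OF ct continuous_on_id]] by auto
 have "BF Om P (\<lambda>p x. (vt b p \<bullet> i) * (x \<bullet> i))" for i proof -
  obtain B' where B': "\<forall>p\<in>P. \<bar>vt b p \<bullet> i\<bar> <= B'" using bd[OF continuous_on_inner[OF ct continuous_on_const]] by auto
  show ?thesis
   using op B' by (intro BF_mult BF_const[where B = B'] BF_fun smooth_on_inner smooth_on_const
     smooth_on_bounded_linear[OF bounded_linear_ident]) auto
 qed
 then have "BF Om P (\<lambda>p x. (\<Sum>i\<in>Basis. (vt b p \<bullet> i) * (x \<bullet> i)) - vt b p \<bullet> p)"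
  using op B by (intro BF_diff BF_sum BF_const[where B = B]) auto
 then show ?thesis
  by (rule BF_cong[OF op]) (simp add: y_def inner_diff_right flip: euclidean_inner)
qed

lemma BF_mono: "compact P ==> P \<subseteq> Om ==> BF Om P (\<lambda>p. mon p aa)"
 by (induction aa) (auto intro!: BF_mult op BF_y BF_const[where B = 1])

lemma BF_pf:
 assumes P: "compact P" "P \<subseteq> Om"
 shows "BF Om P (\<lambda>p. pf j p m)" proof (induction m)
 case (Suc m)
 have "BF Om P (\<lambda>p x. (ders Y bt (pf j p m) p / ders Y bt (mon p bt) p) * mon p bt x)" if "bt \<in> CL (m + 2)" for bt
 proof -
  from BF_bounded[OF P BF_ders[where v = bt and Z = Y, OF op smY Suc]] obtain C where
   C: "C > 0" "\<And>p. p \<in> P ==> \<bar>ders Y bt (pf j p m) p\<bar> <= C" by meson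
  have "\<bar>ders Y bt (pf j p m) p / ders Y bt (mon p bt) p\<bar> <= C" if "p \<in> P" for p proof -
   \<comment> \<open>This lower bound keeps the quotient bounded as \<open>p\<close> varies in
     \<open>P\<close>.\<close>
   have "ders Y bt (mon p bt) p \<ge> 1" using ders_mono_top[of p bt bt] P that by auto
   then have "\<bar>ders Y bt (pf j p m) p / ders Y bt (mon p bt) p\<bar> <= \<bar>ders Y bt (pf j p m) p\<bar> / 1"
    unfolding abs_divide by (intro divide_left_mono) auto
   then show ?thesis using C(2)[OF that] by simp
  qed
  then show ?thesis using op P by (intro BF_mult BF_const[where B = C] BF_mono) auto
 qed
 then show ?case unfolding pf.simps by (intro BF_diff op Suc BF_sum)
qed (simp add: BF_y P)

end

section \<open>Noncommutative power series\<close>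

typedef 'k ncs = "UNIV :: ('k list => real) set" morphisms coef Ncs ..

setup_lifting type_definition_ncs

lemma ncs_eqI: "(\<And>w. coef A w = coef B w) ==> A = B" by (metis coef_inject ext)

instantiation ncs :: (type) ring_1
begin

lift_definition zero_ncs :: "'a ncs" is "\<lambda>w. 0" .
lift_definition one_ncs :: "'a ncs" is "\<lambda>w. if w = [] then 1 else 0" .
lift_definition plus_ncs :: "'a ncs => 'a ncs => 'a ncs" is "\<lambda>A B w. A w + B w" .
lift_definition minus_ncs :: "'a ncs => 'a ncs => 'a ncs" is "\<lambda>A B w. A w - B w" .
lift_definition uminus_ncs :: "'a ncs => 'a ncs" is "\<lambda>A w. - A w" .
lift_definition times_ncs :: "'a ncs => 'a ncs => 'a ncs"
 is "\<lambda>A B w. \<Sum>k\<le>length w. A (take k w) * B (drop k w)" .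

instance proof
 fix A B C :: "'a ncs"
 show "A + B + C = A + (B + C)" "A + B = B + A" "0 + A = A" "- A + A = 0" "A - B = A + - B"
  by (transfer, auto)+
 show "(A + B) * C = A * C + B * C" "A * (B + C) = A * B + A * C"
  by (transfer, auto simp: algebra_simps sum.distrib)+
 show "1 * A = A" proof (transfer, rule ext)
  fix A :: "'a list => real" and w :: "'a list"
  have "(\<Sum>k\<le>length w. (if take k w = [] then 1 else 0) * A (drop k w)) = (\<Sum>k\<in>{0}. (if take k w = [] then 1 else 0) * A (drop k w))"
   by (intro sum.mono_neutral_right) auto
  then show "(\<Sum>k\<le>length w. (if take k w = [] then 1 else 0) * A (drop k w)) = A w" by simp
 qed
 show "A * 1 = A" proof (transfer, rule ext)
  fix A :: "'a list => real" and w :: "'a list"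
  have "(\<Sum>k\<le>length w. A (take k w) * (if drop k w = [] then 1 else 0)) = (\<Sum>k\<in>{length w}. A (take k w) * (if drop k w = [] then 1 else 0))"
   by (intro sum.mono_neutral_right) auto
  then show "(\<Sum>k\<le>length w. A (take k w) * (if drop k w = [] then 1 else 0)) = A w" by simp
 qed
 show "(0::'a ncs) \<noteq> 1" by (transfer, metis zero_neq_one)
 show "A * B * C = A * (B * C)" proof (transfer, rule ext)
  fix A B C :: "'a list => real" and w :: "'a list"
  let ?n = "length w"
  let ?t = "\<lambda>j k. A (take j w) * B (drop j (take k w)) * C (drop k w)"
  have "(\<Sum>k\<le>?n. (\<Sum>j\<le>length (take k w). A (take j (take k w)) * B (drop j (take k w))) * C (drop k w))
    = (\<Sum>k\<le>?n. \<Sum>j\<le>k. ?t j k)"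
   by (intro sum.cong refl) (auto simp: sum_distrib_right min_def intro!: sum.cong)
  also have "... = (\<Sum>(k, j)\<in>Sigma {..?n} (\<lambda>k. {..k}). ?t j k)" by (simp add: sum.Sigma)
  \<comment> \<open>Both sides sum over the ways to cut \<open>w\<close> into three pieces, given by
    the two cuts or by the first cut and the length of the middle piece.\<close>
  also have "... = (\<Sum>(j, i)\<in>Sigma {..?n} (\<lambda>j. {..?n - j}). ?t j (j + i))"
   by (rule sum.reindex_bij_witness[where i = "\<lambda>(j, i). (j + i, j)" and j = "\<lambda>(k, j). (j, k - j)"]) auto
  also have "... = (\<Sum>j\<le>?n. \<Sum>i\<le>?n - j. ?t j (j + i))" by (simp add: sum.Sigma)
  also have "... = (\<Sum>j\<le>?n. A (take j w) * (\<Sum>i\<le>length (drop j w). B (take i (drop j w)) * C (drop i (drop j w))))"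
   by (intro sum.cong refl) (auto simp: sum_distrib_left drop_take mult.assoc add.commute intro!: sum.cong)
  finally show "(\<Sum>k\<le>?n. (\<Sum>j\<le>length (take k w). A (take j (take k w)) * B (drop j (take k w))) * C (drop k w))
   = (\<Sum>j\<le>?n. A (take j w) * (\<Sum>i\<le>length (drop j w). B (take i (drop j w)) * C (drop i (drop j w))))" .
 qed
qed

end

lemmas coef_simps [simp] = zero_ncs.rep_eq one_ncs.rep_eq plus_ncs.rep_eq minus_ncs.rep_eq uminus_ncs.rep_eq
lemmas coef_times = times_ncs.rep_eq

definition ordge :: "nat => 'k ncs => bool" where "ordge m A \<longleftrightarrow> (\<forall>w. length w < m --> coef A w = 0)"

lemma ordge_add: "ordge m A ==> ordge m B ==> ordge m (A + B)"
 and ordge_diff: "ordge m A ==> ordge m B ==> ordge m (A - B)"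
 and ordge_mono: "ordge m A ==> k <= m ==> ordge k A" by (auto simp: ordge_def)

lemma ordge_mult:
 assumes "ordge m A" "ordge k B"
 shows "ordge (m + k) (A * B)" unfolding ordge_def proof (intro allI impI)
 fix w :: "'a list" assume w: "length w < m + k"
 have "coef A (take j w) * coef B (drop j w) = 0" if "j <= length w" for j
  using assms w that by (cases "j < m") (auto simp: ordge_def)
 then show "coef (A * B) w = 0" unfolding coef_times by (intro sum.neutral) auto
qed

definition homog :: "nat => 'k ncs => bool" where "homog m A \<longleftrightarrow> (\<forall>w. length w \<noteq> m --> coef A w = 0)"

lemma homog_diff: "homog m A ==> homog m B ==> homog m (A - B)" and homog_ordge: "homog m A ==> ordge m A"
 by (auto simp: homog_def ordge_def)

lemma homog_mult:
 assumes "homog m A" "homog k B"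
 shows "homog (m + k) (A * B)" unfolding homog_def proof (intro allI impI)
 fix w :: "'a list" assume w: "length w \<noteq> m + k"
 have "coef A (take j w) * coef B (drop j w) = 0" if "j <= length w" for j
  using assms w that by (cases "j = m") (auto simp: homog_def)
 then show "coef (A * B) w = 0" unfolding coef_times by (intro sum.neutral) auto
qed

lift_definition letter :: "'k => 'k ncs" is "\<lambda>i w. if w = [i] then 1 else 0" .

lemma homog_letter: "homog 1 (letter i)" unfolding homog_def by transfer auto

text \<open>The exponential series of \<open>t\<close> times the letter \<open>i\<close>: the
  signature of a straight segment.\<close>

lift_definition seg :: "'k => real => 'k ncs"
 is "\<lambda>i t w. if w = replicate (length w) i then t ^ length w / fact (length w) else 0" .

lemma seg_add: "seg i t * seg i s = seg i (t + s)" proof (rule ncs_eqI)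
 fix w
 show "coef (seg i t * seg i s) w = coef (seg i (t + s)) w"
 proof (cases "w = replicate (length w) i")
  case True
  define n where "n = length w"
  have w: "w = replicate n i" using True by (simp add: n_def)
  have "coef (seg i t * seg i s) w = (\<Sum>k\<le>n. (t ^ k / fact k) * (s ^ (n - k) / fact (n - k)))"
   unfolding coef_times w by (intro sum.cong) (auto simp: seg.rep_eq)
  also have "... = (\<Sum>k\<le>n. (of_nat (n choose k) * t ^ k * s ^ (n - k)) / fact n)"
   by (intro sum.cong refl) (auto simp: binomial_fact field_simps)
  also have "... = (t + s) ^ n / fact n" by (simp add: binomial_ring sum_divide_distrib)
  finally show ?thesis by (simp add: seg.rep_eq w)
 next
  case False
  have "coef (seg i t) (take k w) * coef (seg i s) (drop k w) = 0" if "k <= length w" for k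
  proof (rule ccontr)
   assume "\<not> ?thesis"
   then have "take k w = replicate (length (take k w)) i" "drop k w = replicate (length (drop k w)) i"
    by (auto simp: seg.rep_eq split: if_splits)
   then have "take k w @ drop k w = replicate (length (take k w) + length (drop k w)) i"
    by (metis replicate_add)
   then show False using False that by simp
  qed
  then have "coef (seg i t * seg i s) w = 0" unfolding coef_times by (intro sum.neutral) auto
  then show ?thesis using False by (simp add: seg.rep_eq)
 qed
qed

lemma seg_0: "seg i 0 = 1" by (rule ncs_eqI) (auto simp: seg.rep_eq power_0_left)

lemma seg_lead: "ordge 2 (seg i 1 - 1 - letter i)" unfolding ordge_def proof (intro allI impI)
 fix w :: "'a list" assume "length w < 2"
 then consider "w = []" | j where "w = [j]" by (cases w) (auto simp: Suc_le_eq less_Suc_eq)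
 then show "coef (seg i 1 - 1 - letter i) w = 0" by cases (auto simp: seg.rep_eq letter.rep_eq)
qed

text \<open>Chen's signature of the path that follows the generators with the given times.\<close>

primrec sig :: "('k \<times> real) list => 'k ncs"
 where "sig [] = 1" | "sig (s # ps) = seg (fst s) (snd s) * sig ps"

lemma sig_append: "sig (ps @ qs) = sig ps * sig qs" by (induction ps) (auto simp: mult.assoc)

definition pinv :: "('k \<times> real) list => ('k \<times> real) list"
 where "pinv ps = rev (map (\<lambda>(i, t). (i, - t)) ps)"

definition pscale :: "real => ('k \<times> real) list => ('k \<times> real) list"
 where "pscale c ps = map (\<lambda>(i, t). (i, c * t)) ps"

lemma pscale_simps [simp]: "pscale c [] = []" "pscale c (s # ps) = (fst s, c * snd s) # pscale c ps"
 "pscale c (ps @ qs) = pscale c ps @ pscale c qs" "map fst (pscale c ps) = map fst ps" "length (pscale c ps) = length ps"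
 by (auto simp: pscale_def split_beta)

lemma sig_pinv: "sig ps * sig (pinv ps) = 1" "sig (pinv ps) * sig ps = 1" proof -
 have "sig ps * sig (pinv ps) = 1 \<and> sig (pinv ps) * sig ps = 1" proof (induction ps)
  case (Cons s ps)
  obtain i t where s: "s = (i, t)" by fastforce
  have p: "sig (pinv (s # ps)) = sig (pinv ps) * seg i (- t)" by (simp add: pinv_def sig_append s)
  have "sig (s # ps) * sig (pinv (s # ps)) = seg i t * (sig ps * sig (pinv ps)) * seg i (- t)"
   unfolding p by (simp add: s mult.assoc)
  moreover have "sig (pinv (s # ps)) * sig (s # ps) = sig (pinv ps) * (seg i (- t) * seg i t) * sig ps"
   unfolding p by (simp add: s mult.assoc)
  ultimately show ?case using Cons by (simp add: seg_add seg_0)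
 qed (simp add: pinv_def)
 then show "sig ps * sig (pinv ps) = 1" "sig (pinv ps) * sig ps = 1" by auto
qed

lemma coef_seg_scale: "coef (seg i (c * t)) w = c ^ length w * coef (seg i t) w"
 by (simp add: seg.rep_eq power_mult_distrib)

text \<open>Dilating the times of a path multiplies the coefficient of a word by a power given by
  its length. This is the source of the anisotropic scaling of boxes.\<close>

lemma coef_sig_pscale: "coef (sig (pscale c ps)) w = c ^ length w * coef (sig ps) w"
proof (induction ps arbitrary: w)
 case (Cons s ps)
 have "coef (sig (pscale c (s # ps))) w = (\<Sum>k\<le>length w. (c ^ k * coef (seg (fst s) (snd s)) (take k w)) * (c ^ (length w - k) * coef (sig ps) (drop k w)))"
  by (auto simp: coef_times coef_seg_scale Cons intro!: sum.cong)
 also have "... = (\<Sum>k\<le>length w. c ^ length w * (coef (seg (fst s) (snd s)) (take k w) * coef (sig ps) (drop k w)))"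
 proof (intro sum.cong refl)
  fix k assume "k \<in> {..length w}"
  then have "c ^ length w = c ^ k * c ^ (length w - k)" by (simp flip: power_add)
  then show "(c ^ k * coef (seg (fst s) (snd s)) (take k w)) * (c ^ (length w - k) * coef (sig ps) (drop k w)) =
   c ^ length w * (coef (seg (fst s) (snd s)) (take k w) * coef (sig ps) (drop k w))" by (simp add: mult_ac)
 qed
 finally show ?case by (simp add: coef_times sum_distrib_left)
qed auto

lemma sig_nil [simp]: "coef (sig ps) [] = 1" proof (induction ps)
 case (Cons s ps)
 then show ?case by (simp add: coef_times seg.rep_eq)
qed simp

section \<open>Lie elements and commutator paths\<close>

fun lie :: "'k list => 'k ncs"
 where "lie [] = 0" | "lie [i] = letter i" | "lie (i # J) = letter i * lie J - lie J * letter i"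

text \<open>The path counterpart of the nested bracket: a group commutator of the segment along
  \<open>i\<close> with the path of the remaining word. The empty word only receives a default
  value.\<close>

fun cp :: "'k list => ('k \<times> real) list"
 where "cp [] = []" | "cp [i] = [(i, 1)]"
 | "cp (i # J) = [(i, 1)] @ cp J @ [(i, - 1)] @ pinv (cp J)"

lemma homog_lie: "J \<noteq> [] ==> homog (length J) (lie J)" proof (induction J rule: lie.induct)
 case (3 i j J)
 then have "homog (length (j # J)) (lie (j # J))" by simp
 from homog_mult[OF homog_letter[of i] this] homog_mult[OF this homog_letter[of i]]
 show ?case by (auto intro!: homog_diff)
qed (use homog_letter in auto)

text \<open>With \<open>e = exp X\<close> and \<open>S = 1 + A\<close> the group commutator is
 \<open>e S e\<inverse> S\<inverse> = 1 + [e - 1, A] e\<inverse> S\<inverse>\<close>.\<close>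

lemma sig_cp_lead: "J \<noteq> [] ==> ordge (length J + 1) (sig (cp J) - 1 - lie J)"
proof (induction J rule: lie.induct)
 case (2 i)
 then show ?case using seg_lead[of i] by (simp add: numeral_2_eq_2)
next
 case (3 i j J)
 let ?K = "j # J" and ?n = "length (j # J)"
 define e e' where "e = seg i 1" and "e' = seg i (- 1)"
 define S S' where "S = sig (cp ?K)" and "S' = sig (pinv (cp ?K))"
 define A E where "A = S - 1" and "E = e - 1"
 have ee: "e * e' = 1" by (simp add: e_def e'_def seg_add seg_0)
 have SS: "S * S' = 1" by (simp add: S_def S'_def sig_pinv)
 have s1: "sig (cp (i # ?K)) = e * S * e' * S'"
  by (simp add: sig_append e_def e'_def S_def S'_def mult.assoc)
 have one: "S * e * (e' * S') = 1" using ee SS by (metis mult.assoc mult_1_left)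
 have "sig (cp (i # ?K)) - 1 = (e * S - S * e) * (e' * S')"
  unfolding s1 left_diff_distrib one by (simp add: mult.assoc)
 also have "e * S - S * e = E * A - A * E" by (simp add: A_def E_def algebra_simps)
 finally have s2: "sig (cp (i # ?K)) - 1 = (E * A - A * E) * (e' * S')" .
 have A1: "ordge (?n + 1) (A - lie ?K)" using 3 by (simp add: A_def S_def)
 have E1: "ordge 2 (E - letter i)" using seg_lead[of i] by (simp add: E_def e_def)
 have l: "ordge ?n (lie ?K)" "ordge 1 (letter i)" using homog_lie[of ?K] homog_letter[of i] homog_ordge by auto
 have A0: "ordge ?n A" using ordge_add[OF ordge_mono[OF A1, of ?n] l(1)] by simp
 have E0: "ordge 1 E" using ordge_add[OF ordge_mono[OF E1, of 1] l(2)] by simp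
 have R: "ordge 1 (e' * S' - 1)"
  unfolding ordge_def by (auto simp: coef_times e'_def S'_def seg.rep_eq)
 have EA: "ordge (?n + 1) (E * A - A * E)"
  using ordge_mult[OF E0 A0] ordge_mult[OF A0 E0] by (intro ordge_diff) auto
 \<comment> \<open>The factors \<open>E\<close>, \<open>A\<close> and \<open>e' * S'\<close> are
   replaced one at a time by their leading terms \<open>letter i\<close>, \<open>lie ?K\<close> and
   1; each error term gains one order.\<close>
 have "sig (cp (i # ?K)) - 1 - lie (i # ?K) =
   (E * A - A * E) * (e' * S' - 1) + ((E - letter i) * A + letter i * (A - lie ?K))
    - ((A - lie ?K) * E + lie ?K * (E - letter i))" unfolding s2 by (simp add: algebra_simps)
 moreover have "ordge (?n + 2) ((E * A - A * E) * (e' * S' - 1))" using ordge_mult[OF EA R] by simp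
 moreover have "ordge (?n + 2) ((E - letter i) * A)" using ordge_mult[OF E1 A0] by simp
 moreover have "ordge (?n + 2) (letter i * (A - lie ?K))" using ordge_mult[OF l(2) A1] by simp
 moreover have "ordge (?n + 2) ((A - lie ?K) * E)" using ordge_mult[OF A1 E0] by simp
 moreover have "ordge (?n + 2) (lie ?K * (E - letter i))" using ordge_mult[OF l(1) E1] by simp
 ultimately have "ordge (?n + 2) (sig (cp (i # ?K)) - 1 - lie (i # ?K))"
  by (simp only:) (intro ordge_add ordge_diff)
 then show ?case by simp
qed simp

section \<open>Flows and the Chen-Fliess expansion\<close>

fun vf :: "('k => 'e::euclidean_space => 'e) => 'k list => 'e => 'e"
 where "vf X [] = (\<lambda>x. 0)" | "vf X [i] = X i" | "vf X (i # J) = lb (X i) (vf X J)"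

lemma vf_smooth [intro!]: "open Om ==> (\<And>i. smooth_on Om (X i)) ==> smooth_on Om (vf X J)"
 by (induction J rule: lie.induct) auto

lemma finite_words: "finite {w :: 'k::finite list. length w = m}"
 using finite_lists_length_eq[of "UNIV :: 'k set" m] by simp

lemma finite_words_lt: "finite {w :: 'k::finite list. length w < m}" proof -
 have "{w :: 'k list. length w < m} = (\<Union>k<m. {w. length w = k})" by auto
 then show ?thesis by (simp add: finite_words)
qed

lemma coef_letter_left: "coef (letter i * A) (j # w) = (if i = j then coef A w else 0)" proof -
 have "(\<Sum>k\<le>length (j # w). coef (letter i) (take k (j # w)) * coef A (drop k (j # w))) =
  (\<Sum>k\<in>{1}. coef (letter i) (take k (j # w)) * coef A (drop k (j # w)))"
 proof (intro sum.mono_neutral_right ballI)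
  fix k assume "k \<in> {..length (j # w)} - {1}"
  then have "length (take k (j # w)) \<noteq> 1" by (auto)
  then have "take k (j # w) \<noteq> [i]" by (metis One_nat_def length_Cons list.size(3))
  then show "coef (letter i) (take k (j # w)) * coef A (drop k (j # w)) = 0" by (simp add: letter.rep_eq)
 qed auto
 then show ?thesis by (simp add: coef_times letter.rep_eq)
qed

lemma coef_letter_right: "coef (A * letter i) (w @ [j]) = (if i = j then coef A w else 0)" proof -
 have "(\<Sum>k\<le>length (w @ [j]). coef A (take k (w @ [j])) * coef (letter i) (drop k (w @ [j]))) =
  (\<Sum>k\<in>{length w}. coef A (take k (w @ [j])) * coef (letter i) (drop k (w @ [j])))"
 proof (intro sum.mono_neutral_right ballI)
  fix k assume "k \<in> {..length (w @ [j])} - {length w}"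
  then have "length (drop k (w @ [j])) \<noteq> 1" by auto
  then have "drop k (w @ [j]) \<noteq> [i]" by (metis One_nat_def length_Cons list.size(3))
  then show "coef A (take k (w @ [j])) * coef (letter i) (drop k (w @ [j])) = 0" by (simp add: letter.rep_eq)
 qed auto
 then show ?thesis by (simp add: coef_times letter.rep_eq)
qed

lemma sum_words_Cons:
 fixes F :: "'k::finite list => real"
 shows "(\<Sum>w | length w = Suc m. F w) = (\<Sum>j\<in>UNIV. \<Sum>w | length w = m. F (j # w))" proof -
 have "(\<Sum>w | length w = Suc m. F w) = (\<Sum>(j, w)\<in>UNIV \<times> {w. length w = m}. F (j # w))"
  by (rule sum.reindex_bij_witness[where i = "\<lambda>(j, w). j # w" and j = "\<lambda>w. (hd w, tl w)"])
    (auto simp: length_Suc_conv)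
 then show ?thesis by (simp add: sum.cartesian_product)
qed

lemma sum_words_snoc:
 fixes F :: "'k::finite list => real"
 shows "(\<Sum>w | length w = Suc m. F w) = (\<Sum>j\<in>UNIV. \<Sum>w | length w = m. F (w @ [j]))" proof -
 have "(\<Sum>w | length w = Suc m. F w) = (\<Sum>(j, w)\<in>UNIV \<times> {w. length w = m}. F (w @ [j]))"
  by (rule sum.reindex_bij_witness[where i = "\<lambda>(j, w). w @ [j]" and j = "\<lambda>w. (last w, butlast w)"])
    (auto simp flip: length_0_conv)
 then show ?thesis by (simp add: sum.cartesian_product)
qed

text \<open>Sending letters to derivations respects products of words, and \<open>vf\<close> is
  nested exactly as \<open>lie\<close>. The product with \<open>letter i\<close> on the left or on
  the right selects the words that begin or end with \<open>i\<close>, which are the two halves of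
  the commutator.\<close>

lemma der_vf_eq:
 fixes X :: "'k::finite => 'e::euclidean_space => 'e" and g :: "'e => real"
 assumes op: "open Om" and X: "\<And>i. smooth_on Om (X i)"
 shows "J \<noteq> [] ==> smooth_on Om g ==> x \<in> Om ==>
  der (vf X J) g x = (\<Sum>w | length w = length J. coef (lie J) w * ders X w g x)"
proof (induction J arbitrary: g x rule: lie.induct)
 case (2 i)
 have "(\<Sum>w | length w = length [i]. coef (lie [i]) w * ders X w g x) =
   (\<Sum>w\<in>{[i]}. coef (lie [i]) w * ders X w g x)"
  by (rule sum.mono_neutral_right) (auto simp: letter.rep_eq finite_words)
 then show ?case by (simp add: letter.rep_eq)
next
 case (3 i j J)
 let ?K = "j # J" and ?m = "length (j # J)"

 have sm: "smooth_on Om (ders X w g)" for w using op X 3 by auto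
 have l: "(\<Sum>w | length w = Suc ?m. coef (letter i * lie ?K) w * ders X w g x) = der (X i) (der (vf X ?K) g) x"
 proof -
  have "(\<Sum>w | length w = Suc ?m. coef (letter i * lie ?K) w * ders X w g x)
    = (\<Sum>j'\<in>UNIV. if i = j' then (\<Sum>w | length w = ?m. coef (lie ?K) w * der (X i) (ders X w g) x) else 0)"
   unfolding sum_words_Cons by (intro sum.cong refl) (auto simp: coef_letter_left)
  also have "... = (\<Sum>w | length w = ?m. coef (lie ?K) w * der (X i) (ders X w g) x)" by simp
  also have "... = (\<Sum>w | length w = ?m. der (X i) (\<lambda>x. coef (lie ?K) w * ders X w g x) x)"
   using sm 3 by (intro sum.cong refl) (simp add: der_cmult[of Om])
  also have "... = der (X i) (\<lambda>x. \<Sum>w | length w = ?m. coef (lie ?K) w * ders X w g x) x"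
   using sm 3 op X by (intro der_sum[of Om, symmetric]) auto
  also have "... = der (X i) (der (vf X ?K) g) x"
   using sm 3(1)[of g] "3.prems" op X by (intro der_cong[of Om]) auto
  finally show ?thesis .
 qed
 have r: "(\<Sum>w | length w = Suc ?m. coef (lie ?K * letter i) w * ders X w g x) = der (vf X ?K) (der (X i) g) x"
 proof -
  have "(\<Sum>w | length w = Suc ?m. coef (lie ?K * letter i) w * ders X w g x)
    = (\<Sum>j'\<in>UNIV. if i = j' then (\<Sum>w | length w = ?m. coef (lie ?K) w * ders X w (der (X i) g) x) else 0)"
   unfolding sum_words_snoc by (intro sum.cong refl) (auto simp: coef_letter_right ders_append)
  also have "... = der (vf X ?K) (der (X i) g) x" proof -
   have "smooth_on Om (der (X i) g)" using "3.prems" op X by auto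
   then show ?thesis using 3(1)[of "der (X i) g" x] "3.prems" by simp
  qed
  finally show ?thesis .
 qed
 have "smooth_on Om (vf X ?K)" by (rule vf_smooth[OF op]) (rule X)
 then have "der (vf X (i # ?K)) g x = der (X i) (der (vf X ?K) g) x - der (vf X ?K) (der (X i) g) x"
  using der_commutator[OF op "3.prems"(3,2), of "X i" "vf X ?K"] X by simp
 also have "... = (\<Sum>w | length w = Suc ?m. coef (lie (i # ?K)) w * ders X w g x)"
  unfolding l[symmetric] r[symmetric] by (simp add: left_diff_distrib sum_subtractf)
 finally show ?case by simp
qed simp

section \<open>Local flows\<close>

lemma vector_derivative_bound:
 fixes h :: "real => 'e::real_normed_vector"
 assumes S: "convex S" and D: "\<And>t. t \<in> S ==> (h has_vector_derivative h' t) (at t within S)"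
  and M: "\<And>t. t \<in> S ==> norm (h' t) <= M" and ab: "a \<in> S" "b \<in> S"
 shows "norm (h b - h a) <= M * \<bar>b - a\<bar>" proof -
 have "norm (h b - h a) <= M * norm (b - a)" proof (rule differentiable_bound[OF S])
  show "(h has_derivative (\<lambda>r. r *\<^sub>R h' t)) (at t within S)" if "t \<in> S" for t
   using D[OF that] by (simp add: has_vector_derivative_def)
  show "onorm (\<lambda>r. r *\<^sub>R h' t) <= M" if "t \<in> S" for t proof (rule onorm_bound)
   show "0 <= M" using M[OF that] norm_ge_zero order_trans by blast
   show "norm (r *\<^sub>R h' t) <= M * norm r" for r
    using mult_left_mono[OF M[OF that], of "\<bar>r\<bar>"] by (simp add: mult.commute)
  qed
 qed (use ab in auto)
 then show ?thesis by simp
qed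

text \<open>Picard iteration in the complete space of bounded continuous curves. The smallness of
  \<open>L * ta\<close> makes the integral operator a contraction with factor 1/2, for all starting
  points at once.\<close>

lemma lipschitz_flow:
 fixes Z :: "'e::euclidean_space => 'e"
 assumes L: "\<And>x y. norm (Z x - Z y) <= L * norm (x - y)" "0 <= L" and ta: "0 < ta" "L * ta <= 1 / 2"
 obtains fi where "\<And>x. fi 0 x = x"
  "\<And>x t. t \<in> {-ta..ta} ==> ((\<lambda>t. fi t x) has_vector_derivative Z (fi t x)) (at t within {-ta..ta})"
  "\<And>x y t. t \<in> {-ta..ta} ==> norm (fi t x - fi t y) <= 2 * norm (x - y)" proof -
 \<comment> \<open>The integral from 0 to \<open>t\<close>, written as a difference in order to
   cover negative times.\<close>
 define J where "J gm t = integral {-ta..t} (\<lambda>s. Z (apply_bcontfun gm s)) - integral {-ta..0} (\<lambda>s. Z (apply_bcontfun gm s))"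
  for gm :: "real \<Rightarrow>\<^sub>C 'e" and t
 \<comment> \<open>Clamping the time turns curves on the interval into bounded continuous functions
   on the whole line.\<close>
 define cl where "cl t = max (-ta) (min ta t)" for t
 have cl: "cl t \<in> {-ta..ta}" "t \<in> {-ta..ta} ==> cl t = t" for t using ta by (auto simp: cl_def)
 have clc: "continuous_on UNIV cl" unfolding cl_def by (intro continuous_intros)
 have "L-lipschitz_on UNIV Z" using L by (intro lipschitz_onI) (auto simp: dist_norm)
 then have Zc: "continuous_on UNIV Z" by (rule lipschitz_on_continuous_on)
 have Zg: "continuous_on S (\<lambda>s. Z (apply_bcontfun gm s))" for S gm
  by (rule continuous_on_compose2[OF Zc]) auto
 have JD: "(J gm has_vector_derivative Z (apply_bcontfun gm t)) (at t within {-ta..ta})" if "t \<in> {-ta..ta}" for gm t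
  unfolding J_def using integral_has_vector_derivative[OF Zg that]
  by (auto intro!: derivative_eq_intros)
 have J0: "J gm 0 = 0" for gm by (simp add: J_def)
 have Jc: "continuous_on {-ta..ta} (J gm)" for gm
  unfolding continuous_on_eq_continuous_within using JD has_vector_derivative_continuous by blast
 have J: "norm (J gm (cl t) - J dl (cl t)) <= dist gm dl / 2" for gm dl t proof -
  have "norm ((J gm (cl t) - J dl (cl t)) - (J gm 0 - J dl 0)) <= (L * dist gm dl) * \<bar>cl t - 0\<bar>"
  proof (rule vector_derivative_bound[where S = "{-ta..ta}" and h = "\<lambda>t. J gm t - J dl t"
     and h' = "\<lambda>t. Z (apply_bcontfun gm t) - Z (apply_bcontfun dl t)"])
   fix s :: real
   have "norm (Z (apply_bcontfun gm s) - Z (apply_bcontfun dl s)) <= L * norm (apply_bcontfun gm s - apply_bcontfun dl s)"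
    by (rule L)
   also have "... <= L * dist gm dl" using dist_bounded[of gm s dl] L by (intro mult_left_mono) (auto simp: dist_norm)
   finally show "norm (Z (apply_bcontfun gm s) - Z (apply_bcontfun dl s)) <= L * dist gm dl" .
   show "((\<lambda>t. J gm t - J dl t) has_vector_derivative Z (apply_bcontfun gm s) - Z (apply_bcontfun dl s)) (at s within {-ta..ta})"
    if "s \<in> {-ta..ta}" using JD[OF that] by (auto intro!: derivative_eq_intros)
  qed (use ta cl in auto)
  also have "... <= (L * dist gm dl) * ta" using cl[of t] L ta by (intro mult_left_mono) auto
  also have "... = (L * ta) * dist gm dl" by simp
  also have "... <= 1 / 2 * dist gm dl" using ta by (intro mult_right_mono) auto
  finally show ?thesis by (simp add: J0)
 qed
 define F where "F x gm = Bcontfun (\<lambda>t. x + J gm (cl t))" for x gm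
 have Fb: "(\<lambda>t. x + J gm (cl t)) \<in> bcontfun" for x gm proof -
  have "compact (J gm ` {-ta..ta})" by (rule compact_continuous_image[OF Jc]) simp
  then have "bounded ((+) x ` (J gm ` {-ta..ta}))" by (intro bounded_translation compact_imp_bounded)
  then have "bounded (range (\<lambda>t. x + J gm (cl t)))" by (rule bounded_subset) (use cl in auto)
  moreover have "continuous_on UNIV (\<lambda>t. x + J gm (cl t))"
   by (intro continuous_intros continuous_on_compose2[OF Jc clc]) (use cl in auto)
  ultimately show ?thesis by (simp add: bcontfun_def)
 qed
 have F: "apply_bcontfun (F x gm) t = x + J gm (cl t)" for x gm t
  unfolding F_def using Fb by (simp add: Bcontfun_inverse)
 have "\<exists>!gm. F x gm = gm" for x proof (rule banach_fix_type[of "1/2"])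
  show "\<forall>gm dl. dist (F x gm) (F x dl) <= 1 / 2 * dist gm dl" proof (intro allI)
   fix gm dl
   have "dist (F x gm) (F x dl) <= dist gm dl / 2"
    by (rule dist_bound) (simp only: F dist_norm add_diff_cancel_left J[unfolded dist_norm])
   then show "dist (F x gm) (F x dl) <= 1 / 2 * dist gm dl" by simp
  qed
 qed auto
 then have "\<forall>x. \<exists>gm. F x gm = gm" by blast
 then obtain G where G: "\<And>x. F x (G x) = G x" by metis
 have Gt: "apply_bcontfun (G x) t = x + J (G x) (cl t)" for x t using F[of x "G x" t] unfolding G .
 \<comment> \<open>The distance of two fixed points is at most that of the starting points plus half
   of itself, whence the factor 2.\<close>
 have lip: "dist (G x) (G z) <= 2 * norm (x - z)" for x z proof -
  have "dist (G x) (G z) <= norm (x - z) + dist (G x) (G z) / 2" proof (rule dist_bound)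
   fix t
   have "dist (apply_bcontfun (G x) t) (apply_bcontfun (G z) t) = norm ((x - z) + (J (G x) (cl t) - J (G z) (cl t)))"
    by (simp only: Gt[of x] Gt[of z] dist_norm) (simp add: algebra_simps)
   also have "... <= norm (x - z) + norm (J (G x) (cl t) - J (G z) (cl t))" by (rule norm_triangle_ineq)
   also have "... <= norm (x - z) + dist (G x) (G z) / 2" using J by (intro add_left_mono)
   finally show "dist (apply_bcontfun (G x) t) (apply_bcontfun (G z) t) <= norm (x - z) + dist (G x) (G z) / 2" .
  qed
  then show ?thesis by simp
 qed
 show thesis proof (rule that[of "\<lambda>t x. apply_bcontfun (G x) t"])
  show "apply_bcontfun (G x) 0 = x" for x using Gt[of x 0] J0 cl(2)[of 0] ta by simp
  show "((\<lambda>t. apply_bcontfun (G x) t) has_vector_derivative Z (apply_bcontfun (G x) t)) (at t within {-ta..ta})"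
   if "t \<in> {-ta..ta}" for x t proof -
   have "((\<lambda>t. x + J (G x) t) has_vector_derivative Z (apply_bcontfun (G x) t)) (at t within {-ta..ta})"
    using JD[OF that] by (auto intro!: derivative_eq_intros)
   then show ?thesis
    by (rule has_vector_derivative_transform[rotated 2]) (use that Gt cl in auto)
  qed
  show "norm (apply_bcontfun (G x) t - apply_bcontfun (G z) t) <= 2 * norm (x - z)" for x z t
   using dist_bounded[of "G x" t "G z"] lip[of x z] by (simp add: dist_norm)
 qed
qed

lemma smooth_lipschitz:
 fixes f :: "'e::euclidean_space => 'f::euclidean_space"
 assumes "compact K" "convex K" "K \<subseteq> Om" "open Om" "smooth_on Om f"
 shows "\<exists>L>0. \<forall>x\<in>K. \<forall>z\<in>K. norm (f x - f z) <= L * norm (x - z)" proof -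
 have "\<exists>C>0. \<forall>x\<in>K. \<forall>z\<in>K. \<bar>f x \<bullet> b - f z \<bullet> b\<bar> <= C * norm (x - z)" for b
  using BF_lipschitz[OF assms(1-4) BF_fun[OF smooth_on_inner_left[OF assms(4,5)]], of "UNIV :: unit set" b] by auto
 then obtain C where C: "\<And>b. C b > 0"
  "\<And>b x z. x \<in> K ==> z \<in> K ==> \<bar>f x \<bullet> b - f z \<bullet> b\<bar> <= C b * norm (x - z)" by metis
 have "norm (f x - f z) <= (\<Sum>b\<in>Basis. C b) * norm (x - z)" if "x \<in> K" "z \<in> K" for x z proof -
  have "norm (f x - f z) <= (\<Sum>b\<in>Basis. \<bar>(f x - f z) \<bullet> b\<bar>)" by (rule norm_le_l1)
  also have "... <= (\<Sum>b\<in>Basis. C b * norm (x - z))"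
   using C(2)[OF that] by (intro sum_mono) (auto simp: inner_diff_left)
  finally show ?thesis by (simp add: sum_distrib_right)
 qed
 moreover have "(\<Sum>b\<in>(Basis::'f set). C b) > 0" using C by (intro sum_pos) auto
 ultimately show ?thesis by blast
qed

primrec endp :: "('k => real => 'e => 'e) => ('k \<times> real) list => 'e => 'e"
 where "endp fi [] x = x" | "endp fi (s # ps) x = endp fi ps (fi (fst s) (snd s) x)"

text \<open>Closeness and joint continuity are global in \<open>x\<close>, while the differential
  equation is asserted only as long as the speed bound \<open>B\<close> keeps the curve inside the
  ball of radius \<open>R\<close>. This matches flows of fields that are modified outside the
  ball.\<close>

locale flows =
 fixes Om :: "'e::euclidean_space set" and X :: "'k::finite => 'e => 'e"
  and x0 :: 'e and R B ta :: real and fi :: "'k => real => 'e => 'e"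
 assumes op': "open Om" and smX': "\<And>i. smooth_on Om (X i)"
  and R: "0 < R" "cball x0 R \<subseteq> Om" and B: "0 < B" and ta: "0 < ta" and flow0: "\<And>i x. fi i 0 x = x"
  and flow_near: "\<And>i x t. \<bar>t\<bar> <= ta ==> norm (fi i t x - x) <= B * \<bar>t\<bar>"
  and flow_deriv: "\<And>i x t. \<bar>t\<bar> <= ta ==> norm (x - x0) + B * \<bar>t\<bar> <= R ==>
   ((\<lambda>t. fi i t x) has_vector_derivative X i (fi i t x)) (at t within {-ta..ta})"
  and flow_cont: "\<And>i. continuous_on ({-ta..ta} \<times> UNIV) (\<lambda>(t, x). fi i t x)"

text \<open>On the ball the fields are Lipschitz and bounded. Precomposing them with the closest
  point projection extends both properties to the whole space without changing them on the
  ball.\<close>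

lemma flows_exist:
 fixes X :: "'k::finite => 'e::euclidean_space => 'e"
 assumes op: "open Om" and X: "\<And>i. smooth_on Om (X i)" and R: "0 < R" "cball x0 R \<subseteq> Om"
 obtains B ta fi where "flows Om X x0 R B ta fi" proof -
 let ?K = "cball x0 R"
 have "\<exists>L>0. \<forall>x\<in>?K. \<forall>z\<in>?K. norm (X i x - X i z) <= L * norm (x - z)" for i
  using R op X by (intro smooth_lipschitz[of _ Om]) auto
 then obtain L where L: "\<And>i. L i > 0" "\<And>i x z. x \<in> ?K ==> z \<in> ?K ==> norm (X i x - X i z) <= L i * norm (x - z)"
  by metis
 define L' where "L' = Max (range L)"
 have L': "L i <= L'" for i by (simp add: L'_def)
 then have L'0: "0 < L'" using L(1)[of undefined] less_le_trans by blast
 have "\<exists>b. \<forall>x\<in>?K. norm (X i x) <= b" for i proof -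
  have "continuous_on ?K (X i)" using smooth_on_continuous[OF X] R continuous_on_subset by blast
  then have "bounded (X i ` ?K)" by (intro compact_imp_bounded compact_continuous_image) auto
  then show ?thesis by (auto simp: bounded_iff)
 qed
 then obtain b where b: "\<And>i x. x \<in> ?K ==> norm (X i x) <= b i" by metis
 define B where "B = max 1 (Max (range b))"
 have "b i <= B" for i by (simp add: B_def le_max_iff_disj)
 then have B: "0 < B" "\<And>i x. x \<in> ?K ==> norm (X i x) <= B"
  using b order_trans by (auto simp: B_def, blast)
 define ta where "ta = 1 / (2 * L')"
 have ta: "0 < ta" "L' * ta <= 1 / 2" using L'0 by (auto simp: ta_def)
 have cp: "closest_point ?K x \<in> ?K" for x using R by (intro closest_point_in_set) auto
 \<comment> \<open>The projection onto a closed convex set does not increase distances, so the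
   Lipschitz constant is kept.\<close>
 define Z where "Z i x = X i (closest_point ?K x)" for i x
 have ZX: "Z i x = X i x" if "x \<in> ?K" for i x using that by (simp add: Z_def closest_point_self)
 have ZB: "norm (Z i x) <= B" for i x unfolding Z_def by (rule B(2)[OF cp])
 have ZL: "norm (Z i x - Z i z) <= L' * norm (x - z)" for i x z proof -
  have "norm (Z i x - Z i z) <= L i * norm (closest_point ?K x - closest_point ?K z)"
   unfolding Z_def by (rule L(2)[OF cp cp])
  also have "... <= L' * norm (x - z)"
   using closest_point_lipschitz[of ?K x z] R L' L'0 by (intro mult_mono) (auto simp: dist_norm)
  finally show ?thesis .
 qed
 have "\<exists>fi. (\<forall>x. fi 0 x = x) \<and>
  (\<forall>x t. t \<in> {-ta..ta} --> ((\<lambda>t. fi t x) has_vector_derivative Z i (fi t x)) (at t within {-ta..ta})) \<and>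
  (\<forall>x y t. t \<in> {-ta..ta} --> norm (fi t x - fi t y) <= 2 * norm (x - y))" for i
  using lipschitz_flow[of "Z i" L' ta] ZL L'0 ta by (metis less_imp_le)
 then obtain fi where p: "\<And>i x. fi i 0 x = x"
  "\<And>i x t. t \<in> {-ta..ta} ==> ((\<lambda>t. fi i t x) has_vector_derivative Z i (fi i t x)) (at t within {-ta..ta})"
  "\<And>i x y t. t \<in> {-ta..ta} ==> norm (fi i t x - fi i t y) <= 2 * norm (x - y)" by metis
 have spd: "norm (fi i t x - fi i s x) <= B * \<bar>t - s\<bar>" if "\<bar>t\<bar> <= ta" "\<bar>s\<bar> <= ta" for i t s x
  by (rule vector_derivative_bound[where S = "{-ta..ta}" and h' = "\<lambda>t. Z i (fi i t x)"])
    (use p(2) ZB that in \<open>auto simp: abs_le_iff\<close>)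
 have near: "norm (fi i t x - x) <= B * \<bar>t\<bar>" if "\<bar>t\<bar> <= ta" for i t x
  using spd[OF that, of 0 i x] ta p(1) by simp
 have "flows Om X x0 R B ta fi" proof
  fix i x t
  show "((\<lambda>t. fi i t x) has_vector_derivative X i (fi i t x)) (at t within {-ta..ta})"
   if "\<bar>t\<bar> <= ta" "norm (x - x0) + B * \<bar>t\<bar> <= R" proof -
   have "norm (fi i t x - x0) <= norm (fi i t x - x) + norm (x - x0)"
    using norm_triangle_ineq[of "fi i t x - x" "x - x0"] by simp
   then have "fi i t x \<in> ?K" using near[OF that(1), of i x] that by (simp add: dist_norm norm_minus_commute)
   then show ?thesis using p(2)[of t i x] that ZX by (auto simp: abs_le_iff)
  qed
  show "continuous_on ({-ta..ta} \<times> UNIV) (\<lambda>(t, x). fi i t x)"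
  proof (clarsimp simp: continuous_on_iff)
   fix t x and e :: real assume t: "- ta <= t" "t <= ta" and e: "0 < e"
   \<comment> \<open>The share \<open>B\<close> pays for the change of time, the share 2 for the
     change of the starting point.\<close>
   define d where "d = e / (B + 2)"
   have "(B + 2) * d = e" using B by (simp add: d_def)
   then have "B * d + 2 * d = e" by (simp add: distrib_right)
   then have d: "0 < d" "B * d + 2 * d = e" using e B by (auto simp: d_def)
   show "\<exists>d>0. \<forall>t'\<in>{-ta..ta}. \<forall>x'. dist (t', x') (t, x) < d --> dist (fi i t' x') (fi i t x) < e"
   proof (intro exI[of _ d] conjI ballI allI impI)
    fix t' x' assume t': "t' \<in> {-ta..ta}" and *: "dist (t', x') (t, x) < d"
    have "\<bar>t' - t\<bar> < d" "norm (x' - x) < d"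
     using * dist_fst_le[of "(t', x')" "(t, x)"] dist_snd_le[of "(t', x')" "(t, x)"]
     by (auto simp: dist_norm)
    moreover have "norm (fi i t' x' - fi i t x) <= norm (fi i t' x' - fi i t' x) + norm (fi i t' x - fi i t x)"
     using norm_triangle_ineq[of "fi i t' x' - fi i t' x" "fi i t' x - fi i t x"] by simp
    moreover have "norm (fi i t' x' - fi i t' x) <= 2 * norm (x' - x)" using p(3)[OF t'] .
    moreover have "norm (fi i t' x - fi i t x) <= B * \<bar>t' - t\<bar>" using spd[of t' t] t t' by auto
    moreover have "B * \<bar>t' - t\<bar> <= B * d" using B calculation(1) by (intro mult_left_mono) auto
    ultimately show "dist (fi i t' x') (fi i t x) < e" using d by (simp add: dist_norm)
   qed (use d in auto)
  qed
 qed (use assms B ta near p in auto)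
 then show thesis by (rule that)
qed

section \<open>The expansion along concatenated flows\<close>

lemma coef_sig_bound:
 assumes "\<And>s. s \<in> set ps ==> \<bar>snd s\<bar> <= T" "0 <= T"
 shows "\<bar>coef (sig ps) w\<bar> <= (real (length w) + 1) ^ length ps * T ^ length w" using assms(1)
proof (induction ps arbitrary: w)
 case (Cons s ps)
 have "\<bar>coef (sig (s # ps)) w\<bar> <= (\<Sum>k\<le>length w. \<bar>coef (seg (fst s) (snd s)) (take k w) * coef (sig ps) (drop k w)\<bar>)"
  by (simp add: coef_times)
 also have "... <= (\<Sum>k\<le>length w. (real (length w) + 1) ^ length ps * T ^ length w)"
 proof (rule sum_mono)
  fix k assume "k \<in> {..length w}"
  then have k: "k <= length w" by simp
  have "\<bar>coef (seg (fst s) (snd s)) (take k w)\<bar> <= \<bar>snd s\<bar> ^ k"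
   using k mult_left_mono[OF fact_ge_1[of k, where 'a = real], of "\<bar>snd s\<bar> ^ k"]
   by (auto simp: seg.rep_eq power_abs abs_divide divide_le_eq)
  also have "... <= T ^ k" using Cons.prems[of s] by (intro power_mono) auto
  finally have 1: "\<bar>coef (seg (fst s) (snd s)) (take k w)\<bar> <= T ^ k" .
  have "\<bar>coef (sig ps) (drop k w)\<bar> <= (real (length (drop k w)) + 1) ^ length ps * T ^ length (drop k w)"
   by (rule Cons.IH) (auto intro: Cons.prems)
  also have "... <= (real (length w) + 1) ^ length ps * T ^ (length w - k)"
   using assms(2) by (simp, intro mult_right_mono power_mono) auto
  finally have "\<bar>coef (seg (fst s) (snd s)) (take k w) * coef (sig ps) (drop k w)\<bar>
    <= T ^ k * ((real (length w) + 1) ^ length ps * T ^ (length w - k))"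
   unfolding abs_mult using 1 assms(2) by (intro mult_mono) auto
  also have "... = (real (length w) + 1) ^ length ps * T ^ length w"
   using k by (simp flip: power_add)
  finally show "\<bar>coef (seg (fst s) (snd s)) (take k w) * coef (sig ps) (drop k w)\<bar> <= (real (length w) + 1) ^ length ps * T ^ length w" .
 qed
 also have "... = (real (length w) + 1) ^ length (s # ps) * T ^ length w" by simp
 finally show ?case .
qed (use assms in auto)

text \<open>A splitting contributes only if its left part is a power of the letter \<open>i\<close>.
  What remains is, for each right part \<open>v\<close>, a Taylor polynomial of order
  \<open>M - length v\<close> along the first segment.\<close>

lemma sum_words_seg:
 fixes F :: "'k::finite list => real"
 shows "(\<Sum>w | length w < M. coef (seg i t * S) w * F w) =
  (\<Sum>v | length v < M. coef S v * (\<Sum>m<M - length v. t ^ m / fact m * F (replicate m i @ v)))"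
proof -
 let ?A = "Sigma {w :: 'k list. length w < M} (\<lambda>w. {..length w})"
 let ?f = "\<lambda>(w, k). coef (seg i t) (take k w) * coef S (drop k w) * F w"
 let ?C = "Sigma {v :: 'k list. length v < M} (\<lambda>v. {..<M - length v})"
 have "(\<Sum>w | length w < M. coef (seg i t * S) w * F w) = sum ?f ?A"
  by (simp add: coef_times sum_distrib_right sum.Sigma finite_words_lt)
 also have "... = sum ?f {(w, k) \<in> ?A. take k w = replicate k i}" by (rule sum.mono_neutral_right)
    (auto simp: finite_words_lt min_def seg.rep_eq split: if_splits)
 also have "... = (\<Sum>(v, m)\<in>?C. coef S v * (t ^ m / fact m * F (replicate m i @ v)))"
 proof (rule sum.reindex_bij_witness[where i = "\<lambda>(v, m). (replicate m i @ v, m)" and j = "\<lambda>(w, k). (drop k w, k)"])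
  fix a assume "a \<in> {(w, k) \<in> ?A. take k w = replicate k i}"
  then obtain w k where a: "a = (w, k)" "length w < M" "k <= length w" "take k w = replicate k i" by auto
  have w: "replicate k i @ drop k w = w" using a(4) by (metis append_take_drop_id)
  show "(case case a of (w, k) => (drop k w, k) of (v, m) => (replicate m i @ v, m)) = a"
   using a w by simp
  show "(case a of (w, k) => (drop k w, k)) \<in> ?C" using a by auto
  show "(case case a of (w, k) => (drop k w, k) of (v, m) => coef S v * (t ^ m / fact m * F (replicate m i @ v))) = ?f a"
   using a w by (simp add: seg.rep_eq min_def)
 qed auto
 also have "... = (\<Sum>v | length v < M. coef S v * (\<Sum>m<M - length v. t ^ m / fact m * F (replicate m i @ v)))"
  by (simp add: sum.Sigma finite_words_lt sum_distrib_left)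
 finally show ?thesis .
qed

context flows
begin

lemma flow_region:
 assumes "\<bar>t\<bar> <= ta" "norm (x - x0) + B * \<bar>t\<bar> <= R"
 shows "fi i t x \<in> cball x0 R" "fi i t x \<in> Om" "norm (fi i t x - x0) <= norm (x - x0) + B * \<bar>t\<bar>" proof -
 have "norm (fi i t x - x0) <= norm (fi i t x - x) + norm (x - x0)"
  using norm_triangle_ineq[of "fi i t x - x" "x - x0"] by simp
 then show n: "norm (fi i t x - x0) <= norm (x - x0) + B * \<bar>t\<bar>"
  using flow_near[OF assms(1), of i x] by simp
 with assms show "fi i t x \<in> cball x0 R" by (simp add: dist_norm norm_minus_commute)
 then show "fi i t x \<in> Om" using R by blast
qed

text \<open>Along the flow of \<open>X i\<close> the derivatives in time are iterated derivatives
  along \<open>X i\<close>, so this is the Maclaurin formula with remainder. The region condition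
  keeps all intermediate points in the ball.\<close>

lemma flow_taylor:
 fixes g :: "'e => real"
 assumes g: "smooth_on Om g" and t: "\<bar>t\<bar> < ta" "norm (x - x0) + B * \<bar>t\<bar> <= R"
  and C: "\<And>z. z \<in> cball x0 R ==> \<bar>ders X (replicate M i) g z\<bar> <= C"
 shows "\<bar>g (fi i t x) - (\<Sum>m<M. t ^ m / fact m * ders X (replicate m i) g x)\<bar> <= C * \<bar>t\<bar> ^ M" proof -
 define D where "D m s = ders X (replicate m i) g (fi i s x)" for m s
 have st: "norm (x - x0) + B * \<bar>s\<bar> <= R" if "\<bar>s\<bar> <= \<bar>t\<bar>" for s
  using mult_left_mono[OF that, of B] B t by linarith
 have "\<exists>s. \<bar>s\<bar> <= \<bar>t\<bar> \<and> D 0 t = (\<Sum>m<M. D m 0 / fact m * t ^ m) + D M s / fact M * t ^ M"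
 proof (rule Maclaurin_bi_le[OF refl], intro allI impI)
  fix m s assume s: "m < M \<and> \<bar>s\<bar> <= \<bar>t\<bar>"
  then have s': "\<bar>s\<bar> < ta" using t by simp
  have "((\<lambda>s. fi i s x) has_vector_derivative X i (fi i s x)) (at s within {-ta..ta})"
   using s s' st by (intro flow_deriv) auto
  then have "((\<lambda>s. fi i s x) has_vector_derivative X i (fi i s x)) (at s)"
   using s' by (subst (asm) at_within_interior) (auto simp: abs_less_iff)
  then have 1: "((\<lambda>s. fi i s x) has_derivative (\<lambda>r. r *\<^sub>R X i (fi i s x))) (at s)"
   by (simp add: has_vector_derivative_def)
  have "fi i s x \<in> Om" using s s' st by (intro flow_region(2)) auto
  then have 2: "(ders X (replicate m i) g has_derivative frechet_derivative (ders X (replicate m i) g) (at (fi i s x))) (at (fi i s x))"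
   using op' smX' g by (intro smooth_on_has_derivative[of Om]) auto
  show "DERIV (D m) s :> D (Suc m) s" unfolding has_field_derivative_def D_def
   by (rule has_derivative_eq_rhs[OF has_derivative_compose[OF 1 2]])
     (simp add: linear_scale[OF has_derivative_linear[OF 2]] der_def fun_eq_iff mult.commute)
 qed
 then obtain s where s: "\<bar>s\<bar> <= \<bar>t\<bar>" "D 0 t = (\<Sum>m<M. D m 0 / fact m * t ^ m) + D M s / fact M * t ^ M" by blast
 have "g (fi i t x) - (\<Sum>m<M. t ^ m / fact m * ders X (replicate m i) g x) = D M s / fact M * t ^ M"
  using s(2) by (simp add: D_def flow0 mult.commute)
 also have "\<bar>...\<bar> = \<bar>D M s\<bar> / fact M * \<bar>t\<bar> ^ M" by (simp add: abs_mult power_abs)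
 also have "... <= C / 1 * \<bar>t\<bar> ^ M" using C[OF flow_region(1)[of s x i]] s(1) t st[OF s(1)]
  by (intro mult_right_mono frac_le) (auto simp: D_def fact_ge_1 intro: order_trans[OF abs_ge_zero])
 finally show ?thesis by simp
qed

text \<open>Induction over the list of letters, not over the path, so that the constant is
  independent of the times. After the first segment the hypothesis is used at the new point, and
  each derivative there is expanded to order \<open>M - length v\<close>; together with the size of
  the coefficient every error is of order \<open>M\<close>.\<close>

lemma chen_fliess:
 fixes g :: "'p => 'e => real"
 shows "BF Om P g ==> \<exists>C>0. \<forall>ps p x T. map fst ps = is --> p \<in> P --> 0 <= T --> T < ta -->
   (\<forall>s\<in>set ps. \<bar>snd s\<bar> <= T) --> norm (x - x0) + B * real (length is) * T <= R -->
   \<bar>g p (endp fi ps x) - (\<Sum>w | length w < M. coef (sig ps) w * ders X w (g p) x)\<bar> <= C * T ^ M"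
proof (induction "is")
 case Nil
 have K: "compact (cball x0 R)" by simp
 from BF_bounded[OF K R(2) Nil] obtain C where C: "C > 0" "\<forall>p\<in>P. \<forall>x\<in>cball x0 R. \<bar>g p x\<bar> <= C" by blast
 have "\<bar>g p x - (\<Sum>w | length w < M. (if w = [] then 1 else 0) * ders X w (g p) x)\<bar> <= C * T ^ M"
  if "p \<in> P" "norm (x - x0) <= R" "0 <= T" for p x T proof (cases "M = 0")
  case True
  then show ?thesis using C that by (simp add: dist_norm norm_minus_commute)
 next
  case False
  then have "(\<Sum>w :: 'k list | length w < M. (if w = [] then 1 else 0) * ders X w (g p) x) = (\<Sum>w\<in>{[]}. (if w = [] then 1 else 0) * ders X w (g p) x)"
   by (intro sum.mono_neutral_right) (auto simp: finite_words_lt)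
  then show ?thesis using C that by simp
 qed
 then show ?case using C by (intro exI[of _ C]) auto
next
 case (Cons i "is")
 note g = \<open>BF Om P g\<close>
 let ?n = "length is"
 from Cons.IH[OF g] obtain C1 where C1: "C1 > 0"
  "\<And>ps p x T. map fst ps = is ==> p \<in> P ==> 0 <= T ==> T < ta ==>
   (\<forall>s\<in>set ps. \<bar>snd s\<bar> <= T) ==> norm (x - x0) + B * real ?n * T <= R ==>
   \<bar>g p (endp fi ps x) - (\<Sum>w | length w < M. coef (sig ps) w * ders X w (g p) x)\<bar> <= C1 * T ^ M" by blast
 have "\<exists>C>0. \<forall>p\<in>P. \<forall>x\<in>cball x0 R. \<bar>ders X (replicate (M - length v) i) (ders X v (g p)) x\<bar> <= C" for v
  using R by (intro BF_bounded[of _ Om] BF_ders g op' smX') auto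
 then obtain D where D: "\<And>v. D v > 0" "\<And>v p x. p \<in> P ==> x \<in> cball x0 R ==>
   \<bar>ders X (replicate (M - length v) i) (ders X v (g p)) x\<bar> <= D v" by metis
 \<comment> \<open>The bound for the coefficient of \<open>v\<close> in the signature of the
   remaining path, times the bound for the Taylor remainder.\<close>
 define E where "E v = (real (length v) + 1) ^ ?n * D v" for v
 define C where "C = C1 + (\<Sum>v | length v < M. E v)"
 have E0: "E v \<ge> 0" for v using D(1)[of v] by (simp add: E_def)
 have C0: "C > 0" unfolding C_def using C1 E0 by (intro add_pos_nonneg sum_nonneg) auto
 have main: "\<bar>g p (endp fi ps x) - (\<Sum>w | length w < M. coef (sig ps) w * ders X w (g p) x)\<bar> <= C * T ^ M"
  if ps: "map fst ps = i # is" and p: "p \<in> P" and T: "0 <= T" "T < ta" and sm: "\<forall>s\<in>set ps. \<bar>snd s\<bar> <= T"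
   and x: "norm (x - x0) + B * real (length (i # is)) * T <= R" for ps p x T proof -
  from ps obtain t qs where q: "ps = (i, t) # qs" "map fst qs = is" by (auto)
  have t: "\<bar>t\<bar> <= T" using sm q by auto
  let ?z = "fi i t x"
  have Bt: "B * \<bar>t\<bar> <= B * T" using t B by (intro mult_left_mono) auto
  have xn: "norm (x - x0) + B * T + B * real ?n * T <= R" using x by (simp add: algebra_simps)
  have BnT: "0 <= B * real ?n * T" using B T by simp
  have xt: "norm (x - x0) + B * \<bar>t\<bar> <= R" using xn Bt BnT by linarith
  have z: "norm (?z - x0) + B * real ?n * T <= R"
   using flow_region(3)[of t x i] t T xt xn Bt by linarith
  have "\<bar>g p (endp fi qs ?z) - (\<Sum>v | length v < M. coef (sig qs) v * ders X v (g p) ?z)\<bar> <= C1 * T ^ M"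
   using q sm by (intro C1(2) p T z) auto
  moreover have "\<bar>(\<Sum>v | length v < M. coef (sig qs) v * ders X v (g p) ?z) -
    (\<Sum>w | length w < M. coef (sig ps) w * ders X w (g p) x)\<bar> <= (\<Sum>v | length v < M. E v) * T ^ M"
  proof -
   let ?S = "\<lambda>v. \<Sum>m<M - length v. t ^ m / fact m * ders X (replicate m i) (ders X v (g p)) x"
   have "(\<Sum>w | length w < M. coef (sig ps) w * ders X w (g p) x) = (\<Sum>v | length v < M. coef (sig qs) v * ?S v)"
    by (simp add: q sum_words_seg ders_append)
   then have "\<bar>(\<Sum>v | length v < M. coef (sig qs) v * ders X v (g p) ?z) -
    (\<Sum>w | length w < M. coef (sig ps) w * ders X w (g p) x)\<bar> =
    \<bar>\<Sum>v | length v < M. coef (sig qs) v * (ders X v (g p) ?z - ?S v)\<bar>"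
    by (simp add: sum_subtractf right_diff_distrib)
   also have "... <= (\<Sum>v | length v < M. \<bar>coef (sig qs) v * (ders X v (g p) ?z - ?S v)\<bar>)" by (rule sum_abs)
   also have "... <= (\<Sum>v | length v < M. E v * T ^ M)" proof (rule sum_mono)
    fix v :: "'k list" assume "v \<in> {v. length v < M}"
    then have v: "length v < M" by simp
    have "\<bar>coef (sig qs) v\<bar> <= (real (length v) + 1) ^ length qs * T ^ length v"
     using q sm T by (intro coef_sig_bound) auto
    moreover have "length qs = ?n" using q by (metis length_map)
    moreover have "\<bar>ders X v (g p) ?z - ?S v\<bar> <= D v * \<bar>t\<bar> ^ (M - length v)"
     using D(2)[OF p] t T xt BF_smooth[OF op' g p]
     by (intro flow_taylor ders_smooth op' smX') auto
    moreover have "D v * \<bar>t\<bar> ^ (M - length v) <= D v * T ^ (M - length v)"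
     using t D(1)[of v] by (intro mult_left_mono power_mono) auto
    ultimately have "\<bar>coef (sig qs) v * (ders X v (g p) ?z - ?S v)\<bar> \<le>
      ((real (length v) + 1) ^ ?n * T ^ length v) * (D v * T ^ (M - length v))"
     unfolding abs_mult using T by (intro mult_mono) auto
    also have "... = E v * (T ^ length v * T ^ (M - length v))" by (simp add: E_def)
    also have "T ^ length v * T ^ (M - length v) = T ^ M" using v by (simp flip: power_add)
    finally show "\<bar>coef (sig qs) v * (ders X v (g p) ?z - ?S v)\<bar> <= E v * T ^ M" .
   qed
   finally show ?thesis by (simp add: sum_distrib_right)
  qed
  ultimately show ?thesis by (simp add: C_def distrib_right q)
 qed
 show ?case by (intro exI[of _ C] conjI C0 allI impI) (rule main; assumption)
qed

end

section \<open>Boxes in privileged coordinates\<close>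

text \<open>The set is covered by dyadic cubes of almost the same total volume. The part of the set
  in a cube of side \<open>s\<close> has an image inside a cube whose half side is \<open>C\<close>
  times the dimension times \<open>s\<close>; this explains the crude constant.\<close>

lemma lipschitz_image_measure:
 fixes f :: "'e::euclidean_space => 'e"
 assumes S: "S \<in> lmeasurable" "bounded S" and fS: "f ` S \<in> sets lebesgue"
  and C: "0 <= C" "\<And>x y. x \<in> S ==> y \<in> S ==> norm (f x - f y) <= C * norm (x - y)"
 shows "measure lebesgue (f ` S) <= (2 * C * DIM('e)) ^ DIM('e) * measure lebesgue S" proof -
 define ka where "ka = (2 * C * DIM('e)) ^ DIM('e)"
 have ka0: "0 <= ka" using C by (simp add: ka_def)
 from S(2) obtain N where N: "N > 0" "\<And>x. x \<in> S ==> norm x <= N" by (auto simp: bounded_pos)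
 let ?a = "- N *\<^sub>R One :: 'e" and ?b = "N *\<^sub>R One :: 'e"
 have SN: "S \<subseteq> cbox ?a ?b" proof
  fix x assume "x \<in> S"
  then have "\<bar>x \<bullet> i\<bar> <= N" if "i \<in> Basis" for i using N(2) Basis_le_norm[OF that, of x] by fastforce
  then show "x \<in> cbox ?a ?b" by (auto simp: mem_box abs_le_iff) (metis minus_le_iff)
 qed
 have "measure lebesgue (f ` S) <= ka * measure lebesgue S + e" if e: "e > 0" for e proof -
  define e' where "e' = e / (ka + 1)"
  have e': "e' > 0" "ka * e' <= e" using e ka0 by (auto simp: e'_def field_simps)
  obtain DD where D: "countable DD" "\<And>K. K \<in> DD ==> K \<subseteq> cbox ?a ?b \<and> K \<noteq> {} \<and> (\<exists>c d. K = cbox c d)"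
    "pairwise (\<lambda>A B. interior A \<inter> interior B = {}) DD"
    "\<And>u v. cbox u v \<in> DD ==> \<exists>n. \<forall>i \<in> Basis. v \<bullet> i - u \<bullet> i = (?b \<bullet> i - ?a \<bullet> i)/2^n"
    "S \<subseteq> \<Union>DD" "\<Union>DD \<in> lmeasurable" "measure lebesgue (\<Union>DD) <= measure lebesgue S + e'"
   using measurable_outer_intervals_bounded[OF S(1) SN e'(1)] by metis
  have "\<exists>b. f ` (K \<inter> S) \<subseteq> b \<and> b \<in> lmeasurable \<and> measure lebesgue b <= ka * measure lebesgue K" if K: "K \<in> DD" for K
  proof (cases "K \<inter> S = {}")
   case True
   then show ?thesis using ka0 by (intro exI[of _ "{}"]) auto
  next
   case False
   then obtain x where x: "x \<in> K" "x \<in> S" by auto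
   from D(2)[OF K] obtain u v where uv: "K = cbox u v" by auto
   from D(4)[of u v] K uv obtain n where n: "\<And>i. i \<in> Basis ==> v \<bullet> i - u \<bullet> i = 2 * N / 2 ^ n" by auto
   define s where "s = 2 * N / 2 ^ n"
   have s: "s > 0" using N by (simp add: s_def)
   \<comment> \<open>The norm is bounded by the sum of the coordinates, so two points of the cube
     are at most the dimension times \<open>s\<close> apart.\<close>
   define h where "h = C * (DIM('e) * s)"
   have h: "h \<ge> 0" using C s by (simp add: h_def)
   have mK: "measure lebesgue K = s ^ DIM('e)"
    using n s by (simp add: uv content_cbox_if box_eq_empty s_def[symmetric])
     (metis diff_gt_0_iff_gt less_asym)
   let ?B = "cbox (f x - h *\<^sub>R One) (f x + h *\<^sub>R One)"
   have "measure lebesgue ?B = (2 * h) ^ DIM('e)"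
    using h by (simp add: content_cbox_if box_eq_empty inner_add_left inner_diff_left)
   also have "... = ka * measure lebesgue K"
    by (simp add: mK ka_def h_def power_mult_distrib)
   finally have mB: "measure lebesgue ?B = ka * measure lebesgue K" .
   have "f ` (K \<inter> S) \<subseteq> ?B" proof clarify
    fix y assume y: "y \<in> K" "y \<in> S"
    have "norm (y - x) <= (\<Sum>b\<in>Basis. \<bar>(y - x) \<bullet> b\<bar>)" by (rule norm_le_l1)
    also have "... <= (\<Sum>b\<in>(Basis :: 'e set). s)" proof (rule sum_mono)
     fix b :: 'e assume b: "b \<in> Basis"
     show "\<bar>(y - x) \<bullet> b\<bar> <= s"
      using y(1) x(1) n[OF b] unfolding uv mem_box by (auto simp: inner_diff_left s_def abs_le_iff dest!: bspec[OF _ b])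
    qed
    finally have yx: "norm (y - x) <= DIM('e) * s" by simp
    have "norm (f y - f x) <= C * norm (y - x)" by (rule C(2)[OF y(2) x(2)])
    also have "... <= h" unfolding h_def using yx C(1) by (rule mult_left_mono)
    finally have "\<bar>(f y - f x) \<bullet> b\<bar> <= h" if "b \<in> Basis" for b
     using Basis_le_norm[OF that, of "f y - f x"] by linarith
    then show "f y \<in> ?B" by (auto simp: mem_box inner_diff_left inner_add_left abs_le_iff algebra_simps)
   qed
   with mB show ?thesis by (intro exI[of _ ?B]) auto
  qed
  then obtain b where b: "\<And>K. K \<in> DD ==> f ` (K \<inter> S) \<subseteq> b K" "\<And>K. K \<in> DD ==> b K \<in> lmeasurable"
   "\<And>K. K \<in> DD ==> measure lebesgue (b K) <= ka * measure lebesgue K" by metis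
  have fin: "measure lebesgue (\<Union>K\<in>I. b K) <= ka * (measure lebesgue S + e')" if I: "I \<subseteq> DD" "finite I" for I
  proof -
   have iK: "measure lebesgue (interior K) = measure lebesgue K" "interior K \<in> lmeasurable" if "K \<in> DD" for K
    using D(2)[OF that] by (auto simp: interior_cbox measure_lborel_box_eq measure_lborel_cbox_eq)
   have "measure lebesgue (\<Union>K\<in>I. b K) <= (\<Sum>K\<in>I. measure lebesgue (b K))"
    using I b by (intro measure_UNION_le) auto
   also have "... <= (\<Sum>K\<in>I. ka * measure lebesgue K)" using I b by (intro sum_mono) auto
   also have "... = ka * (\<Sum>K\<in>I. measure lebesgue (interior K))"
    using I iK by (auto simp: sum_distrib_left intro!: sum.cong)
   also have "(\<Sum>K\<in>I. measure lebesgue (interior K)) = measure lebesgue (\<Union>K\<in>I. interior K)"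
   proof (rule measure_finite_Union[symmetric])
    show "disjoint_family_on interior I" using D(3) I by (auto simp: disjoint_family_on_def pairwise_def)
    show "emeasure lebesgue (interior K) \<noteq> \<infinity>" if "K \<in> I" for K
     using iK(2)[of K] that I by (auto simp: fmeasurable_def top.not_eq_extremum)
   qed (use I iK in auto)
   also have "... <= measure lebesgue (\<Union>DD)" proof (rule measure_mono_fmeasurable)
    show "(\<Union>K\<in>I. interior K) \<subseteq> \<Union>DD" using I(1) interior_subset by fast
    show "(\<Union>K\<in>I. interior K) \<in> sets lebesgue" using I iK(2) by (intro sets.finite_UN) auto
   qed (rule D(6))
   also have "... <= measure lebesgue S + e'" by (rule D(7))
   finally show ?thesis using ka0 by (simp add: mult_left_mono)
  qed
  have U: "(\<Union>K\<in>DD. b K) \<in> lmeasurable" "measure lebesgue (\<Union>K\<in>DD. b K) <= ka * (measure lebesgue S + e')"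
   using fmeasurable_UN_bound[OF D(1) b(2) fin] measure_UN_bound[OF D(1) b(2) fin] by auto
  have "f ` S \<subseteq> (\<Union>K\<in>DD. b K)" using D(5) b(1) by blast
  then have "measure lebesgue (f ` S) <= measure lebesgue (\<Union>K\<in>DD. b K)"
   using fS U by (intro measure_mono_fmeasurable)
  also have "... <= ka * (measure lebesgue S + e')" by (rule U)
  finally show ?thesis using e' by (simp add: distrib_left)
 qed
 then show ?thesis unfolding ka_def[symmetric] by (rule field_le_epsilon)
qed

text \<open>The frame fields are nested brackets and the weight is the length of the word. Thus the
  pairing of \<open>lie\<close> with iterated derivatives applies to the frame.\<close>

locale hframe = adapted_frame Om X "\<lambda>j. vf X (J j)" "\<lambda>j. length (J j)" vt
 for Om :: "(real ^ 'n) set" and X :: "'k::finite => real ^ 'n => real ^ 'n"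
  and J :: "'n::finite => 'k list" and vt :: "'n => real ^ 'n => real ^ 'n"
begin

definition smax :: nat where "smax = Max (range (\<lambda>j. length (J j)))"

definition F :: "real ^ 'n => real ^ 'n => real ^ 'n" where "F p x = (\<chi> j. pf j p smax x)"

definition Qdim :: nat where "Qdim = (\<Sum>j\<in>UNIV. length (J j))"

abbreviation w :: "'n => nat" where "w j \<equiv> length (J j)"

lemma w_le: "w j <= smax" and smax_pos: "0 < smax" proof -
 show *: "w j <= smax" for j by (simp add: smax_def)
 show "0 < smax" using wpos[of undefined] *[of undefined] by linarith
qed

lemma F_self: "p \<in> Om ==> F p p = 0" by (simp add: F_def vec_eq_iff pf_low)

lemma F_nth [simp]: "F p x $ j = pf j p smax x" by (simp add: F_def)

lemma pf_partial:
 assumes p: "p \<in> Om"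
 shows "der (\<lambda>_. v) (pf j p m) p = vt j p \<bullet> v" proof -
 have "der (\<lambda>_. v) (pf j p m) p = der (\<lambda>x. \<Sum>l\<in>UNIV. (vt l x \<bullet> v) *\<^sub>R vf X (J l) x) (pf j p m) p"
  by (rule der_field_cong) (rule expand[OF p])
 also have "... = (\<Sum>l\<in>UNIV. (vt l p \<bullet> v) * der (vf X (J l)) (pf j p m) p)"
  using p pf_smooth by (simp add: der_field_sum[of Om] der_field_scaleR[of Om])
 also have "... = vt j p \<bullet> v" using p by (simp add: pf_low if_distrib cong: if_cong)
 finally show ?thesis .
qed

text \<open>Up to first order at \<open>p\<close> the map is the linear isomorphism given by the
  coframe. The difference \<open>G\<close> has zero derivative at \<open>p\<close> and Lipschitz
  derivatives, so on a small ball it is a small perturbation, uniformly in \<open>p\<close>.\<close>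

lemma F_bilipschitz:
 assumes P: "compact P" "P \<subseteq> Om" "cball x0 R \<subseteq> Om" "R > 0" and PR: "P \<subseteq> cball x0 (R / 2)"
 obtains rh c C where "0 < rh" "rh <= R / 2" "0 < c" "0 < C"
  "\<And>p x z. p \<in> P ==> x \<in> cball p rh ==> z \<in> cball p rh ==> c * norm (x - z) <= norm (F p x - F p z)"
  "\<And>p x z. p \<in> P ==> x \<in> cball p rh ==> z \<in> cball p rh ==> norm (F p x - F p z) <= C * norm (x - z)"
proof -
 let ?K = "cball x0 R"
 have K: "compact ?K" "convex ?K" "?K \<subseteq> Om" using P by auto
 let ?n = "real CARD('n)"
 have n: "?n \<ge> 1" using zero_less_card_finite[where 'a = 'n] by linarith
 define G where "G j p x = pf j p smax x - y j p x" for j p x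
 have BG: "BF Om P (G j)" for j unfolding G_def using op P by (intro BF_diff BF_pf BF_y)
 have BdG: "BF Om P (\<lambda>p. der (\<lambda>_. b) (G j p))" for j b using BG op by (intro BF_der) auto
 have "\<exists>C>0. \<forall>p\<in>P. \<forall>x\<in>?K. \<forall>z\<in>?K. \<bar>der (\<lambda>_. b) (G j p) x - der (\<lambda>_. b) (G j p) z\<bar> <= C * norm (x - z)" for j b
  by (rule BF_lipschitz[OF K op BdG])
 note ex = this
 define D where "D j b = (SOME C. C > 0 \<and> (\<forall>p\<in>P. \<forall>x\<in>?K. \<forall>z\<in>?K.
   \<bar>der (\<lambda>_. b) (G j p) x - der (\<lambda>_. b) (G j p) z\<bar> <= C * norm (x - z)))" for j b
 have "D j b > 0 \<and> (\<forall>p\<in>P. \<forall>x\<in>?K. \<forall>z\<in>?K.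
   \<bar>der (\<lambda>_. b) (G j p) x - der (\<lambda>_. b) (G j p) z\<bar> <= D j b * norm (x - z))" for j b
  unfolding D_def by (rule someI_ex[OF ex])
 then have D: "\<And>j b. D j b > 0" "\<And>j b p x z. p \<in> P ==> x \<in> ?K ==> z \<in> ?K ==>
   \<bar>der (\<lambda>_. b) (G j p) x - der (\<lambda>_. b) (G j p) z\<bar> <= D j b * norm (x - z)" by auto
 define D' where "D' = (\<Sum>j\<in>UNIV. \<Sum>b\<in>Basis. D j b) + 1"
 have D'j: "(\<Sum>b\<in>Basis. D j b) <= D'" for j
  unfolding D'_def using member_le_sum[of j UNIV "\<lambda>j. \<Sum>b\<in>Basis. D j b"] D(1) by (simp add: sum_nonneg less_imp_le)
 have "0 <= (\<Sum>j\<in>UNIV. \<Sum>b\<in>Basis. D j b)" using D(1) by (simp add: sum_nonneg less_imp_le)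
 then have D'0: "D' > 0" by (simp add: D'_def)
 have "\<exists>B>0. \<forall>x\<in>P. norm (vf X (J j) x) <= B" for j proof -
  have "continuous_on P (vf X (J j))" using smooth_on_continuous[OF smY] P continuous_on_subset by blast
  then have "bounded (vf X (J j) ` P)" using P by (intro compact_imp_bounded compact_continuous_image)
  then show ?thesis by (auto simp: bounded_pos)
 qed
 then obtain By where By: "\<And>j. By j > 0" "\<And>j p. p \<in> P ==> norm (vf X (J j) p) <= By j" by metis
 define B where "B = Max (range By)"
 have Bj: "By j <= B" for j by (simp add: B_def)
 have B0: "B > 0" using By(1)[of undefined] Bj[of undefined] by linarith
 \<comment> \<open>Chosen so that the perturbation, summed over the coordinates and multiplied by
   \<open>B\<close>, consumes at most half of \<open>norm (x - z)\<close>.\<close>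
 define rh where "rh = min (R / 2) (1 / (2 * B * ?n * D'))"
 have rh: "0 < rh" "rh <= R / 2" using P B0 D'0 by (auto simp: rh_def)
 have "rh <= 1 / (2 * B * ?n * D')" by (simp add: rh_def)
 then have rh': "?n * (D' * rh) <= 1 / (2 * B)" using B0 D'0 by (simp add: field_simps)
 have sub: "cball p rh \<subseteq> ?K" if "p \<in> P" for p proof
  fix x assume "x \<in> cball p rh"
  moreover have "dist x0 p <= R / 2" using PR that by auto
  ultimately show "x \<in> ?K" using rh dist_triangle[of x0 x p] by (auto simp: dist_commute)
 qed
 have GL: "\<bar>G j p x - G j p z\<bar> <= D' * rh * norm (x - z)"
  if p: "p \<in> P" and x: "x \<in> cball p rh" "z \<in> cball p rh" for j p x z proof -
  have pO: "p \<in> Om" using p P by blast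
  have d0: "der (\<lambda>_. b) (G j p) p = 0" for b
   unfolding G_def using der_diff[OF pf_smooth y_smooth pO, of "\<lambda>_. b" j p smax j p] pO
   by (simp add: pf_partial der_y)
  have "\<bar>G j p x - G j p z\<bar> <= (\<Sum>b\<in>Basis. D j b * rh) * norm (x - z)"
  proof (rule smooth_partials_bound[where K = "cball p rh" and Om = Om])
   show "\<bar>der (\<lambda>x. b) (G j p) u\<bar> <= D j b * rh" if "u \<in> cball p rh" for b u proof -
    have "\<bar>der (\<lambda>x. b) (G j p) u - der (\<lambda>x. b) (G j p) p\<bar> <= D j b * norm (u - p)"
    proof (rule D(2)[OF p])
     show "u \<in> ?K" "p \<in> ?K" using subsetD[OF sub[OF p]] that rh by simp_all
    qed
    also have "... <= D j b * rh" using that D(1)[of j b] by (intro mult_left_mono) (auto simp: dist_norm norm_minus_commute)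
    finally show ?thesis by (simp add: d0)
   qed
  qed (use x sub[OF p] K BF_smooth[OF op BG p] in auto)
  also have "... <= (D' * rh) * norm (x - z)"
   using D'j[of j] rh by (intro mult_right_mono) (simp_all flip: sum_distrib_right)
  finally show ?thesis .
 qed
 have lower: "1 / (2 * B * ?n) * norm (x - z) <= norm (F p x - F p z)"
  if p: "p \<in> P" and x: "x \<in> cball p rh" "z \<in> cball p rh" for p x z proof -
  have pO: "p \<in> Om" using p P by blast
  let ?v = "x - z"
  have "norm ?v = norm (\<Sum>l\<in>UNIV. (vt l p \<bullet> ?v) *\<^sub>R vf X (J l) p)" using expand[OF pO, of ?v] by simp
  also have "... <= (\<Sum>l\<in>UNIV. \<bar>vt l p \<bullet> ?v\<bar> * B)"
   by (intro sum_norm_le) (simp add: mult_left_mono order_trans[OF By(2)[OF p] Bj])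
  finally have 1: "norm ?v <= B * (\<Sum>l\<in>UNIV. \<bar>vt l p \<bullet> ?v\<bar>)" by (simp add: sum_distrib_left mult.commute)
  have "(\<Sum>l\<in>UNIV. \<bar>vt l p \<bullet> ?v\<bar>) <= (\<Sum>l\<in>(UNIV :: 'n set). norm (F p x - F p z) + D' * rh * norm ?v)"
  proof (rule sum_mono)
   fix l
   have "vt l p \<bullet> ?v = (F p x - F p z) $ l - (G l p x - G l p z)"
    by (simp add: G_def y_def inner_diff_right)
   then have "\<bar>vt l p \<bullet> ?v\<bar> <= \<bar>(F p x - F p z) $ l\<bar> + \<bar>G l p x - G l p z\<bar>" by linarith
   also have "... <= norm (F p x - F p z) + D' * rh * norm ?v"
    by (intro add_mono component_le_norm_cart GL p x)
   finally show "\<bar>vt l p \<bullet> ?v\<bar> <= norm (F p x - F p z) + D' * rh * norm ?v" .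
  qed
  also have "... = ?n * norm (F p x - F p z) + (?n * (D' * rh)) * norm ?v" by (simp add: distrib_left)
  also have "... <= ?n * norm (F p x - F p z) + 1 / (2 * B) * norm ?v"
   by (intro add_left_mono mult_right_mono rh') auto
  finally have "B * (\<Sum>l\<in>UNIV. \<bar>vt l p \<bullet> ?v\<bar>) <= B * (?n * norm (F p x - F p z) + 1 / (2 * B) * norm ?v)"
   using B0 by (intro mult_left_mono) auto
  with 1 have "norm ?v <= B * (?n * norm (F p x - F p z)) + norm ?v / 2" using B0 by (simp add: distrib_left)
  then show ?thesis using B0 by (simp add: field_simps)
 qed
 have "\<exists>C>0. \<forall>p\<in>P. \<forall>x\<in>?K. \<forall>z\<in>?K. \<bar>pf j p smax x - pf j p smax z\<bar> <= C * norm (x - z)" for j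
  using P by (intro BF_lipschitz[OF K op BF_pf]) auto
 then obtain E where E: "\<And>j. E j > 0" "\<And>j p x z. p \<in> P ==> x \<in> ?K ==> z \<in> ?K ==>
   \<bar>pf j p smax x - pf j p smax z\<bar> <= E j * norm (x - z)" by metis
 have upper: "norm (F p x - F p z) <= (\<Sum>j\<in>UNIV. E j) * norm (x - z)"
  if p: "p \<in> P" and x: "x \<in> cball p rh" "z \<in> cball p rh" for p x z proof -
  have "norm (F p x - F p z) <= (\<Sum>j\<in>UNIV. \<bar>(F p x - F p z) $ j\<bar>)" by (rule norm_le_l1_cart)
  also have "... <= (\<Sum>j\<in>UNIV. E j * norm (x - z))"
   using E(2)[OF p subsetD[OF sub[OF p] x(1)] subsetD[OF sub[OF p] x(2)]] by (intro sum_mono) simp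
  finally show ?thesis by (simp add: sum_distrib_right)
 qed
 show thesis
  using rh B0 n E(1) lower upper by (intro that[of rh "1 / (2 * B * ?n)" "\<Sum>j\<in>UNIV. E j"]) (auto intro!: sum_pos)
qed

section \<open>Volumes of boxes\<close>

definition Fbox :: "real ^ 'n => real => real => (real ^ 'n) set"
 where "Fbox p rh r = {x \<in> cball p rh. \<forall>j. \<bar>pf j p smax x\<bar> <= r ^ w j}"

lemma mem_weighted_box:
 fixes r :: real
 shows "v \<in> cbox (- (\<chi> j. r ^ w j)) (\<chi> j. r ^ w j) \<longleftrightarrow> (\<forall>j. \<bar>v $ j\<bar> <= r ^ w j)" proof -
 have "- c <= a \<and> a <= c \<longleftrightarrow> \<bar>a\<bar> <= c" for a c :: real by linarith
 then show ?thesis by (simp add: mem_box_cart)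
qed

lemma measure_weighted_box:
 assumes "0 <= r"
 shows "measure lebesgue (cbox (- (\<chi> j. r ^ w j)) (\<chi> j. r ^ w j)) = 2 ^ CARD('n) * r ^ Qdim"
proof -
 have ne: "cbox (- (\<chi> j. r ^ w j)) (\<chi> j. r ^ w j :: real ^ 'n) \<noteq> {}" proof -
  have "0 \<in> cbox (- (\<chi> j. r ^ w j)) (\<chi> j. r ^ w j :: real ^ 'n)"
   unfolding mem_weighted_box using assms by simp
  then show ?thesis by blast
 qed
 have "measure lebesgue (cbox (- (\<chi> j. r ^ w j)) (\<chi> j. r ^ w j)) = (\<Prod>j\<in>UNIV. 2 * r ^ w j)"
  using content_cbox_cart[OF ne] by simp
 then show ?thesis by (simp add: prod.distrib Qdim_def power_sum)
qed

text \<open>Both bounds compare with the exact volume of a weighted box in coordinates, through the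
  Lipschitz constants of the inverse map and of the map. The inclusion required for the lower bound
  is supplied later by the paths that reach every point of the box.\<close>

lemma Fbox_measure:
 assumes P: "compact P" "P \<subseteq> Om" "cball x0 R \<subseteq> Om" "R > 0" and PR: "P \<subseteq> cball x0 (R / 2)"
 obtains rh K where "0 < rh" "rh <= R / 2" "0 < K" "\<And>p. p \<in> P ==> inj_on (F p) (cball p rh)"
  "\<And>p r. p \<in> P ==> compact (Fbox p rh r)"
  "\<And>p r. p \<in> P ==> 0 < r ==> measure lebesgue (Fbox p rh r) <= K * r ^ Qdim"
  "\<And>p r. p \<in> P ==> 0 < r ==> cbox (- (\<chi> j. r ^ w j)) (\<chi> j. r ^ w j) \<subseteq> F p ` cball p rh ==>
    r ^ Qdim <= K * measure lebesgue (Fbox p rh r)"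
  "\<And>p r. p \<in> P ==> 0 < r ==> p \<in> interior (Fbox p rh r)" proof -
 obtain rh c C where rh: "0 < rh" "rh <= R / 2" "0 < c" "0 < C"
  and lo: "\<And>p x z. p \<in> P ==> x \<in> cball p rh ==> z \<in> cball p rh ==> c * norm (x - z) <= norm (F p x - F p z)"
  and hi: "\<And>p x z. p \<in> P ==> x \<in> cball p rh ==> z \<in> cball p rh ==> norm (F p x - F p z) <= C * norm (x - z)"
  using F_bilipschitz[OF assms] by blast
 let ?N = "real DIM(real ^ 'n)" and ?d = "DIM(real ^ 'n)"
 let ?box = "\<lambda>r. cbox (- (\<chi> j. r ^ w j)) (\<chi> j. r ^ w j) :: (real ^ 'n) set"
 have inj: "inj_on (F p) (cball p rh)" if "p \<in> P" for p proof (rule inj_onI)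
  fix x z assume "x \<in> cball p rh" "z \<in> cball p rh" "F p x = F p z"
  then show "x = z" using lo[OF that, of x z] rh by (simp add: mult_le_0_iff)
 qed
 have contF: "continuous_on (cball p rh) (F p)" if "p \<in> P" for p proof -
  have "C-lipschitz_on (cball p rh) (F p)" using hi[OF that] rh by (intro lipschitz_onI) (auto simp: dist_norm)
  then show ?thesis by (rule lipschitz_on_continuous_on)
 qed
 have Feq: "Fbox p rh r = cball p rh \<inter> F p -` ?box r" for p r
  by (auto simp: Fbox_def mem_weighted_box)
 have comp: "compact (Fbox p rh r)" if "p \<in> P" for p r proof -
  have "closed (Fbox p rh r)"
   unfolding Feq by (rule continuous_closed_preimage[OF contF[OF that]]) auto
  moreover have "bounded (Fbox p rh r)"
   by (rule bounded_subset[OF bounded_cball[of p rh]]) (auto simp: Fbox_def)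
  ultimately show ?thesis by (simp add: compact_eq_bounded_closed)
 qed
 have FF: "F p ` Fbox p rh r = F p ` cball p rh \<inter> ?box r" for p r by (auto simp: Feq)
 have compF: "compact (F p ` Fbox p rh r)" if "p \<in> P" for p r
  by (rule compact_continuous_image[OF continuous_on_subset[OF contF[OF that]] comp[OF that]]) (auto simp: Feq)
 define K1 where "K1 = (2 * (1 / c) * ?N) ^ ?d"
 define K2 where "K2 = (2 * C * ?N) ^ ?d"
 define K where "K = K1 * 2 ^ CARD('n) + K2 + 1"
 have K12: "0 <= K1" "0 <= K2" using rh by (auto simp: K1_def K2_def)
 have up: "measure lebesgue (Fbox p rh r) <= K * r ^ Qdim" if p: "p \<in> P" and r: "0 < r" for p r
 proof -
  let ?g = "the_inv_into (cball p rh) (F p)"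
  let ?T = "F p ` Fbox p rh r"
  have sub: "Fbox p rh r \<subseteq> cball p rh" by (auto simp: Fbox_def)
  have gF: "?g (F p x) = x" if "x \<in> cball p rh" for x by (rule the_inv_into_f_f[OF inj[OF p] that])
  have gT: "?g ` ?T = Fbox p rh r" using sub gF by (force simp: image_iff)
  have "measure lebesgue (?g ` ?T) <= (2 * (1 / c) * ?N) ^ ?d * measure lebesgue ?T"
  proof (rule lipschitz_image_measure)
   show "?T \<in> lmeasurable" "bounded ?T" using compF[OF p] by (auto intro: lmeasurable_compact compact_imp_bounded)
   show "?g ` ?T \<in> sets lebesgue" unfolding gT using comp[OF p] by (auto dest: lmeasurable_compact)
   show "norm (?g a - ?g b) <= 1 / c * norm (a - b)" if "a \<in> ?T" "b \<in> ?T" for a b proof -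
    from that obtain x z where xz: "x \<in> Fbox p rh r" "a = F p x" "z \<in> Fbox p rh r" "b = F p z" by blast
    then have "c * norm (x - z) <= norm (a - b)" using sub by (auto intro!: lo[OF p])
    moreover have "?g a = x" "?g b = z" using xz sub gF by blast+
    ultimately show ?thesis using rh by (simp add: field_simps)
   qed
  qed (use rh in auto)
  also have "... <= K1 * measure lebesgue (?box r)" unfolding K1_def[symmetric]
  proof (intro mult_left_mono measure_mono_fmeasurable)
   show "?T \<subseteq> ?box r" by (auto simp: FF)
   show "?T \<in> sets lebesgue" by (rule fmeasurableD[OF lmeasurable_compact[OF compF[OF p]]])
  qed (use K12 in auto)
  also have "... = K1 * 2 ^ CARD('n) * r ^ Qdim"
   unfolding measure_weighted_box[OF less_imp_le[OF r]] by simp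
  also have "... <= K * r ^ Qdim" using K12 r by (intro mult_right_mono) (auto simp: K_def)
  finally show ?thesis unfolding gT .
 qed
 have low: "r ^ Qdim <= K * measure lebesgue (Fbox p rh r)"
  if p: "p \<in> P" and r: "0 < r" and sub: "?box r \<subseteq> F p ` cball p rh" for p r proof -
  have FB: "F p ` Fbox p rh r = ?box r" unfolding FF using sub by blast
  have "1 * r ^ Qdim <= 2 ^ CARD('n) * r ^ Qdim" using r by (intro mult_right_mono) auto
  also have "... = measure lebesgue (?box r)"
   by (rule measure_weighted_box[OF less_imp_le[OF r], symmetric])
  also have "... <= K2 * measure lebesgue (Fbox p rh r)" unfolding FB[symmetric] K2_def
  proof (rule lipschitz_image_measure)
   show "norm (F p a - F p b) <= C * norm (a - b)" if "a \<in> Fbox p rh r" "b \<in> Fbox p rh r" for a b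
    using that by (intro hi[OF p]) (auto simp: Fbox_def)
  qed (use rh comp[OF p] compF[OF p] in \<open>auto intro: lmeasurable_compact compact_imp_bounded dest: lmeasurable_compact\<close>)
  also have "... <= K * measure lebesgue (Fbox p rh r)"
   using K12 by (intro mult_right_mono) (auto simp: K_def)
  finally show ?thesis by simp
 qed
 have int: "p \<in> interior (Fbox p rh r)" if p: "p \<in> P" and r: "0 < r" for p r proof -
  define m where "m = Min (range (\<lambda>j. r ^ w j))"
  have m: "m > 0" "m <= r ^ w j" for j using r by (auto simp: m_def)
  define d where "d = min rh (m / C)"
  have "d <= m / C" by (simp add: d_def)
  then have "C * d <= m" using rh by (simp add: pos_le_divide_eq mult.commute)
  then have d: "d > 0" "d <= rh" "C * d <= m" using m rh by (auto simp: d_def)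
  have "ball p d \<subseteq> Fbox p rh r" proof
   fix x assume x: "x \<in> ball p d"
   then have xb: "x \<in> cball p rh" using d by auto
   have "\<bar>pf j p smax x\<bar> <= r ^ w j" for j proof -
    have "\<bar>pf j p smax x\<bar> = \<bar>(F p x - F p p) $ j\<bar>" using p P by (simp add: F_self pf_low subset_iff)
    also have "... <= norm (F p x - F p p)" by (rule component_le_norm_cart)
    also have "... <= C * norm (x - p)" using xb rh by (intro hi[OF p]) auto
    also have "... <= C * d" using x rh by (intro mult_left_mono) (auto simp: dist_norm norm_minus_commute)
    finally show ?thesis using d m(2)[of j] by linarith
   qed
   then show "x \<in> Fbox p rh r" using xb by (simp add: Fbox_def)
  qed
  from interior_maximal[OF this open_ball] show ?thesis using d(1) by auto
 qed
 show thesis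
  by (rule that[OF rh(1,2) _ inj comp up low int]) (use K12 in \<open>auto simp: K_def intro!: add_nonneg_pos\<close>)
qed

text \<open>A curve with the property assumed for \<open>gm\<close> behaves like a horizontal curve of length \<open>r\<close>.\<close>

lemma horizontal_upper:
 assumes P: "compact P" "P \<subseteq> Om" "cball x0 R \<subseteq> Om"
 obtains C where "0 < C" "\<And>p gm r t j. p \<in> P ==> 0 < r ==> (\<And>t :: real. t \<in> {0..1} ==> gm t \<in> cball x0 R) ==>
   (\<And>g M. smooth_on Om g ==> (\<And>t i. t \<in> {0..1} ==> \<bar>der (X i) g (gm t)\<bar> <= M) ==>
     (\<And>t. t \<in> {0..1} ==> \<bar>g (gm t) - g p\<bar> <= r * M)) ==>
   t \<in> {0..1} ==> \<bar>pf j p smax (gm t)\<bar> <= C * r ^ w j" proof -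
 \<comment> \<open>The hypotheses on the curve as a single predicate, in order to quantify over
   curves inside the induction.\<close>
 define hor where "hor r gm p \<longleftrightarrow> (\<forall>t\<in>{0..1}. gm t \<in> cball x0 R) \<and>
   (\<forall>g M. smooth_on Om g --> (\<forall>t\<in>{0..1}. \<forall>i. \<bar>der (X i) g (gm t)\<bar> <= M) -->
     (\<forall>t\<in>{0..1}. \<bar>g (gm t) - g p\<bar> <= r * M))" for r :: real and gm :: "real => real ^ 'n" and p
 have B: "BF Om P (\<lambda>p. ders X v (pf j p smax))" for v j using op smX P by (intro BF_ders BF_pf) auto
 \<comment> \<open>Induction downwards from words of length \<open>w j\<close>, whose derivatives
   are merely bounded. A shorter derivative vanishes at \<open>p\<close>, and its horizontal
   derivatives are the longer ones, so each letter removed gains one factor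
   \<open>r\<close>.\<close>
 have "\<exists>C>0. \<forall>p\<in>P. \<forall>r>0. \<forall>gm. hor r gm p --> (\<forall>t\<in>{0..1}. \<bar>ders X v (pf j p smax) (gm t)\<bar> <= C * r ^ (w j - length v))"
  if "length v <= w j" for v j using that proof (induction "w j - length v" arbitrary: v)
  case 0
  obtain C where "C > 0" "\<forall>p\<in>P. \<forall>x\<in>cball x0 R. \<bar>ders X v (pf j p smax) x\<bar> <= C"
   using BF_bounded[OF _ P(3) B, of v j] by auto
  with 0 show ?case by (auto simp: hor_def intro!: exI[of _ C])
 next
  case (Suc k)
  have v: "length v < w j" using Suc by simp
  have "\<exists>C>0. \<forall>p\<in>P. \<forall>r>0. \<forall>gm. hor r gm p --> (\<forall>t\<in>{0..1}. \<bar>ders X (i # v) (pf j p smax) (gm t)\<bar> <= C * r ^ (w j - length (i # v)))" for i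
   using Suc by (intro Suc(1)) auto
  then obtain C where C: "\<And>i. C i > 0" "\<And>i p r gm t. p \<in> P ==> r > 0 ==> hor r gm p ==> t \<in> {0..1} ==>
    \<bar>ders X (i # v) (pf j p smax) (gm t)\<bar> <= C i * r ^ (w j - length (i # v))" by metis
  define D where "D = Max (range C)"
  have D: "C i <= D" for i by (simp add: D_def)
  have D0: "D > 0" using C(1)[of undefined] D[of undefined] by linarith
  have "\<bar>ders X v (pf j p smax) (gm t)\<bar> <= D * r ^ (w j - length v)"
   if p: "p \<in> P" and l: "r > 0" and h: "hor r gm p" and t: "t \<in> {0..1}" for p r gm t proof -
   let ?g = "ders X v (pf j p smax)"
   have sm: "smooth_on Om ?g" by (rule BF_smooth[OF op B p])
   have "\<bar>der (X i) ?g (gm t)\<bar> <= D * r ^ k" if "t \<in> {0..1}" for i t proof -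
    have "w j - length (i # v) = k" using Suc(2) by simp
    then have "\<bar>der (X i) ?g (gm t)\<bar> <= C i * r ^ k" using C(2)[OF p l h that, of i] by simp
    also have "... <= D * r ^ k" using D l by (intro mult_right_mono) auto
    finally show ?thesis .
   qed
   then have "\<bar>?g (gm t) - ?g p\<bar> <= r * (D * r ^ k)" using h sm t unfolding hor_def by blast
   moreover have "?g p = 0" using p P v by (intro pf_words_vanish[OF _ w_le]) auto
   ultimately show ?thesis by (simp add: Suc(2)[symmetric] mult_ac)
  qed
  then show ?case using D0 by (intro exI[of _ D]) auto
 qed
 from this[of "[]"] have "\<exists>C>0. \<forall>p\<in>P. \<forall>r>0. \<forall>gm. hor r gm p --> (\<forall>t\<in>{0..1}. \<bar>pf j p smax (gm t)\<bar> <= C * r ^ w j)" for j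
  by simp
 then obtain C where C: "\<And>j. C j > 0" "\<And>j p r gm t. p \<in> P ==> r > 0 ==> hor r gm p ==> t \<in> {0..1} ==>
   \<bar>pf j p smax (gm t)\<bar> <= C j * r ^ w j" by metis
 define D where "D = Max (range C)"
 have D: "C j <= D" for j by (simp add: D_def)
 have D0: "D > 0" using C(1)[of undefined] D[of undefined] by linarith
 show thesis proof (rule that[OF D0])
  fix p j and gm :: "real => real ^ 'n" and t r :: real
  assume p: "p \<in> P" and l: "0 < r" and t: "t \<in> {0..1::real}"
   and "\<And>t. t \<in> {0..1} ==> gm t \<in> cball x0 R"
   and "\<And>g M. smooth_on Om g ==> (\<And>t i. t \<in> {0..1} ==> \<bar>der (X i) g (gm t)\<bar> <= M) ==>
     (\<And>t. t \<in> {0..1} ==> \<bar>g (gm t) - g p\<bar> <= r * M)"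
  then have "hor r gm p" unfolding hor_def by blast
  from C(2)[OF p l this t] have "\<bar>pf j p smax (gm t)\<bar> <= C j * r ^ w j" .
  also have "... <= D * r ^ w j" using D l by (intro mult_right_mono) auto
  finally show "\<bar>pf j p smax (gm t)\<bar> <= D * r ^ w j" .
 qed
qed

end

section \<open>Leading terms of rescaled commutator paths\<close>

lemma cp_unit: "s \<in> set (cp J) ==> \<bar>snd s\<bar> <= 1"
 by (induction J arbitrary: s rule: cp.induct) (auto simp: pinv_def)

lemma pinv_unit: "(\<And>s. s \<in> set ps ==> \<bar>snd s\<bar> <= 1) ==> s \<in> set (pinv ps) ==> \<bar>snd s\<bar> <= 1"
 by (force simp: pinv_def)

lemma sig_pscale_0: "sig (pscale 0 ps) = 1"
 by (rule ncs_eqI) (simp add: coef_sig_pscale power_0_left)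

text \<open>The inverse of \<open>1 + L\<close> plus higher terms begins with \<open>1 - L\<close>:
  since the two signatures multiply to 1, the deviation is expressed by that of \<open>cp J\<close>
  and a product of higher order.\<close>

lemma sig_pinv_cp_lead:
 assumes "J \<noteq> []"
 shows "ordge (length J + 1) (sig (pinv (cp J)) - 1 - (- lie J))" proof -
 let ?S = "sig (cp J)" and ?S' = "sig (pinv (cp J))"
 have 1: "ordge (length J + 1) (?S - 1 - lie J)" by (rule sig_cp_lead[OF assms])
 have "ordge (length J) (lie J)" using homog_lie[OF assms] homog_ordge by blast
 from ordge_add[OF ordge_mono[OF 1, of "length J"] this] have 2: "ordge (length J) (?S - 1)" by simp
 have 3: "ordge 1 (?S' - 1)" by (auto simp: ordge_def)
 have "?S' - 1 - (- lie J) = - (?S - 1 - lie J) - (?S - 1) * (?S' - 1)"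
  by (simp add: algebra_simps sig_pinv)
 moreover have "ordge (length J + 1) ((?S - 1) * (?S' - 1))" by (rule ordge_mult[OF 2 3])
 moreover have "ordge (length J + 1) (- (?S - 1 - lie J))" using 1 by (simp add: ordge_def)
 ultimately show ?thesis by (simp only: ordge_diff)
qed

text \<open>Coefficients of words up to length \<open>m\<close> agree exactly with the leading term.
  Longer words carry at least the factor \<open>t ^ (m + 1)\<close>, because \<open>t <= 1\<close>;
  only the finitely many of length at most \<open>s\<close> enter the constant.\<close>

lemma sig_lead_near:
 fixes ps :: "('k::finite \<times> real) list"
 assumes m: "ordge (m + 1) (sig ps - 1 - L)" "homog m L"
 obtains D where "D \<ge> 0" "\<And>t v. 0 <= t ==> t <= 1 ==> v \<noteq> [] ==> length v <= s ==>
   \<bar>coef (sig (pscale t ps)) v - t ^ m * coef L v\<bar> <= D * t ^ (m + 1)" proof -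
 define D where "D = (\<Sum>v | length v < s + 1. \<bar>coef (sig ps) v\<bar>)"
 have D0: "D \<ge> 0" unfolding D_def by (intro sum_nonneg) auto
 have "\<bar>coef (sig (pscale t ps)) v - t ^ m * coef L v\<bar> <= D * t ^ (m + 1)"
  if t: "0 <= t" "t <= 1" and v: "v \<noteq> []" "length v <= s" for t v proof (cases "length v <= m")
  case True
  then have "coef (sig ps) v = coef L v" using m(1)[unfolded ordge_def, rule_format, of v] v by simp
  then have "coef (sig (pscale t ps)) v - t ^ m * coef L v = 0"
   using m(2) True by (cases "length v = m") (auto simp: coef_sig_pscale homog_def)
  then show ?thesis using D0 t by simp
 next
  case False
  then have "coef L v = 0" using m(2) by (auto simp: homog_def)
  then have "\<bar>coef (sig (pscale t ps)) v - t ^ m * coef L v\<bar> = \<bar>coef (sig ps) v\<bar> * t ^ length v"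
   using t by (simp add: coef_sig_pscale abs_mult)
  also have "... <= D * t ^ (m + 1)" proof (rule mult_mono)
   show "\<bar>coef (sig ps) v\<bar> <= D" unfolding D_def using v by (intro member_le_sum) (auto simp: finite_words_lt)
   show "t ^ length v <= t ^ (m + 1)" using False t by (intro power_decreasing) auto
  qed (use D0 t in auto)
  finally show ?thesis .
 qed
 with D0 show thesis by (rule that)
qed

section \<open>Reaching the points of a box\<close>

text \<open>Here \<open>La\<close> is the part linear in the parameters, of size \<open>et\<close>,
  and the error is smaller by the factor \<open>dl\<close>. Two scales occur because a parameter of
  size \<open>et = dl ^ smax\<close> leads, through a root, to path times as large as
  \<open>dl\<close>.\<close>

definition near :: "nat => real => real => real => 'k ncs => ('k list => real) => bool"
 where "near s et dl C S La \<longleftrightarrow> coef S [] = 1 \<and>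
  (\<forall>v. v \<noteq> [] \<and> length v <= s --> \<bar>coef S v - La v\<bar> <= C * (et * dl) \<and> \<bar>La v\<bar> <= C * et)"

lemma near_mono: "near s et dl C S La ==> C <= D ==> 0 <= et ==> 0 <= dl ==> near s et dl D S La"
 unfolding near_def by (meson mult_right_mono mult_nonneg_nonneg order_trans)

text \<open>Linear parts add up. Every proper splitting of a word contributes a product of two
  factors of size \<open>et\<close>, and \<open>et * et <= et * dl\<close>; there are fewer than
  \<open>s\<close> proper splittings.\<close>

lemma near_mult:
 assumes S: "near s et dl C S La" and T: "near s et dl C' T La'"
  and n: "0 <= et" "et <= dl" "dl <= 1" "0 <= C" "0 <= C'"
 shows "near s et dl (C + C' + 4 * real s * C * C') (S * T) (\<lambda>v. La v + La' v)" proof -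
 have b: "\<bar>coef S v\<bar> <= 2 * C * et" "\<bar>coef T v\<bar> <= 2 * C' * et" if "v \<noteq> []" "length v <= s" for v
 proof -
  have et: "et * dl <= et" using n by (simp add: mult_left_le)
  have "\<bar>coef S v\<bar> <= C * (et * dl) + C * et" "\<bar>coef T v\<bar> <= C' * (et * dl) + C' * et"
   using S T that unfolding near_def by (smt (verit))+
  moreover have "C * (et * dl) <= C * et" "C' * (et * dl) <= C' * et" using et n by (auto intro: mult_left_mono)
  ultimately show "\<bar>coef S v\<bar> <= 2 * C * et" "\<bar>coef T v\<bar> <= 2 * C' * et" by auto
 qed
 have "\<bar>coef (S * T) v - (La v + La' v)\<bar> <= (C + C' + 4 * real s * C * C') * (et * dl)"
  and "\<bar>La v + La' v\<bar> <= (C + C' + 4 * real s * C * C') * et" if v: "v \<noteq> []" "length v <= s" for v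
 proof -
  let ?n = "length v" and ?t = "\<lambda>k. coef S (take k v) * coef T (drop k v)"
  have "{..?n} = insert 0 (insert ?n {1..<?n})" by auto
  then have "coef (S * T) v = coef T v + coef S v + (\<Sum>k\<in>{1..<?n}. ?t k)"
   using v S T by (simp add: coef_times near_def)
  moreover have "\<bar>\<Sum>k\<in>{1..<?n}. ?t k\<bar> <= 4 * real s * C * C' * (et * dl)" proof -
   have "\<bar>\<Sum>k\<in>{1..<?n}. ?t k\<bar> <= (\<Sum>k\<in>{1..<?n}. (2 * C * et) * (2 * C' * et))"
   proof (rule order_trans[OF sum_abs], rule sum_mono)
    fix k assume k: "k \<in> {1..<?n}"
    then have "take k v \<noteq> []" "drop k v \<noteq> []" by auto
    then show "\<bar>?t k\<bar> <= (2 * C * et) * (2 * C' * et)"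
     unfolding abs_mult using b[of "take k v"] b[of "drop k v"] v n by (intro mult_mono) auto
   qed
   also have "... = real (?n - 1) * (4 * C * C' * (et * et))" by simp
   also have "... <= real s * (4 * C * C' * (et * dl))"
    using v n by (intro mult_mono mult_left_mono) auto
   finally show ?thesis by (simp add: mult_ac)
  qed
  moreover have "\<bar>coef S v - La v\<bar> <= C * (et * dl)" "\<bar>coef T v - La' v\<bar> <= C' * (et * dl)"
   using S T v by (auto simp: near_def)
  ultimately show "\<bar>coef (S * T) v - (La v + La' v)\<bar> <= (C + C' + 4 * real s * C * C') * (et * dl)"
   unfolding distrib_right by linarith
  have "\<bar>La v\<bar> <= C * et" "\<bar>La' v\<bar> <= C' * et" using S T v by (auto simp: near_def)
  moreover have "0 <= 4 * real s * C * C' * et" using n by simp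
  ultimately show "\<bar>La v + La' v\<bar> <= (C + C' + 4 * real s * C * C') * et"
   unfolding distrib_right by linarith
 qed
 moreover have "coef (S * T) [] = 1" using S T by (simp add: coef_times near_def)
 ultimately show ?thesis unfolding near_def by blast
qed

text \<open>The constant is chosen before the series and the scales, hence it is uniform over all
  parameters.\<close>

lemma near_prod_list:
 fixes js :: "'j list"
 assumes C: "0 <= C"
 shows "\<exists>D\<ge>0. \<forall>(S :: 'j => 'k ncs) La et dl. 0 <= et --> et <= dl --> dl <= 1 --> (\<forall>j\<in>set js. near s et dl C (S j) (La j)) -->
  near s et dl D (prod_list (map S js)) (\<lambda>v. \<Sum>j\<leftarrow>js. La j v)" proof (induction js)
 case Nil
 have "near s et dl 0 1 (\<lambda>v. 0)" for et dl by (auto simp: near_def)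
 then show ?case by auto
next
 case (Cons j js)
 then obtain D where D: "D \<ge> 0" "\<forall>(S :: 'j => 'k ncs) La et dl. 0 <= et --> et <= dl --> dl <= 1 --> (\<forall>j\<in>set js. near s et dl C (S j) (La j)) -->
  near s et dl D (prod_list (map S js)) (\<lambda>v. \<Sum>j\<leftarrow>js. La j v)" by (elim exE conjE) (rule that)
 show ?case proof (intro exI[of _ "C + D + 4 * real s * C * D"] conjI allI impI)
  fix S :: "'j => 'k ncs" and La et dl assume n: "0 <= et" "et <= dl" "dl <= 1" and nr: "\<forall>j\<in>set (j # js). near s et dl C (S j) (La j)"
  have "near s et dl C (S j) (La j)" using nr by simp
  moreover have "near s et dl D (prod_list (map S js)) (\<lambda>v. \<Sum>j\<leftarrow>js. La j v)"
   using nr by (intro D(2)[rule_format] n) simp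
  ultimately show "near s et dl (C + D + 4 * real s * C * D) (prod_list (map S (j # js))) (\<lambda>v. \<Sum>j\<leftarrow>j # js. La j v)"
   using near_mult[OF _ _ n C D(1)] by simp
 qed (use C D in auto)
qed

context flows
begin

lemma endp_near:
 "(\<And>s. s \<in> set ps ==> \<bar>snd s\<bar> <= T) ==> 0 <= T ==> T <= ta ==> norm (endp fi ps x - x) <= B * real (length ps) * T"
proof (induction ps arbitrary: x)
 case (Cons s ps)
 let ?z = "fi (fst s) (snd s) x"
 have s: "\<bar>snd s\<bar> <= T" using Cons.prems by simp
 have "norm (endp fi ps ?z - ?z) <= B * real (length ps) * T" using Cons by simp
 moreover have "norm (?z - x) <= B * \<bar>snd s\<bar>" using s Cons.prems(3) by (intro flow_near) linarith
 moreover have "B * \<bar>snd s\<bar> <= B * T" using s B by (intro mult_left_mono) auto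
 moreover have "norm (endp fi ps ?z - x) <= norm (endp fi ps ?z - ?z) + norm (?z - x)"
  using norm_triangle_ineq[of "endp fi ps ?z - ?z" "?z - x"] by simp
 ultimately show ?case by (simp add: algebra_simps)
qed simp

lemma endp_cont:
 fixes hs :: "('k \<times> ('a::topological_space => real)) list"
 shows "(\<And>i h. (i, h) \<in> set hs ==> continuous_on S h \<and> h ` S \<subseteq> {-ta..ta}) ==> continuous_on S e ==>
  continuous_on S (\<lambda>sg. endp fi (map (\<lambda>(i, h). (i, h sg)) hs) (e sg))"
proof (induction hs arbitrary: e)
 case (Cons a hs)
 obtain i h where a: "a = (i, h)" by fastforce
 have h: "continuous_on S h" "h ` S \<subseteq> {-ta..ta}" using Cons.prems(1)[of i h] a by auto
 have "continuous_on S (\<lambda>sg. (\<lambda>(t, x). fi i t x) (h sg, e sg))"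
  using h Cons.prems(2) by (intro continuous_on_compose2[OF flow_cont] continuous_intros) auto
 then have "continuous_on S (\<lambda>sg. fi i (h sg) (e sg))" by simp
 from this have "continuous_on S (\<lambda>sg. endp fi (map (\<lambda>(i, h). (i, h sg)) hs) (fi i (h sg) (e sg)))"
  by (rule Cons.IH[rotated]) (use Cons.prems(1) in auto)
 then show ?case by (simp add: a)
qed simp

end

locale ballbox = hframe Om X J vt + flows Om X x0 R B ta fi
 for Om :: "(real ^ 'n) set" and X :: "'k::finite => real ^ 'n => real ^ 'n"
  and J :: "'n::finite => 'k list" and vt and x0 R B ta fi
begin

text \<open>The path for the coordinate \<open>j\<close> has the leading term \<open>r ^ w j * sg $ j\<close>, whence the roots. One of its
 two halves is trivial, depending on the sign of the coordinate.\<close>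

definition blk :: "real => 'n => ('k \<times> (real ^ 'n => real)) list"
 where "blk r j = map (\<lambda>(i, c). (i, \<lambda>sg. r * root (w j) (max (sg $ j) 0) * c)) (cp (J j)) @
  map (\<lambda>(i, c). (i, \<lambda>sg. r * root (w j) (max (- sg $ j) 0) * c)) (pinv (cp (J j)))"

text \<open>Any enumeration of the coordinates will do, since the order of the blocks does not
  affect the part linear in the parameters.\<close>

definition blocks :: "real => ('k \<times> (real ^ 'n => real)) list"
 where "blocks r = concat (map (blk r) (SOME js. set js = UNIV \<and> distinct js))"

definition path :: "real => real ^ 'n => ('k \<times> real) list"
 where "path r sg = map (\<lambda>(i, h). (i, h sg)) (blocks r)"

definition bsig :: "real ^ 'n => 'n => 'k ncs"
 where "bsig sg j = sig (pscale (root (w j) (max (sg $ j) 0)) (cp (J j)) @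
   pscale (root (w j) (max (- sg $ j) 0)) (pinv (cp (J j))))"

lemma J_ne: "J j \<noteq> []" using wpos[of j] by auto

lemma sig_concat: "sig (concat pss) = prod_list (map sig pss)"
 by (induction pss) (auto simp: sig_append)

lemma path_scale: "path r sg = pscale r (path 1 sg)"
 by (simp add: path_def pscale_def blocks_def map_concat blk_def comp_def split_beta mult.assoc)

lemma sig_path_1: "sig (path 1 sg) = prod_list (map (bsig sg) (SOME js. set js = UNIV \<and> distinct js))"
 by (simp add: path_def blocks_def map_concat sig_concat blk_def bsig_def[abs_def] comp_def case_prod_unfold pscale_def)

lemma js: "set (SOME js. set js = (UNIV :: 'n set) \<and> distinct js) = UNIV \<and> distinct (SOME js. set js = (UNIV :: 'n set) \<and> distinct js)"
 by (rule someI_ex[of "\<lambda>js. set js = (UNIV :: 'n set) \<and> distinct js"]) (rule finite_distinct_list, simp)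

lemma length_path: "length (path r sg) = length (path 1 0)"
 by (simp add: path_def blocks_def length_concat blk_def comp_def)

text \<open>The exponent \<open>smax\<close> dominates every weight, so parameters bounded by
  \<open>dl ^ smax\<close> have all their weighted roots bounded by \<open>dl\<close>.\<close>

lemma root_le:
 assumes "0 <= dl" "dl <= 1" "\<bar>a\<bar> <= dl ^ smax" "0 <= b" "b <= \<bar>a\<bar>"
 shows "0 <= root (w j) b" "root (w j) b <= dl" "root (w j) b ^ w j = b" proof -
 have "b <= dl ^ w j" using assms power_decreasing[OF w_le assms(1,2), of j] by linarith
 then have "root (w j) b <= root (w j) (dl ^ w j)" using wpos by simp
 then show "root (w j) b <= dl" using assms wpos by (simp add: real_root_power_cancel)
 show "0 <= root (w j) b" "root (w j) b ^ w j = b" using assms wpos[of j] by auto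
qed

text \<open>With \<open>t\<close> the root of the parameter, \<open>t ^ w j\<close> is the parameter
  up to sign, so the leading term is linear in it, and the error \<open>t ^ (w j + 1)\<close> is the
  parameter times \<open>t\<close>. A negative parameter uses the inverse path, whose leading term
  has the opposite sign.\<close>

lemma bsig_near: "\<exists>C\<ge>0. \<forall>sg dl. 0 <= dl --> dl <= 1 --> \<bar>sg $ j\<bar> <= dl ^ smax -->
  near smax (dl ^ smax) dl C (bsig sg j) (\<lambda>v. sg $ j * coef (lie (J j)) v)" proof -
 obtain D1 where D1: "D1 \<ge> 0" "\<And>t v. 0 <= t ==> t <= 1 ==> v \<noteq> [] ==> length v <= smax ==>
   \<bar>coef (sig (pscale t (cp (J j)))) v - t ^ w j * coef (lie (J j)) v\<bar> <= D1 * t ^ (w j + 1)"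
  using sig_lead_near[OF sig_cp_lead[OF J_ne] homog_lie[OF J_ne]] by metis
 have "homog (w j) (- lie (J j))" using homog_lie[OF J_ne] by (simp add: homog_def)
 from sig_lead_near[OF sig_pinv_cp_lead[OF J_ne] this]
 obtain D2 where D2: "D2 \<ge> 0" "\<And>t v. 0 <= t ==> t <= 1 ==> v \<noteq> [] ==> length v <= smax ==>
   \<bar>coef (sig (pscale t (pinv (cp (J j))))) v - t ^ w j * coef (- lie (J j)) v\<bar> <= D2 * t ^ (w j + 1)"
  by metis
 define D3 where "D3 = (\<Sum>v | length v < smax + 1. \<bar>coef (lie (J j)) v\<bar>)"
 have D30: "D3 \<ge> 0" unfolding D3_def by (intro sum_nonneg) auto
 have D3: "\<bar>coef (lie (J j)) v\<bar> <= D3" if "length v <= smax" for v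
  unfolding D3_def using that by (intro member_le_sum) (auto simp: finite_words_lt)
 have "near smax (dl ^ smax) dl (D1 + D2 + D3) (bsig sg j) (\<lambda>v. sg $ j * coef (lie (J j)) v)"
  if dl: "0 <= dl" "dl <= 1" and sg: "\<bar>sg $ j\<bar> <= dl ^ smax" for sg dl unfolding near_def
 proof (intro conjI allI impI)
  show "coef (bsig sg j) [] = 1" by (simp add: bsig_def)
  fix v :: "'k list" assume v: "v \<noteq> [] \<and> length v <= smax"
  have "\<bar>sg $ j * coef (lie (J j)) v\<bar> <= dl ^ smax * D3"
   unfolding abs_mult using sg D3 v by (intro mult_mono) auto
  moreover have "0 <= (D1 + D2) * dl ^ smax" using D1 D2 dl by simp
  ultimately show "\<bar>sg $ j * coef (lie (J j)) v\<bar> <= (D1 + D2 + D3) * dl ^ smax" by (simp add: algebra_simps)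
  have *: "D * t ^ (w j + 1) <= (D1 + D2 + D3) * (dl ^ smax * dl)"
   if D: "0 <= D" "D <= D1 + D2 + D3" and t: "0 <= t" "t <= dl" "t ^ w j = \<bar>sg $ j\<bar>" for D t proof -
   have "t ^ (w j + 1) = \<bar>sg $ j\<bar> * t" using t by simp
   also have "... <= dl ^ smax * dl" using t sg dl by (intro mult_mono) auto
   finally show ?thesis using D t by (intro mult_mono) auto
  qed
  show "\<bar>coef (bsig sg j) v - sg $ j * coef (lie (J j)) v\<bar> <= (D1 + D2 + D3) * (dl ^ smax * dl)"
  proof (cases "sg $ j \<ge> 0")
   case True
   let ?t = "root (w j) (sg $ j)"
   note t = root_le[OF dl sg True, of j]
   have b: "bsig sg j = sig (pscale ?t (cp (J j)))" using True by (simp add: bsig_def sig_append sig_pscale_0)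
   have "\<bar>coef (bsig sg j) v - ?t ^ w j * coef (lie (J j)) v\<bar> <= D1 * ?t ^ (w j + 1)"
    unfolding b using t dl v True by (intro D1) auto
   also have "... <= (D1 + D2 + D3) * (dl ^ smax * dl)" using t True D1 D2 D30 by (intro *) auto
   finally show ?thesis using t by simp
  next
   case False
   let ?t = "root (w j) (- sg $ j)"
   note t = root_le[OF dl sg, of "- sg $ j" j]
   have b: "bsig sg j = sig (pscale ?t (pinv (cp (J j))))" using False by (simp add: bsig_def sig_append sig_pscale_0)
   have "\<bar>coef (bsig sg j) v - ?t ^ w j * coef (- lie (J j)) v\<bar> <= D2 * ?t ^ (w j + 1)"
    unfolding b using t dl v False by (intro D2) auto
   also have "... <= (D1 + D2 + D3) * (dl ^ smax * dl)" using t False D1 D2 D30 by (intro *) auto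
   finally show ?thesis using t False by simp
  qed
 qed
 then show ?thesis using D1 D2 D30 by (intro exI[of _ "D1 + D2 + D3"]) auto
qed

lemma path_times:
 assumes dl: "0 <= dl" "dl <= 1" and sg: "\<And>j. \<bar>sg $ j\<bar> <= dl ^ smax" and r: "0 <= r" and s: "s \<in> set (path r sg)"
 shows "\<bar>snd s\<bar> <= r" proof -
 from s obtain j where s: "s \<in> set (map (\<lambda>(i, h). (i, h sg)) (blk r j))" by (force simp: path_def blocks_def)
 then obtain b c where bc: "\<bar>c\<bar> <= 1" "snd s = r * root (w j) b * c" "0 <= b" "b <= \<bar>sg $ j\<bar>" proof -
  from s consider i c where "(i, c) \<in> set (cp (J j))" "s = (i, r * root (w j) (max (sg $ j) 0) * c)"
   | i c where "(i, c) \<in> set (pinv (cp (J j)))" "s = (i, r * root (w j) (max (- sg $ j) 0) * c)"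
   by (auto simp: blk_def)
  then show ?thesis proof cases
   case 1
   with cp_unit[OF 1(1)] show ?thesis by (intro that[of c "max (sg $ j) 0"]) auto
  next
   case 2
   with pinv_unit[OF cp_unit 2(1)] show ?thesis by (intro that[of c "max (- sg $ j) 0"]) auto
  qed
 qed
 note t = root_le[OF dl sg[of j] bc(3,4), of j]
 have "\<bar>snd s\<bar> = r * (root (w j) b * \<bar>c\<bar>)" using bc r t by (simp add: abs_mult)
 also have "... <= r * (1 * 1)" using bc r t dl by (intro mult_left_mono mult_mono) auto
 finally show ?thesis by simp
qed

lemma path_cont: "r \<ge> 0 ==> r <= ta ==> 0 <= dl ==> dl <= 1 ==> (\<And>sg j. sg \<in> S ==> \<bar>sg $ j\<bar> <= dl ^ smax) ==>
 continuous_on S (\<lambda>sg. endp fi (path r sg) p)" unfolding path_def proof (rule endp_cont)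
 fix i h assume a: "r \<ge> 0" "r <= ta" "0 <= dl" "dl <= 1" "\<And>sg j. sg \<in> S ==> \<bar>sg $ j\<bar> <= dl ^ smax" and ih: "(i, h) \<in> set (blocks r)"
 have "continuous_on S h" using ih by (auto simp: blocks_def blk_def intro!: continuous_intros)
 moreover have "h sg \<in> {-ta..ta}" if "sg \<in> S" for sg proof -
  have "(i, h sg) \<in> set (path r sg)" using ih by (force simp: path_def)
  from path_times[OF a(3,4) a(5)[OF that] a(1) this] a(2) show ?thesis by auto
 qed
 ultimately show "continuous_on S h \<and> h ` S \<subseteq> {-ta..ta}" by auto
qed (auto intro: continuous_intros)

text \<open>For equal weights the sum is the derivative of the coordinate \<open>i\<close> along the
  frame field \<open>j\<close>, given by duality. For different weights homogeneity of
  \<open>lie\<close> makes it vanish.\<close>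

lemma lie_pairing:
 assumes p: "p \<in> Om"
 shows "(\<Sum>v | length v = w i. coef (lie (J j)) v * ders X v (pf i p smax) p) = (if i = j then 1 else 0)"
proof (cases "w j = w i")
 case True
 have "(\<Sum>v | length v = w i. coef (lie (J j)) v * ders X v (pf i p smax) p) = der (vf X (J j)) (pf i p smax) p"
  using der_vf_eq[of Om X "J j" "pf i p smax" p] op smX J_ne pf_smooth p True by auto
 then show ?thesis using p by (simp add: pf_low)
next
 case False
 then have "coef (lie (J j)) v = 0" if "length v = w i" for v
  using homog_lie[OF J_ne, of j] that by (auto simp: homog_def)
 then show ?thesis using False by auto
qed

text \<open>In the Chen-Fliess expansion of order \<open>w i + 1\<close> words shorter than
  \<open>w i\<close> vanish at \<open>p\<close>, and words of length \<open>w i\<close> yield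
  \<open>r ^ w i\<close> times the linear part plus its error. The remainder of order
  \<open>r ^ (w i + 1)\<close> becomes \<open>C * r\<close> after rescaling.\<close>

lemma endpoint_estimate:
 assumes P: "compact P" "P \<subseteq> Om" and PR: "P \<subseteq> cball x0 (R / 2)"
 obtains A C where "0 < A" "0 < C"
  "\<And>p sg dl r i. p \<in> P ==> 0 <= dl ==> dl <= 1 ==> (\<And>j. \<bar>sg $ j\<bar> <= dl ^ smax) ==> 0 < r ==> r < ta ==>
   B * real (length (path 1 0)) * r <= R / 2 ==>
   \<bar>pf i p smax (endp fi (path r sg) p) / r ^ w i - sg $ i\<bar> <= A * (dl ^ smax * dl) + C * r" proof -
 let ?js = "SOME js. set js = (UNIV :: 'n set) \<and> distinct js"
 let ?N = "length (path 1 0)"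
 have "\<forall>j. \<exists>C\<ge>0. \<forall>sg dl. 0 <= dl --> dl <= 1 --> \<bar>sg $ j\<bar> <= dl ^ smax -->
  near smax (dl ^ smax) dl C (bsig sg j) (\<lambda>v. sg $ j * coef (lie (J j)) v)" using bsig_near by blast
 then obtain Cb where Cb: "\<And>j. Cb j \<ge> 0" "\<And>j sg dl. 0 <= dl ==> dl <= 1 ==> \<bar>sg $ j\<bar> <= dl ^ smax ==>
  near smax (dl ^ smax) dl (Cb j) (bsig sg j) (\<lambda>v. sg $ j * coef (lie (J j)) v)" by metis
 define Cm where "Cm = Max (range Cb)"
 have Cm: "Cb j <= Cm" for j by (simp add: Cm_def)
 have Cm0: "0 <= Cm" using Cb(1)[of undefined] Cm[of undefined] by linarith
 obtain D where D: "D \<ge> 0" "\<And>(S :: 'n => 'k ncs) La et dl. 0 <= et ==> et <= dl ==> dl <= 1 ==> (\<forall>j\<in>set ?js. near smax et dl Cm (S j) (La j)) ==>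
  near smax et dl D (prod_list (map S ?js)) (\<lambda>v. \<Sum>j\<leftarrow>?js. La j v)"
  using near_prod_list[OF Cm0, of ?js smax] by blast
 have BFf: "BF Om P (\<lambda>p. pf i p smax)" for i by (rule BF_pf[OF P])
 have "\<exists>G>0. \<forall>p\<in>P. \<forall>x\<in>P. \<bar>ders X v (pf i p smax) x\<bar> <= G" for i v
  by (rule BF_bounded[OF P BF_ders[where Z = X, OF op smX BFf]])
 then have "\<forall>i v. \<exists>G>0. \<forall>p\<in>P. \<bar>ders X v (pf i p smax) p\<bar> <= G" by blast
 then obtain G where G: "\<And>i v. G i v > 0" "\<And>i v p. p \<in> P ==> \<bar>ders X v (pf i p smax) p\<bar> <= G i v" by metis
 define A where "A = (\<Sum>i\<in>UNIV. \<Sum>v | length v = w i. D * G i v) + 1"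
 have Apos: "0 <= (\<Sum>v | length v = w i. D * G i v)" for i
  using D G(1) by (intro sum_nonneg) (simp add: less_imp_le)
 have A: "(\<Sum>v | length v = w i. D * G i v) <= A" for i
  unfolding A_def using member_le_sum[of i UNIV "\<lambda>i. \<Sum>v | length v = w i. D * G i v"] Apos by simp
 have A0: "A > 0" unfolding A_def using Apos by (simp add: sum_nonneg add_nonneg_pos)
 \<comment> \<open>The letters of the path depend neither on \<open>r\<close> nor on the parameters,
   so one Chen-Fliess constant serves all of them.\<close>
 define ids where "ids = map fst (path 1 0)"
 have fstp: "map fst (path r sg) = ids" for r sg
  by (simp add: ids_def path_def comp_def split_beta blocks_def map_concat blk_def)
 define CF where "CF i C \<longleftrightarrow> C > 0 \<and> (\<forall>ps p x T. map fst ps = ids --> p \<in> P --> 0 <= T --> T < ta -->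
   (\<forall>s\<in>set ps. \<bar>snd s\<bar> <= T) --> norm (x - x0) + B * real (length ids) * T <= R -->
   \<bar>pf i p smax (endp fi ps x) - (\<Sum>v | length v < w i + 1. coef (sig ps) v * ders X v (pf i p smax) x)\<bar> <= C * T ^ (w i + 1))" for i C
 have "\<exists>C. CF i C" for i
  using chen_fliess[OF BFf[of i], of ids "w i + 1"] unfolding CF_def by (elim exE conjE) (intro exI conjI)
 then obtain Cf where CF: "\<And>i. CF i (Cf i)" by metis
 have Cf: "Cf i > 0" "\<And>ps p x T. map fst ps = ids ==> p \<in> P ==> 0 <= T ==> T < ta ==>
   (\<forall>s\<in>set ps. \<bar>snd s\<bar> <= T) ==> norm (x - x0) + B * real (length ids) * T <= R ==>
   \<bar>pf i p smax (endp fi ps x) - (\<Sum>v | length v < w i + 1. coef (sig ps) v * ders X v (pf i p smax) x)\<bar> <= Cf i * T ^ (w i + 1)" for i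
  using CF[of i] unfolding CF_def by auto
 define C where "C = Max (range Cf)"
 have C: "Cf i <= C" for i by (simp add: C_def)
 have C0: "C > 0" using Cf(1)[of undefined] C[of undefined] by linarith
 have "\<bar>pf i p smax (endp fi (path r sg) p) / r ^ w i - sg $ i\<bar> <= A * (dl ^ smax * dl) + C * r"
  if p: "p \<in> P" and dl: "0 <= dl" "dl <= 1" and sg: "\<And>j. \<bar>sg $ j\<bar> <= dl ^ smax" and r: "0 < r" "r < ta"
   "B * real ?N * r <= R / 2" for p sg dl r i proof -
  have pO: "p \<in> Om" using p P by blast
  let ?f = "pf i p smax" and ?S = "sig (path 1 sg)"
  let ?et = "dl ^ smax"
  have et: "0 <= ?et" "?et <= dl" using dl smax_pos power_decreasing[of 1 smax dl] by auto
  let ?La = "\<lambda>v. \<Sum>j\<in>UNIV. sg $ j * coef (lie (J j)) v"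
  have "near smax ?et dl D (prod_list (map (bsig sg) ?js)) (\<lambda>v. \<Sum>j\<leftarrow>?js. sg $ j * coef (lie (J j)) v)"
  proof (rule D(2)[OF et dl(2)])
   show "\<forall>j\<in>set ?js. near smax ?et dl Cm (bsig sg j) (\<lambda>v. sg $ j * coef (lie (J j)) v)"
    using near_mono[OF Cb(2)[OF dl sg] Cm et(1) dl(1)] by blast
  qed
  then have nr: "near smax ?et dl D ?S ?La"
   using js by (simp add: sig_path_1 sum_list_distinct_conv_sum_set)
  let ?W = "{v :: 'k list. length v = w i}"
  have sum1: "(\<Sum>v | length v < w i + 1. coef (sig (path r sg)) v * ders X v ?f p) =
    r ^ w i * (\<Sum>v\<in>?W. coef ?S v * ders X v ?f p)" proof -
   have "(\<Sum>v | length v < w i + 1. coef (sig (path r sg)) v * ders X v ?f p) =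
     (\<Sum>v\<in>?W. coef (sig (path r sg)) v * ders X v ?f p)" by (rule sum.mono_neutral_right)
      (use pf_words_vanish[OF pO w_le] in \<open>auto simp: less_Suc_eq finite_words finite_words_lt\<close>)
   also have "... = (\<Sum>v\<in>?W. r ^ w i * (coef ?S v * ders X v ?f p))"
    by (subst path_scale) (simp add: coef_sig_pscale mult.assoc)
   finally show ?thesis by (simp add: sum_distrib_left)
  qed
  have sum2: "(\<Sum>v\<in>?W. ?La v * ders X v ?f p) = sg $ i" proof -
   have "(\<Sum>v\<in>?W. ?La v * ders X v ?f p) = (\<Sum>v\<in>?W. \<Sum>j\<in>UNIV. sg $ j * (coef (lie (J j)) v * ders X v ?f p))"
    by (simp add: sum_distrib_right mult.assoc)
   also have "... = (\<Sum>j\<in>UNIV. \<Sum>v\<in>?W. sg $ j * (coef (lie (J j)) v * ders X v ?f p))" by (rule sum.swap)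
   also have "... = (\<Sum>j\<in>UNIV. sg $ j * (if i = j then 1 else 0))"
    by (simp add: sum_distrib_left[symmetric] lie_pairing[OF pO])
   finally show ?thesis by (simp add: if_distrib cong: if_cong)
  qed
  have "\<bar>(\<Sum>v\<in>?W. coef ?S v * ders X v ?f p) - (\<Sum>v\<in>?W. ?La v * ders X v ?f p)\<bar> =
    \<bar>\<Sum>v\<in>?W. (coef ?S v - ?La v) * ders X v ?f p\<bar>" by (simp add: sum_subtractf left_diff_distrib)
  also have "... <= (\<Sum>v\<in>?W. (D * (?et * dl)) * G i v)"
  proof (rule order_trans[OF sum_abs], rule sum_mono)
   fix v assume v: "v \<in> ?W"
   then have "v \<noteq> []" "length v <= smax" using wpos[of i] w_le[of i] by auto
   then have "\<bar>coef ?S v - ?La v\<bar> <= D * (?et * dl)" using nr by (simp add: near_def)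
   then show "\<bar>(coef ?S v - ?La v) * ders X v ?f p\<bar> <= (D * (?et * dl)) * G i v"
    unfolding abs_mult using G(2)[OF p] D et dl by (intro mult_mono) auto
  qed
  also have "... = (\<Sum>v\<in>?W. D * G i v) * (?et * dl)"
   unfolding sum_distrib_right by (intro sum.cong refl) (simp add: mult_ac)
  also have "... <= A * (?et * dl)" using A et dl by (intro mult_right_mono) auto
  finally have e1: "\<bar>(\<Sum>v\<in>?W. coef ?S v * ders X v ?f p) - sg $ i\<bar> <= A * (?et * dl)" unfolding sum2 .
  have lis: "length ids = ?N" by (simp add: ids_def)
  have "\<bar>?f (endp fi (path r sg) p) - r ^ w i * (\<Sum>v\<in>?W. coef ?S v * ders X v ?f p)\<bar> <= Cf i * r ^ (w i + 1)"
   unfolding sum1[symmetric] proof (rule Cf(2)[OF fstp p])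
   show "\<forall>s\<in>set (path r sg). \<bar>snd s\<bar> <= r" using path_times[OF dl sg, of r] r by auto
   have "norm (p - x0) <= R / 2" using p PR by (auto simp: dist_norm norm_minus_commute)
   then show "norm (p - x0) + B * real (length ids) * r <= R" using r(3) unfolding lis by linarith
  qed (use r in auto)
  also have "... <= C * r ^ (w i + 1)" using C r by (intro mult_right_mono) auto
  finally have "\<bar>?f (endp fi (path r sg) p) - r ^ w i * (\<Sum>v\<in>?W. coef ?S v * ders X v ?f p)\<bar> / r ^ w i <= C * r ^ (w i + 1) / r ^ w i"
   using r by (intro divide_right_mono) auto
  then have "\<bar>(?f (endp fi (path r sg) p) - r ^ w i * (\<Sum>v\<in>?W. coef ?S v * ders X v ?f p)) / r ^ w i\<bar> <= C * r"
   using r by (simp add: abs_divide)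
  then have "\<bar>?f (endp fi (path r sg) p) / r ^ w i - (\<Sum>v\<in>?W. coef ?S v * ders X v ?f p)\<bar> <= C * r"
   using r by (simp add: diff_divide_distrib)
  with e1 show ?thesis by linarith
 qed
 with A0 C0 show thesis by (rule that)
qed

text \<open>Parameters with end point \<open>y\<close> are fixed points of a continuous self-map of
  a cube, obtained by subtracting the rescaled error of the end point.\<close>

lemma reach_box:
 assumes P: "compact P" "P \<subseteq> Om" and PR: "P \<subseteq> cball x0 (R / 2)" and rh: "0 < rh"
 obtains c r0 where "0 < c" "0 < r0" "r0 < ta" "B * real (length (path 1 0)) * r0 <= R / 2"
  "\<And>p r y. p \<in> P ==> 0 < r ==> r < r0 ==> (\<And>j. \<bar>y $ j\<bar> <= (c * r) ^ w j) ==>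
   \<exists>ps. length ps = length (path 1 0) \<and> (\<forall>s\<in>set ps. \<bar>snd s\<bar> <= r) \<and>
    endp fi ps p \<in> cball p rh \<and> F p (endp fi ps p) = y" proof -
 let ?N = "length (path 1 0)"
 obtain A C where AC: "0 < A" "0 < C"
  and est: "\<And>p sg dl r i. p \<in> P ==> 0 <= dl ==> dl <= 1 ==> (\<And>j. \<bar>sg $ j\<bar> <= dl ^ smax) ==> 0 < r ==> r < ta ==>
   B * real ?N * r <= R / 2 ==>
   \<bar>pf i p smax (endp fi (path r sg) p) / r ^ w i - sg $ i\<bar> <= A * (dl ^ smax * dl) + C * r"
  using endpoint_estimate[OF assms(1-3)] by blast
 \<comment> \<open>Makes the first error term at most a quarter of \<open>et\<close>. The choice of
   \<open>r0\<close> below does the same for the second, and the rescaled target is at most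
   \<open>c = et / 2\<close>, so in total \<open>et\<close> is not exceeded.\<close>
 define dl where "dl = min 1 (1 / (4 * A))"
 have dl: "0 < dl" "dl <= 1" using AC by (auto simp: dl_def)
 have "dl <= 1 / (4 * A)" by (simp add: dl_def)
 then have Adl: "A * dl <= 1 / 4" using AC by (simp add: field_simps)
 define et where "et = dl ^ smax"
 have et: "0 < et" "et <= 1" using dl by (auto simp: et_def power_le_one)
 define c where "c = et / 2"
 have c: "0 < c" "c <= 1" using et by (auto simp: c_def)
 define BN where "BN = B * real ?N + 1"
 have BN: "BN > 0" using B by (simp add: BN_def add_nonneg_pos)
 \<comment> \<open>The bounds keep the flows defined, make the remainder small, and confine the end
   points both to the region of the flows and to the ball of radius \<open>rh\<close>.\<close>
 define r0 where "r0 = min (ta / 2) (min (et / (4 * C)) (min (R / 2) rh / BN))"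
 have r0: "0 < r0" "r0 < ta" using ta et AC R rh BN by (auto simp: r0_def)
 have "r0 <= et / (4 * C)" "r0 <= min (R / 2) rh / BN" by (auto simp: r0_def)
 then have Cr0: "C * r0 <= et / 4" and BNr0: "BN * r0 <= min (R / 2) rh"
  using AC BN by (auto simp: field_simps)
 have BNr: "B * real ?N * r <= min (R / 2) rh" if "0 <= r" "r <= r0" for r proof -
  have "B * real ?N * r <= BN * r" using that by (intro mult_right_mono) (auto simp: BN_def)
  also have "... <= BN * r0" using that BN by (intro mult_left_mono) auto
  finally show ?thesis using BNr0 by linarith
 qed
 have main: "\<exists>ps. length ps = ?N \<and> (\<forall>s\<in>set ps. \<bar>snd s\<bar> <= r) \<and>
    endp fi ps p \<in> cball p rh \<and> F p (endp fi ps p) = y"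
  if p: "p \<in> P" and r: "0 < r" "r < r0" and y: "\<And>j. \<bar>y $ j\<bar> <= (c * r) ^ w j" for p r y proof -
  define Q where "Q = cbox (- (\<chi> j. et)) (\<chi> j. et :: real ^ 'n)"
  have Q: "sg \<in> Q \<longleftrightarrow> (\<forall>j. \<bar>sg $ j\<bar> <= et)" for sg proof -
   have "- c <= a \<and> a <= c \<longleftrightarrow> \<bar>a\<bar> <= c" for a c :: real by linarith
   then show ?thesis by (simp add: Q_def mem_box_cart)
  qed
  have rt: "r < ta" and BNr': "B * real ?N * r <= R / 2" "B * real ?N * r <= rh"
   using r r0 BNr[of r] by auto
  let ?E = "\<lambda>sg. endp fi (path r sg) p"
  have Erh: "?E sg \<in> cball p rh" if "sg \<in> Q" for sg proof -
   have "norm (?E sg - p) <= B * real (length (path r sg)) * r"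
    using path_times[OF _ dl(2), of sg r] dl that r rt unfolding Q et_def by (intro endp_near) auto
   then show ?thesis using BNr' length_path[of r sg] by (simp add: dist_norm norm_minus_commute)
  qed
  \<comment> \<open>A fixed point is exactly a parameter whose end point has the coordinates
    \<open>y\<close>.\<close>
  define T where "T sg = (\<chi> i. sg $ i - pf i p smax (?E sg) / r ^ w i + y $ i / r ^ w i)" for sg
  have TQ: "T sg \<in> Q" if s: "sg \<in> Q" for sg unfolding Q proof
   fix i
   have "\<bar>pf i p smax (?E sg) / r ^ w i - sg $ i\<bar> <= A * (dl ^ smax * dl) + C * r"
    using s dl r rt BNr' unfolding Q et_def by (intro est[OF p]) auto
   also have "A * (dl ^ smax * dl) = (A * dl) * et" by (simp add: et_def)
   also have "... <= 1 / 4 * et" using Adl et by (intro mult_right_mono) auto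
   also have "C * r <= et / 4" using Cr0 r AC mult_left_mono[of r r0 C] by linarith
   finally have 1: "\<bar>pf i p smax (?E sg) / r ^ w i - sg $ i\<bar> <= et / 2" by simp
   have "\<bar>y $ i / r ^ w i\<bar> = \<bar>y $ i\<bar> / r ^ w i" using r by (simp add: abs_divide)
   also have "... <= (c * r) ^ w i / r ^ w i" using y r by (intro divide_right_mono) auto
   also have "... = c ^ w i" using r by (simp add: power_mult_distrib)
   also have "... <= c ^ 1" using c wpos[of i] by (intro power_decreasing) (auto simp: Suc_le_eq)
   finally have 2: "\<bar>y $ i / r ^ w i\<bar> <= et / 2" by (simp add: c_def)
   show "\<bar>T sg $ i\<bar> <= et" using 1 2 unfolding T_def vec_lambda_beta by linarith
  qed
  have Econt: "continuous_on Q ?E"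
   using r rt dl Q by (intro path_cont[where dl = dl]) (auto simp: et_def)
  have EO: "?E sg \<in> Om" if "sg \<in> Q" for sg proof -
   have "norm (?E sg - p) <= B * real (length (path r sg)) * r"
    using path_times[OF _ dl(2), of sg r] dl that r rt unfolding Q et_def by (intro endp_near) auto
   then have "norm (?E sg - p) <= R / 2" using BNr' length_path[of r sg] by simp
   moreover have "dist x0 p <= R / 2" using p PR by auto
   ultimately have "?E sg \<in> cball x0 R"
    using dist_triangle[of x0 "?E sg" p] by (simp add: dist_norm norm_minus_commute)
   then show ?thesis using R by blast
  qed
  have pfc: "continuous_on Om (pf i p smax)" for i using smooth_on_continuous[OF pf_smooth] .
  have "continuous_on Q T" unfolding T_def using Econt EO r
   by (intro continuous_on_vec_lambda continuous_intros continuous_on_compose2[OF pfc]) auto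
  moreover have "Q \<noteq> {}" using Q[of 0] et by auto
  ultimately obtain sg where sg: "sg \<in> Q" "T sg = sg" using brouwer[of Q T] TQ by (auto simp: Q_def)
  have "pf i p smax (?E sg) = y $ i" for i proof -
   have "T sg $ i = sg $ i" using sg by simp
   then have "sg $ i - pf i p smax (?E sg) / r ^ w i + y $ i / r ^ w i = sg $ i"
    by (simp only: T_def vec_lambda_beta)
   then have "pf i p smax (?E sg) / r ^ w i = y $ i / r ^ w i" by linarith
   then have "r ^ w i = 0 \<or> pf i p smax (?E sg) = y $ i" by (simp only: divide_cancel_right)
   then show ?thesis using r by auto
  qed
  then have "F p (?E sg) = y" by (simp add: vec_eq_iff)
  moreover have "\<forall>s\<in>set (path r sg). \<bar>snd s\<bar> <= r"
   using path_times[OF _ dl(2), of sg r] dl sg(1) r unfolding Q et_def by auto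
  ultimately show ?thesis using Erh[OF sg(1)] length_path by blast
 qed
 have "B * real ?N * r0 <= R / 2" using BNr[of r0] r0 by simp
 from that[OF c(1) r0 this main] show thesis by blast
qed

end

section \<open>Absolutely continuous functions\<close>

text \<open>Indexed families are more flexible than the sets of pairs in \<open>ac_on\<close>: they
  describe clipped intervals, affine images and the pieces of a tagged division.\<close>

definition disjoint_intervals :: "real => real => 'i set => ('i => real) => ('i => real) => bool"
 where "disjoint_intervals a b J l r \<longleftrightarrow> finite J \<and> (\<forall>j\<in>J. a <= l j \<and> l j < r j \<and> r j <= b) \<and>
  (\<forall>i\<in>J. \<forall>j\<in>J. i \<noteq> j --> {l i<..<r i} \<inter> {l j<..<r j} = {})"

lemma disjoint_intervalsI:
 assumes "finite J" "\<And>j. j \<in> J ==> a <= l j \<and> l j < r j \<and> r j <= b"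
  "\<And>i j. i \<in> J ==> j \<in> J ==> i \<noteq> j ==> {l i<..<r i} \<inter> {l j<..<r j} = {}"
 shows "disjoint_intervals a b J l r" unfolding disjoint_intervals_def using assms by simp

lemma ac_on_pairs:
 "ac_on a b g \<longleftrightarrow> (\<forall>e>0. \<exists>d>0. \<forall>I. disjoint_intervals a b I fst snd -->
   (\<Sum>j\<in>I. snd j - fst j) < d --> (\<Sum>j\<in>I. dist (g (fst j)) (g (snd j))) < e)"
 by (simp add: ac_on_def disjoint_intervals_def disjoint_family_on_def split_beta imp_conjL)

text \<open>Nonempty disjoint intervals are distinct, so indexing by pairs of end points loses
  nothing.\<close>

lemma ac_on_indexed:
 assumes "ac_on a b g" "0 < e"
 shows "\<exists>d>0. \<forall>(J :: 'i set) l r. disjoint_intervals a b J l r -->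
   (\<Sum>j\<in>J. r j - l j) < d --> (\<Sum>j\<in>J. dist (g (l j)) (g (r j))) < e" proof -
 from assms obtain d where d: "d > 0" "\<forall>I. disjoint_intervals a b I fst snd -->
    (\<Sum>j\<in>I. snd j - fst j) < d --> (\<Sum>j\<in>I. dist (g (fst j)) (g (snd j))) < e"
  unfolding ac_on_pairs by blast
 show ?thesis proof (intro exI[of _ d] conjI allI impI d(1))
  fix J :: "'i set" and l r assume J: "disjoint_intervals a b J l r" and sm: "(\<Sum>j\<in>J. r j - l j) < d"
  let ?h = "\<lambda>j. (l j, r j)"
  have inj: "inj_on ?h J" proof (rule inj_onI)
   fix i j assume ij: "i \<in> J" "j \<in> J" "?h i = ?h j"
   have "l i < r i" using J ij(1) by (simp add: disjoint_intervals_def)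
   then have "{l i<..<r i} \<inter> {l j<..<r j} \<noteq> {}" using ij(3) by simp
   then show "i = j" using J ij(1,2) unfolding disjoint_intervals_def by blast
  qed
  have "disjoint_intervals a b (?h ` J) fst snd"
   using J inj unfolding disjoint_intervals_def by (auto simp: inj_on_def)
  then show "(\<Sum>j\<in>J. dist (g (l j)) (g (r j))) < e"
   using d(2) sm by (auto simp: sum.reindex[OF inj])
 qed
qed

lemma ac_on_imp_continuous_on:
 assumes "ac_on a b g"
 shows "continuous_on {a..b} g" unfolding continuous_on_iff proof (intro ballI allI impI)
 fix x e :: real assume x: "x \<in> {a..b}" and e: "e > 0"
 obtain d where d: "d > 0" "\<forall>(J :: unit set) l r. disjoint_intervals a b J l r -->
   (\<Sum>j\<in>J. r j - l j) < d --> (\<Sum>j\<in>J. dist (g (l j)) (g (r j))) < e"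
  using ac_on_indexed[OF assms e] by blast
 show "\<exists>d>0. \<forall>x'\<in>{a..b}. dist x' x < d --> dist (g x') (g x) < e"
 proof (intro exI[of _ d] conjI ballI impI)
  fix x' assume x': "x' \<in> {a..b}" "dist x' x < d"
  show "dist (g x') (g x) < e" proof (cases "x' = x")
   case False
   then show ?thesis using d(2)[rule_format, of "{()}" "\<lambda>_. min x x'" "\<lambda>_. max x x'"] x x'
    by (cases "x < x'") (auto simp: disjoint_intervals_def dist_real_def dist_commute)
  qed (use e in auto)
 qed (rule d)
qed

lemma ac_on_lipschitz_comp:
 assumes g: "ac_on a b g" and gK: "g ` {a..b} \<subseteq> K"
  and L: "\<And>x y. x \<in> K ==> y \<in> K ==> dist (f x) (f y) <= L * dist x y"
 shows "ac_on a b (\<lambda>t. f (g t))" unfolding ac_on_pairs proof (intro allI impI)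
 fix e :: real assume e: "e > 0"
 define L' where "L' = max L 1"
 have "e / L' > 0" using e by (simp add: L'_def)
 with g obtain d where d: "d > 0" "\<forall>I. disjoint_intervals a b I fst snd -->
    (\<Sum>j\<in>I. snd j - fst j) < d --> (\<Sum>j\<in>I. dist (g (fst j)) (g (snd j))) < e / L'"
  unfolding ac_on_pairs by meson
 show "\<exists>d>0. \<forall>I. disjoint_intervals a b I fst snd --> (\<Sum>j\<in>I. snd j - fst j) < d -->
    (\<Sum>j\<in>I. dist (f (g (fst j))) (f (g (snd j)))) < e" proof (intro exI[of _ d] conjI allI impI)
  fix I :: "(real \<times> real) set"
  assume I: "disjoint_intervals a b I fst snd" "(\<Sum>j\<in>I. snd j - fst j) < d"
  have "(\<Sum>j\<in>I. dist (f (g (fst j))) (f (g (snd j)))) <= (\<Sum>j\<in>I. L' * dist (g (fst j)) (g (snd j)))"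
  proof (rule sum_mono)
   fix j assume "j \<in> I"
   then have "fst j \<in> {a..b}" "snd j \<in> {a..b}" using I(1) by (fastforce simp: disjoint_intervals_def)+
   then have "dist (f (g (fst j))) (f (g (snd j))) <= L * dist (g (fst j)) (g (snd j))" using gK by (intro L) auto
   also have "... <= L' * dist (g (fst j)) (g (snd j))" by (intro mult_right_mono) (auto simp: L'_def)
   finally show "dist (f (g (fst j))) (f (g (snd j))) <= L' * dist (g (fst j)) (g (snd j))" .
  qed
  also have "... = L' * (\<Sum>j\<in>I. dist (g (fst j)) (g (snd j)))" by (simp add: sum_distrib_left)
  also have "... < L' * (e / L')" using d(2) I by (intro mult_strict_left_mono) (auto simp: L'_def)
  finally show "(\<Sum>j\<in>I. dist (f (g (fst j))) (f (g (snd j)))) < e" by (simp add: L'_def)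
 qed (rule d)
qed

lemma ac_on_lipschitz:
 fixes g :: "real => 'e::metric_space"
 assumes L: "\<And>s t. s \<in> {a..b} ==> t \<in> {a..b} ==> dist (g s) (g t) <= L * \<bar>s - t\<bar>"
 shows "ac_on a b g" proof -
 have "(\<Sum>j\<in>I. dist (fst j) (snd j)) = (\<Sum>j\<in>I. snd j - fst j)" if "disjoint_intervals a b I fst snd" for I
  using that by (intro sum.cong) (auto simp: disjoint_intervals_def dist_real_def)
 then have "ac_on a b (\<lambda>t. t)" unfolding ac_on_pairs by auto
 from ac_on_lipschitz_comp[OF this, of "{a..b}" g L] L show ?thesis by (auto simp: dist_real_def)
qed

section \<open>Increments of absolutely continuous functions\<close>

lemma negligible_open_cover:
 fixes N :: "real set"
 assumes "negligible N" "d > 0"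
 obtains U where "open U" "N \<subseteq> U" "U \<in> lmeasurable" "measure lebesgue U < d" proof -
 have N: "N \<in> sets lebesgue" "emeasure lebesgue N = 0"
  using assms(1) by (auto simp: negligible_iff_null_sets null_sets_def)
 obtain U where U: "open U" "N \<subseteq> U" "(U - N) \<in> lmeasurable" "emeasure lebesgue (U - N) < ennreal d"
  using sets_lebesgue_outer_open[OF N(1) assms(2)] by blast
 have "emeasure lebesgue U <= emeasure lebesgue N + emeasure lebesgue (U - N)"
  using U N emeasure_subadditive[of N lebesgue "U - N"] by (auto simp: Un_absorb1)
 then have lt: "emeasure lebesgue U < ennreal d" using N U by simp
 have "U \<in> sets lebesgue" using U by auto
 then have Um: "U \<in> lmeasurable" using lt by (auto simp: fmeasurable_def intro: less_trans)
 have "ennreal (measure lebesgue U) < ennreal d" using lt Um by (simp add: emeasure_eq_measure2 fmeasurableD2)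
 then have "measure lebesgue U < d" by (simp add: ennreal_less_iff)
 then show thesis using that U Um by blast
qed

text \<open>Gauge argument on a tagged division. Intervals tagged outside \<open>N\<close> are
  controlled by differentiability at the tag; those tagged in \<open>N\<close> lie in an open set of
  small measure, where absolute continuity bounds their total contribution.\<close>

lemma ac_on_henstock_bound:
 fixes g :: "real => real"
 assumes ab: "a <= b" and ac: "ac_on a b g" and N: "negligible N"
  and D: "\<And>t. t \<in> {a..b} - N ==> (g has_real_derivative D t) (at t)"
  and I: "((\<lambda>t. if t \<in> N then 0 else \<bar>D t\<bar>) has_integral I) {a..b}"
 shows "\<bar>g b - g a\<bar> <= I" proof (rule field_le_epsilon)
 fix e0 :: real assume "e0 > 0"
 \<comment> \<open>The errors are \<open>e * (b - a)\<close> from differentiability,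
   \<open>e\<close> from the intervals tagged in \<open>N\<close> and \<open>e\<close> from the
   Riemann sum.\<close>
 define e where "e = e0 / (b - a + 2)"
 have e: "e > 0" "e * (b - a + 2) = e0" using ab \<open>e0 > 0\<close> by (auto simp: e_def)
 let ?f = "\<lambda>t. if t \<in> N then 0 else \<bar>D t\<bar>"
 obtain d where d: "d > 0" "\<forall>(J :: (real \<times> real set) set) l r. disjoint_intervals a b J l r -->
   (\<Sum>j\<in>J. r j - l j) < d --> (\<Sum>j\<in>J. dist (g (l j)) (g (r j))) < e"
  using ac_on_indexed[OF ac e(1)] by blast
 obtain U where U: "open U" "N \<subseteq> U" "U \<in> lmeasurable" "measure lebesgue U < d"
  using negligible_open_cover[OF N d(1)] by blast
 have "(?f has_integral I) (cbox a b)" using I by simp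
 from has_integral[THEN iffD1, OF this, THEN spec, THEN mp, OF e(1)]
 obtain gm1 where gm': "gauge gm1 \<and> (\<forall>p. p tagged_division_of cbox a b \<and> gm1 fine p -->
   norm ((\<Sum>(x, k)\<in>p. measure lborel k *\<^sub>R ?f x) - I) < e)" by (elim exE)
 have gm1: "gauge gm1" "\<And>p. p tagged_division_of cbox a b ==> gm1 fine p ==>
   norm ((\<Sum>(x, k)\<in>p. measure lborel k *\<^sub>R ?f x) - I) < e" using gm' by auto
 have "\<exists>r>0. \<forall>y. \<bar>y - t\<bar> < r --> \<bar>g y - g t - D t * (y - t)\<bar> <= e * \<bar>y - t\<bar>" if "t \<in> {a..b} - N" for t
  using D[OF that] e(1) unfolding has_field_derivative_def has_derivative_at_alt
  by (auto simp: mult.commute)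
 then obtain r where r: "\<And>t. t \<in> {a..b} - N ==> r t > 0"
   "\<And>t y. t \<in> {a..b} - N ==> \<bar>y - t\<bar> < r t ==> \<bar>g y - g t - D t * (y - t)\<bar> <= e * \<bar>y - t\<bar>" by metis
 define gm2 where "gm2 t = (if t \<in> N then U else if t \<in> {a..b} then ball t (r t) else ball t 1)" for t
 have "gauge gm2" using U r(1) by (auto simp: gauge_def gm2_def)
 then have g12: "gauge (\<lambda>t. gm1 t \<inter> gm2 t)" using gm1(1) by (rule gauge_Int[rotated])
 obtain p where p: "p tagged_division_of {a..b}" "(\<lambda>t. gm1 t \<inter> gm2 t) fine p"
  using fine_division_exists_real[OF g12, of a b] by blast
 have f1: "gm1 fine p" and f2: "gm2 fine p" using p(2) by (auto simp: fine_Int)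
 note pD = tagged_division_ofD[OF p(1)]
 have k: "k = {Inf k..Sup k} \<and> Inf k <= x \<and> x <= Sup k \<and> a <= Inf k \<and> Sup k <= b" if "(x, k) \<in> p" for x k
 proof -
  from pD(4)[OF that] obtain u v where "k = cbox u v" by (elim exE)
  then have uv: "k = {u..v}" by simp
  have x: "x \<in> {u..v}" and "{u..v} \<subseteq> {a..b}" using pD(2)[OF that] pD(3)[OF that] uv by simp_all
  moreover have "Inf k = u" "Sup k = v" using x unfolding uv by simp_all
  ultimately show ?thesis using uv by simp
 qed
 let ?Dl = "\<lambda>k. \<bar>g (Sup k) - g (Inf k)\<bar>"
 have good: "?Dl k <= measure lborel k * ?f x + e * measure lborel k" if xk: "(x, k) \<in> p" "x \<notin> N" for x k
 proof -
  obtain u v where uv: "k = {u..v}" "u <= x" "x <= v" "a <= u" "v <= b" "Inf k = u" "Sup k = v"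
   using k[OF xk(1)] by metis
  have x: "x \<in> {a..b} - N" using uv(2-5) xk(2) by simp
  have "k \<subseteq> ball x (r x)" using fineD[OF f2 xk(1)] x by (simp add: gm2_def)
  moreover have "u \<in> k" "v \<in> k" using uv by auto
  ultimately have "v \<in> ball x (r x)" "u \<in> ball x (r x)" by blast+
  then have "\<bar>v - x\<bar> < r x" "\<bar>u - x\<bar> < r x" by (simp_all add: dist_real_def)
  from r(2)[OF x this(1)] r(2)[OF x this(2)]
  have 1: "\<bar>g v - g x - D x * (v - x)\<bar> <= e * (v - x)" "\<bar>g u - g x - D x * (u - x)\<bar> <= e * (x - u)" using uv by auto
  have "\<bar>g v - g u - D x * (v - u)\<bar> <= e * (v - x) + e * (x - u)"
   using 1 by (simp add: right_diff_distrib)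
  moreover have "\<bar>D x * (v - u)\<bar> = \<bar>D x\<bar> * (v - u)" using uv by (simp add: abs_mult)
  ultimately have "\<bar>g v - g u\<bar> <= \<bar>D x\<bar> * (v - u) + e * (v - u)" by (simp add: right_diff_distrib)
  then show ?thesis using uv xk by (simp add: mult.commute)
 qed
 \<comment> \<open>Degenerate intervals contribute nothing and are left out, because absolute
   continuity speaks of proper intervals.\<close>
 define pb where "pb = {(x, k) \<in> p. x \<in> N \<and> Inf k < Sup k}"
 have pb: "finite pb" "pb \<subseteq> p" using pD(1) by (auto simp: pb_def intro: rev_finite_subset)
 have dis: "interior k \<inter> interior k' = {}" if "(x, k) \<in> p" "(x', k') \<in> p" "(x, k) \<noteq> (x', k')" for x k x' k'
  using pD(5)[OF that] .
 have inter: "interior k = {Inf k<..<Sup k}" if "(x, k) \<in> p" for x k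
  using k[OF that] interior_atLeastAtMost_real by metis
 let ?l = "\<lambda>q :: real \<times> real set. Inf (snd q)" and ?u = "\<lambda>q :: real \<times> real set. Sup (snd q)"
 have di: "disjoint_intervals a b pb ?l ?u" unfolding disjoint_intervals_def
 proof (intro conjI ballI impI)
  fix q q' assume "q \<in> pb" "q' \<in> pb" "q \<noteq> q'"
  then have q: "(fst q, snd q) \<in> p" "(fst q', snd q') \<in> p" "(fst q, snd q) \<noteq> (fst q', snd q')"
   using pb(2) by (auto simp: prod_eq_iff)
  show "{?l q<..<?u q} \<inter> {?l q'<..<?u q'} = {}"
   using dis[OF q] unfolding inter[OF q(1)] inter[OF q(2)] .
 qed (use pb k in \<open>auto simp: pb_def\<close>)
 have "(\<Sum>q\<in>pb. ?u q - ?l q) = (\<Sum>q\<in>pb. measure lebesgue {?l q<..<?u q})"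
  by (intro sum.cong) (auto simp: pb_def)
 also have "... = measure lebesgue (\<Union>q\<in>pb. {?l q<..<?u q})"
  using pb(1) di by (intro measure_finite_Union[symmetric])
   (auto simp: disjoint_intervals_def disjoint_family_on_def)
 also have "... <= measure lebesgue U" proof (rule measure_mono_fmeasurable)
  show "(\<Union>q\<in>pb. {?l q<..<?u q}) \<subseteq> U" proof (rule UN_least)
   fix q assume q: "q \<in> pb"
   then have xp: "(fst q, snd q) \<in> p" "fst q \<in> N" by (auto simp: pb_def)
   then have "snd q \<subseteq> U" using fineD[OF f2 xp(1)] by (simp add: gm2_def)
   then show "{?l q<..<?u q} \<subseteq> U" using inter[OF xp(1)] interior_subset by blast
  qed
 qed (use pb(1) U in auto)
 finally have "(\<Sum>q\<in>pb. dist (g (?l q)) (g (?u q))) < e" using d(2) di U(4) by auto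
 then have bad: "(\<Sum>(x, k)\<in>pb. ?Dl k) < e" by (simp add: split_beta dist_real_def abs_minus_commute)
 have f0: "0 <= ?f x" for x by simp
 have "\<bar>g b - g a\<bar> = \<bar>\<Sum>(x, k)\<in>p. g (Sup k) - g (Inf k)\<bar>"
  using additive_tagged_division_1[OF ab p(1), of g] by simp
 also have "... <= (\<Sum>(x, k)\<in>p. ?Dl k)" by (rule order_trans[OF sum_abs]) (auto simp: split_beta)
 also have "... = (\<Sum>(x, k)\<in>p - pb. ?Dl k) + (\<Sum>(x, k)\<in>pb. ?Dl k)"
  using pb pD(1) by (rule_tac sum.subset_diff) auto
 also have "(\<Sum>(x, k)\<in>p - pb. ?Dl k) <= (\<Sum>(x, k)\<in>p - pb. measure lborel k * ?f x + e * measure lborel k)"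
 proof (rule sum_mono, clarify)
  fix x k assume xk: "(x, k) \<in> p" "(x, k) \<notin> pb"
  show "?Dl k <= measure lborel k * ?f x + e * measure lborel k" proof (cases "x \<in> N")
   case True
   then have "Inf k = Sup k" using xk k[OF xk(1)] by (force simp: pb_def)
   then show ?thesis using True e by simp
  qed (rule good[OF xk(1)])
 qed
 also have "(\<Sum>(x, k)\<in>p - pb. measure lborel k * ?f x + e * measure lborel k) <= (\<Sum>(x, k)\<in>p. measure lborel k * ?f x + e * measure lborel k)"
  using pD(1) e f0 by (intro sum_mono2) auto
 also have "... = (\<Sum>(x, k)\<in>p. measure lborel k *\<^sub>R ?f x) + e * (\<Sum>(x, k)\<in>p. measure lborel k)"
  by (simp add: split_beta sum.distrib sum_distrib_left)
 also have "(\<Sum>(x, k)\<in>p. measure lborel k) = b - a"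
  using additive_content_tagged_division[of p a b] p(1) ab by simp
 finally have "\<bar>g b - g a\<bar> <= (\<Sum>(x, k)\<in>p. measure lborel k *\<^sub>R ?f x) + e * (b - a) + e" using bad by linarith
 moreover have "(\<Sum>(x, k)\<in>p. measure lborel k *\<^sub>R ?f x) <= I + e"
  using gm1(2)[unfolded box_real(2), OF p(1) f1] unfolding real_norm_def by linarith
 ultimately show "\<bar>g b - g a\<bar> <= I + e0" using e(2) by (simp add: algebra_simps)
qed

text \<open>The function \<open>h\<close> need not be measurable; its integral is then a lower integral.\<close>

lemma ac_on_derivative_bound:
 fixes g :: "real => real" and h :: "real => ennreal"
 assumes ab: "a <= b" and ac: "ac_on a b g" and M: "0 < M" and l: "0 <= l"
  and AE: "AE t in lebesgue_on {a..b}. \<exists>D. (g has_real_derivative D) (at t) \<and> ennreal \<bar>D\<bar> <= ennreal M * h t"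
  and h: "(\<integral>\<^sup>+t. h t \<partial>lebesgue_on {a..b}) <= ennreal l"
 shows "\<bar>g b - g a\<bar> <= l * M" proof -
 let ?L = "lebesgue_on {a..b}"
 \<comment> \<open>Constant continuation beyond the end points, so that difference quotients make
   sense everywhere.\<close>
 define G where "G t = g (max a (min b t))" for t
 have "continuous_on UNIV G" unfolding G_def
  by (rule continuous_on_compose2[OF ac_on_imp_continuous_on[OF ac]]) (use ab in \<open>auto intro!: continuous_intros\<close>)
 then have Gm: "(\<lambda>t. G (t + c)) \<in> borel_measurable borel" for c
  by (intro borel_measurable_continuous_onI)
    (rule continuous_on_compose2[of UNIV G UNIV "\<lambda>t. t + c"],
    auto intro: continuous_on_add continuous_on_id continuous_on_const)
 \<comment> \<open>A Borel representative of the derivative, as a limit of continuous difference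
   quotients; it allows the use of the Lebesgue integral although \<open>h\<close> may fail to be
   measurable.\<close>
 define D where "D t = lim (\<lambda>n. (G (t + 1 / real (Suc n)) - G (t + 0)) * real (Suc n))" for t
 have Dm: "D \<in> borel_measurable borel" unfolding D_def using Gm by measurable
 have DmL: "D \<in> borel_measurable ?L"
  using Dm by (intro measurable_restrict_space1 measurable_completion) auto
 have lim: "D t = D0" if t: "a < t" "t < b" and D0: "(g has_real_derivative D0) (at t)" for t D0
 proof -
  have "(\<lambda>h. (g (t + h) - g t) / h) \<midarrow>0\<rightarrow> D0" using D0 by (simp add: DERIV_def)
  moreover have "filterlim (\<lambda>n. 1 / real (Suc n)) (at 0) sequentially"
   using LIMSEQ_Suc[OF lim_1_over_n[where 'a = real]] by (simp add: filterlim_at del: of_nat_Suc)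
  ultimately have "(\<lambda>n. (g (t + 1 / real (Suc n)) - g t) / (1 / real (Suc n))) \<longlonglongrightarrow> D0"
   by (rule filterlim_compose)
  moreover have "\<forall>\<^sub>F n in sequentially. (g (t + 1 / real (Suc n)) - g t) / (1 / real (Suc n)) = (G (t + 1 / real (Suc n)) - G (t + 0)) * real (Suc n)"
  proof -
   have "(\<lambda>n. 1 / real (Suc n)) \<longlonglongrightarrow> 0" by (rule LIMSEQ_Suc[OF lim_1_over_n[where 'a = real]])
   then have "\<forall>\<^sub>F n in sequentially. 1 / real (Suc n) < b - t" using t by (intro order_tendstoD) auto
   then show ?thesis proof eventually_elim
    case (elim n)
    then have "max a (min b (t + 1 / real (Suc n))) = t + 1 / real (Suc n)"
     using t by (simp add: min_def max_def add_increasing2 del: of_nat_Suc)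
    then show ?case using t by (simp add: G_def)
   qed
  qed
  ultimately have "(\<lambda>n. (G (t + 1 / real (Suc n)) - G (t + 0)) * real (Suc n)) \<longlonglongrightarrow> D0"
   by (rule Lim_transform_eventually)
  then show ?thesis unfolding D_def by (rule limI)
 qed
 have "AE t in lebesgue_on {a..b}. t \<noteq> a \<and> t \<noteq> b" proof (rule AE_I'[of "{a, b} \<inter> {a..b}"])
  show "{a, b} \<inter> {a..b} \<in> null_sets ?L" using finite_imp_null_set_lborel[of "{a, b} \<inter> {a..b}"]
   by (subst null_sets_restrict_space) (auto simp: null_sets_completionI)
 qed auto
 with AE have AE': "AE t in ?L. (g has_real_derivative D t) (at t) \<and> ennreal \<bar>D t\<bar> <= ennreal M * h t"
  using AE_space proof eventually_elim
  case (elim t)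
  then obtain D0 where "(g has_real_derivative D0) (at t)" "ennreal \<bar>D0\<bar> <= ennreal M * h t" by blast
  moreover have "D t = D0" by (rule lim) (use elim calculation in auto)
  ultimately show ?case by simp
 qed
 from AE_E3[OF this] obtain N where
  N: "\<And>t. t \<in> space ?L - N ==> (g has_real_derivative D t) (at t) \<and> ennreal \<bar>D t\<bar> <= ennreal M * h t" "N \<in> null_sets ?L"
  by blast
 have neg: "negligible N" using N(2) by (simp add: null_sets_restrict_space negligible_iff_null_sets)
 have good: "(g has_real_derivative D t) (at t)" if "t \<in> {a..b} - N" for t using N(1)[of t] that by simp
 have "(\<integral>\<^sup>+t. ennreal (\<bar>D t\<bar> / M) \<partial>?L) <= (\<integral>\<^sup>+t. h t \<partial>?L)" proof (rule nn_integral_mono_AE)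
  show "AE t in ?L. ennreal (\<bar>D t\<bar> / M) <= h t" using AE' proof eventually_elim
   case (elim t)
   have "ennreal (\<bar>D t\<bar> / M) = ennreal (1 / M) * ennreal \<bar>D t\<bar>" using M by (simp flip: ennreal_mult)
   also have "... <= ennreal (1 / M) * (ennreal M * h t)" using elim by (intro mult_left_mono) auto
   also have "... = h t" using M by (simp flip: mult.assoc ennreal_mult)
   finally show ?case .
  qed
 qed
 then have nn: "(\<integral>\<^sup>+t. ennreal (\<bar>D t\<bar> / M) \<partial>?L) <= ennreal l" using h by simp
 have int: "integrable ?L (\<lambda>t. \<bar>D t\<bar> / M)"
  using DmL M nn by (intro integrableI_bounded) (auto simp: le_less_trans)
 then have int': "integrable ?L (\<lambda>t. \<bar>D t\<bar>)" using integrable_mult_right[OF int, of M] M by simp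
 have "ennreal (integral\<^sup>L ?L (\<lambda>t. \<bar>D t\<bar> / M)) <= ennreal l"
  using nn nn_integral_eq_integral[OF int] M by simp
 then have "integral\<^sup>L ?L (\<lambda>t. \<bar>D t\<bar>) / M <= l" using l by simp
 then have le: "integral {a..b} (\<lambda>t. \<bar>D t\<bar>) <= l * M"
  using M lebesgue_integral_eq_integral[OF int'] by (simp add: pos_divide_le_eq)
 have "((\<lambda>t. \<bar>D t\<bar>) has_integral integral {a..b} (\<lambda>t. \<bar>D t\<bar>)) {a..b}"
  using integrable_on_lebesgue_on[OF int'] by (simp add: has_integral_integral)
 then have "((\<lambda>t. if t \<in> N then 0 else \<bar>D t\<bar>) has_integral integral {a..b} (\<lambda>t. \<bar>D t\<bar>)) {a..b}"
  by (rule has_integral_spike[OF neg, rotated]) auto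
 from ac_on_henstock_bound[OF ab ac neg good this] le show ?thesis by linarith
qed

lemma ac_on_affine:
 assumes g: "ac_on l h g" and al: "aa \<noteq> 0" and m: "\<And>x. x \<in> {s..t} ==> bt + aa * x \<in> {l..h}"
 shows "ac_on s t (\<lambda>x. g (bt + aa * x))" unfolding ac_on_pairs proof (intro allI impI)
 let ?fi = "\<lambda>x. bt + aa * x"
 fix e :: real assume e: "e > 0"
 from ac_on_indexed[OF g e, where 'i = "real \<times> real"] obtain d where d: "0 < d"
   "\<forall>(J :: (real \<times> real) set) p q. disjoint_intervals l h J p q -->
   (\<Sum>j\<in>J. q j - p j) < d --> (\<Sum>j\<in>J. dist (g (p j)) (g (q j))) < e" by (elim exE conjE)
 show "\<exists>d>0. \<forall>I. disjoint_intervals s t I fst snd --> (\<Sum>j\<in>I. snd j - fst j) < d -->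
    (\<Sum>j\<in>I. dist (g (?fi (fst j))) (g (?fi (snd j)))) < e"
 proof (intro exI[of _ "d / \<bar>aa\<bar>"] conjI allI impI)
  fix I :: "(real \<times> real) set"
  assume I: "disjoint_intervals s t I fst snd" "(\<Sum>j\<in>I. snd j - fst j) < d / \<bar>aa\<bar>"
  have lt: "s <= fst j" "fst j < snd j" "snd j <= t" if "j \<in> I" for j using I(1) that by (auto simp: disjoint_intervals_def)
  define p where "p j = (if 0 < aa then ?fi (fst j) else ?fi (snd j))" for j
  define q where "q j = (if 0 < aa then ?fi (snd j) else ?fi (fst j))" for j
  have inv: "(z - bt) / aa \<in> {fst j<..<snd j}" if "z \<in> {p j<..<q j}" for z j
   using that al by (auto simp: field_simps p_def q_def split: if_splits)
  have "(\<Sum>j\<in>I. dist (g (p j)) (g (q j))) < e"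
  proof (rule d(2)[rule_format, OF disjoint_intervalsI])
   fix j assume j: "j \<in> I"
   have "?fi (fst j) \<in> {l..h}" "?fi (snd j) \<in> {l..h}" by (rule m, use lt[OF j] in simp)+
   moreover have "p j < q j" using lt(2)[OF j] al by (simp add: p_def q_def)
   ultimately show "l <= p j \<and> p j < q j \<and> q j <= h" by (simp add: p_def q_def)
  next
   fix i j assume ij: "i \<in> I" "j \<in> I" "i \<noteq> j"
   have "{fst i<..<snd i} \<inter> {fst j<..<snd j} = {}"
    using I(1) ij unfolding disjoint_intervals_def by blast
   then show "{p i<..<q i} \<inter> {p j<..<q j} = {}" using inv by blast
  next
   have "(\<Sum>j\<in>I. q j - p j) = (\<Sum>j\<in>I. \<bar>aa\<bar> * (snd j - fst j))"
    by (intro sum.cong) (auto simp: p_def q_def algebra_simps)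
   also have "... = \<bar>aa\<bar> * (\<Sum>j\<in>I. snd j - fst j)" by (simp add: sum_distrib_left)
   also have "... < \<bar>aa\<bar> * (d / \<bar>aa\<bar>)" using I(2) al by (intro mult_strict_left_mono) auto
   finally show "(\<Sum>j\<in>I. q j - p j) < d" using al by simp
  qed (use I(1) in \<open>simp add: disjoint_intervals_def\<close>)
  moreover have "(\<Sum>j\<in>I. dist (g (p j)) (g (q j))) = (\<Sum>j\<in>I. dist (g (?fi (fst j))) (g (?fi (snd j))))"
   by (intro sum.cong) (auto simp: p_def q_def dist_commute)
  ultimately show "(\<Sum>j\<in>I. dist (g (?fi (fst j))) (g (?fi (snd j)))) < e" by simp
 qed (use d al in simp)
qed

text \<open>Intervals that contain \<open>m\<close> are cut there; the triangle inequality pays for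
  the cut.\<close>

lemma ac_on_join:
 assumes g: "ac_on s m g" "ac_on m t g" and "s <= m" "m <= t"
 shows "ac_on s t g" unfolding ac_on_pairs proof (intro allI impI)
 fix e :: real assume "e > 0"
 then have e: "e / 2 > 0" by simp
 from ac_on_indexed[OF g(1) e, where 'i = "real \<times> real"] obtain d1 where d1: "0 < d1"
   "\<forall>(J :: (real \<times> real) set) l r. disjoint_intervals s m J l r -->
   (\<Sum>j\<in>J. r j - l j) < d1 --> (\<Sum>j\<in>J. dist (g (l j)) (g (r j))) < e / 2" by (elim exE conjE)
 from ac_on_indexed[OF g(2) e, where 'i = "real \<times> real"] obtain d2 where d2: "0 < d2"
   "\<forall>(J :: (real \<times> real) set) l r. disjoint_intervals m t J l r -->
   (\<Sum>j\<in>J. r j - l j) < d2 --> (\<Sum>j\<in>J. dist (g (l j)) (g (r j))) < e / 2" by (elim exE conjE)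
 show "\<exists>d>0. \<forall>I. disjoint_intervals s t I fst snd --> (\<Sum>j\<in>I. snd j - fst j) < d -->
    (\<Sum>j\<in>I. dist (g (fst j)) (g (snd j))) < e" proof (intro exI[of _ "min d1 d2"] conjI allI impI)
  fix I :: "(real \<times> real) set"
  assume dI: "disjoint_intervals s t I fst snd" and sm: "(\<Sum>j\<in>I. snd j - fst j) < min d1 d2"
  then have I: "finite I" "\<And>j. j \<in> I ==> s <= fst j \<and> fst j < snd j \<and> snd j <= t" "(\<Sum>j\<in>I. snd j - fst j) < min d1 d2"
   by (auto simp: disjoint_intervals_def)
  have dj: "{fst i<..<snd i} \<inter> {fst j<..<snd j} = {}" if "i \<in> I" "j \<in> I" "i \<noteq> j" for i j
   using dI that unfolding disjoint_intervals_def by blast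
  define I1 where "I1 = {j \<in> I. fst j < m}"
  define I2 where "I2 = {j \<in> I. m < snd j}"
  have sub: "I1 \<subseteq> I" "I2 \<subseteq> I" by (auto simp: I1_def I2_def)
  have fin: "finite I1" "finite I2" using sub I finite_subset by blast+
  have small: "(\<Sum>j\<in>J. f j) < min d1 d2" if J: "J \<subseteq> I" "\<And>j. j \<in> J ==> f j <= snd j - fst j" for J f
  proof -
   have "(\<Sum>j\<in>J. f j) <= (\<Sum>j\<in>J. snd j - fst j)" by (rule sum_mono) (rule J(2))
   also have "... <= (\<Sum>j\<in>I. snd j - fst j)" by (rule sum_mono2[OF I(1) J(1)]) (use I(2) in fastforce)
   finally show ?thesis using I(3) by simp
  qed
  have 1: "(\<Sum>j\<in>I1. dist (g (fst j)) (g (min (snd j) m))) < e / 2"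
  proof (rule d1(2)[rule_format, OF disjoint_intervalsI[OF fin(1)]])
   show "s <= fst j \<and> fst j < min (snd j) m \<and> min (snd j) m <= m" if "j \<in> I1" for j
    using I(2)[of j] that by (auto simp: I1_def)
   show "{fst i<..<min (snd i) m} \<inter> {fst j<..<min (snd j) m} = {}" if "i \<in> I1" "j \<in> I1" "i \<noteq> j" for i j
    using dj[of i j] that sub(1) by fastforce
   have "(\<Sum>j\<in>I1. min (snd j) m - fst j) < min d1 d2" by (rule small[OF sub(1)]) simp
   then show "(\<Sum>j\<in>I1. min (snd j) m - fst j) < d1" by simp
  qed
  have 2: "(\<Sum>j\<in>I2. dist (g (max (fst j) m)) (g (snd j))) < e / 2"
  proof (rule d2(2)[rule_format, OF disjoint_intervalsI[OF fin(2)]])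
   show "m <= max (fst j) m \<and> max (fst j) m < snd j \<and> snd j <= t" if "j \<in> I2" for j
    using I(2)[of j] that by (auto simp: I2_def)
   show "{max (fst i) m<..<snd i} \<inter> {max (fst j) m<..<snd j} = {}" if "i \<in> I2" "j \<in> I2" "i \<noteq> j" for i j
    using dj[of i j] that sub(2) by fastforce
   have "(\<Sum>j\<in>I2. snd j - max (fst j) m) < min d1 d2" by (rule small[OF sub(2)]) simp
   then show "(\<Sum>j\<in>I2. snd j - max (fst j) m) < d2" by simp
  qed
  have "(\<Sum>j\<in>I. dist (g (fst j)) (g (snd j))) <= (\<Sum>j\<in>I. (if fst j < m then dist (g (fst j)) (g (min (snd j) m)) else 0) + (if m < snd j then dist (g (max (fst j) m)) (g (snd j)) else 0))"
  proof (rule sum_mono)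
   fix j assume "j \<in> I"
   then have "fst j < snd j" using I(2) by blast
   then show "dist (g (fst j)) (g (snd j)) <= (if fst j < m then dist (g (fst j)) (g (min (snd j) m)) else 0) + (if m < snd j then dist (g (max (fst j) m)) (g (snd j)) else 0)"
    using dist_triangle[of "g (fst j)" "g (snd j)" "g m"] by (auto simp: min_def max_def)
  qed
  also have "... = (\<Sum>j\<in>I. (if fst j < m then dist (g (fst j)) (g (min (snd j) m)) else 0)) + (\<Sum>j\<in>I. (if m < snd j then dist (g (max (fst j) m)) (g (snd j)) else 0))"
   by (simp add: sum.distrib)
  also have "(\<Sum>j\<in>I. (if fst j < m then dist (g (fst j)) (g (min (snd j) m)) else 0)) = (\<Sum>j\<in>I1. dist (g (fst j)) (g (min (snd j) m)))"
   by (rule sum.mono_neutral_cong_right) (use I(1) in \<open>auto simp: I1_def\<close>)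
  also have "(\<Sum>j\<in>I. (if m < snd j then dist (g (max (fst j) m)) (g (snd j)) else 0)) = (\<Sum>j\<in>I2. dist (g (max (fst j) m)) (g (snd j)))"
   by (rule sum.mono_neutral_cong_right) (use I(1) in \<open>auto simp: I2_def\<close>)
  finally show "(\<Sum>j\<in>I. dist (g (fst j)) (g (snd j))) < e" using 1 2 by linarith
 qed (use d1 d2 in simp)
qed

lemma ac_on_cong:
 assumes "ac_on a b g" "\<And>t. t \<in> {a..b} ==> g t = g' t"
 shows "ac_on a b g'" proof -
 have "(\<Sum>j\<in>I. dist (g (fst j)) (g (snd j))) = (\<Sum>j\<in>I. dist (g' (fst j)) (g' (snd j)))"
  if "disjoint_intervals a b I fst snd" for I
  using that assms(2) by (intro sum.cong) (fastforce simp: disjoint_intervals_def)+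
 then show ?thesis using assms(1) unfolding ac_on_pairs by (metis (no_types, lifting))
qed

text \<open>The integral is by definition a supremum over simple minorants. Facts that are additive
  only for measurable functions can thus be used for an arbitrary \<open>f\<close>, one minorant at
  a time.\<close>

lemma nn_integral_le_minorants:
 assumes "\<And>g. g \<in> borel_measurable M ==> g <= f ==> (\<integral>\<^sup>+x. g x \<partial>M) <= B"
 shows "(\<integral>\<^sup>+x. f x \<partial>M) <= B" unfolding nn_integral_def proof (rule SUP_least)
 fix g assume "g \<in> {g. simple_function M g \<and> g <= f}"
 then have g: "simple_function M g" "g <= f" by auto
 then show "integral\<^sup>S M g <= B"
  using assms[OF borel_measurable_simple_function[OF g(1)] g(2)] nn_integral_eq_simple_integral[OF g(1)] by simp
qed

text \<open>The pointwise hypothesis says that \<open>f\<close> vanishes outside the union of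
  \<open>A\<close> and \<open>B\<close>. Removing \<open>A\<close> from \<open>B\<close> avoids
  counting the overlap twice in the minorant.\<close>

lemma nn_integral_split_le:
 assumes A: "A \<in> sets M" and le: "\<And>x. f x <= f x * indicator A x + f x * indicator (B - A) x" and B: "B \<in> sets M"
 shows "(\<integral>\<^sup>+x. f x \<partial>M) <= (\<integral>\<^sup>+x. f x * indicator A x \<partial>M) + (\<integral>\<^sup>+x. f x * indicator B x \<partial>M)"
proof (rule nn_integral_le_minorants)
 fix g assume g: "g \<in> borel_measurable M" "g <= f"
 have "(\<integral>\<^sup>+x. g x \<partial>M) <= (\<integral>\<^sup>+x. g x * indicator A x + g x * indicator (B - A) x \<partial>M)"
 proof (rule nn_integral_mono)
  fix x
  have "g x = 0" if "x \<notin> A" "x \<notin> B" using le[of x] g(2) that by (auto simp: le_fun_def indicator_def dest: spec[of _ x])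
  then show "g x <= g x * indicator A x + g x * indicator (B - A) x" by (auto simp: indicator_def)
 qed
 also have "... = (\<integral>\<^sup>+x. g x * indicator A x \<partial>M) + (\<integral>\<^sup>+x. g x * indicator (B - A) x \<partial>M)"
  using g A B by (intro nn_integral_add) auto
 also have "... <= (\<integral>\<^sup>+x. f x * indicator A x \<partial>M) + (\<integral>\<^sup>+x. f x * indicator B x \<partial>M)"
  using g(2) by (intro add_mono nn_integral_mono) (auto simp: le_fun_def indicator_def)
 finally show "(\<integral>\<^sup>+x. g x \<partial>M) <= (\<integral>\<^sup>+x. f x * indicator A x \<partial>M) + (\<integral>\<^sup>+x. f x * indicator B x \<partial>M)" .
qed

lemma AE_lebesgue_affine:
 assumes "aa \<noteq> 0" "AE t in lebesgue. P t"
 shows "AE t in lebesgue. P (bt + aa * t :: real)" proof -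
 have m: "(\<lambda>x. bt + aa * x) \<in> lebesgue \<rightarrow>\<^sub>M lebesgue"
  using lebesgue_affine_measurable[of "\<lambda>_. aa" bt] assms(1) by simp
 have "AE t in density (distr lebesgue lebesgue (\<lambda>x. bt + aa * x)) (\<lambda>_. ennreal \<bar>aa\<bar>). P t"
  using assms(2) unfolding lebesgue_real_affine[OF assms(1), of bt, symmetric] .
 then have "AE t in distr lebesgue lebesgue (\<lambda>x. bt + aa * x). P t"
  using assms(1) by (subst (asm) AE_density) auto
 from AE_distrD[OF m this] show ?thesis .
qed

text \<open>A minorant of the left integrand is carried by the inverse affine map to a minorant of
  \<open>f\<close> with the same integral.\<close>

lemma nn_integral_affine_le:
 fixes f :: "real => ennreal"
 assumes al: "aa \<noteq> 0"
 shows "(\<integral>\<^sup>+t. ennreal \<bar>aa\<bar> * f (bt + aa * t) \<partial>lebesgue) <= (\<integral>\<^sup>+t. f t \<partial>lebesgue)"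
proof (rule nn_integral_le_minorants)
 fix g :: "real => ennreal" assume g: "g \<in> borel_measurable lebesgue" "g <= (\<lambda>t. ennreal \<bar>aa\<bar> * f (bt + aa * t))"
 define G where "G t = ennreal (1 / \<bar>aa\<bar>) * g (- bt / aa + (1 / aa) * t)" for t
 have m: "(\<lambda>x. - bt / aa + (1 / aa) * x) \<in> lebesgue \<rightarrow>\<^sub>M lebesgue"
  using lebesgue_affine_measurable[of "\<lambda>_. 1 / aa" "- bt / aa"] al by simp
 have Gm: "G \<in> borel_measurable lebesgue" unfolding G_def
  using measurable_compose[OF m g(1)] by (intro borel_measurable_times_ennreal borel_measurable_const)
 have eq: "G (bt + aa * t) = ennreal (1 / \<bar>aa\<bar>) * g t" for t using al by (simp add: G_def field_simps)
 have "(\<integral>\<^sup>+t. G t \<partial>lebesgue) = ennreal \<bar>aa\<bar> * (\<integral>\<^sup>+t. ennreal (1 / \<bar>aa\<bar>) * g t \<partial>lebesgue)"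
  by (subst nn_integral_real_affine_lebesgue[OF Gm al, of bt]) (simp add: eq)
 also have "... = (ennreal \<bar>aa\<bar> * ennreal (1 / \<bar>aa\<bar>)) * (\<integral>\<^sup>+t. g t \<partial>lebesgue)"
  using g(1) by (simp add: nn_integral_cmult mult.assoc)
 also have "ennreal \<bar>aa\<bar> * ennreal (1 / \<bar>aa\<bar>) = 1" using al by (simp flip: ennreal_mult)
 finally have "(\<integral>\<^sup>+t. g t \<partial>lebesgue) = (\<integral>\<^sup>+t. G t \<partial>lebesgue)" by simp
 also have "... <= (\<integral>\<^sup>+t. f t \<partial>lebesgue)" proof (rule nn_integral_mono)
  fix t
  have "g (- bt / aa + (1 / aa) * t) <= ennreal \<bar>aa\<bar> * f (bt + aa * (- bt / aa + (1 / aa) * t))"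
   using g(2) by (simp add: le_fun_def)
  also have "bt + aa * (- bt / aa + (1 / aa) * t) = t" using al by (simp add: field_simps)
  finally have "G t <= ennreal (1 / \<bar>aa\<bar>) * (ennreal \<bar>aa\<bar> * f t)" unfolding G_def by (intro mult_left_mono) auto
  also have "... = f t" using al by (simp flip: mult.assoc ennreal_mult)
  finally show "G t <= f t" .
 qed
 finally show "(\<integral>\<^sup>+t. g t \<partial>lebesgue) <= (\<integral>\<^sup>+t. f t \<partial>lebesgue)" .
qed

lemma AE_lebesgue_neq: "AE t in lebesgue. t \<noteq> (a :: real)"
 by (rule AE_completion) (rule AE_lborel_singleton)

section \<open>Admissible curves\<close>

locale sub_finsler =
 fixes \<A> :: "('a::{t2_space, second_countable_topology}, 'n::finite) chart set"
  and \<xi> :: "'a => real ^ 'k => ('a, 'n) tangent" and N :: "'a => real ^ 'k => real"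
 assumes sfm: "sub_finsler_manifold \<A> \<xi> N"
begin

lemma xi_linear: "Vector_Spaces.linear scaleR tscale (\<xi> q)" and xi_tangent: "\<xi> q w \<in> tangent_space \<A> q"
 and norm_N: "is_norm (N q)" using sfm by (auto simp: sub_finsler_manifold_def bundle_morphism_def)

lemma N_nonneg: "0 <= N q w" and N_scale: "N q (r *\<^sub>R w) = \<bar>r\<bar> * N q w"
 and N_triangle: "N q (w + w') <= N q w + N q w'" and N_zero_iff: "N q w = 0 \<longleftrightarrow> w = 0"
 using norm_N[of q] by (auto simp: is_norm_def)

lemma xi_scale: "\<xi> q (r *\<^sub>R w) = tscale r (\<xi> q w)" and xi_add: "\<xi> q (w + w') = \<xi> q w + \<xi> q w'"
proof -
 interpret L: Vector_Spaces.linear scaleR tscale "\<xi> q" by (rule xi_linear)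
 show "\<xi> q (r *\<^sub>R w) = tscale r (\<xi> q w)" "\<xi> q (w + w') = \<xi> q w + \<xi> q w'"
  by (rule L.scale, rule L.add)
qed

lemma xi_zero: "\<xi> q 0 = 0" using xi_scale[of q 0 0] by (simp add: tscale_def fun_eq_iff)

lemma xi_sum: "\<xi> q (\<Sum>i\<in>I. f i) = (\<Sum>i\<in>I. \<xi> q (f i))"
 by (induction I rule: infinite_finite_induct) (auto simp: xi_zero xi_add)

lemma xi_expand: "(\<Sum>i\<in>UNIV. tscale (u $ i) (generating_field \<xi> i q)) = \<xi> q u" proof -
 have "\<xi> q u = \<xi> q (\<Sum>i\<in>UNIV. u $ i *\<^sub>R axis i 1)"
  using basis_expansion[of u] by (simp add: scalar_mult_eq_scaleR)
 then show ?thesis by (simp add: xi_sum xi_scale generating_field_def)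
qed

abbreviation hn where "hn \<equiv> horizontal_norm \<xi> N"

lemma hn_le: "hn q (\<xi> q w) <= N q w"
 unfolding horizontal_norm_def using N_nonneg by (intro cInf_lower) (auto intro!: bdd_belowI[of _ 0])

lemma hn_greatest: "(\<And>w'. \<xi> q w' = \<xi> q w ==> B <= N q w') ==> B <= hn q (\<xi> q w)"
 unfolding horizontal_norm_def by (intro cInf_greatest) auto

lemma hn_nonneg: "0 <= hn q (\<xi> q w)" by (rule hn_greatest) (rule N_nonneg)

lemma hn_scale_le:
 assumes "r \<noteq> 0"
 shows "hn q (\<xi> q (r *\<^sub>R w)) <= \<bar>r\<bar> * hn q (\<xi> q w)" proof -
 have "hn q (\<xi> q (r *\<^sub>R w)) / \<bar>r\<bar> <= hn q (\<xi> q w)" proof (rule hn_greatest)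
  fix w' assume "\<xi> q w' = \<xi> q w"
  then have "\<xi> q (r *\<^sub>R w) = \<xi> q (r *\<^sub>R w')" by (simp add: xi_scale)
  then have "hn q (\<xi> q (r *\<^sub>R w)) <= \<bar>r\<bar> * N q w'" using hn_le[of q "r *\<^sub>R w'"] by (simp add: N_scale)
  then show "hn q (\<xi> q (r *\<^sub>R w)) / \<bar>r\<bar> <= N q w'" using assms by (simp add: pos_divide_le_eq mult.commute)
 qed
 then show ?thesis using assms by (simp add: pos_divide_le_eq mult.commute)
qed

definition vel_at :: "(real => 'a) => ('a, 'n) tangent => real => bool"
 where "vel_at gm v t \<longleftrightarrow> v \<in> tangent_space \<A> (gm t) \<and>
  (\<forall>c\<in>charts_at \<A> (gm t). ((snd c \<circ> gm) has_vector_derivative v c) (at t))"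

lemma vel_unique: "vel_at gm v t ==> vel_at gm v' t ==> v = v'" proof (rule ext)
 fix c assume v: "vel_at gm v t" "vel_at gm v' t"
 show "v c = v' c" proof (cases "c \<in> charts_at \<A> (gm t)")
  case True
  then show ?thesis using v vector_derivative_unique_at unfolding vel_at_def by blast
 next
  case False
  then have "v c = 0" "v' c = 0" using v unfolding vel_at_def tangent_space_def by blast+
  then show ?thesis by simp
 qed
qed

lemma the_vel: "vel_at gm v t ==> (THE v. vel_at gm v t) = v" using vel_unique by blast

lemma has_velocity_vel_at:
 assumes "0 < t" "t < 1"
 shows "has_velocity \<A> gm v t \<longleftrightarrow> vel_at gm v t"
 unfolding has_velocity_def vel_at_def using assms at_within_Icc_at[of 0 t 1] by simp

lemma vel_at_cong:
 assumes "a < t" "t < b" "\<And>s. s \<in> {a..b} ==> gm s = gm' s" "vel_at gm v t"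
 shows "vel_at gm' v t" proof -
 have e: "gm t = gm' t" using assms by auto
 have "((snd c \<circ> gm') has_vector_derivative v c) (at t)" if "c \<in> charts_at \<A> (gm t)" for c proof -
  have "((snd c \<circ> gm) has_vector_derivative v c) (at t)" using assms(4) that by (simp add: vel_at_def)
  then show ?thesis
   by (rule has_vector_derivative_transform_within_open[of _ _ _ "{a<..<b}"]) (use assms in auto)
 qed
 then show ?thesis using assms(4) e by (simp add: vel_at_def)
qed

text \<open>The derivatives are two-sided here; at the end points this makes no difference up to null sets.\<close>

definition adm :: "real => real => (real => 'a) => bool"
 where "adm a b gm \<longleftrightarrow> continuous_on {a..b} gm \<and>
  (\<forall>c\<in>charts \<A>. \<forall>s t. a <= s \<and> s <= t \<and> t <= b \<and> gm ` {s..t} \<subseteq> fst c --> ac_on s t (snd c \<circ> gm)) \<and>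
  (\<exists>u :: real => real ^ 'k. u \<in> borel_measurable lebesgue \<and>
    integrable lebesgue (\<lambda>t. indicator {a..b} t *\<^sub>R (norm (u t))\<^sup>2) \<and>
    (AE t in lebesgue. t \<in> {a..b} --> vel_at gm (\<xi> (gm t) (u t)) t))"

definition spd :: "(real => 'a) => real => ennreal"
 where "spd gm t = ennreal (hn (gm t) (THE v. vel_at gm v t))"

definition len :: "real => real => (real => 'a) => ennreal"
 where "len a b gm = (\<integral>\<^sup>+t. spd gm t * indicator {a..b} t \<partial>lebesgue)"

lemma AE_interior: "AE t in lebesgue. t \<in> {a..b} --> a < t \<and> t < (b :: real)"
 using AE_lebesgue_neq[of a] AE_lebesgue_neq[of b] by eventually_elim auto

lemma admissible_iff: "admissible \<A> \<xi> gm \<longleftrightarrow> adm 0 1 gm" proof -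
 have AEiff: "(AE t in lebesgue_on {0..1}. has_velocity \<A> gm (\<Sum>i\<in>UNIV. tscale (u t $ i) (generating_field \<xi> i (gm t))) t)
   \<longleftrightarrow> (AE t in lebesgue. t \<in> {0..1} --> vel_at gm (\<xi> (gm t) (u t)) t)" (is "?l \<longleftrightarrow> ?r") for u proof -
  have "?l \<longleftrightarrow> (AE t in lebesgue. t \<in> {0..1} --> has_velocity \<A> gm (\<xi> (gm t) (u t)) t)"
   unfolding xi_expand by (rule AE_restrict_space_iff) simp
  also have "... \<longleftrightarrow> ?r" proof
   assume "AE t in lebesgue. t \<in> {0..1} --> has_velocity \<A> gm (\<xi> (gm t) (u t)) t"
   with AE_interior[of 0 1] show ?r by eventually_elim (auto simp: has_velocity_vel_at)
  next
   assume ?r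
   with AE_interior[of 0 1] show "AE t in lebesgue. t \<in> {0..1} --> has_velocity \<A> gm (\<xi> (gm t) (u t)) t"
    by eventually_elim (auto simp: has_velocity_vel_at)
  qed
  finally show ?thesis .
 qed
 show ?thesis proof
  assume a: "admissible \<A> \<xi> gm"
  then obtain u where u: "u \<in> borel_measurable (lebesgue_on {0..1})" "integrable (lebesgue_on {0..1}) (\<lambda>t. (norm (u t))\<^sup>2)"
   "AE t in lebesgue_on {0..1}. has_velocity \<A> gm (\<Sum>i\<in>UNIV. tscale (u t $ i) (generating_field \<xi> i (gm t))) t"
   by (auto simp: admissible_def)
  \<comment> \<open>Extension by zero gives a control that is measurable on the whole line.\<close>
  let ?u = "\<lambda>t. indicator {0..1} t *\<^sub>R u t"
  have "?u \<in> borel_measurable lebesgue"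
   using u(1) by (subst (asm) borel_measurable_restrict_space_iff) auto
  moreover have "integrable lebesgue (\<lambda>t. indicator {0..1} t *\<^sub>R (norm (?u t))\<^sup>2)" proof -
   have "integrable lebesgue (\<lambda>t. indicator {0..1} t *\<^sub>R (norm (u t))\<^sup>2)"
    using u(2) by (subst (asm) integrable_restrict_space) auto
   moreover have "(\<lambda>t. indicator {0..1} t *\<^sub>R (norm (?u t))\<^sup>2) = (\<lambda>t. indicator {0..1} t *\<^sub>R (norm (u t))\<^sup>2)"
    by (auto simp: indicator_def)
   ultimately show ?thesis by simp
  qed
  moreover have "AE t in lebesgue. t \<in> {0..1} --> vel_at gm (\<xi> (gm t) (?u t)) t"
   using u(3)[unfolded AEiff] by eventually_elim auto
  ultimately show "adm 0 1 gm" using a unfolding adm_def admissible_def by blast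
 next
  assume a: "adm 0 1 gm"
  then obtain u where u: "u \<in> borel_measurable lebesgue" "integrable lebesgue (\<lambda>t. indicator {0..1} t *\<^sub>R (norm (u t))\<^sup>2)"
   "AE t in lebesgue. t \<in> {0..1} --> vel_at gm (\<xi> (gm t) (u t)) t" by (auto simp: adm_def)
  have "u \<in> borel_measurable (lebesgue_on {0..1})" using u(1) by (rule measurable_restrict_space1)
  moreover have "integrable (lebesgue_on {0..1}) (\<lambda>t. (norm (u t))\<^sup>2)"
   using u(2) by (subst integrable_restrict_space) auto
  ultimately show "admissible \<A> \<xi> gm" using a u(3)[folded AEiff] unfolding adm_def admissible_def by blast
 qed
qed

lemma curve_length_eq: "curve_length \<A> \<xi> N gm = len 0 1 gm" proof -
 have "curve_length \<A> \<xi> N gm = (\<integral>\<^sup>+t. ennreal (hn (gm t) (velocity \<A> gm t)) * indicator {0..1} t \<partial>lebesgue)"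
  unfolding curve_length_def by (rule nn_integral_restrict_space) simp
 also have "... = len 0 1 gm" unfolding len_def proof (rule nn_integral_cong_AE)
  show "AE t in lebesgue. ennreal (hn (gm t) (velocity \<A> gm t)) * indicator {0..1} t = spd gm t * indicator {0..1} t"
   using AE_interior[of 0 1]
   by eventually_elim (auto simp: spd_def velocity_def has_velocity_vel_at indicator_def)
 qed
 finally show ?thesis .
qed

lemma adm_cong:
 assumes a: "adm a b gm" and e: "\<And>t. t \<in> {a..b} ==> gm t = gm' t"
 shows "adm a b gm'" "len a b gm' = len a b gm" proof -
 from a obtain u where u: "u \<in> borel_measurable lebesgue" "integrable lebesgue (\<lambda>t. indicator {a..b} t *\<^sub>R (norm (u t))\<^sup>2)"
   "AE t in lebesgue. t \<in> {a..b} --> vel_at gm (\<xi> (gm t) (u t)) t" by (auto simp: adm_def)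
 have v: "AE t in lebesgue. t \<in> {a..b} --> vel_at gm' (\<xi> (gm' t) (u t)) t"
  using u(3) AE_interior[of a b] proof eventually_elim
  case (elim t)
  then show ?case using vel_at_cong[of a t b gm gm'] e by (metis atLeastAtMost_iff)
 qed
 have "continuous_on {a..b} gm" using a by (simp add: adm_def)
 then have "continuous_on {a..b} gm'" by (rule continuous_on_eq) (rule e)
 moreover have "ac_on s t (snd c \<circ> gm')" if "c \<in> charts \<A>" "a <= s \<and> s <= t \<and> t <= b \<and> gm' ` {s..t} \<subseteq> fst c" for c s t
 proof -
  have "gm ` {s..t} \<subseteq> fst c" using that e by (auto simp: image_subset_iff)
  then have "ac_on s t (snd c \<circ> gm)" using a that unfolding adm_def by blast
  then show ?thesis by (rule ac_on_cong) (use that e in auto)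
 qed
 ultimately show "adm a b gm'" using u v unfolding adm_def by blast
 show "len a b gm' = len a b gm" unfolding len_def proof (rule nn_integral_cong_AE)
  show "AE t in lebesgue. spd gm' t * indicator {a..b} t = spd gm t * indicator {a..b} t"
   using AE_interior[of a b] proof eventually_elim
   case (elim t)
   have "vel_at gm' v t \<longleftrightarrow> vel_at gm v t" if "t \<in> {a..b}" for v
    using vel_at_cong[of a t b gm gm' v] vel_at_cong[of a t b gm' gm v] e elim that by auto
   then show ?case using e[of t] by (auto simp: spd_def indicator_def)
  qed
 qed
qed

lemma vel_at_affine:
 assumes v: "vel_at gm (\<xi> (gm (bt + aa * t)) u) (bt + aa * t)"
 shows "vel_at (\<lambda>t. gm (bt + aa * t)) (\<xi> (gm (bt + aa * t)) (aa *\<^sub>R u)) t" unfolding vel_at_def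
proof (intro conjI ballI xi_tangent)
 fix c assume "c \<in> charts_at \<A> (gm (bt + aa * t))"
 then have "((snd c \<circ> gm) has_vector_derivative \<xi> (gm (bt + aa * t)) u c) (at (bt + aa * t))"
  using v unfolding vel_at_def by blast
 moreover have "((\<lambda>t. bt + aa * t) has_vector_derivative aa) (at t)"
  by (auto intro!: derivative_eq_intros simp flip: has_real_derivative_iff_has_vector_derivative)
 ultimately have "((snd c \<circ> gm) \<circ> (\<lambda>t. bt + aa * t) has_vector_derivative aa *\<^sub>R \<xi> (gm (bt + aa * t)) u c) (at t)"
  by (intro vector_diff_chain_at)
 then show "((snd c \<circ> (\<lambda>t. gm (bt + aa * t))) has_vector_derivative \<xi> (gm (bt + aa * t)) (aa *\<^sub>R u) c) (at t)"
  by (simp add: xi_scale tscale_def o_def)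
qed

text \<open>Covers restriction, translation, rescaling and reversal at once. An inequality between
  the lengths suffices, since it can be applied to curves in either direction.\<close>

lemma adm_affine:
 assumes a: "adm a b gm" and al: "aa \<noteq> 0" and m: "\<And>t. t \<in> {a'..b'} ==> bt + aa * t \<in> {a..b}"
 shows "adm a' b' (\<lambda>t. gm (bt + aa * t))" "len a' b' (\<lambda>t. gm (bt + aa * t)) <= len a b gm" proof -
 let ?fi = "\<lambda>t. bt + aa * t"
 from a obtain u where u: "u \<in> borel_measurable lebesgue" "integrable lebesgue (\<lambda>t. indicator {a..b} t *\<^sub>R (norm (u t))\<^sup>2)"
   "AE t in lebesgue. t \<in> {a..b} --> vel_at gm (\<xi> (gm t) (u t)) t" by (auto simp: adm_def)
 have ph: "?fi \<in> lebesgue \<rightarrow>\<^sub>M lebesgue" using lebesgue_affine_measurable[of "\<lambda>_. aa" bt] al by simp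
 have AE: "AE t in lebesgue. t \<in> {a'..b'} --> vel_at gm (\<xi> (gm (?fi t)) (u (?fi t))) (?fi t)"
  using AE_lebesgue_affine[OF al u(3), of bt] by eventually_elim (use m in auto)
 show "adm a' b' (\<lambda>t. gm (?fi t))" unfolding adm_def proof (intro conjI exI ballI allI impI)
  have "continuous_on {a..b} gm" using a by (simp add: adm_def)
  then show "continuous_on {a'..b'} (\<lambda>t. gm (?fi t))"
   by (rule continuous_on_compose2) (use m in \<open>auto intro!: continuous_intros\<close>)
 next
  fix c s t assume c: "c \<in> charts \<A>" and st: "a' <= s \<and> s <= t \<and> t <= b' \<and> (\<lambda>t. gm (?fi t)) ` {s..t} \<subseteq> fst c"
  let ?l = "min (?fi s) (?fi t)" and ?h = "max (?fi s) (?fi t)"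
  have im: "?fi ` {s..t} = {?l..?h}" using st al image_affinity_atLeastAtMost[of aa bt s t]
   by (auto simp: add.commute min_def max_def mult_le_cancel_left)
  have "?fi s \<in> {a..b}" "?fi t \<in> {a..b}" by (rule m, use st in simp)+
  then have "a <= ?l \<and> ?l <= ?h \<and> ?h <= b" by auto
  moreover have "gm ` {?l..?h} \<subseteq> fst c" using st unfolding im[symmetric] by auto
  ultimately have "ac_on ?l ?h (snd c \<circ> gm)" using a c unfolding adm_def by blast
  then have "ac_on s t (\<lambda>x. (snd c \<circ> gm) (?fi x))" by (rule ac_on_affine[OF _ al]) (use im in blast)
  then show "ac_on s t (snd c \<circ> (\<lambda>t. gm (?fi t)))" by (simp add: o_def)
 next
  show um: "(\<lambda>t. aa *\<^sub>R u (?fi t)) \<in> borel_measurable lebesgue"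
   using measurable_compose[OF ph u(1)] by (intro borel_measurable_scaleR) auto
  obtain I where "has_bochner_integral lebesgue (\<lambda>t. indicator {a..b} t *\<^sub>R (norm (u t))\<^sup>2) I"
   using u(2) by (auto simp: integrable.simps)
  then have "has_bochner_integral lebesgue (\<lambda>t. indicator {a..b} (?fi t) *\<^sub>R (norm (u (?fi t)))\<^sup>2) (I /\<^sub>R \<bar>aa\<bar>)"
   by (rule has_bochner_integral_lebesgue_real_affine_iff[OF al, THEN iffD1])
  then have i: "integrable lebesgue (\<lambda>t. indicator {a..b} (?fi t) *\<^sub>R (norm (u (?fi t)))\<^sup>2)"
   unfolding integrable.simps by blast
  show "integrable lebesgue (\<lambda>t. indicator {a'..b'} t *\<^sub>R (norm (aa *\<^sub>R u (?fi t)))\<^sup>2)"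
  proof (rule Bochner_Integration.integrable_bound[OF integrable_mult_right[OF i, of "aa\<^sup>2"]])
   show "(\<lambda>t. indicator {a'..b'} t *\<^sub>R (norm (aa *\<^sub>R u (?fi t)))\<^sup>2) \<in> borel_measurable lebesgue"
    by (intro borel_measurable_scaleR borel_measurable_power borel_measurable_indicator
      measurable_compose[OF um borel_measurable_norm]) auto
   show "AE t in lebesgue. norm (indicator {a'..b'} t *\<^sub>R (norm (aa *\<^sub>R u (?fi t)))\<^sup>2)
     <= norm (aa\<^sup>2 * (indicator {a..b} (?fi t) *\<^sub>R (norm (u (?fi t)))\<^sup>2))"
    by (rule AE_I2) (use m in \<open>auto simp: indicator_def power_mult_distrib\<close>)
  qed
  show "AE t in lebesgue. t \<in> {a'..b'} --> vel_at (\<lambda>t. gm (?fi t)) (\<xi> (gm (?fi t)) (aa *\<^sub>R u (?fi t))) t"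
   using AE by eventually_elim (blast intro: vel_at_affine)
 qed
 have "len a' b' (\<lambda>t. gm (?fi t)) <= (\<integral>\<^sup>+t. ennreal \<bar>aa\<bar> * (spd gm (?fi t) * indicator {a..b} (?fi t)) \<partial>lebesgue)"
  unfolding len_def proof (rule nn_integral_mono_AE)
  show "AE t in lebesgue. spd (\<lambda>t. gm (?fi t)) t * indicator {a'..b'} t <= ennreal \<bar>aa\<bar> * (spd gm (?fi t) * indicator {a..b} (?fi t))"
   using AE proof eventually_elim
   case (elim t)
   show ?case proof (cases "t \<in> {a'..b'}")
    case True
    with elim have v: "vel_at gm (\<xi> (gm (?fi t)) (u (?fi t))) (?fi t)" by blast
    have "spd (\<lambda>t. gm (?fi t)) t <= ennreal (\<bar>aa\<bar> * hn (gm (?fi t)) (\<xi> (gm (?fi t)) (u (?fi t))))"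
     unfolding spd_def the_vel[OF vel_at_affine[OF v]] by (intro ennreal_leI hn_scale_le al)
    also have "... = ennreal \<bar>aa\<bar> * spd gm (?fi t)"
     unfolding spd_def the_vel[OF v] by (simp add: ennreal_mult hn_nonneg)
    finally show ?thesis using True m[OF True] by simp
   qed simp
  qed
 qed
 also have "... <= len a b gm" unfolding len_def by (rule nn_integral_affine_le[OF al])
 finally show "len a' b' (\<lambda>t. gm (?fi t)) <= len a b gm" .
qed

lemma adm_subset:
 assumes "adm a b gm" "a <= a'" "b' <= b"
 shows "adm a' b' gm" "len a' b' gm <= len a b gm"
 using adm_affine[OF assms(1), of 1 a' b' 0] assms by auto

text \<open>The concatenation of the controls works up to the null set containing the common end
  point; lengths are only subadditive here, in the sense of lower integrals.\<close>

lemma adm_glue: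
 assumes a1: "adm a m gm" and a2: "adm m b gm" and le: "a <= m" "m <= b"
 shows "adm a b gm" "len a b gm <= len a m gm + len m b gm" proof -
 from a1 obtain u where u: "u \<in> borel_measurable lebesgue" "integrable lebesgue (\<lambda>t. indicator {a..m} t *\<^sub>R (norm (u t))\<^sup>2)"
   "AE t in lebesgue. t \<in> {a..m} --> vel_at gm (\<xi> (gm t) (u t)) t" by (auto simp: adm_def)
 from a2 obtain u' where u': "u' \<in> borel_measurable lebesgue" "integrable lebesgue (\<lambda>t. indicator {m..b} t *\<^sub>R (norm (u' t))\<^sup>2)"
   "AE t in lebesgue. t \<in> {m..b} --> vel_at gm (\<xi> (gm t) (u' t)) t" by (auto simp: adm_def)
 let ?u = "\<lambda>t. if t <= m then u t else u' t"
 have um: "?u \<in> borel_measurable lebesgue" by (intro measurable_If u(1) u'(1)) auto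
 show "adm a b gm" unfolding adm_def proof (intro conjI exI ballI allI impI)
  have "continuous_on ({a..m} \<union> {m..b}) gm" using a1 a2 by (intro continuous_on_closed_Un) (auto simp: adm_def)
  then show "continuous_on {a..b} gm" using le by (simp add: ivl_disj_un_two_touch)
 next
  fix c s t assume c: "c \<in> charts \<A>" and st: "a <= s \<and> s <= t \<and> t <= b \<and> gm ` {s..t} \<subseteq> fst c"
  have 1: "ac_on s' t' (snd c \<circ> gm)" if "s <= s'" "s' <= t'" "t' <= t" "t' <= m \<or> m <= s'" for s' t'
  proof -
   have "gm ` {s'..t'} \<subseteq> fst c" using st that by auto
   then show ?thesis using that st a1 a2 c unfolding adm_def by (meson order_trans)
  qed
  show "ac_on s t (snd c \<circ> gm)" proof (cases "t <= m \<or> m <= s")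
   case True then show ?thesis using 1[of s t] st by auto
  next
   case False
   then have "s <= m" "m <= t" by auto
   then show ?thesis using ac_on_join[OF 1[of s m] 1[of m t]] by simp
  qed
 next
  show "?u \<in> borel_measurable lebesgue" by (rule um)
  show "integrable lebesgue (\<lambda>t. indicator {a..b} t *\<^sub>R (norm (?u t))\<^sup>2)"
  proof (rule Bochner_Integration.integrable_bound[OF Bochner_Integration.integrable_add[OF u(2) u'(2)]])
   show "(\<lambda>t. indicator {a..b} t *\<^sub>R (norm (?u t))\<^sup>2) \<in> borel_measurable lebesgue"
    by (intro borel_measurable_scaleR borel_measurable_power borel_measurable_indicator
      measurable_compose[OF um borel_measurable_norm]) auto
   show "AE t in lebesgue. norm (indicator {a..b} t *\<^sub>R (norm (?u t))\<^sup>2)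
     <= norm (indicator {a..m} t *\<^sub>R (norm (u t))\<^sup>2 + indicator {m..b} t *\<^sub>R (norm (u' t))\<^sup>2)"
    by (rule AE_I2) (auto simp: indicator_def)
  qed
  show "AE t in lebesgue. t \<in> {a..b} --> vel_at gm (\<xi> (gm t) (?u t)) t"
   using u(3) u'(3) by eventually_elim auto
 qed
 have "(\<integral>\<^sup>+t. spd gm t * indicator {a..b} t \<partial>lebesgue) \<le>
   (\<integral>\<^sup>+t. (spd gm t * indicator {a..b} t) * indicator {a..m} t \<partial>lebesgue) + (\<integral>\<^sup>+t. (spd gm t * indicator {a..b} t) * indicator {m..b} t \<partial>lebesgue)"
  by (rule nn_integral_split_le) (auto simp: indicator_def)
 also have "... <= len a m gm + len m b gm"
  unfolding len_def by (intro add_mono nn_integral_mono) (auto simp: indicator_def)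
 finally show "len a b gm <= len a m gm + len m b gm" unfolding len_def .
qed

text \<open>The distance before conversion to a real number, which would send an infinite value to
  0. All estimates use this version until finiteness is known.\<close>

definition dE :: "'a => 'a => ennreal"
 where "dE p q = (INF gm\<in>{gm. admissible \<A> \<xi> gm \<and> gm 0 = p \<and> gm 1 = q}. curve_length \<A> \<xi> N gm)"

lemma sf_dist_eq: "sf_dist \<A> \<xi> N p q = enn2real (dE p q)" by (simp add: sf_dist_def dE_def)

lemma dE_le:
 assumes "adm a b gm" "a < b"
 shows "dE (gm a) (gm b) <= len a b gm" proof -
 have m: "a + (b - a) * t \<in> {a..b}" if "t \<in> {0..1}" for t proof -
  have "(b - a) * t <= (b - a) * 1" using that assms(2) by (intro mult_left_mono) auto
  then have "(b - a) * t <= b - a" "0 <= (b - a) * t" using that assms(2) by simp_all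
  then show ?thesis by (simp only: atLeastAtMost_iff) linarith
 qed
 note af = adm_affine[OF assms(1), of "b - a" 0 1 a, OF _ m]
 have "dE (gm a) (gm b) <= len 0 1 (\<lambda>t. gm (a + (b - a) * t))"
  unfolding dE_def curve_length_eq[symmetric]
  by (rule INF_lower) (use af(1) assms(2) in \<open>simp add: admissible_iff\<close>)
 also have "... <= len a b gm" using af(2) assms(2) by simp
 finally show ?thesis .
qed

lemma dE_lessE:
 assumes "dE p q < l"
 obtains gm where "adm 0 1 gm" "gm 0 = p" "gm 1 = q" "len 0 1 gm < l"
 using assms unfolding dE_def INF_less_iff by (auto simp: admissible_iff curve_length_eq)

lemma vel_at_const: "vel_at (\<lambda>_. p) (\<xi> p 0) t"
 unfolding vel_at_def using xi_tangent[of p 0] by (auto simp: xi_zero o_def)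

lemma dE_refl: "dE p p = 0" proof -
 have "adm 0 1 (\<lambda>_. p)" unfolding adm_def proof (intro conjI exI ballI allI impI)
  fix c s t show "ac_on s t (snd c \<circ> (\<lambda>_. p))" by (rule ac_on_lipschitz[of _ _ _ 0]) auto
  show "(\<lambda>_. 0 :: real ^ 'k) \<in> borel_measurable lebesgue" by simp
 qed (auto simp: vel_at_const)
 then have "dE p p <= len 0 1 (\<lambda>_. p)" by (rule dE_le) simp
 also have "hn p (\<xi> p 0) = 0" using hn_le[of p 0] hn_nonneg[of p 0] N_zero_iff[of p 0] by simp
 then have "len 0 1 (\<lambda>_. p) = 0" unfolding len_def spd_def the_vel[OF vel_at_const] by simp
 finally show ?thesis by simp
qed

lemma dE_sym: "dE p q = dE q p" proof (rule antisym)
 have "dE p q <= dE q p" for p q proof (rule dense_ge)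
  fix l assume "dE q p < l"
  then obtain gm where g: "adm 0 1 gm" "gm 0 = q" "gm 1 = p" "len 0 1 gm < l" by (rule dE_lessE)
  note af = adm_affine[OF g(1), of "-1" 0 1 1]
  have "dE p q <= len 0 1 (\<lambda>t. gm (1 + - 1 * t))" using dE_le[OF af(1)] g by simp
  also have "... <= len 0 1 gm" by (rule af(2)) auto
  finally show "dE p q <= l" using g(4) by simp
 qed
 then show "dE p q <= dE q p" "dE q p <= dE p q" by blast+
qed

lemma dE_triangle: "dE p r <= dE p q + dE q r" proof (rule ennreal_le_epsilon)
 fix e :: real assume fin: "dE p q + dE q r < top" and e: "0 < e"
 have "dE p q < dE p q + ennreal (e / 2)" "dE q r < dE q r + ennreal (e / 2)"
  using fin e by (auto simp: ennreal_add_left_cancel_less[of _ 0, simplified])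
 from dE_lessE[OF this(1)] dE_lessE[OF this(2)] obtain f g where
  f: "adm 0 1 f" "f 0 = p" "f 1 = q" "len 0 1 f < dE p q + ennreal (e / 2)" and
  g: "adm 0 1 g" "g 0 = q" "g 1 = r" "len 0 1 g < dE q r + ennreal (e / 2)" by metis
 \<comment> \<open>The concatenation lives on the interval from 0 to 2; \<open>dE_le\<close> accepts
   curves on any interval.\<close>
 define h where "h t = (if t <= 1 then f t else g (-1 + 1 * t))" for t
 have h1: "adm 0 1 h" "len 0 1 h = len 0 1 f" by (rule adm_cong[OF f(1)], simp add: h_def)+
 note ga = adm_affine[OF g(1), of 1 1 2 "-1"]
 have gh: "g (- 1 + 1 * t) = h t" if "t \<in> {1..2}" for t using that f(3) g(2) by (cases "t = 1") (auto simp: h_def)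
 have ga1: "adm 1 2 (\<lambda>t. g (- 1 + 1 * t))" "len 1 2 (\<lambda>t. g (- 1 + 1 * t)) <= len 0 1 g" using ga by auto
 have h2: "adm 1 2 h" "len 1 2 h = len 1 2 (\<lambda>t. g (- 1 + 1 * t))"
  by (rule adm_cong[OF ga1(1)], erule gh)+
 have h02: "adm 0 2 h" "len 0 2 h <= len 0 1 h + len 1 2 h" by (rule adm_glue[OF h1(1) h2(1)]; simp)+
 have "dE p r = dE (h 0) (h 2)" using f g by (simp add: h_def)
 also have "... <= len 0 2 h" using h02(1) by (rule dE_le) simp
 also have "... <= len 0 1 f + len 0 1 g" using h02(2) h1(2) h2(2) ga1(2) by (simp add: order_trans[OF _ add_left_mono])
 also have "... <= (dE p q + ennreal (e / 2)) + (dE q r + ennreal (e / 2))" using f g by (intro add_mono) auto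
 also have "... = dE p q + dE q r + (ennreal (e / 2) + ennreal (e / 2))" by (simp add: add_ac)
 also have "ennreal (e / 2) + ennreal (e / 2) = ennreal e" using e by (simp flip: ennreal_plus)
 finally show "dE p r <= dE p q + dE q r + ennreal e" .
qed

end

section \<open>Frames of iterated brackets\<close>

text \<open>Right-nested brackets suffice: by the Jacobi identity brackets of nested brackets give
  nothing new, see \<open>hspan_lb_word\<close>.\<close>

definition wspan :: "('k => 'e::euclidean_space => 'e) => nat => 'e => 'e set"
 where "wspan X m x = span {vf X u x | u. u \<noteq> [] \<and> length u <= m}"

lemma wspan_mono: "m <= k ==> wspan X m x \<subseteq> wspan X k x" unfolding wspan_def by (intro span_mono) auto

lemma subspace_wspan: "subspace (wspan X m x)" by (simp add: wspan_def)

lemma vf_in_wspan: "u \<noteq> [] ==> length u <= m ==> vf X u x \<in> wspan X m x"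
 unfolding wspan_def by (intro span_base) auto

text \<open>The module over smooth functions generated by the nested brackets of length at most
  \<open>m\<close>. The last rule makes only values on \<open>Om\<close> matter, as needed for
  identities that hold on \<open>Om\<close> alone.\<close>

inductive hspan :: "'e::euclidean_space set => ('k => 'e => 'e) => nat => ('e => 'e) => bool" for Om X
 where word: "u \<noteq> [] ==> length u <= m ==> hspan Om X m (vf X u)" | zero: "hspan Om X m (\<lambda>x. 0)"
 | add: "hspan Om X m f ==> hspan Om X m g ==> hspan Om X m (\<lambda>x. f x + g x)"
 | scale: "hspan Om X m f ==> smooth_on Om a ==> hspan Om X m (\<lambda>x. a x *\<^sub>R f x)"
 | cong: "hspan Om X m f ==> (\<And>x. x \<in> Om ==> f x = g x) ==> hspan Om X m g"

lemma hspan_mono: "hspan Om X m f ==> m <= k ==> hspan Om X k f" proof (induction rule: hspan.induct)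
 case (cong m f g)
 then show ?case by (blast intro: hspan.cong)
qed (auto intro: hspan.word hspan.zero hspan.add hspan.scale)

lemma hspan_in_wspan: "hspan Om X m f ==> x \<in> Om ==> f x \<in> wspan X m x" by (induction rule: hspan.induct)
   (auto simp: vf_in_wspan subspace_0[OF subspace_wspan] intro: subspace_add[OF subspace_wspan] subspace_scale[OF subspace_wspan])

lemma hspan_sum: "(\<And>i. i \<in> I ==> hspan Om X m (f i)) ==> hspan Om X m (\<lambda>x. \<Sum>i\<in>I. f i x)"
 by (induction I rule: infinite_finite_induct) (auto intro: hspan.zero hspan.add)

context
 fixes Om :: "'e::euclidean_space set" and X :: "'k => 'e => 'e"
 assumes op: "open Om" and smX: "\<And>i. smooth_on Om (X i)"
begin

lemma hspan_smooth: "hspan Om X m f ==> smooth_on Om f" proof (induction rule: hspan.induct)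
 case (cong m f g)
 then show ?case using smooth_on_cong[OF op] by blast
qed (use op smX in auto)

lemma lb_add_right: "smooth_on Om f ==> smooth_on Om g ==> smooth_on Om Z ==> x \<in> Om ==>
  lb Z (\<lambda>x. f x + g x) x = lb Z f x + lb Z g x"
 unfolding lb_def der_add[of Om f g x] der_field_add[of Om Z x f g] by simp

lemma lb_scale_right: "smooth_on Om a ==> smooth_on Om f ==> smooth_on Om Z ==> x \<in> Om ==>
  lb Z (\<lambda>x. a x *\<^sub>R f x) x = a x *\<^sub>R lb Z f x + der Z a x *\<^sub>R f x"
 unfolding lb_def der_scaleR[of Om a f x] der_field_scaleR[of Om Z x a f] by (simp add: scaleR_diff_right)

lemma lb_cong_right: "smooth_on Om f ==> x \<in> Om ==> (\<And>x. x \<in> Om ==> f x = g x) ==> lb Z f x = lb Z g x"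
 unfolding lb_def using der_cong[OF op, of x f g] der_field_cong[of f x g] by simp

lemma lb_zero: "smooth_on Om Z ==> x \<in> Om ==> lb Z (\<lambda>x. 0) x = 0"
 using lb_scale_right[of "\<lambda>x. 0" "\<lambda>x. 0" Z x] op by (simp add: smooth_on_const)

lemma hspan_uminus: "hspan Om X m f ==> hspan Om X m (\<lambda>x. - f x)"
 by (rule hspan.cong[OF hspan.scale[of Om X m f "\<lambda>x. -1"]]) (auto simp: op smooth_on_const)

lemma hspan_diff: "hspan Om X m f ==> hspan Om X m g ==> hspan Om X m (\<lambda>x. f x - g x)"
 by (rule hspan.cong[OF hspan.add[OF _ hspan_uminus]]) auto

text \<open>The bracket with \<open>Z\<close> is a derivation. Differentiating a coefficient leaves
  \<open>f\<close> itself, which already lies in layer \<open>m\<close> and hence in layer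
  \<open>k\<close>.\<close>

lemma hspan_lb_induct:
 assumes f: "hspan Om X m f" and Z: "smooth_on Om Z" and mk: "m <= k"
  and w: "\<And>u. u \<noteq> [] ==> length u <= m ==> hspan Om X k (lb Z (vf X u))"
 shows "hspan Om X k (lb Z f)" using f w mk proof (induction rule: hspan.induct)
 case (zero m)
 show ?case by (rule hspan.cong[OF hspan.zero]) (simp add: lb_zero Z)
next
 case (add m f g)
 show ?case by (rule hspan.cong[OF hspan.add[OF add.IH]])
    (use add hspan_smooth Z in \<open>auto simp: lb_add_right\<close>)
next
 case (scale m f a)
 show ?case proof (rule hspan.cong)
  show "hspan Om X k (\<lambda>x. a x *\<^sub>R lb Z f x + der Z a x *\<^sub>R f x)"
   using scale op Z hspan_mono[OF scale.hyps(1)] by (intro hspan.add hspan.scale der_smooth) auto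
 qed (use scale hspan_smooth Z in \<open>auto simp: lb_scale_right\<close>)
next
 case (cong m f g)
 have "hspan Om X k (lb Z f)" by (rule cong.IH) (use cong in auto)
 then show ?case by (rule hspan.cong) (use cong hspan_smooth lb_cong_right in blast)
qed

lemma hspan_lb_letter: "hspan Om X m f ==> hspan Om X (Suc m) (lb (X i) f)"
proof (rule hspan_lb_induct[OF _ smX])
 fix u :: "'k list" assume u: "u \<noteq> []" "length u <= m"
 then have "lb (X i) (vf X u) = vf X (i # u)" by (cases u) auto
 then show "hspan Om X (Suc m) (lb (X i) (vf X u))" using u hspan.word[of "i # u" "Suc m" Om X] by simp
qed auto

text \<open>Induction on the word by the Jacobi identity, which reduces the bracket with a nested
  bracket to brackets with single generators.\<close>

lemma hspan_lb_word: "u \<noteq> [] ==> hspan Om X m f ==> hspan Om X (length u + m) (lb (vf X u) f)"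
proof (induction u arbitrary: m f rule: lie.induct)
 case (2 i)
 then show ?case using hspan_lb_letter by simp
next
 case (3 i j J)
 let ?U = "vf X (j # J)"
 have 1: "hspan Om X (Suc (length (j # J) + m)) (lb (X i) (lb ?U f))"
  by (intro hspan_lb_letter "3.IH"(1)) (use 3 in auto)
 have 2: "hspan Om X (length (j # J) + Suc m) (lb ?U (lb (X i) f))"
  by (intro "3.IH"(1) hspan_lb_letter) (use 3 in auto)
 have 3: "hspan Om X (length (i # j # J) + m) (\<lambda>x. lb (X i) (lb ?U f) x - lb ?U (lb (X i) f) x)"
  by (rule hspan_diff) (use 1 2 in simp_all)
 show ?case proof (rule hspan.cong[OF 3])
  fix x assume "x \<in> Om"
  then have "lb (lb (X i) ?U) f x = lb (X i) (lb ?U f) x - lb ?U (lb (X i) f) x"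
   by (rule lb_jacobi[OF op]) (rule smX, rule vf_smooth[OF op smX], rule hspan_smooth[OF "3.prems"(2)])
  then show "lb (X i) (lb ?U f) x - lb ?U (lb (X i) f) x = lb (vf X (i # j # J)) f x" by simp
 qed
qed simp

lemma hspan_lb:
 assumes f: "hspan Om X m f" and g: "hspan Om X k g"
 shows "hspan Om X (m + k) (lb f g)" proof -
 have "hspan Om X (m + k) (lb g f)" proof (rule hspan_lb_induct[OF f hspan_smooth[OF g]])
  fix u :: "'k list" assume u: "u \<noteq> []" "length u <= m"
  have "hspan Om X (m + k) (lb (vf X u) g)" using hspan_mono[OF hspan_lb_word[OF u(1) g]] u(2) by simp
  then show "hspan Om X (m + k) (lb g (vf X u))"
   by (rule hspan.cong[OF hspan_uminus]) (simp add: lb_def)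
 qed simp
 then show ?thesis by (rule hspan.cong[OF hspan_uminus]) (simp add: lb_def)
qed

end

definition adapted :: "('k => 'e::euclidean_space => 'e) => 'e => nat => 'k list set => bool"
 where "adapted X x m G \<longleftrightarrow> G \<subseteq> {u. u \<noteq> [] \<and> length u <= m} \<and> inj_on (\<lambda>u. vf X u x) G \<and>
  independent ((\<lambda>u. vf X u x) ` G) \<and>
  (\<forall>i\<le>m. span ((\<lambda>u. vf X u x) ` {u \<in> G. length u <= i}) = wspan X i x)"

text \<open>The basis is extended layer by layer, which keeps its part of length at most
  \<open>i\<close> a basis of every earlier layer.\<close>

lemma adapted_exists: "\<exists>G. adapted X x m G" proof (induction m)
 case 0
 have "{u. u \<noteq> [] \<and> length u <= 0} = {}" by auto
 then show ?case by (intro exI[of _ "{}"]) (auto simp: adapted_def wspan_def independent_empty)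
next
 case (Suc m)
 then obtain G where G: "adapted X x m G" by blast
 let ?v = "\<lambda>u. vf X u x"
 let ?S = "\<lambda>m. {?v u | u. u \<noteq> [] \<and> length u <= m}"
 have Gm: "G \<subseteq> {u. u \<noteq> [] \<and> length u <= m}" "inj_on ?v G" "independent (?v ` G)"
  and Gs: "\<And>i. i <= m ==> span (?v ` {u \<in> G. length u <= i}) = wspan X i x"
  using G by (auto simp: adapted_def)
 have Gall: "{u \<in> G. length u <= m} = G" using Gm(1) by auto
 have GS: "?v ` G \<subseteq> ?S (Suc m)" using Gm(1) by fastforce
 obtain B where B: "?v ` G \<subseteq> B" "B \<subseteq> ?S (Suc m)" "independent B" "?S (Suc m) \<subseteq> span B"
  using maximal_independent_subset_extend[OF GS Gm(3)] by blast
 \<comment> \<open>A new basis vector cannot come from a shorter word, because that would put it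
   into the span of the old ones.\<close>
 have "\<exists>u. u \<noteq> [] \<and> length u = Suc m \<and> b = ?v u" if b: "b \<in> B - ?v ` G" for b proof -
  obtain u where u: "u \<noteq> []" "length u <= Suc m" "b = ?v u" using b B(2) by blast
  have "length u = Suc m" proof (rule ccontr)
   assume "length u \<noteq> Suc m"
   then have "b \<in> wspan X m x" using u by (auto intro: vf_in_wspan)
   then have "b \<in> span (?v ` G)" using Gs[of m] Gall by simp
   moreover have "span (?v ` G) \<subseteq> span (B - {b})" using b B(1) by (intro span_mono) auto
   ultimately show False using B(3) b unfolding dependent_def by blast
  qed
  with u show ?thesis by blast
 qed
 then obtain f where f: "\<And>b. b \<in> B - ?v ` G ==> f b \<noteq> [] \<and> length (f b) = Suc m \<and> b = ?v (f b)" by metis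
 define H where "H = G \<union> f ` (B - ?v ` G)"
 have "?v ` f ` (B - ?v ` G) = (\<lambda>b. b) ` (B - ?v ` G)"
  unfolding image_image by (rule image_cong) (use f in auto)
 then have vH: "?v ` H = B" using B(1) by (auto simp: H_def image_Un)
 have low: "{u \<in> H. length u <= i} = {u \<in> G. length u <= i}" if "i <= m" for i
  using f that by (auto simp: H_def)
 have inj: "inj_on ?v H" proof (rule inj_onI)
  fix u u' assume u: "u \<in> H" "u' \<in> H" "?v u = ?v u'"
  have key: "u = f (?v u)" if "u \<in> H" "u \<notin> G" for u using that f by (auto simp: H_def)
  have key2: "?v u \<notin> ?v ` G" if "u \<in> H" "u \<notin> G" for u using that f by (auto simp: H_def)
  show "u = u'" proof (cases "u \<in> G")
   case True
   then have "u' \<in> G" using key2[of u'] u by (metis imageI)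
   then show ?thesis using True Gm(2) u(3) by (auto dest: inj_onD)
  next
   case False
   then have "u' \<notin> G" using key2[of u] u by (metis imageI)
   then show ?thesis using key[of u] key[of u'] u False by simp
  qed
 qed
 have "span B = wspan X (Suc m) x"
  unfolding wspan_def using B(2,4) by (metis (no_types, lifting) span_eq span_superset order_trans)
 moreover have "{u \<in> H. length u <= Suc m} = H" using Gm(1) f by (auto simp: H_def)
 ultimately have "span (?v ` {u \<in> H. length u <= i}) = wspan X i x" if "i <= Suc m" for i
  using that low[of i] Gs[of i] vH by (cases "i = Suc m") auto
 moreover have "H \<subseteq> {u. u \<noteq> [] \<and> length u <= Suc m}" using Gm(1) f by (fastforce simp: H_def)
 ultimately have "adapted X x (Suc m) H" using inj B(3) vH by (auto simp: adapted_def)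
 then show ?case by blast
qed

lemma adapted_index:
 fixes X :: "'k => real ^ 'n => real ^ 'n"
 assumes "wspan X s x = UNIV"
 shows "\<exists>J :: 'n => 'k list. (\<forall>l. J l \<noteq> []) \<and> inj (\<lambda>l. vf X (J l) x) \<and> independent (range (\<lambda>l. vf X (J l) x)) \<and>
  (\<forall>i. span ((\<lambda>l. vf X (J l) x) ` {l. length (J l) <= i}) = wspan X i x)" proof -
 let ?v = "\<lambda>u. vf X u x"
 obtain G where "adapted X x s G" using adapted_exists by blast
 then have G: "G \<subseteq> {u. u \<noteq> [] \<and> length u <= s}" "inj_on ?v G" "independent (?v ` G)"
  and Gs: "\<And>i. i <= s ==> span (?v ` {u \<in> G. length u <= i}) = wspan X i x"
  by (auto simp: adapted_def)
 have Gall: "{u \<in> G. length u <= i} = G" if "s <= i" for i using G(1) that by auto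
 have spn: "span (?v ` G) = UNIV" using Gs[of s] Gall[of s] assms by simp
 have "finite (?v ` G)" using G(3) independent_bound_general by blast
 then have fin: "finite G" using G(2) finite_imageD by blast
 have "card (?v ` G) = DIM(real ^ 'n)"
  using basis_card_eq_dim[of "?v ` G" UNIV] G(3) spn by (simp add: dim_UNIV)
 then have "card G = CARD('n)" using card_image[OF G(2)] by simp
 then obtain J :: "'n => 'k list" where J: "bij_betw J UNIV G"
  using finite_same_card_bij[of "UNIV :: 'n set" G] fin by auto
 have im: "(\<lambda>l. ?v (J l)) ` {l. length (J l) <= i} = ?v ` {u \<in> G. length u <= i}" for i
  using J by (auto simp: bij_betw_def image_iff)
 have spi: "span ((\<lambda>l. ?v (J l)) ` {l. length (J l) <= i}) = wspan X i x" for i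
 proof (cases "i <= s")
  case False
  then have "wspan X i x = UNIV" using wspan_mono[of s i X x] assms by auto
  then show ?thesis using Gall[of i] False spn unfolding im by simp
 qed (simp add: im Gs)
 show ?thesis proof (intro exI[of _ J] conjI allI)
  show "J l \<noteq> []" for l using J G(1) by (auto simp: bij_betw_def)
  show "inj (\<lambda>l. ?v (J l))"
   using J G(2) comp_inj_on[of J UNIV ?v] by (auto simp: bij_betw_def o_def)
  show "independent (range (\<lambda>l. ?v (J l)))"
   using J G(3) by (simp add: bij_betw_def flip: image_image[of ?v J])
 qed (rule spi)
qed

text \<open>The coframe dual to a frame \<open>Y\<close>, by Cramer's rule.\<close>

definition cofr :: "('n::finite => real ^ 'n => real ^ 'n) => 'n => real ^ 'n => real ^ 'n"
 where "cofr Y l x = (\<chi> m. det (\<chi> i j. if j = l then axis m 1 $ i else Y j x $ i) / det (\<chi> i j. Y j x $ i))"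

text \<open>Cramer's rule gives a right inverse of the frame matrix. A right inverse of a square
  matrix is a left inverse, which yields duality; the right inverse itself yields the
  expansion.\<close>

lemma cofr:
 fixes Y :: "'n::finite => real ^ 'n => real ^ 'n"
 assumes "det (\<chi> i j. Y j x $ i) \<noteq> 0"
 shows "cofr Y l x \<bullet> Y j x = (if l = j then 1 else 0)" "v = (\<Sum>l\<in>UNIV. (cofr Y l x \<bullet> v) *\<^sub>R Y l x)"
proof -
 let ?A = "\<chi> i j. Y j x $ i" and ?B = "\<chi> l m. cofr Y l x $ m"
 have "?A *v (\<chi> l. cofr Y l x $ m) = axis m 1" for m
  by (subst cramer[OF assms]) (simp add: cofr_def cong: if_cong)
 then have "?A ** ?B = mat 1"
  by (simp add: matrix_matrix_mult_def matrix_vector_mult_def mat_def axis_def vec_eq_iff)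
 then have "?B ** ?A = mat 1" and AB: "?A ** ?B = mat 1" by (simp_all add: matrix_left_right_inverse)
 then show "cofr Y l x \<bullet> Y j x = (if l = j then 1 else 0)"
  by (simp add: matrix_matrix_mult_def mat_def inner_vec_def vec_eq_iff)
 have "v = ?A *v (?B *v v)" unfolding matrix_vector_mul_assoc AB by simp
 also have "... = (\<Sum>l\<in>UNIV. (cofr Y l x \<bullet> v) *\<^sub>R Y l x)"
  by (simp add: matrix_vector_mult_def inner_vec_def vec_eq_iff sum_component mult.commute)
 finally show "v = (\<Sum>l\<in>UNIV. (cofr Y l x \<bullet> v) *\<^sub>R Y l x)" .
qed

lemma cofr_smooth:
 assumes "open Om" "\<And>l. smooth_on Om (Y l)" "\<And>x. x \<in> Om ==> det (\<chi> i j. Y j x $ i) \<noteq> 0"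
 shows "smooth_on Om (cofr Y l)" proof -
 let ?f = "\<lambda>m x. det (\<chi> i j. if j = l then axis m 1 $ i else Y j x $ i) * inverse (det (\<chi> i j. Y j x $ i))"
 have sn: "smooth_on Om (\<lambda>x. Y j x $ i)" for i j using assms by auto
 have "smooth_on Om (?f m)" for m proof (intro smooth_on_mult smooth_on_inverse smooth_on_det assms)
  show "smooth_on Om (\<lambda>x. (\<chi> i j. if j = l then axis m 1 $ i else Y j x $ i) $ i $ j)" for i j
   by (cases "j = l") (simp_all add: sn smooth_on_const assms(1))
 qed (use sn in auto)
 then have "smooth_on Om (\<lambda>x. \<Sum>m\<in>UNIV. ?f m x *\<^sub>R axis m (1 :: real))"
  using assms(1) by (intro smooth_on_sum smooth_on_scaleR smooth_on_const)
 moreover have "(\<Sum>m\<in>UNIV. ?f m x *\<^sub>R axis m (1 :: real)) = cofr Y l x" for x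
  using basis_expansion[of "cofr Y l x"] by (simp add: cofr_def scalar_mult_eq_scaleR divide_inverse)
 ultimately show ?thesis by simp
qed

lemma independent_det:
 fixes y :: "'n::finite => real ^ 'n"
 shows "(inj y \<and> independent (range y)) \<longleftrightarrow> det (\<chi> i j. y j $ i) \<noteq> 0" proof
 let ?A = "\<chi> i j. y j $ i"
 have col: "column j ?A = y j" for j by (simp add: column_def)
 then have cols: "columns ?A = range y" by (auto simp: columns_def)
 assume y: "inj y \<and> independent (range y)"
 then have "span (range y) = UNIV"
  using card_ge_dim_independent[of "range y" UNIV] by (auto simp: card_image dim_UNIV)
 then have "\<exists>B. ?A ** B = mat 1" by (simp add: matrix_right_invertible_span_columns cols span_vec_eq)
 then show "det ?A \<noteq> 0" by (simp add: invertible_det_nz[symmetric] invertible_right_inverse)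
next
 let ?A = "\<chi> i j. y j $ i"
 have col: "column j ?A = y j" for j by (simp add: column_def)
 then have cols: "columns ?A = range y" by (auto simp: columns_def)
 assume nz: "det ?A \<noteq> 0"
 have inj: "inj y" proof (rule injI, rule ccontr)
  fix i j assume "y i = y j" "i \<noteq> j"
  then have "det ?A = 0" using det_identical_columns[of i j ?A] col by simp
  then show False using nz by simp
 qed
 have "\<exists>B. ?A ** B = mat 1" using nz by (simp add: invertible_det_nz[symmetric] invertible_right_inverse)
 then have "span (range y) = UNIV" by (simp add: matrix_right_invertible_span_columns cols span_vec_eq)
 then have "independent (range y)"
  using card_le_dim_spanning[of "range y" UNIV] inj by (simp add: card_image dim_UNIV)
 with inj show "inj y \<and> independent (range y)" by blast
qed

text \<open>The chosen words stay independent where the determinant does not vanish. Constant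
  dimensions then force those of length at most \<open>m\<close> to span the whole layer
  \<open>m\<close> at nearby points as well, and the dual coframe annihilates lower layers. This
  gives the two filtration conditions of the frame.\<close>

lemma hframe_exists:
 fixes X :: "'k::finite => real ^ 'n => real ^ 'n"
 assumes op: "open V" and x0: "x0 \<in> V" and X: "\<And>i. smooth_on V (X i)"
  and s: "wspan X s x0 = UNIV" and d: "\<And>x m. x \<in> V ==> dim (wspan X m x) = dim (wspan X m x0)"
 obtains Om J vt where "x0 \<in> Om" "Om \<subseteq> V" "hframe Om X J vt"
  "\<And>m. card {l. length (J l) <= m} = dim (wspan X m x0)" proof -
 obtain J :: "'n => 'k list" where J: "\<And>l. J l \<noteq> []" "inj (\<lambda>l. vf X (J l) x0)" "independent (range (\<lambda>l. vf X (J l) x0))"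
  and Js: "\<And>i. span ((\<lambda>l. vf X (J l) x0) ` {l. length (J l) <= i}) = wspan X i x0"
  using adapted_index[OF s] by blast
 let ?Y = "\<lambda>l. vf X (J l)"
 let ?A = "\<lambda>x. \<chi> i j. ?Y j x $ i"
 have smY: "smooth_on V (?Y l)" for l using op X by auto
 have "smooth_on V (\<lambda>x. det (?A x))"
  using smooth_on_nth[OF op smY] by (intro smooth_on_det op) simp
 then have "continuous_on V (\<lambda>x. det (?A x))" by (rule smooth_on_continuous)
 then have "open (V \<inter> (\<lambda>x. det (?A x)) -` (- {0}))"
  by (rule continuous_open_preimage[OF _ op]) auto
 moreover define Om where "Om = {x \<in> V. det (?A x) \<noteq> 0}"
 then have "Om = V \<inter> (\<lambda>x. det (?A x)) -` (- {0})" by auto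
 ultimately have Om: "open Om" "Om \<subseteq> V" by auto
 have x0Om: "x0 \<in> Om" using x0 J independent_det[of "\<lambda>l. ?Y l x0"] by (simp add: Om_def)
 have cardd: "card {l. length (J l) <= m} = dim (wspan X m x0)" for m proof -
  have "independent ((\<lambda>l. ?Y l x0) ` {l. length (J l) <= m})" by (rule independent_mono[OF J(3)]) auto
  then have "dim (wspan X m x0) = card ((\<lambda>l. ?Y l x0) ` {l. length (J l) <= m})"
   unfolding Js[symmetric] by (simp add: dim_eq_card_independent)
  also have "... = card {l. length (J l) <= m}" using J(2) by (intro card_image) (auto intro: inj_on_subset)
  finally show ?thesis by simp
 qed
 \<comment> \<open>The inclusion of one span in the other is clear; equality comes from counting,
   and here the constancy of the dimension enters.\<close>
 have spn: "span ((\<lambda>l. ?Y l x) ` {l. length (J l) <= m}) = wspan X m x" if x: "x \<in> Om" for x m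
 proof -
  let ?B = "(\<lambda>l. ?Y l x) ` {l. length (J l) <= m}"
  have i: "inj (\<lambda>l. ?Y l x)" "independent (range (\<lambda>l. ?Y l x))"
   using x independent_det[of "\<lambda>l. ?Y l x"] by (auto simp: Om_def)
  have iB: "independent ?B" by (rule independent_mono[OF i(2)]) auto
  have "dim (span ?B) = card ?B" using iB by (simp add: dim_eq_card_independent)
  also have "... = card {l. length (J l) <= m}" using i(1) by (intro card_image) (auto intro: inj_on_subset)
  also have "... = dim (wspan X m x)" using cardd d[of x m] x Om by auto
  finally have "dim (wspan X m x) <= dim (span ?B)" by simp
  moreover have "span ?B \<subseteq> wspan X m x"
   using J(1) by (intro span_minimal subspace_wspan) (auto intro: vf_in_wspan)
  ultimately show ?thesis using subspace_dim_equal[OF subspace_span subspace_wspan] by blast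
 qed
 have vanish: "cofr ?Y l x \<bullet> v = 0" if x: "x \<in> Om" and v: "v \<in> wspan X m x" "m < length (J l)" for x l m v
 proof -
  have "v \<in> span ((\<lambda>l. ?Y l x) ` {l. length (J l) <= m})" using v(1) spn[OF x] by simp
  then show ?thesis proof (induction rule: span_induct_alt)
   case (step c b y)
   then obtain l' where "b = ?Y l' x" "length (J l') <= m" by auto
   then have "cofr ?Y l x \<bullet> b = 0" using cofr(1)[of ?Y x l l'] x v(2) by (auto simp: Om_def)
   then show ?case using step by (simp add: inner_add_right)
  qed simp
 qed
 have XOm: "smooth_on Om (X i)" for i by (rule smooth_on_subset[OF X Om(2)])
 have "hframe Om X J (cofr ?Y)" proof (unfold_locales)
  show "smooth_on Om (vf X (J i))" for i by (rule smooth_on_subset[OF smY Om(2)])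
  show "smooth_on Om (cofr ?Y i)" for i
   by (rule cofr_smooth[OF Om(1) smooth_on_subset[OF smY Om(2)]]) (simp add: Om_def)
  show "cofr ?Y i x \<bullet> vf X (J j) x = (if i = j then 1 else 0)" if "x \<in> Om" for x i j
   using cofr(1)[of ?Y x i j] that by (simp add: Om_def)
  show "v = (\<Sum>l\<in>UNIV. (cofr ?Y l x \<bullet> v) *\<^sub>R vf X (J l) x)" if "x \<in> Om" for x v
   using cofr(2)[of ?Y x v] that by (simp add: Om_def)
  show "0 < length (J i)" for i using J(1) by simp
  show "cofr ?Y l x \<bullet> lb (vf X (J i)) (vf X (J j)) x = 0" if "x \<in> Om" "length (J i) + length (J j) < length (J l)" for x i j l
  proof -
   have "hspan Om X (length (J i) + length (J j)) (lb (vf X (J i)) (vf X (J j)))"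
    by (intro hspan_lb Om XOm hspan.word J) auto
   from vanish[OF that(1) hspan_in_wspan[OF this that(1)] that(2)] show ?thesis .
  qed
  show "cofr ?Y l x \<bullet> X i x = 0" if "x \<in> Om" "1 < length (J l)" for x i l
   using vanish[OF that(1) vf_in_wspan[of "[i]"] that(2)] by simp
 qed (use Om XOm in auto)
 from that[OF x0Om Om(2) this cardd] show thesis .
qed

lemma sum_fun_apply: "(\<Sum>i\<in>I. f i) x = (\<Sum>i\<in>I. f i x)" for f :: "'i => 'b => 'c::comm_monoid_add"
 by (induction I rule: infinite_finite_induct) auto

section \<open>Vector fields in charts\<close>

definition rep :: "('a, 'n) chart => ('a, 'n) vfield => real ^ 'n => real ^ 'n"
 where "rep c Z = (\<lambda>x. Z (chart_inv c x) c)"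

lemma rep_add: "rep c (Z + W) = (\<lambda>x. rep c Z x + rep c W x)"
 and rep_scale: "rep c (vfscale r Z) = (\<lambda>x. r *\<^sub>R rep c Z x)" and rep_zero: "rep c 0 = (\<lambda>x. 0)"
 by (rule ext, simp add: rep_def vfscale_def tscale_def)+

context sub_finsler
begin

lemma atlas: "smooth_atlas \<A>" using sfm by (simp add: sub_finsler_manifold_def)

lemma chartsD:
 assumes "c \<in> charts \<A>"
 shows "open (fst c)" "open (chart_image c)" "continuous_on (fst c) (snd c)" "continuous_on (chart_image c) (chart_inv c)"
  "\<And>q. q \<in> fst c ==> chart_inv c (snd c q) = q" "\<And>q. q \<in> fst c ==> snd c q \<in> chart_image c"
  "\<And>x. x \<in> chart_image c ==> chart_inv c x \<in> fst c" "\<And>x. x \<in> chart_image c ==> snd c (chart_inv c x) = x"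
proof -
 have h: "open (fst c)" "open (chart_image c)" "homeomorphism (fst c) (chart_image c) (snd c) (chart_inv c)"
  using assms by (simp_all add: charts_def is_chart_def)
 show "open (fst c)" "open (chart_image c)" by (fact h)+
 show "continuous_on (fst c) (snd c)" "continuous_on (chart_image c) (chart_inv c)"
  using h(3) by (simp_all only: homeomorphism_def)
 have i: "chart_inv c ` chart_image c = fst c" using h(3) by (simp only: homeomorphism_def)
 show "chart_inv c (snd c q) = q" if "q \<in> fst c" for q using h(3) that by (simp only: homeomorphism_def)
 show "snd c (chart_inv c x) = x" if "x \<in> chart_image c" for x using h(3) that by (simp only: homeomorphism_def)
 show "snd c q \<in> chart_image c" if "q \<in> fst c" for q using that by (simp add: chart_image_def)
 show "chart_inv c x \<in> fst c" if "x \<in> chart_image c" for x using that i by blast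
qed

section \<open>Tangent spaces in charts\<close>

lemma charts_at_nonempty: "\<exists>a\<in>\<A>. a \<in> charts_at \<A> q" proof -
 have "q \<in> (\<Union>c\<in>\<A>. fst c)" using atlas by (simp add: smooth_atlas_def)
 then obtain a where "a \<in> \<A>" "q \<in> fst a" by blast
 then show ?thesis using atlas by (auto simp: smooth_atlas_def charts_at_def charts_def)
qed

lemma open_chart_subset:
 assumes c: "c \<in> charts \<A>" and U: "open U" "U \<subseteq> fst c"
 shows "open (snd c ` U)" proof -
 have "openin (top_of_set (chart_image c)) (snd c ` U)"
  using c U homeomorphism_imp_open_map[of "fst c" "chart_image c" "snd c" "chart_inv c" U]
  by (simp add: charts_def is_chart_def openin_open_eq)
 then show ?thesis using chartsD(2)[OF c] by (simp add: openin_open_eq)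
qed

lemma transition_comp:
 assumes c: "c \<in> charts_at \<A> q" "c' \<in> charts_at \<A> q" "c'' \<in> charts_at \<A> q"
  and d: "transition c c' differentiable at (snd c q)" "transition c' c'' differentiable at (snd c' q)"
 shows "(transition c c'' has_derivative (\<lambda>w. frechet_derivative (transition c' c'') (at (snd c' q))
  (frechet_derivative (transition c c') (at (snd c q)) w))) (at (snd c q))" proof -
 have cc: "c \<in> charts \<A>" "c' \<in> charts \<A>" "q \<in> fst c" "q \<in> fst c'" using c by (auto simp: charts_at_def)
 have e: "transition c c' (snd c q) = snd c' q" using chartsD(5)[OF cc(1,3)] by (simp add: transition_def)
 have "((\<lambda>x. transition c' c'' (transition c c' x)) has_derivative (\<lambda>w. frechet_derivative (transition c' c'') (at (snd c' q))
  (frechet_derivative (transition c c') (at (snd c q)) w))) (at (snd c q))"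
  using has_derivative_compose[OF d(1)[unfolded frechet_derivative_works] d(2)[unfolded frechet_derivative_works, folded e]]
  by (simp add: e)
 then show ?thesis proof (rule has_derivative_transform_within_open)
  show "open (snd c ` (fst c \<inter> fst c'))"
   using chartsD(1)[OF cc(1)] chartsD(1)[OF cc(2)] by (intro open_chart_subset cc) auto
  fix x assume "x \<in> snd c ` (fst c \<inter> fst c')"
  then obtain p where "p \<in> fst c" "p \<in> fst c'" "x = snd c p" by blast
  then show "transition c' c'' (transition c c' x) = transition c c'' x"
   using chartsD(5)[OF cc(1)] chartsD(5)[OF cc(2)] by (simp add: transition_def)
 qed (use cc in auto)
qed

text \<open>Charts of the maximal atlas are only assumed compatible with those of the given atlas,
  so the transition is factored through an atlas chart around \<open>q\<close>.\<close>

lemma transition_differentiable: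
 assumes c: "c \<in> charts_at \<A> q" "c' \<in> charts_at \<A> q"
 shows "transition c c' differentiable at (snd c q)" proof -
 obtain a where a: "a \<in> \<A>" "a \<in> charts_at \<A> q" using charts_at_nonempty by blast
 have "compatible c a" "compatible c' a" using c a(1) by (auto simp: charts_at_def charts_def)
 then have s: "smooth_on (snd c ` (fst c \<inter> fst a)) (transition c a)" "smooth_on (snd a ` (fst c' \<inter> fst a)) (transition a c')"
  by (auto simp: compatible_def)
 have q: "q \<in> fst c" "q \<in> fst c'" "q \<in> fst a" using c a by (auto simp: charts_at_def)
 have "transition c a differentiable at (snd c q)" by (rule smooth_on_differentiable[OF s(1)]) (use q in auto)
 moreover have "transition a c' differentiable at (snd a q)" by (rule smooth_on_differentiable[OF s(2)]) (use q in auto)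
 ultimately show ?thesis using transition_comp[OF c(1) a(2) c(2)] unfolding differentiable_def by blast
qed

lemma transition_cocycle:
 assumes c: "c \<in> charts_at \<A> q" "c' \<in> charts_at \<A> q" "c'' \<in> charts_at \<A> q"
 shows "frechet_derivative (transition c c'') (at (snd c q)) w = frechet_derivative (transition c' c'') (at (snd c' q))
  (frechet_derivative (transition c c') (at (snd c q)) w)"
 by (rule fun_cong[OF frechet_derivative_at[OF transition_comp[OF c transition_differentiable[OF c(1,2)] transition_differentiable[OF c(2,3)]]], symmetric])

lemma transition_self:
 assumes c: "c \<in> charts_at \<A> q"
 shows "frechet_derivative (transition c c) (at (snd c q)) w = w" proof -
 have cc: "c \<in> charts \<A>" "q \<in> fst c" using c by (auto simp: charts_at_def)
 have "(transition c c has_derivative (\<lambda>w. w)) (at (snd c q))"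
  by (rule has_derivative_transform_within_open[OF has_derivative_ident chartsD(2)[OF cc(1)]])
    (use chartsD(6,8)[OF cc(1)] cc in \<open>auto simp: transition_def\<close>)
 from fun_cong[OF frechet_derivative_at[OF this]] show ?thesis by simp
qed

lemma tangent_linear: "c \<in> charts_at \<A> q ==> c' \<in> charts_at \<A> q ==> linear (frechet_derivative (transition c c') (at (snd c q)))"
 by (rule linear_frechet_derivative[OF transition_differentiable])

lemma tangent_subspace: "0 \<in> tangent_space \<A> q" "v \<in> tangent_space \<A> q ==> w \<in> tangent_space \<A> q ==> v + w \<in> tangent_space \<A> q"
 "v \<in> tangent_space \<A> q ==> tscale r v \<in> tangent_space \<A> q" proof -
 let ?D = "\<lambda>c c'. frechet_derivative (transition c c') (at (snd c q))"
 show "0 \<in> tangent_space \<A> q" unfolding tangent_space_def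
 proof (intro CollectI conjI allI impI ballI)
  fix c c' assume c: "c \<in> charts_at \<A> q" "c' \<in> charts_at \<A> q"
  show "(0 :: ('a, 'n) tangent) c' = ?D c c' ((0 :: ('a, 'n) tangent) c)" using linear_0[OF tangent_linear[OF c]] by simp
 qed simp
 show "v + w \<in> tangent_space \<A> q" if v: "v \<in> tangent_space \<A> q" and w: "w \<in> tangent_space \<A> q"
  unfolding tangent_space_def proof (intro CollectI conjI allI impI ballI)
  fix c assume "c \<notin> charts_at \<A> q"
  then have "v c = 0" "w c = 0" using v w unfolding tangent_space_def by blast+
  then show "(v + w) c = 0" by simp
 next
  fix c c' assume c: "c \<in> charts_at \<A> q" "c' \<in> charts_at \<A> q"
  then have "v c' = ?D c c' (v c)" "w c' = ?D c c' (w c)" using v w unfolding tangent_space_def by blast+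
  then show "(v + w) c' = ?D c c' ((v + w) c)" by (simp add: linear_add[OF tangent_linear[OF c]])
 qed
 show "tscale r v \<in> tangent_space \<A> q" if v: "v \<in> tangent_space \<A> q" unfolding tangent_space_def
 proof (intro CollectI conjI allI impI ballI)
  fix c assume "c \<notin> charts_at \<A> q"
  then have "v c = 0" using v unfolding tangent_space_def by blast
  then show "tscale r v c = 0" by (simp add: tscale_def)
 next
  fix c c' assume c: "c \<in> charts_at \<A> q" "c' \<in> charts_at \<A> q"
  then have "v c' = ?D c c' (v c)" using v unfolding tangent_space_def by blast
  then show "tscale r v c' = ?D c c' (tscale r v c)" by (simp add: tscale_def linear_scale[OF tangent_linear[OF c]])
 qed
qed

lemma tangent_eval_inj:
 assumes c: "c \<in> charts_at \<A> q" and v: "v \<in> tangent_space \<A> q" "w \<in> tangent_space \<A> q" "v c = w c"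
 shows "v = w" proof
 fix c'
 show "v c' = w c'" proof (cases "c' \<in> charts_at \<A> q")
  case True
  have "v c' = frechet_derivative (transition c c') (at (snd c q)) (v c)" using v(1) c True unfolding tangent_space_def by blast
  moreover have "w c' = frechet_derivative (transition c c') (at (snd c q)) (w c)" using v(2) c True unfolding tangent_space_def by blast
  ultimately show ?thesis using v(3) by simp
 next
  case False
  then have "v c' = 0" "w c' = 0" using v(1,2) unfolding tangent_space_def by blast+
  then show ?thesis by simp
 qed
qed

lemma tangent_eval_surj:
 assumes c: "c \<in> charts_at \<A> q"
 shows "\<exists>v\<in>tangent_space \<A> q. v c = x" proof -
 let ?v = "\<lambda>c'. if c' \<in> charts_at \<A> q then frechet_derivative (transition c c') (at (snd c q)) x else 0"
 have 1: "?v c = x" using c transition_self[OF c] by simp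
 have 2: "?v \<in> tangent_space \<A> q" unfolding tangent_space_def
 proof (intro CollectI conjI allI impI ballI)
  fix c' c'' assume c': "c' \<in> charts_at \<A> q" "c'' \<in> charts_at \<A> q"
  show "?v c'' = frechet_derivative (transition c' c'') (at (snd c' q)) (?v c')"
   using transition_cocycle[OF c c', of x] c' by (simp only: if_True)
 qed simp
 show ?thesis using bexI[of "\<lambda>v. v c = x", OF 1 2] .
qed

lemma rep_at: "c \<in> charts \<A> ==> q \<in> fst c ==> rep c Z (snd c q) = Z q c"
 by (simp add: rep_def chartsD(5))

definition Xc :: "('a, 'n) chart => 'k => real ^ 'n => real ^ 'n"
 where "Xc c i = rep c (generating_field \<xi> i)"

lemma Xc_eq: "Xc c i x = \<xi> (chart_inv c x) (axis i 1) c"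
 by (simp add: Xc_def rep_def generating_field_def)

lemma xi_smooth:
 assumes c: "c \<in> charts \<A>"
 shows "smooth_on (chart_image c) (\<lambda>x. \<xi> (chart_inv c x) w c)" proof -
 have "smooth_on (chart_image c \<times> UNIV) (\<lambda>(x, w). \<xi> (chart_inv c x) w c)"
  using sfm c unfolding sub_finsler_manifold_def bundle_morphism_def by blast
 then have "smooth_on (chart_image c) (\<lambda>x. (\<lambda>(x, w). \<xi> (chart_inv c x) w c) ((0, w) + (x, 0)))"
  by (rule smooth_on_affine_comp[rotated 4])
    (use chartsD(2)[OF c] in \<open>auto intro!: open_Times bounded_linear_Pair bounded_linear_ident bounded_linear_zero\<close>)
 then show ?thesis by simp
qed

lemma Xc_smooth: "c \<in> charts \<A> ==> smooth_on (chart_image c) (Xc c i)"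
 using xi_smooth[of c "axis i 1"] by (simp add: Xc_eq[abs_def])

lemma xi_chart: "\<xi> (chart_inv c x) u c = (\<Sum>i\<in>UNIV. u $ i *\<^sub>R Xc c i x)" proof -
 have "\<xi> (chart_inv c x) u c = (\<Sum>i\<in>UNIV. tscale (u $ i) (generating_field \<xi> i (chart_inv c x))) c"
  by (simp only: xi_expand)
 then show ?thesis by (simp add: sum_fun_apply tscale_def Xc_def rep_def)
qed

abbreviation "HF \<equiv> horizontal_fields \<A> \<xi>"
abbreviation "IB \<equiv> iterated_brackets \<A> HF"
abbreviation "hs c m Z \<equiv> hspan (chart_image c) (Xc c) m (rep c Z)"

section \<open>Brackets and the flag in a chart\<close>

lemma rep_bracket:
 assumes c: "c \<in> charts \<A>" and x: "x \<in> chart_image c"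
 shows "rep c (lie_bracket \<A> Z W) x = lb (rep c Z) (rep c W) x"
 using chartsD(7,8)[OF c x] c by (simp add: rep_def[abs_def] lie_bracket_def lb_def der_def charts_at_def)

lemma hs_HF:
 assumes c: "c \<in> charts \<A>" and Z: "Z \<in> HF"
 shows "hs c 1 Z" proof -
 obtain sg where sg: "smooth_map \<A> sg" "Z = (\<lambda>q. \<xi> q (sg q))" using Z by (auto simp: horizontal_fields_def)
 have s: "smooth_on (chart_image c) (sg \<circ> chart_inv c)" using sg(1) c by (simp add: smooth_map_def)
 have "hspan (chart_image c) (Xc c) 1 (\<lambda>x. \<Sum>i\<in>UNIV. ((sg \<circ> chart_inv c) x $ i) *\<^sub>R vf (Xc c) [i] x)"
  by (intro hspan_sum hspan.scale hspan.word smooth_on_nth s chartsD(2) c) auto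
 moreover have "(\<lambda>x. \<Sum>i\<in>UNIV. ((sg \<circ> chart_inv c) x $ i) *\<^sub>R vf (Xc c) [i] x) = rep c Z"
  by (simp add: rep_def sg(2) xi_chart)
 ultimately show ?thesis by simp
qed

lemma hs_add: "hs c m Z ==> hs c m W ==> hs c m (Z + W)" unfolding rep_add by (rule hspan.add)

lemma hs_scale: "c \<in> charts \<A> ==> hs c m Z ==> hs c m (vfscale r Z)"
 unfolding rep_scale by (rule hspan.scale) (auto intro: smooth_on_const chartsD(2))

lemma hs_zero: "hs c m 0" unfolding rep_zero by (rule hspan.zero)

lemma hs_bracket:
 assumes "c \<in> charts \<A>" "hs c m Z" "hs c k W"
 shows "hs c (m + k) (lie_bracket \<A> Z W)"
 by (rule hspan.cong[OF hspan_lb[OF chartsD(2)[OF assms(1)] Xc_smooth[OF assms(1)] assms(2,3)]])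
   (simp add: rep_bracket[OF assms(1)])

interpretation vfm: vector_space "vfscale :: real => ('a, 'n) vfield => ('a, 'n) vfield"
 by (rule vector_space_vfscale)
interpretation tm: vector_space "tscale :: real => ('a, 'n) tangent => ('a, 'n) tangent"
 by (rule vector_space_tscale)

lemma hs_vfspan:
 assumes c: "c \<in> charts \<A>" and S: "\<And>Z. Z \<in> S ==> hs c m Z" and Z: "Z \<in> vfspan S"
 shows "hs c m Z" using Z proof (rule vfm.span_induct_alt)
 show "hs c m 0" by (rule hs_zero)
 show "hs c m (vfscale r Z + W)" if "Z \<in> S" "hs c m W" for r Z W
  by (rule hs_add[OF hs_scale[OF c S[OF that(1)]] that(2)])
qed

lemma hs_flag:
 assumes c: "c \<in> charts \<A>"
 shows "Z \<in> flag \<A> HF (Suc j) ==> hs c (Suc j) Z" proof (induction j arbitrary: Z)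
 case 0
 then show ?case using hs_HF[OF c] by simp
next
 case (Suc j)
 then obtain X Y where XY: "Z = X + Y" "X \<in> flag \<A> HF (Suc j)"
  "Y \<in> vfspan {lie_bracket \<A> V W | V W. V \<in> HF \<and> W \<in> flag \<A> HF (Suc j)}" by auto
 have "hs c (Suc (Suc j)) Y" proof (rule hs_vfspan[OF c _ XY(3)])
  fix U assume "U \<in> {lie_bracket \<A> V W | V W. V \<in> HF \<and> W \<in> flag \<A> HF (Suc j)}"
  then obtain V W where "U = lie_bracket \<A> V W" "V \<in> HF" "W \<in> flag \<A> HF (Suc j)" by blast
  then show "hs c (Suc (Suc j)) U" using hs_bracket[OF c hs_HF[OF c] Suc.IH, of V W] by simp
 qed
 moreover have "hs c (Suc (Suc j)) X" using hspan_mono[OF Suc.IH[OF XY(2)], of "Suc (Suc j)"] by simp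
 ultimately show ?case unfolding XY(1) by (intro hs_add)
qed

lemma hs_IB: "c \<in> charts \<A> ==> Z \<in> IB ==> \<exists>m. hs c m Z"
 by (rotate_tac, induction rule: iterated_brackets.induct) (auto intro: hs_HF hs_bracket)

text \<open>Brackets are additive only on differentiable fields. Membership in some layer, which
  includes smoothness, is therefore carried along in the induction.\<close>

lemma vfspan_IB:
 assumes "W \<in> vfspan IB"
 shows "(\<forall>c\<in>charts \<A>. \<exists>m. hs c m W) \<and> (\<forall>V\<in>HF. lie_bracket \<A> V W \<in> vfspan IB)" (is "?P W")
 using assms proof (rule vfm.span_induct_alt)
 have "lie_bracket \<A> V 0 = 0" if V: "V \<in> HF" for V proof (intro ext)
  fix q c
  show "lie_bracket \<A> V 0 q c = 0 q c" proof (cases "c \<in> charts_at \<A> q")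
   case True
   then have cc: "c \<in> charts \<A>" "q \<in> fst c" by (auto simp: charts_at_def)
   have "rep c (lie_bracket \<A> V 0) (snd c q) = lb (rep c V) (\<lambda>x. 0) (snd c q)"
    using rep_bracket[OF cc(1) chartsD(6)[OF cc]] by (simp add: rep_zero)
   also have "... = 0"
    by (rule lb_zero[OF chartsD(2)[OF cc(1)] Xc_smooth[OF cc(1)] hspan_smooth[OF chartsD(2)[OF cc(1)] Xc_smooth[OF cc(1)] hs_HF[OF cc(1) V]] chartsD(6)[OF cc]])
   finally show ?thesis using chartsD(5)[OF cc] by (simp add: rep_def)
  qed (simp add: lie_bracket_def)
 qed
 then show "?P 0" using hs_zero vfm.span_zero by metis
next
 fix r Z W assume step: "Z \<in> IB" "?P W"
 have 1: "\<exists>m. hs c m (vfscale r Z + W)" if c: "c \<in> charts \<A>" for c proof -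
  obtain m k where "hs c m Z" "hs c k W" using hs_IB[OF c step(1)] step(2) c by blast
  then have "hs c (max m k) Z" "hs c (max m k) W" by (auto intro: hspan_mono)
  then show ?thesis using hs_add hs_scale[OF c] by blast
 qed
 have 2: "lie_bracket \<A> V (vfscale r Z + W) \<in> vfspan IB" if V: "V \<in> HF" for V proof -
  have "lie_bracket \<A> V (vfscale r Z + W) = vfscale r (lie_bracket \<A> V Z) + lie_bracket \<A> V W"
  proof (intro ext)
   fix q c
   show "lie_bracket \<A> V (vfscale r Z + W) q c = (vfscale r (lie_bracket \<A> V Z) + lie_bracket \<A> V W) q c"
   proof (cases "c \<in> charts_at \<A> q")
    case True
    then have cc: "c \<in> charts \<A>" "q \<in> fst c" by (auto simp: charts_at_def)
    note op = chartsD(2)[OF cc(1)] and sX = Xc_smooth[OF cc(1)] and xq = chartsD(6)[OF cc]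
    obtain m k where mk: "hs c m Z" "hs c k W" using hs_IB[OF cc(1) step(1)] step(2) cc by blast
    have s: "smooth_on (chart_image c) (rep c Z)" "smooth_on (chart_image c) (rep c W)" "smooth_on (chart_image c) (rep c V)"
     by (rule hspan_smooth[OF op sX], rule mk hs_HF[OF cc(1) V])+
    have "rep c (lie_bracket \<A> V (vfscale r Z + W)) (snd c q) = lb (rep c V) (\<lambda>x. r *\<^sub>R rep c Z x + rep c W x) (snd c q)"
     using rep_bracket[OF cc(1) xq] by (simp add: rep_add rep_scale)
    also have "... = lb (rep c V) (\<lambda>x. r *\<^sub>R rep c Z x) (snd c q) + lb (rep c V) (rep c W) (snd c q)"
     by (rule lb_add_right[OF op sX]) (use s xq op in \<open>auto intro!: smooth_on_scaleR smooth_on_const\<close>)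
    also have "lb (rep c V) (\<lambda>x. r *\<^sub>R rep c Z x) (snd c q) = r *\<^sub>R lb (rep c V) (rep c Z) (snd c q) + der (rep c V) (\<lambda>x. r) (snd c q) *\<^sub>R rep c Z (snd c q)"
     by (rule lb_scale_right[OF op sX]) (use s xq op in \<open>auto intro!: smooth_on_const\<close>)
    also have "... + lb (rep c V) (rep c W) (snd c q) = rep c (vfscale r (lie_bracket \<A> V Z) + lie_bracket \<A> V W) (snd c q)"
     by (simp add: rep_add rep_scale rep_bracket[OF cc(1) xq])
    finally show ?thesis unfolding rep_at[OF cc] .
   qed (simp add: lie_bracket_def vfscale_def tscale_def)
  qed
  also have "... \<in> vfspan IB"
   using step V by (intro vfm.span_add vfm.span_scale) (auto intro: iterated_brackets.base vfm.span_base iterated_brackets.bracket)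
  finally show ?thesis .
 qed
 show "?P (vfscale r Z + W)" using 1 2 by blast
qed

lemma flag_vfspan: "flag \<A> HF (Suc j) \<subseteq> vfspan IB" proof (induction j)
 case 0
 show ?case by (auto intro: vfm.span_base iterated_brackets.base)
next
 case (Suc j)
 have "vfspan {lie_bracket \<A> V W | V W. V \<in> HF \<and> W \<in> flag \<A> HF (Suc j)} \<subseteq> vfspan IB"
  by (rule vfm.span_minimal) (use Suc vfspan_IB in \<open>auto simp: vfm.subspace_span\<close>)
 then show ?case using Suc by (auto intro!: vfm.span_add)
qed

lemma span_IB_eq: "tspan {Z q | Z. Z \<in> IB} = tangent_space \<A> q"
 using sfm by (simp add: sub_finsler_manifold_def bracket_generating_def)

text \<open>That values of brackets are tangent vectors is taken from the bracket-generating
  equation, which avoids checking the transformation law for brackets.\<close>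

lemma vfspan_IB_tangent: "Z \<in> vfspan IB ==> Z q \<in> tangent_space \<A> q" proof (erule vfm.span_induct_alt)
 show "0 q \<in> tangent_space \<A> q" using tangent_subspace(1) by simp
next
 fix r Z W assume step: "Z \<in> IB" "W q \<in> tangent_space \<A> q"
 then have "Z q \<in> tangent_space \<A> q" using tm.span_base[of "Z q" "{Z q | Z. Z \<in> IB}"] span_IB_eq by auto
 then show "(vfscale r Z + W) q \<in> tangent_space \<A> q" using step tangent_subspace(2,3) by (simp add: vfscale_def)
qed

lemma HF_I: "smooth_map \<A> sg ==> (\<lambda>q. \<xi> q (sg q)) \<in> HF" by (auto simp: horizontal_fields_def)

lemma smooth_map_const: "smooth_map \<A> (\<lambda>q. a)"
 by (auto simp: smooth_map_def intro!: smooth_on_const chartsD(2))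

lemma generating_field_HF: "generating_field \<xi> i \<in> HF"
 unfolding generating_field_def by (intro HF_I smooth_map_const)

lemma subspace_flag: "vfm.subspace (flag \<A> HF (Suc j))" proof (induction j)
 case 0
 show ?case unfolding vfm.subspace_def proof (intro conjI ballI allI)
  have "(\<lambda>q. \<xi> q 0) \<in> HF" by (intro HF_I smooth_map_const)
  moreover have "(\<lambda>q. \<xi> q 0) = 0" by (rule ext) (simp add: xi_zero)
  ultimately show "0 \<in> flag \<A> HF (Suc 0)" by simp
  fix Z W assume ZW: "Z \<in> flag \<A> HF (Suc 0)" "W \<in> flag \<A> HF (Suc 0)"
  then obtain sg ta where s: "smooth_map \<A> sg" "Z = (\<lambda>q. \<xi> q (sg q))" "smooth_map \<A> ta" "W = (\<lambda>q. \<xi> q (ta q))"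
   by (auto simp: horizontal_fields_def)
  have "(\<lambda>q. \<xi> q (sg q + ta q)) \<in> HF"
   by (rule HF_I) (use s in \<open>auto simp: smooth_map_def o_def intro!: smooth_on_add chartsD(2)\<close>)
  moreover have "(\<lambda>q. \<xi> q (sg q + ta q)) = Z + W" by (rule ext) (simp add: s xi_add)
  ultimately show "Z + W \<in> flag \<A> HF (Suc 0)" by simp
 next
  fix r Z assume ZW: "Z \<in> flag \<A> HF (Suc 0)"
  then obtain sg where s: "smooth_map \<A> sg" "Z = (\<lambda>q. \<xi> q (sg q))" by (auto simp: horizontal_fields_def)
  have "(\<lambda>q. \<xi> q (r *\<^sub>R sg q)) \<in> HF"
   by (rule HF_I) (use s in \<open>auto simp: smooth_map_def o_def intro!: smooth_on_scaleR smooth_on_const chartsD(2)\<close>)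
  then show "vfscale r Z \<in> flag \<A> HF (Suc 0)" by (simp add: s xi_scale vfscale_def)
 qed
next
 case (Suc j)
 have "flag \<A> HF (Suc (Suc j)) = {x + y | x y. x \<in> flag \<A> HF (Suc j) \<and>
  y \<in> vfspan {lie_bracket \<A> V W | V W. V \<in> HF \<and> W \<in> flag \<A> HF (Suc j)}}" by simp
 then show ?case using vfm.subspace_sums[OF Suc vfm.subspace_span] by simp
qed

lemma flag_Suc_mono: "flag \<A> HF (Suc j) \<subseteq> flag \<A> HF (Suc (Suc j))" proof
 fix Z assume "Z \<in> flag \<A> HF (Suc j)"
 then have "Z = Z + 0 \<and> Z \<in> flag \<A> HF (Suc j) \<and> 0 \<in> vfspan {lie_bracket \<A> V W | V W. V \<in> HF \<and> W \<in> flag \<A> HF (Suc j)}"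
  by (simp add: vfm.span_zero)
 then show "Z \<in> flag \<A> HF (Suc (Suc j))" unfolding flag.simps by blast
qed

lemma flag_mono: "j <= k ==> flag \<A> HF (Suc j) \<subseteq> flag \<A> HF (Suc k)"
proof (induction k rule: dec_induct)
 case (step k)
 show ?case by (rule order_trans[OF step.IH flag_Suc_mono])
qed simp

text \<open>The nested brackets of the chart fields are restrictions of brackets of globally defined
  horizontal fields, so no cut-off functions are needed.\<close>

lemma word_field_in_flag:
 assumes c: "c \<in> charts \<A>"
 shows "u \<noteq> [] ==> \<exists>Z \<in> flag \<A> HF (length u). \<forall>x\<in>chart_image c. rep c Z x = vf (Xc c) u x"
proof (induction u rule: lie.induct)
 case (2 i)
 show ?case using generating_field_HF by (intro bexI[of _ "generating_field \<xi> i"]) (auto simp: Xc_def)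
next
 case (3 i j J)
 then obtain Z where Z: "Z \<in> flag \<A> HF (Suc (length J))" "\<And>x. x \<in> chart_image c ==> rep c Z x = vf (Xc c) (j # J) x" by auto
 let ?W = "lie_bracket \<A> (generating_field \<xi> i) Z"
 have "?W \<in> vfspan {lie_bracket \<A> V W | V W. V \<in> HF \<and> W \<in> flag \<A> HF (Suc (length J))}"
  using Z(1) generating_field_HF by (intro vfm.span_base) blast
 moreover have "0 \<in> flag \<A> HF (Suc (length J))" using vfm.subspace_0[OF subspace_flag] .
 ultimately have "0 + ?W \<in> flag \<A> HF (Suc (Suc (length J)))" unfolding flag.simps by blast
 moreover have "rep c ?W x = vf (Xc c) (i # j # J) x" if x: "x \<in> chart_image c" for x proof -
  note op = chartsD(2)[OF c] and sX = Xc_smooth[OF c]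
  have "rep c ?W x = lb (Xc c i) (rep c Z) x" by (simp add: rep_bracket[OF c x] Xc_def)
  also have "... = lb (Xc c i) (vf (Xc c) (j # J)) x"
   by (rule lb_cong_right[OF op sX hspan_smooth[OF op sX hs_flag[OF c Z(1)]] x Z(2)])
  finally show ?thesis by simp
 qed
 ultimately show ?case by (intro bexI[of _ ?W]) auto
qed simp

text \<open>Fields of the flag lie in the corresponding module over smooth functions, and conversely
  every nested bracket is represented in the flag. Pointwise, the real span and the span over
  functions coincide.\<close>

lemma eval_flag:
 assumes c: "c \<in> charts_at \<A> q"
 shows "(\<lambda>v. v c) ` flag_at \<A> \<xi> j q = wspan (Xc c) j (snd c q)" proof (cases j)
 case 0
 have "{vf (Xc c) u (snd c q) |u. u \<noteq> [] \<and> length u <= 0} = {}" by auto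
 then show ?thesis using 0 by (simp add: flag_at_def wspan_def)
next
 case (Suc i)
 have cc: "c \<in> charts \<A>" "q \<in> fst c" using c by (auto simp: charts_at_def)
 have ev: "rep c Z (snd c q) = Z q c" for Z using chartsD(5)[OF cc] by (simp add: rep_def)
 have im: "(\<lambda>v. v c) ` flag_at \<A> \<xi> j q = {rep c Z (snd c q) | Z. Z \<in> flag \<A> HF (Suc i)}"
  unfolding flag_at_def ev Suc by blast
 show ?thesis unfolding im proof
  show "{rep c Z (snd c q) | Z. Z \<in> flag \<A> HF (Suc i)} \<subseteq> wspan (Xc c) j (snd c q)"
   using hspan_in_wspan[OF hs_flag[OF cc(1)] chartsD(6)[OF cc]] unfolding Suc by blast
  show "wspan (Xc c) j (snd c q) \<subseteq> {rep c Z (snd c q) | Z. Z \<in> flag \<A> HF (Suc i)}" (is "_ \<subseteq> ?R")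
   unfolding wspan_def proof (rule span_minimal)
   show "{vf (Xc c) u (snd c q) |u. u \<noteq> [] \<and> length u <= j} \<subseteq> ?R" proof
    fix v assume "v \<in> {vf (Xc c) u (snd c q) |u. u \<noteq> [] \<and> length u <= j}"
    then obtain u where u: "u \<noteq> []" "length u <= j" "v = vf (Xc c) u (snd c q)" by blast
    obtain Z where Z: "Z \<in> flag \<A> HF (length u)" "\<forall>x\<in>chart_image c. rep c Z x = vf (Xc c) u x"
     using word_field_in_flag[OF cc(1) u(1)] by blast
    have "Z \<in> flag \<A> HF (Suc i)" proof (cases u)
     case (Cons a u')
     then have "length u' <= i" using u Suc by simp
     from flag_mono[OF this] Z(1) show ?thesis unfolding Cons list.size add_0_right add_Suc_right by blast
    qed (use u in simp)
    moreover have "v = rep c Z (snd c q)" using Z(2) chartsD(6)[OF cc] u(3) by simp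
    ultimately show "v \<in> ?R" by blast
   qed
   show "subspace ?R" unfolding subspace_def proof (intro conjI ballI allI)
    have "0 = rep c 0 (snd c q)" by (simp add: rep_zero)
    then show "0 \<in> ?R" using vfm.subspace_0[OF subspace_flag[of i]] by blast
   next
    fix x y assume "x \<in> ?R" "y \<in> ?R"
    then obtain Z W where ZW: "x = rep c Z (snd c q)" "y = rep c W (snd c q)" "Z \<in> flag \<A> HF (Suc i)" "W \<in> flag \<A> HF (Suc i)" by blast
    have "x + y = rep c (Z + W) (snd c q)" by (simp add: rep_add ZW)
    then show "x + y \<in> ?R" using vfm.subspace_add[OF subspace_flag ZW(3,4)] by blast
   next
    fix r x assume "x \<in> ?R"
    then obtain Z where ZW: "x = rep c Z (snd c q)" "Z \<in> flag \<A> HF (Suc i)" by blast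
    have "r *\<^sub>R x = rep c (vfscale r Z) (snd c q)" by (simp add: rep_scale ZW)
    then show "r *\<^sub>R x \<in> ?R" using vfm.subspace_scale[OF subspace_flag ZW(2)] by blast
   qed
  qed
 qed
qed

lemma flag_at_tangent: "flag_at \<A> \<xi> j q \<subseteq> tangent_space \<A> q" proof (cases j)
 case 0
 have "flag_at \<A> \<xi> j q = {0}" unfolding 0 flag_at_def flag.simps by auto
 then show ?thesis by (simp add: tangent_subspace(1))
next
 case (Suc i)
 show ?thesis proof
  fix v assume "v \<in> flag_at \<A> \<xi> j q"
  then obtain Z where Z: "v = Z q" "Z \<in> flag \<A> HF (Suc i)" unfolding flag_at_def Suc by blast
  then have "Z \<in> vfspan IB" using flag_vfspan[of i] by blast
  then show "v \<in> tangent_space \<A> q" unfolding Z(1) by (rule vfspan_IB_tangent)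
 qed
qed

lemma flag_at_eq_iff:
 assumes c: "c \<in> charts_at \<A> q"
 shows "flag_at \<A> \<xi> j q = tangent_space \<A> q \<longleftrightarrow> wspan (Xc c) j (snd c q) = UNIV" proof
 have "(\<lambda>v. v c) ` tangent_space \<A> q = UNIV" proof -
  have "x \<in> (\<lambda>v. v c) ` tangent_space \<A> q" for x using tangent_eval_surj[OF c, of x] by blast
  then show ?thesis by blast
 qed
 then show "flag_at \<A> \<xi> j q = tangent_space \<A> q ==> wspan (Xc c) j (snd c q) = UNIV"
  using eval_flag[OF c, of j] by simp
 assume *: "wspan (Xc c) j (snd c q) = UNIV"
 show "flag_at \<A> \<xi> j q = tangent_space \<A> q" proof (rule antisym[OF flag_at_tangent subsetI])
  fix v assume v: "v \<in> tangent_space \<A> q"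
  have "v c \<in> (\<lambda>v. v c) ` flag_at \<A> \<xi> j q" using eval_flag[OF c, of j] * by simp
  then obtain w where w: "w \<in> flag_at \<A> \<xi> j q" "v c = w c" by blast
  then have "v = w" using tangent_eval_inj[OF c v] flag_at_tangent by blast
  then show "v \<in> flag_at \<A> \<xi> j q" using w by simp
 qed
qed

text \<open>Evaluation in the chart is linear and injective on the tangent space, so it preserves
  the dimension although the two sides use different vector space structures.\<close>

lemma flag_dim_eq:
 assumes c: "c \<in> charts_at \<A> q"
 shows "flag_dim \<A> \<xi> j q = dim (wspan (Xc c) j (snd c q))" proof -
 let ?E = "\<lambda>v :: ('a, 'n) tangent. v c" and ?F = "flag_at \<A> \<xi> j q"
 have T: "tm.subspace (tangent_space \<A> q)" using tangent_subspace by (auto simp: tm.subspace_def)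
 obtain B where B: "B \<subseteq> ?F" "tm.independent B" "?F \<subseteq> tspan B" "card B = tdim ?F"
  by (rule tm.basis_exists)
 have BT: "tspan B \<subseteq> tangent_space \<A> q" using B(1) flag_at_tangent T by (intro tm.span_minimal) blast+
 have "?E (v + w) = ?E v + ?E w" "?E (tscale r v) = r *\<^sub>R ?E v" for v w r by (simp_all add: tscale_def)
 then have "Vector_Spaces.linear tscale scaleR ?E"
  using tm.vector_space_axioms real_vector.vector_space_axioms by (auto simp only: Vector_Spaces.linear_iff)
 then interpret E: Vector_Spaces.linear tscale scaleR ?E .
 have inj: "inj_on ?E (tspan B)" by (rule inj_onI) (use BT tangent_eval_inj[OF c] in blast)
 have ind: "independent (?E ` B)"
  using E.independent_injective_image[OF B(2) inj] by (simp add: dependent_raw_def)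
 have "dim (?E ` ?F) = card (?E ` B)" proof (rule dim_unique)
  show "?E ` B \<subseteq> ?E ` ?F" using B(1) by blast
  show "?E ` ?F \<subseteq> span (?E ` B)" using B(3) E.span_image[of B] by (auto simp: span_raw_def)
 qed (use ind in auto)
 also have "... = card B" using inj tm.span_superset[of B] by (intro card_image) (rule inj_on_subset)
 finally show ?thesis using B(4) eval_flag[OF c, of j] by (simp add: flag_dim_def)
qed

lemma wspan_UNIV_ex:
 assumes c: "c \<in> charts_at \<A> q"
 shows "\<exists>s. wspan (Xc c) s (snd c q) = UNIV" proof -
 have cc: "c \<in> charts \<A>" "q \<in> fst c" using c by (auto simp: charts_at_def)
 have ev: "\<exists>m. v c \<in> wspan (Xc c) m (snd c q)" if "v \<in> tspan {Z q | Z. Z \<in> IB}" for v using that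
 proof (rule tm.span_induct_alt)
  show "\<exists>m. (0 :: ('a, 'n) tangent) c \<in> wspan (Xc c) m (snd c q)"
   using subspace_0[OF subspace_wspan[of "Xc c" 0 "snd c q"]] by auto
 next
  fix r :: real and v w :: "('a, 'n) tangent"
  assume step: "v \<in> {Z q | Z. Z \<in> IB}" "\<exists>m. w c \<in> wspan (Xc c) m (snd c q)"
  then obtain Z where Z: "v = Z q" "Z \<in> IB" by blast
  obtain m where m: "hs c m Z" using hs_IB[OF cc(1) Z(2)] by blast
  from hspan_in_wspan[OF m chartsD(6)[OF cc]] have "v c \<in> wspan (Xc c) m (snd c q)"
   using chartsD(5)[OF cc] by (simp add: rep_def Z)
  moreover obtain k where "w c \<in> wspan (Xc c) k (snd c q)" using step by blast
  ultimately have "v c \<in> wspan (Xc c) (max m k) (snd c q)" "w c \<in> wspan (Xc c) (max m k) (snd c q)"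
   using wspan_mono[of m "max m k" "Xc c" "snd c q"] wspan_mono[of k "max m k" "Xc c" "snd c q"] by auto
  then have "r *\<^sub>R v c + w c \<in> wspan (Xc c) (max m k) (snd c q)"
   using subspace_wspan subspace_add subspace_scale by blast
  then show "\<exists>m. (tscale r v + w) c \<in> wspan (Xc c) m (snd c q)" by (auto simp: tscale_def)
 qed
 have "\<exists>m. x \<in> wspan (Xc c) m (snd c q)" for x
  using tangent_eval_surj[OF c, of x] ev unfolding span_IB_eq by blast
 then obtain m where m: "\<And>x. x \<in> wspan (Xc c) (m x) (snd c q)" by metis
 define s where "s = Max (m ` (Basis :: (real ^ 'n) set))"
 have "Basis \<subseteq> wspan (Xc c) s (snd c q)" proof
  fix b :: "real ^ 'n" assume "b \<in> Basis"
  then have "m b <= s" by (simp add: s_def)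
  then show "b \<in> wspan (Xc c) s (snd c q)" using m[of b] wspan_mono by blast
 qed
 then have "UNIV \<subseteq> wspan (Xc c) s (snd c q)"
  using span_minimal[OF _ subspace_wspan] span_Basis by metis
 then show ?thesis by blast
qed

section \<open>Growth vector and homogeneous dimension\<close>

lemma step_wspan:
 assumes c: "c \<in> charts_at \<A> q"
 shows "wspan (Xc c) j (snd c q) = UNIV \<longleftrightarrow> step \<A> \<xi> q <= j" proof -
 have st: "step \<A> \<xi> q = (LEAST j. wspan (Xc c) j (snd c q) = UNIV)"
  by (simp add: step_def flag_at_eq_iff[OF c])
 show ?thesis proof
  show "wspan (Xc c) j (snd c q) = UNIV ==> step \<A> \<xi> q <= j" unfolding st by (rule Least_le)
  assume "step \<A> \<xi> q <= j"
  moreover have "wspan (Xc c) (step \<A> \<xi> q) (snd c q) = UNIV"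
   unfolding st using wspan_UNIV_ex[OF c] by (rule LeastI_ex)
  ultimately show "wspan (Xc c) j (snd c q) = UNIV" using wspan_mono by blast
 qed
qed

text \<open>The length of the growth vector determines the step. Layers beyond it are full at both
  points, and the layer 0 is trivial.\<close>

lemma growth_vector_wspan:
 assumes c: "c \<in> charts_at \<A> p" "c \<in> charts_at \<A> q" and g: "growth_vector \<A> \<xi> p = growth_vector \<A> \<xi> q"
 shows "dim (wspan (Xc c) m (snd c p)) = dim (wspan (Xc c) m (snd c q))" proof -
 have st: "step \<A> \<xi> p = step \<A> \<xi> q" using arg_cong[OF g, of length] by (simp add: growth_vector_def del: upt_Suc)
 consider "m = 0" | "1 <= m" "m <= step \<A> \<xi> q" | "step \<A> \<xi> q < m" by linarith
 then show ?thesis proof cases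
  case 1
  have "{vf (Xc c) u (snd c q) |u. u \<noteq> [] \<and> length u <= 0} = {}" for q by auto
  then show ?thesis by (simp add: wspan_def 1)
 next
  case 2
  then have "growth_vector \<A> \<xi> p ! (m - 1) = flag_dim \<A> \<xi> m p" "growth_vector \<A> \<xi> q ! (m - 1) = flag_dim \<A> \<xi> m q"
   using st by (auto simp: growth_vector_def simp del: upt_Suc)
  then show ?thesis using g flag_dim_eq[OF c(1)] flag_dim_eq[OF c(2)] by simp
 next
  case 3
  then show ?thesis using step_wspan[OF c(1), of m] step_wspan[OF c(2), of m] st by simp
 qed
qed

text \<open>The difference of consecutive dimensions counts the words of a given length, so the
  weighted sum is the sum of all word lengths.\<close>

lemma homogeneous_dim_eq:
 fixes J :: "'n => 'k list"
 assumes c: "c \<in> charts_at \<A> q" and J: "\<And>m. card {l. length (J l) <= m} = dim (wspan (Xc c) m (snd c q))"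
 shows "homogeneous_dim \<A> \<xi> q = real (\<Sum>l\<in>UNIV. length (J l))" proof -
 let ?s = "step \<A> \<xi> q"
 have fd: "flag_dim \<A> \<xi> i q = card {l. length (J l) <= i}" for i using flag_dim_eq[OF c] J by simp
 have "card {l. length (J l) <= ?s} = CARD('n)" using J[of ?s] step_wspan[OF c, of ?s] by (simp add: dim_UNIV)
 then have "{l. length (J l) <= ?s} = UNIV" by (intro card_subset_eq) auto
 then have le: "length (J l) <= ?s" for l by auto
 have "{vf (Xc c) u (snd c q) |u. u \<noteq> [] \<and> length u <= 0} = {}" by auto
 then have "wspan (Xc c) 0 (snd c q) = {0}" unfolding wspan_def by simp
 then have "card {l. length (J l) <= 0} = 0" using J[of 0] by simp
 then have pos: "0 < length (J l)" for l by (auto)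
 have trm: "real i * (real (flag_dim \<A> \<xi> i q) - real (flag_dim \<A> \<xi> (i - 1) q)) = (\<Sum>l | l \<in> UNIV \<and> length (J l) = i. real (length (J l)))"
  if "i \<in> {1..?s}" for i proof -
  have "{l. length (J l) <= i} = {l. length (J l) <= i - 1} \<union> {l. length (J l) = i}" by auto
  then have "card {l. length (J l) <= i} = card {l. length (J l) <= i - 1} + card {l. length (J l) = i}"
   using that by (simp, subst card_Un_disjoint) auto
  then show ?thesis by (simp add: fd)
 qed
 have "homogeneous_dim \<A> \<xi> q = (\<Sum>i = 1..?s. \<Sum>l | l \<in> UNIV \<and> length (J l) = i. real (length (J l)))"
  unfolding homogeneous_dim_def by (rule sum.cong[OF refl trm])
 also have "... = (\<Sum>l\<in>UNIV. real (length (J l)))"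
  by (rule sum.group) (use le pos in \<open>auto simp: Suc_le_eq\<close>)
 finally show ?thesis by simp
qed

lemma hframe_at:
 assumes eq: "equiregular \<A> \<xi>" and c: "c \<in> charts_at \<A> q" and V: "open V" "snd c q \<in> V"
 obtains Om J vt where "snd c q \<in> Om" "Om \<subseteq> V" "Om \<subseteq> chart_image c" "hframe Om (Xc c) J vt"
  "homogeneous_dim \<A> \<xi> q = real (\<Sum>l\<in>UNIV. length (J l))" proof -
 have cc: "c \<in> charts \<A>" "q \<in> fst c" using c by (auto simp: charts_at_def)
 obtain U where U: "open U" "q \<in> U" "\<And>p. p \<in> U ==> growth_vector \<A> \<xi> p = growth_vector \<A> \<xi> q" proof -
  from eq have "\<exists>U. open U \<and> q \<in> U \<and> (\<forall>p\<in>U. growth_vector \<A> \<xi> p = growth_vector \<A> \<xi> q)"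
   unfolding equiregular_def by (rule spec)
  then show thesis using that by blast
 qed
 define W where "W = snd c ` (U \<inter> fst c) \<inter> V"
 have "open (snd c ` (U \<inter> fst c))" by (rule open_chart_subset[OF cc(1)]) (use U(1) chartsD(1)[OF cc(1)] in auto)
 then have W: "open W" "W \<subseteq> chart_image c" using V by (auto simp: W_def chart_image_def)
 have x0: "snd c q \<in> W" using U(2) cc V by (auto simp: W_def)
 obtain s where s: "wspan (Xc c) s (snd c q) = UNIV" using wspan_UNIV_ex[OF c] by blast
 have d: "dim (wspan (Xc c) m x) = dim (wspan (Xc c) m (snd c q))" if x: "x \<in> W" for x m proof -
  obtain p where p: "p \<in> U" "p \<in> fst c" "x = snd c p" using x by (auto simp: W_def)
  then show ?thesis using growth_vector_wspan[of c p q m] U(3)[OF p(1)] c by (simp add: charts_at_def)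
 qed
 show thesis
 proof (rule hframe_exists[OF W(1) x0 smooth_on_subset[OF Xc_smooth[OF cc(1)] W(2)] s d])
  fix Om J vt assume h: "snd c q \<in> Om" "Om \<subseteq> W" "hframe Om (Xc c) J vt"
   "\<And>m. card {l. length (J l) <= m} = dim (wspan (Xc c) m (snd c q))"
  show thesis
   by (rule that[OF h(1) _ _ h(3) homogeneous_dim_eq[OF c h(4)]]) (use h(2) W(2) in \<open>auto simp: W_def\<close>)
 qed
qed

lemma N_sum: "N q (\<Sum>i\<in>I. f i) <= (\<Sum>i\<in>I. N q (f i))" proof (induction I rule: infinite_finite_induct)
 case (insert i I)
 then show ?case using N_triangle[of q "f i" "\<Sum>i\<in>I. f i"] by simp
qed (use N_zero_iff[of q 0] in simp_all)

section \<open>Small balls in charts\<close>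

text \<open>Smooth dependence is given for fixed \<open>w\<close> only. The upper bound on the basis
  vectors and the triangle inequality upgrade it to joint continuity, and the minimum over
  \<open>K\<close> times the unit sphere gives the reverse bound.\<close>

lemma N_compact_bounds:
 assumes c: "c \<in> charts \<A>" and K: "compact K" "K \<subseteq> chart_image c"
 obtains C where "0 < C" "\<And>x w. x \<in> K ==> N (chart_inv c x) w <= C * norm w"
  "\<And>x w. x \<in> K ==> norm w <= C * N (chart_inv c x) w" proof -
 have nc: "continuous_on K (\<lambda>x. N (chart_inv c x) w)" for w proof -
  have "smooth_map \<A> (\<lambda>q. N q w)" using sfm unfolding sub_finsler_manifold_def by blast
  then have "smooth_on (chart_image c) ((\<lambda>q. N q w) \<circ> chart_inv c)" using c by (simp add: smooth_map_def)
  then have "continuous_on (chart_image c) (\<lambda>x. N (chart_inv c x) w)"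
   using smooth_on_continuous by (fastforce simp: o_def)
  then show ?thesis using K(2) by (rule continuous_on_subset)
 qed
 have "\<exists>b. \<forall>x\<in>K. N (chart_inv c x) (axis i 1) <= b" for i proof -
  have "bounded ((\<lambda>x. N (chart_inv c x) (axis i 1)) ` K)"
   using nc K(1) by (intro compact_imp_bounded compact_continuous_image)
  then show ?thesis unfolding bounded_iff by (auto dest: abs_le_D1)
 qed
 then obtain b where b: "\<And>i x. x \<in> K ==> N (chart_inv c x) (axis i 1) <= b i" by metis
 define C1 where "C1 = (\<Sum>i\<in>UNIV. max 0 (b i))"
 have C10: "0 <= C1" unfolding C1_def by (intro sum_nonneg) auto
 have up: "N (chart_inv c x) w <= C1 * norm w" if x: "x \<in> K" for x w proof -
  have "N (chart_inv c x) w = N (chart_inv c x) (\<Sum>i\<in>UNIV. w $ i *\<^sub>R axis i 1)"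
   using basis_expansion[of w] by (simp add: scalar_mult_eq_scaleR)
  also have "... <= (\<Sum>i\<in>UNIV. N (chart_inv c x) (w $ i *\<^sub>R axis i 1))" by (rule N_sum)
  also have "... <= (\<Sum>i\<in>UNIV. norm w * max 0 (b i))" unfolding N_scale
   by (intro sum_mono mult_mono component_le_norm_cart N_nonneg) (use b[OF x] in \<open>auto simp: le_max_iff_disj\<close>)
  finally show ?thesis by (simp add: C1_def sum_distrib_left mult.commute)
 qed
 show thesis proof (cases "K = {}")
  case True
  then show thesis by (intro that[of 1]) auto
 next
  case False
  let ?S = "K \<times> sphere (0 :: real ^ 'k) 1"
  let ?h = "\<lambda>z. N (chart_inv c (fst z)) (snd z)"
  have Sne: "?S \<noteq> {}" using False vector_choose_size[of 1, where 'a = "real ^ 'k"] by (auto simp: sphere_def dist_norm)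
  have Sc: "compact ?S" using K(1) by (intro compact_Times compact_sphere)
  have "continuous_on ?S ?h" unfolding continuous_on_def proof
   fix z0 assume z0: "z0 \<in> ?S"
   obtain x0 w0 where zz: "z0 = (x0, w0)" by fastforce
   \<comment> \<open>A majorant of the change of the norm: its first term bounds the change of the
     vector, its second the change of the base point with the vector frozen.\<close>
   let ?g = "\<lambda>z :: (real ^ 'n) \<times> (real ^ 'k). C1 * norm (snd z - w0) + \<bar>N (chart_inv c (fst z)) w0 - N (chart_inv c x0) w0\<bar>"
   have "continuous_on ?S (\<lambda>z. N (chart_inv c (fst z)) w0)"
    by (rule continuous_on_compose2[OF nc continuous_on_fst[OF continuous_on_id]]) auto
   then have "continuous_on ?S ?g" by (intro continuous_intros)
   then have "(?g \<longlongrightarrow> ?g z0) (at z0 within ?S)" using z0 unfolding continuous_on_def by blast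
   then have g0: "(?g \<longlongrightarrow> 0) (at z0 within ?S)" by (simp add: zz)
   have "((\<lambda>z. ?h z - ?h z0) \<longlongrightarrow> 0) (at z0 within ?S)" proof (rule Lim_null_comparison[OF _ g0])
    have "norm (?h z - ?h z0) <= ?g z" if z: "z \<in> ?S" for z proof -
     have "?h z <= N (chart_inv c (fst z)) (snd z - w0) + N (chart_inv c (fst z)) w0"
      using N_triangle[of "chart_inv c (fst z)" "snd z - w0" w0] by simp
     moreover have "N (chart_inv c (fst z)) w0 <= N (chart_inv c (fst z)) (w0 - snd z) + ?h z"
      using N_triangle[of "chart_inv c (fst z)" "w0 - snd z" "snd z"] by simp
     moreover have "N (chart_inv c (fst z)) (snd z - w0) <= C1 * norm (snd z - w0)"
      "N (chart_inv c (fst z)) (w0 - snd z) <= C1 * norm (snd z - w0)"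
      using up[of "fst z" "snd z - w0"] up[of "fst z" "w0 - snd z"] z by (auto simp: norm_minus_commute)
     ultimately show ?thesis by (simp add: zz)
    qed
    then show "\<forall>\<^sub>F z in at z0 within ?S. norm (?h z - ?h z0) <= ?g z"
     unfolding eventually_at_filter by (auto intro!: always_eventually)
   qed
   then show "(?h \<longlongrightarrow> ?h z0) (at z0 within ?S)" by (rule LIM_zero_cancel)
  qed
  from continuous_attains_inf[OF Sc Sne this] obtain zm where zm: "zm \<in> ?S" "\<And>z. z \<in> ?S ==> ?h zm <= ?h z" by blast
  define m where "m = ?h zm"
  have m: "0 < m" proof -
   have "snd zm \<noteq> 0" using zm(1) by auto
   then show ?thesis using N_nonneg[of "chart_inv c (fst zm)" "snd zm"] N_zero_iff[of "chart_inv c (fst zm)" "snd zm"]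
    unfolding m_def by linarith
  qed
  have lo: "m * norm w <= N (chart_inv c x) w" if x: "x \<in> K" for x w proof (cases "w = 0")
   case False
   have "(x, (1 / norm w) *\<^sub>R w) \<in> ?S" using x False by simp
   from zm(2)[OF this] have "m <= N (chart_inv c x) ((1 / norm w) *\<^sub>R w)" by (simp add: m_def)
   then have "m <= (1 / norm w) * N (chart_inv c x) w" by (simp add: N_scale)
   then show ?thesis using False by (simp add: field_simps)
  qed (use N_nonneg in simp)
  show thesis proof (rule that[of "max 1 (max C1 (1 / m))"])
   fix x w assume x: "x \<in> K"
   have "N (chart_inv c x) w <= C1 * norm w" by (rule up[OF x])
   also have "... <= max 1 (max C1 (1 / m)) * norm w" by (intro mult_right_mono) auto
   finally show "N (chart_inv c x) w <= max 1 (max C1 (1 / m)) * norm w" .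
   have "norm w = (1 / m) * (m * norm w)" using m by simp
   also have "... <= (1 / m) * N (chart_inv c x) w" using m lo[OF x] by (intro mult_left_mono) auto
   also have "... <= max 1 (max C1 (1 / m)) * N (chart_inv c x) w" by (intro mult_right_mono N_nonneg) auto
   finally show "norm w <= max 1 (max C1 (1 / m)) * N (chart_inv c x) w" .
  qed auto
 qed
qed

section \<open>Admissible curves seen in a chart\<close>

lemma chart_curve_derivative:
 assumes c: "c \<in> charts \<A>" and y: "y s \<in> chart_image c" and c': "c' \<in> charts_at \<A> (chart_inv c (y s))"
  and d: "(y has_vector_derivative \<xi> (chart_inv c (y s)) u c) (at s within S)"
 shows "((snd c' \<circ> (\<lambda>s. chart_inv c (y s))) has_vector_derivative \<xi> (chart_inv c (y s)) u c') (at s within S)"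
proof -
 let ?q = "chart_inv c (y s)"
 have cq: "c \<in> charts_at \<A> ?q" and yq: "snd c ?q = y s" using chartsD(7,8)[OF c y] c by (auto simp: charts_at_def)
 have "(transition c c' has_derivative frechet_derivative (transition c c') (at (y s))) (at (y s))"
  using transition_differentiable[OF cq c'] unfolding yq frechet_derivative_works .
 from vector_derivative_diff_chain_within[OF d has_derivative_at_withinI[OF this]]
 have "((transition c c' \<circ> y) has_vector_derivative frechet_derivative (transition c c') (at (y s)) (\<xi> ?q u c)) (at s within S)" .
 moreover have "\<xi> ?q u c' = frechet_derivative (transition c c') (at (snd c ?q)) (\<xi> ?q u c)"
  using xi_tangent[of ?q u] cq c' unfolding tangent_space_def by blast
 then have "\<xi> ?q u c' = frechet_derivative (transition c c') (at (y s)) (\<xi> ?q u c)" unfolding yq .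
 ultimately show ?thesis by (simp add: transition_def o_def)
qed

text \<open>The control is the constant \<open>axis i 1\<close>. In every chart the curve has a
  continuous derivative on compact pieces, hence is Lipschitz and absolutely continuous
  there.\<close>

lemma adm_integral_curve:
 assumes c: "c \<in> charts \<A>" and ab: "a < b" and y: "\<And>s. s \<in> {a..b} ==> y s \<in> chart_image c"
  and d: "\<And>s. s \<in> {a..b} ==> (y has_vector_derivative Xc c i (y s)) (at s within {a..b})"
  and C: "\<And>s. s \<in> {a..b} ==> N (chart_inv c (y s)) (axis i 1) <= C"
 shows "adm a b (\<lambda>s. chart_inv c (y s))" "len a b (\<lambda>s. chart_inv c (y s)) <= ennreal (C * (b - a))"
proof -
 let ?g = "\<lambda>s. chart_inv c (y s)"
 have d': "((snd c' \<circ> ?g) has_vector_derivative \<xi> (?g s) (axis i 1) c') (at s within {a..b})"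
  if "s \<in> {a..b}" "c' \<in> charts_at \<A> (?g s)" for s c'
  by (rule chart_curve_derivative[where y = y and s = s, OF c y[OF that(1)] that(2)])
    (use d[OF that(1)] in \<open>simp add: Xc_eq\<close>)
 have yc: "continuous_on {a..b} y"
  unfolding continuous_on_eq_continuous_within by (rule ballI, rule has_vector_derivative_continuous[OF d])
 have gc: "continuous_on {a..b} ?g"
  by (rule continuous_on_compose2[OF chartsD(4)[OF c] yc]) (use y in auto)
 have vel: "AE t in lebesgue. t \<in> {a..b} --> vel_at ?g (\<xi> (?g t) (axis i 1)) t"
  using AE_interior[of a b] proof eventually_elim
  case (elim t)
  show ?case unfolding vel_at_def proof (intro impI conjI ballI xi_tangent)
   fix c' assume t: "t \<in> {a..b}" and c': "c' \<in> charts_at \<A> (?g t)"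
   from d'[OF this] show "((snd c' \<circ> ?g) has_vector_derivative \<xi> (?g t) (axis i 1) c') (at t)"
    using elim t at_within_Icc_at[of a t b] by simp
  qed
 qed
 show "adm a b ?g" unfolding adm_def proof (intro conjI exI ballI allI impI)
  show "(\<lambda>_. axis i 1 :: real ^ 'k) \<in> borel_measurable lebesgue" by simp
  show "integrable lebesgue (\<lambda>t. indicator {a..b} t *\<^sub>R (norm (axis i 1 :: real ^ 'k))\<^sup>2)"
   by (simp, rule integrable_real_indicator) (use ab in auto)
 next
  fix c' s t assume c': "c' \<in> charts \<A>" and st: "a <= s \<and> s <= t \<and> t <= b \<and> ?g ` {s..t} \<subseteq> fst c'"
  let ?x = "snd c' \<circ> ?g"
  have at: "c' \<in> charts_at \<A> (?g r)" if "r \<in> {s..t}" for r using st c' that by (auto simp: charts_at_def)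
  have xc: "continuous_on {s..t} ?x"
   by (rule continuous_on_compose[OF continuous_on_subset[OF gc] continuous_on_subset[OF chartsD(3)[OF c']]]) (use st in auto)
  have xim: "?x ` {s..t} \<subseteq> chart_image c'" using st by (auto simp: chart_image_def)
  have "continuous_on {s..t} (\<lambda>r. Xc c' i (?x r))"
   by (rule continuous_on_compose2[OF smooth_on_continuous[OF Xc_smooth[OF c']] xc xim])
  then have "bounded ((\<lambda>r. Xc c' i (?x r)) ` {s..t})" by (intro compact_imp_bounded compact_continuous_image) auto
  then obtain M where M: "\<And>r. r \<in> {s..t} ==> norm (Xc c' i (?x r)) <= M"
   unfolding bounded_iff by blast
  have XX: "Xc c' i (?x r) = \<xi> (?g r) (axis i 1) c'" if "r \<in> {s..t}" for r
   using rep_at[OF c', of "?g r"] at[OF that] by (simp add: Xc_def charts_at_def generating_field_def)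
  show "ac_on s t ?x" proof (rule ac_on_lipschitz)
   fix r r' assume r: "r \<in> {s..t}" "r' \<in> {s..t}"
   have "norm (?x r - ?x r') <= M * \<bar>r - r'\<bar>"
   proof (rule vector_derivative_bound[where S = "{s..t}"])
    show "(?x has_vector_derivative Xc c' i (?x q)) (at q within {s..t})" if "q \<in> {s..t}" for q
     unfolding XX[OF that]
     by (rule has_vector_derivative_within_subset[OF d'[OF _ at[OF that]]]) (use that st in auto)
   qed (use M r in auto)
   then show "dist (?x r) (?x r') <= M * \<bar>r - r'\<bar>" by (simp add: dist_norm)
  qed
 qed (rule gc vel)+
 have "len a b ?g <= (\<integral>\<^sup>+t. ennreal C * indicator {a..b} t \<partial>lebesgue)" unfolding len_def
 proof (rule nn_integral_mono_AE)
  show "AE t in lebesgue. spd ?g t * indicator {a..b} t <= ennreal C * indicator {a..b} t"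
   using vel proof eventually_elim
   case (elim t)
   show ?case proof (cases "t \<in> {a..b}")
    case True
    with elim have "vel_at ?g (\<xi> (?g t) (axis i 1)) t" by blast
    then have "spd ?g t = ennreal (hn (?g t) (\<xi> (?g t) (axis i 1)))" unfolding spd_def by (simp only: the_vel)
    also have "... <= ennreal C" by (intro ennreal_leI order_trans[OF hn_le C[OF True]])
    finally show ?thesis using True by simp
   qed simp
  qed
 qed
 also have "... = ennreal C * ennreal (b - a)" using ab by (subst nn_integral_cmult_indicator) auto
 also have "... = ennreal (C * (b - a))" proof -
  have "0 <= C" using C[of a] N_nonneg[of "chart_inv c (y a)" "axis i 1"] ab by auto
  then show ?thesis using ab by (simp add: ennreal_mult)
 qed
 finally show "len a b ?g <= ennreal (C * (b - a))" .
qed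

text \<open>For almost every time the derivative of \<open>g\<close> along the curve is bounded by a
  multiple of \<open>N\<close> at every \<open>w\<close> representing the velocity, hence by the
  infimum \<open>hn\<close>. Absolute continuity then integrates this bound.\<close>

lemma adm_change_bound:
 assumes c: "c \<in> charts \<A>" and a: "adm a b gm" "a <= b" and im: "\<And>t. t \<in> {a..b} ==> gm t \<in> fst c \<and> snd c (gm t) \<in> K"
  and K: "compact K" "convex K" "K \<subseteq> Om" "Om \<subseteq> chart_image c" "open Om"
  and C0: "0 < C0" "\<And>x w. x \<in> K ==> norm w <= C0 * N (chart_inv c x) w"
  and g: "smooth_on Om g" and M: "\<And>t i. t \<in> {a..b} ==> \<bar>der (Xc c i) g (snd c (gm t))\<bar> <= M"
  and l: "0 <= l" "len a b gm <= ennreal l"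
 shows "\<bar>g (snd c (gm b)) - g (snd c (gm a))\<bar> <= l * (real CARD('k) * C0 * M)"
proof (rule field_le_epsilon)
 fix e :: real assume e: "0 < e"
 let ?y = "snd c \<circ> gm"
 let ?k = "real CARD('k) * C0"
 have k: "0 < ?k" using C0 by simp
 have M0: "0 <= M" using M[of a undefined] a(2) by force
 \<comment> \<open>The derivative bound requires a positive factor, while \<open>M\<close> may be 0.
   The increment is small enough to change the final estimate by at most \<open>e\<close>.\<close>
 define M' where "M' = M + e / (?k * (l + 1))"
 have M': "0 < M'" "M <= M'" unfolding M'_def using M0 e k l(1) by (auto intro!: add_nonneg_pos divide_nonneg_pos)
 have yac: "ac_on a b ?y" using a c im unfolding adm_def by (metis (no_types, lifting) image_subsetI order_refl)
 obtain L where L: "\<And>x z. x \<in> K ==> z \<in> K ==> norm (g x - g z) <= L * norm (x - z)"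
  using smooth_lipschitz[OF K(1-3,5) g] by blast
 have gac: "ac_on a b (\<lambda>t. g (?y t))"
  by (rule ac_on_lipschitz_comp[OF yac, of K g L]) (use im L in \<open>auto simp: dist_norm\<close>)
 from a obtain u where u: "AE t in lebesgue. t \<in> {a..b} --> vel_at gm (\<xi> (gm t) (u t)) t"
  by (auto simp: adm_def)
 have "\<bar>g (?y b) - g (?y a)\<bar> <= l * (?k * M')"
 proof (rule ac_on_derivative_bound[OF a(2) gac _ l(1)])
  show "AE t in lebesgue_on {a..b}. \<exists>D. ((\<lambda>t. g (?y t)) has_real_derivative D) (at t) \<and> ennreal \<bar>D\<bar> <= ennreal (?k * M') * spd gm t"
  proof (subst AE_restrict_space_iff)
   show "AE t in lebesgue. t \<in> {a..b} --> (\<exists>D. ((\<lambda>t. g (?y t)) has_real_derivative D) (at t) \<and> ennreal \<bar>D\<bar> <= ennreal (?k * M') * spd gm t)"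
   using u proof eventually_elim
   case (elim t)
   show ?case proof
    assume t: "t \<in> {a..b}"
    with elim have v: "vel_at gm (\<xi> (gm t) (u t)) t" by blast
    let ?x = "?y t"
    have tc: "gm t \<in> fst c" "?x \<in> K" "?x \<in> Om" using im[OF t] K(3) by auto
    have inv: "chart_inv c ?x = gm t" using chartsD(5)[OF c tc(1)] by simp
    have ca: "c \<in> charts_at \<A> (gm t)" using c tc by (simp add: charts_at_def)
    define D where "D = frechet_derivative g (at ?x) (\<xi> (gm t) (u t) c)"
    have "(?y has_vector_derivative \<xi> (gm t) (u t) c) (at t)" using v ca unfolding vel_at_def by blast
    from vector_derivative_diff_chain_within[OF this has_derivative_at_withinI[OF smooth_on_has_derivative[OF g tc(3)]]]
    have d: "((\<lambda>t. g (?y t)) has_real_derivative D) (at t)"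
     by (simp add: D_def o_def has_real_derivative_iff_has_vector_derivative)
    have Db: "\<bar>D\<bar> <= ?k * M' * N (gm t) w" if w: "\<xi> (gm t) w = \<xi> (gm t) (u t)" for w proof -
     interpret g: linear "frechet_derivative g (at ?x)"
      using smooth_on_has_derivative[OF g tc(3)] has_derivative_linear by blast
     have e: "\<xi> (gm t) w c = (\<Sum>i\<in>UNIV. w $ i *\<^sub>R Xc c i ?x)" using xi_chart[of c ?x w] unfolding inv .
     have "D = (\<Sum>i\<in>UNIV. w $ i * der (Xc c i) g ?x)"
      unfolding D_def w[symmetric] e der_def by (simp only: g.sum g.scaleR real_scaleR_def)
     also have "\<bar>...\<bar> <= (\<Sum>i\<in>UNIV. \<bar>w $ i * der (Xc c i) g ?x\<bar>)" by (rule sum_abs)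
     also have "... <= (\<Sum>i\<in>(UNIV :: 'k set). norm w * M')"
      unfolding abs_mult using M[OF t] M' by (intro sum_mono mult_mono component_le_norm_cart) (auto intro: order_trans)
     also have "... = real CARD('k) * (norm w * M')" by simp
     also have "... <= real CARD('k) * ((C0 * N (gm t) w) * M')"
      using C0(2)[OF tc(2), of w] M' unfolding inv by (intro mult_left_mono mult_right_mono) auto
     finally show ?thesis by (simp add: mult_ac)
    qed
    have "\<bar>D\<bar> / (?k * M') <= hn (gm t) (\<xi> (gm t) (u t))"
     by (rule hn_greatest) (use Db k M' in \<open>simp add: pos_divide_le_eq mult.commute\<close>)
    then have "\<bar>D\<bar> <= ?k * M' * hn (gm t) (\<xi> (gm t) (u t))" using k M' by (simp add: pos_divide_le_eq mult.commute)
    then have "ennreal \<bar>D\<bar> <= ennreal (?k * M') * ennreal (hn (gm t) (\<xi> (gm t) (u t)))"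
     using k M' by (simp flip: ennreal_mult' add: ennreal_leI)
    then have "ennreal \<bar>D\<bar> <= ennreal (?k * M') * spd gm t" unfolding spd_def the_vel[OF v] .
    with d show "\<exists>D. ((\<lambda>t. g (?y t)) has_real_derivative D) (at t) \<and> ennreal \<bar>D\<bar> <= ennreal (?k * M') * spd gm t" by blast
   qed
  qed
  qed simp
  show "(\<integral>\<^sup>+ t. spd gm t \<partial>lebesgue_on {a..b}) <= ennreal l"
   using l(2) by (simp add: len_def nn_integral_restrict_space)
 qed (use k M' in simp)
 also have "l * (?k * M') = l * (?k * M) + l * (e / (l + 1))" proof -
  have "?k * (e / (?k * (l + 1))) = e / (l + 1)" using C0(1) by simp
  then have "?k * M' = ?k * M + e / (l + 1)" by (simp add: M'_def distrib_left)
  then show ?thesis by (simp add: distrib_left)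
 qed
 also have "l * (e / (l + 1)) <= e" using l(1) e by (simp add: field_simps)
 finally show "\<bar>g (snd c (gm b)) - g (snd c (gm a))\<bar> <= l * (?k * M) + e" by simp
qed

text \<open>Up to the first exit from a smaller ball the speed bound applies, and it shows that a
  short curve has not yet reached the boundary.\<close>

lemma short_curves:
 assumes c: "c \<in> charts \<A>" and op: "open Om" and Om: "Om \<subseteq> chart_image c" and R: "0 < R" "cball x0 R \<subseteq> Om"
 obtains C where "0 < C"
  "\<And>p gm l t. p \<in> cball x0 (R / 2) ==> adm 0 1 gm ==> gm 0 = chart_inv c p ==> len 0 1 gm <= ennreal l ==> 0 <= l ==>
   C * l < R / 2 ==> t \<in> {0..1} ==> gm t \<in> fst c \<and> snd c (gm t) \<in> cball p (C * l)"
  "\<And>p gm l t g M. p \<in> cball x0 (R / 2) ==> adm 0 1 gm ==> gm 0 = chart_inv c p ==> len 0 1 gm <= ennreal l ==> 0 <= l ==>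
   C * l < R / 2 ==> smooth_on Om g ==> (\<And>t i. t \<in> {0..1} ==> \<bar>der (Xc c i) g (snd c (gm t))\<bar> <= M) ==>
   t \<in> {0..1} ==> \<bar>g (snd c (gm t)) - g p\<bar> <= C * l * M" proof -
 let ?K = "cball x0 R"
 have Kc: "?K \<subseteq> chart_image c" using R Om by blast
 obtain C0 where C0: "0 < C0" "\<And>x w. x \<in> ?K ==> N (chart_inv c x) w <= C0 * norm w"
   "\<And>x w. x \<in> ?K ==> norm w <= C0 * N (chart_inv c x) w"
  using N_compact_bounds[OF c compact_cball Kc] by blast
 have "\<exists>b. \<forall>x\<in>?K. norm (Xc c i x) <= b" for i proof -
  have "continuous_on ?K (Xc c i)" by (rule continuous_on_subset[OF smooth_on_continuous[OF Xc_smooth[OF c]] Kc])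
  then have "bounded (Xc c i ` ?K)" by (intro compact_imp_bounded compact_continuous_image) auto
  then show ?thesis by (auto simp: bounded_iff)
 qed
 then obtain b where b: "\<And>i x. x \<in> ?K ==> norm (Xc c i x) <= b i" by metis
 define B where "B = (\<Sum>i\<in>UNIV. max 0 (b i))"
 have B0: "0 <= B" unfolding B_def by (intro sum_nonneg) auto
 have B: "norm (Xc c i x) <= B" if "x \<in> ?K" for i x proof -
  have "norm (Xc c i x) <= max 0 (b i)" using b[OF that] by (simp add: le_max_iff_disj)
  also have "... <= B" unfolding B_def by (rule member_le_sum) auto
  finally show ?thesis .
 qed
 let ?k = "real CARD('k) * C0" and ?n = "real CARD('n)"
 have k: "0 < ?k" using C0 by simp
 \<comment> \<open>The first summand serves functions with bounded horizontal derivatives, the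
   second the displacement, which is estimated coordinate by coordinate.\<close>
 define C where "C = ?k * (1 + ?n * B)"
 have C: "0 < C" "?k <= C" "?n * (?k * B) <= C"
  using C0(1) B0 by (auto simp: C_def algebra_simps intro!: add_pos_nonneg mult_nonneg_nonneg)
 have pK: "cball p (R / 2) \<subseteq> ?K" if "p \<in> cball x0 (R / 2)" for p proof
  fix x assume "x \<in> cball p (R / 2)"
  then show "x \<in> ?K" using that dist_triangle[of x0 x p] by (simp add: mem_cball)
 qed
 have start: "snd c (chart_inv c p) = p" "chart_inv c p \<in> fst c" if "p \<in> cball x0 (R / 2)" for p
  using chartsD(7,8)[OF c, of p] pK[OF that] that Kc R by (auto simp: subset_iff)
 have key: "\<bar>g (snd c (gm t)) - g p\<bar> <= l * (?k * M)"
  if p: "p \<in> cball x0 (R / 2)" and gm: "adm 0 1 gm" "gm 0 = chart_inv c p" "len 0 1 gm <= ennreal l" "0 <= l"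
   and t: "t \<in> {0..1}" and im: "\<And>s. s \<in> {0..t} ==> gm s \<in> fst c \<and> snd c (gm s) \<in> ?K"
   and g: "smooth_on Om g" "\<And>s i. s \<in> {0..t} ==> \<bar>der (Xc c i) g (snd c (gm s))\<bar> <= M" for p gm l t g M
 proof -
  have "adm 0 t gm" "len 0 t gm <= ennreal l" using adm_subset[OF gm(1), of 0 t] t gm(3) by auto
  from adm_change_bound[OF c this(1) _ im compact_cball convex_cball R(2) Om op C0(1) C0(3) g gm(4) this(2)]
  show ?thesis using t by (simp add: gm(2) start[OF p])
 qed
 have keyn: "norm (snd c (gm t) - p) <= C * l"
  if p: "p \<in> cball x0 (R / 2)" and gm: "adm 0 1 gm" "gm 0 = chart_inv c p" "len 0 1 gm <= ennreal l" "0 <= l"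
   and t: "t \<in> {0..1}" and im: "\<And>s. s \<in> {0..t} ==> gm s \<in> fst c \<and> snd c (gm s) \<in> ?K" for p gm l t
 proof -
  have "\<bar>snd c (gm t) $ j - p $ j\<bar> <= l * (?k * B)" for j
  proof (rule key[OF p gm t im, of "\<lambda>x. x $ j"])
   show sm: "smooth_on Om (\<lambda>x :: real ^ 'n. x $ j)" by (intro smooth_on_bounded_linear bounded_linear_vec_nth op)
   fix s i assume s: "s \<in> {0..t}"
   let ?x = "snd c (gm s)"
   have "der (Xc c i) (\<lambda>x. x $ j) ?x = Xc c i ?x $ j"
    by (rule der_unique[OF bounded_linear_imp_has_derivative[OF bounded_linear_vec_nth]])
   then show "\<bar>der (Xc c i) (\<lambda>x. x $ j) ?x\<bar> <= B"
    using component_le_norm_cart[of "Xc c i ?x" j] B[of ?x i] im[OF s] by simp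
  qed
  then have "(\<Sum>j\<in>UNIV. \<bar>(snd c (gm t) - p) $ j\<bar>) <= (\<Sum>j\<in>(UNIV :: 'n set). l * (?k * B))" by (intro sum_mono) simp
  also have "... = (?n * (?k * B)) * l" by simp
  also have "... <= C * l" using C(3) gm(4) by (rule mult_right_mono)
  finally show ?thesis using norm_le_l1_cart[of "snd c (gm t) - p"] by linarith
 qed
 have stay: "gm t \<in> fst c \<and> snd c (gm t) \<in> ball p (R / 2)"
  if p: "p \<in> cball x0 (R / 2)" and gm: "adm 0 1 gm" "gm 0 = chart_inv c p" "len 0 1 gm <= ennreal l" "0 <= l"
   and Cl: "C * l < R / 2" and t: "t \<in> {0..1}" for p gm l t proof (rule ccontr)
  define G where "G = fst c \<inter> snd c -` ball p (R / 2)"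
  \<comment> \<open>At the exit time the curve might leave the chart domain. The image of the closed
    ball is compact, hence closed in the Hausdorff space \<open>M\<close>, and so it still contains
    the exit point.\<close>
  let ?Q = "chart_inv c ` cball p (R / 2)"
  assume neg: "\<not> ?thesis"
  have G: "open G" unfolding G_def by (rule continuous_open_preimage[OF chartsD(3,1)[OF c] open_ball])
  have "cball p (R / 2) \<subseteq> chart_image c" using pK[OF p] Kc by blast
  then have "compact ?Q" using continuous_on_subset[OF chartsD(4)[OF c]] by (intro compact_continuous_image) auto
  then have Q: "closed ?Q" by (rule compact_imp_closed)
  have gc: "continuous_on {0..1} gm" using gm(1) by (simp add: adm_def)
  have "closed ({0..1} \<inter> gm -` (- G))"
   by (rule continuous_closed_preimage[OF gc]) (use G in \<open>simp_all add: closed_Compl\<close>)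
  then have "compact ({0..1} \<inter> gm -` (- G))"
   using bounded_subset[OF bounded_closed_interval, of "{0..1} \<inter> gm -` (- G)" 0 1]
   by (simp add: compact_eq_bounded_closed)
  moreover have "{0..1} \<inter> gm -` (- G) \<noteq> {}" using t neg by (auto simp: G_def)
  ultimately obtain T where T: "T \<in> {0..1}" "gm T \<notin> G" "\<And>s. s \<in> {0..1} ==> gm s \<notin> G ==> T <= s"
   using compact_attains_inf[of "{0..1} \<inter> gm -` (- G)"] by blast
  have "gm 0 \<in> G" using start[OF p] R by (simp add: gm(2) G_def)
  then have T0: "0 < T" using T(1,2) by (cases "T = 0") auto
  have lt: "gm s \<in> G" if "s \<in> {0..<T}" for s using T(1) T(3)[of s] that by force
  have GQ: "G \<subseteq> ?Q" proof
   fix q assume "q \<in> G"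
   then have "q = chart_inv c (snd c q)" "snd c q \<in> cball p (R / 2)" using chartsD(5)[OF c, of q] by (auto simp: G_def)
   then show "q \<in> ?Q" by blast
  qed
  have "closed ({0..T} \<inter> gm -` ?Q)"
   by (rule continuous_closed_preimage[OF continuous_on_subset[OF gc] _ Q]) (use T(1) in auto)
  moreover have "{0..<T} \<subseteq> {0..T} \<inter> gm -` ?Q" using lt GQ by fastforce
  ultimately have "closure {0..<T} \<subseteq> {0..T} \<inter> gm -` ?Q" by (intro closure_minimal)
  then have inQ: "gm s \<in> ?Q" if "s \<in> {0..T}" for s using T0 that by auto
  have im: "gm s \<in> fst c \<and> snd c (gm s) \<in> cball p (R / 2)" if s: "s \<in> {0..T}" for s proof -
   obtain x where x: "x \<in> cball p (R / 2)" "gm s = chart_inv c x" using inQ[OF s] by blast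
   then have "x \<in> chart_image c" using pK[OF p] Kc by blast
   then show ?thesis using chartsD(7,8)[OF c] x by simp
  qed
  have "norm (snd c (gm T) - p) <= C * l" by (rule keyn[OF p gm T(1)]) (use im pK[OF p] in blast)
  then have "snd c (gm T) \<in> ball p (R / 2)" using Cl by (simp add: dist_norm norm_minus_commute)
  then show False using T(2) im[of T] T0 by (simp add: G_def)
 qed
 show thesis proof (rule that[OF C(1)])
  fix p gm l and t :: real assume *: "p \<in> cball x0 (R / 2)" "adm 0 1 gm" "gm 0 = chart_inv c p" "len 0 1 gm <= ennreal l" "0 <= l"
   "C * l < R / 2" and t: "t \<in> {0..1}"
  have im: "gm s \<in> fst c \<and> snd c (gm s) \<in> ?K" if "s \<in> {0..t}" for s proof -
   have "s \<in> {0..1}" using that t by auto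
   from stay[OF * this] show ?thesis using pK[OF *(1)] ball_subset_cball[of p "R / 2"] by blast
  qed
  from keyn[OF *(1-5) t im] show "gm t \<in> fst c \<and> snd c (gm t) \<in> cball p (C * l)"
   using im[of t] t by (auto simp: dist_norm norm_minus_commute)
  fix g and M :: real assume g: "smooth_on Om g" "\<And>t i. t \<in> {0..1} ==> \<bar>der (Xc c i) g (snd c (gm t))\<bar> <= M"
  have "\<bar>der (Xc c undefined) g (snd c (gm 0))\<bar> <= M" by (rule g(2)) simp
  then have "0 <= M" by linarith
  have "\<bar>g (snd c (gm t)) - g p\<bar> <= l * (?k * M)" by (rule key[OF *(1-5) t im g(1)]) (use g(2) t in auto)
  also have "... <= l * (C * M)" using C(2) \<open>0 <= M\<close> *(5) by (intro mult_left_mono mult_right_mono) auto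
  finally show "\<bar>g (snd c (gm t)) - g p\<bar> <= C * l * M" by (simp add: mult_ac)
 qed
qed

lemma flow_dE:
 assumes c: "c \<in> charts \<A>" and Om: "Om \<subseteq> chart_image c" and fl: "flows Om (Xc c) x0 R B ta fi"
  and C: "0 < C" "\<And>x i. x \<in> cball x0 R ==> N (chart_inv c x) (axis i 1) <= C"
  and t: "\<bar>t\<bar> <= ta" "norm (x - x0) + B * \<bar>t\<bar> <= R"
 shows "dE (chart_inv c x) (chart_inv c (fi i t x)) <= ennreal (C * \<bar>t\<bar>)" proof -
 interpret fl: flows Om "Xc c" x0 R B ta fi by (rule fl)
 have near: "fi i s x \<in> cball x0 R" if "\<bar>s\<bar> <= \<bar>t\<bar>" for s proof -
  have "norm (fi i s x - x) <= B * \<bar>s\<bar>" using that t by (intro fl.flow_near) simp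
  also have "... <= B * \<bar>t\<bar>" using that fl.B by (intro mult_left_mono) auto
  finally show ?thesis using t(2) norm_triangle_ineq[of "fi i s x - x" "x - x0"] by (simp add: dist_norm norm_minus_commute)
 qed
 have im: "fi i s x \<in> chart_image c" if "\<bar>s\<bar> <= \<bar>t\<bar>" for s using near[OF that] fl.R(2) Om by blast
 have d: "((\<lambda>s. fi i s x) has_vector_derivative Xc c i (fi i s x)) (at s within {a..b})"
  if "s \<in> {a..b}" "- \<bar>t\<bar> <= a" "b <= \<bar>t\<bar>" for s a b
 proof (rule has_vector_derivative_within_subset[OF fl.flow_deriv])
  have s: "\<bar>s\<bar> <= \<bar>t\<bar>" using that by auto
  then show "\<bar>s\<bar> <= ta" using t by simp
  have "B * \<bar>s\<bar> <= B * \<bar>t\<bar>" using s fl.B by (intro mult_left_mono) auto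
  then show "norm (x - x0) + B * \<bar>s\<bar> <= R" using t by simp
  show "{a..b} \<subseteq> {- ta..ta}" using that t by auto
 qed
 consider "t = 0" | "0 < t" | "t < 0" by linarith
 then show ?thesis proof cases
  case 1
  then show ?thesis by (simp add: fl.flow0 dE_refl)
 next
  case 2
  have i: "fi i s x \<in> chart_image c" "N (chart_inv c (fi i s x)) (axis i 1) <= C" if "s \<in> {0..t}" for s
   using im[of s] C(2)[OF near[of s]] that by auto
  note a = adm_integral_curve[OF c 2 i(1) d i(2)]
  have "adm 0 t (\<lambda>s. chart_inv c (fi i s x))" "len 0 t (\<lambda>s. chart_inv c (fi i s x)) <= ennreal (C * (t - 0))"
   by (rule a; use 2 in auto)+
  then show ?thesis using dE_le[OF _ 2, of "\<lambda>s. chart_inv c (fi i s x)"] 2 by (simp add: fl.flow0)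
 next
  case 3
  have i: "fi i s x \<in> chart_image c" "N (chart_inv c (fi i s x)) (axis i 1) <= C" if "s \<in> {t..0}" for s
   using im[of s] C(2)[OF near[of s]] that by auto
  note a = adm_integral_curve[OF c 3 i(1) d i(2)]
  have "adm t 0 (\<lambda>s. chart_inv c (fi i s x))" "len t 0 (\<lambda>s. chart_inv c (fi i s x)) <= ennreal (C * (0 - t))"
   by (rule a; use 3 in auto)+
  then show ?thesis using dE_le[OF _ 3, of "\<lambda>s. chart_inv c (fi i s x)"] 3 dE_sym by (simp add: fl.flow0)
 qed
qed

lemma endp_dE:
 assumes c: "c \<in> charts \<A>" and Om: "Om \<subseteq> chart_image c" and fl: "flows Om (Xc c) x0 R B ta fi"
  and C: "0 < C" "\<And>x i. x \<in> cball x0 R ==> N (chart_inv c x) (axis i 1) <= C" and T: "0 <= T" "T <= ta"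
 shows "(\<And>s. s \<in> set ps ==> \<bar>snd s\<bar> <= T) ==> norm (x - x0) + B * real (length ps) * T <= R ==>
  dE (chart_inv c x) (chart_inv c (endp fi ps x)) <= ennreal (C * real (length ps) * T)"
proof (induction ps arbitrary: x)
 case Nil
 then show ?case by (simp add: dE_refl)
next
 case (Cons s ps)
 interpret fl: flows Om "Xc c" x0 R B ta fi by (rule fl)
 let ?z = "fi (fst s) (snd s) x"
 have s: "\<bar>snd s\<bar> <= T" using Cons.prems(1) by simp
 have Bs: "B * \<bar>snd s\<bar> <= B * T" using s fl.B by (intro mult_left_mono) auto
 have nz: "norm (?z - x) <= B * \<bar>snd s\<bar>" using s T by (intro fl.flow_near) simp
 have pos: "0 <= B * real (length ps) * T" using fl.B T by simp
 have R: "norm (x - x0) + B * T + B * real (length ps) * T <= R" using Cons.prems(2) by (simp add: algebra_simps)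
 have "dE (chart_inv c x) (chart_inv c (endp fi (s # ps) x)) <= dE (chart_inv c x) (chart_inv c ?z) + dE (chart_inv c ?z) (chart_inv c (endp fi ps ?z))"
  using dE_triangle by simp
 also have "... <= ennreal (C * \<bar>snd s\<bar>) + ennreal (C * real (length ps) * T)" proof (rule add_mono)
  show "dE (chart_inv c x) (chart_inv c ?z) <= ennreal (C * \<bar>snd s\<bar>)"
   by (rule flow_dE[OF c Om fl C]) (use s T Bs R pos in linarith)+
  show "dE (chart_inv c ?z) (chart_inv c (endp fi ps ?z)) <= ennreal (C * real (length ps) * T)"
  proof (rule Cons.IH)
   show "norm (?z - x0) + B * real (length ps) * T <= R"
    using nz Bs R norm_triangle_ineq[of "?z - x" "x - x0"] by simp
  qed (use Cons.prems in auto)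
 qed
 also have "... = ennreal (C * \<bar>snd s\<bar> + C * real (length ps) * T)" using C(1) T by (simp add: ennreal_plus)
 also have "... <= ennreal (C * real (length (s # ps)) * T)" proof (rule ennreal_leI)
  have "C * \<bar>snd s\<bar> <= C * T" using s C(1) by (intro mult_left_mono) auto
  then show "C * \<bar>snd s\<bar> + C * real (length ps) * T <= C * real (length (s # ps)) * T" by (simp add: algebra_simps)
 qed
 finally show ?case .
qed

text \<open>Both box predicates speak of compact sets in coordinates, so measurability is immediate,
  and of \<open>dE\<close>, so finiteness of the distance is not presupposed. The interior point
  here and the Euclidean ball in \<open>outer_box\<close> serve to compare the topologies.\<close>

definition inner_box :: "('a, 'n) chart => real => real => real ^ 'n => real => bool"
 where "inner_box c C h p r \<longleftrightarrow> (\<exists>A. compact A \<and> A \<subseteq> chart_image c \<and>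
  (\<forall>x\<in>A. dE (chart_inv c p) (chart_inv c x) < ennreal r) \<and> p \<in> interior A \<and> r powr h <= C * measure lebesgue A)"

definition outer_box :: "('a, 'n) chart => real => real => real ^ 'n => real => bool"
 where "outer_box c C h p r \<longleftrightarrow> (\<exists>A. compact A \<and> A \<subseteq> cball p (C * r) \<and>
  (\<forall>q. dE (chart_inv c p) q < ennreal r --> q \<in> fst c \<and> snd c q \<in> A) \<and> measure lebesgue A <= C * r powr h)"

lemma local_ballbox:
 assumes eq: "equiregular \<A> \<xi>" and c: "c \<in> charts_at \<A> q0" and V: "open V" "snd c q0 \<in> V"
 obtains R r0 C where "0 < R" "0 < r0" "1 <= C" "cball (snd c q0) R \<subseteq> V" "cball (snd c q0) R \<subseteq> chart_image c"
  "\<And>p r. p \<in> cball (snd c q0) R ==> 0 < r ==> r < r0 ==> inner_box c C (homogeneous_dim \<A> \<xi> q0) p r"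
  "\<And>p r. p \<in> cball (snd c q0) R ==> 0 < r ==> r < r0 ==> outer_box c C (homogeneous_dim \<A> \<xi> q0) p r" proof -
 let ?x0 = "snd c q0"
 have cc: "c \<in> charts \<A>" using c by (simp add: charts_at_def)
 obtain Om J vt where Om: "?x0 \<in> Om" "Om \<subseteq> V" "Om \<subseteq> chart_image c" and hf: "hframe Om (Xc c) J vt"
  and Q: "homogeneous_dim \<A> \<xi> q0 = real (\<Sum>l\<in>UNIV. length (J l))" by (rule hframe_at[OF eq c V])
 interpret hf: hframe Om "Xc c" J vt by (rule hf)
 obtain R where R: "0 < R" "cball ?x0 R \<subseteq> Om" using hf.op Om(1) open_contains_cball by blast
 obtain B ta fi where fl: "flows Om (Xc c) ?x0 R B ta fi" by (rule flows_exist[OF hf.op hf.smX R])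
 interpret fl: flows Om "Xc c" ?x0 R B ta fi by (rule fl)
 interpret bb: ballbox Om "Xc c" J vt ?x0 R B ta fi ..
 let ?P = "cball ?x0 (R / 2)" and ?Q = "hf.Qdim"
 have PK: "?P \<subseteq> cball ?x0 R" using R by auto
 have P: "compact ?P" "?P \<subseteq> Om" using PK R(2) by auto
 show thesis proof (rule hf.Fbox_measure[OF P R(2,1) order_refl])
 fix rh K assume rh: "0 < rh" "rh <= R / 2" "0 < K" and inj: "\<And>p. p \<in> ?P ==> inj_on (hf.F p) (cball p rh)"
  and cpt: "\<And>p r. p \<in> ?P ==> compact (hf.Fbox p rh r)"
  and mle: "\<And>p r. p \<in> ?P ==> 0 < r ==> measure lebesgue (hf.Fbox p rh r) <= K * r ^ ?Q"
  and mge: "\<And>p r. p \<in> ?P ==> 0 < r ==> cbox (- (\<chi> j. r ^ hf.w j)) (\<chi> j. r ^ hf.w j) \<subseteq> hf.F p ` cball p rh ==>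
    r ^ ?Q <= K * measure lebesgue (hf.Fbox p rh r)"
  and int: "\<And>p r. p \<in> ?P ==> 0 < r ==> p \<in> interior (hf.Fbox p rh r)"
 show thesis proof (rule hf.horizontal_upper[OF P R(2)])
 fix C2 assume C2: "0 < C2" and hor: "\<And>p gm r t j. p \<in> ?P ==> 0 < r ==> (\<And>t :: real. t \<in> {0..1} ==> gm t \<in> cball ?x0 R) ==>
   (\<And>g M. smooth_on Om g ==> (\<And>t i. t \<in> {0..1} ==> \<bar>der (Xc c i) g (gm t)\<bar> <= M) ==>
     (\<And>t. t \<in> {0..1} ==> \<bar>g (gm t) - g p\<bar> <= r * M)) ==>
   t \<in> {0..1} ==> \<bar>hf.pf j p hf.smax (gm t)\<bar> <= C2 * r ^ hf.w j"
 let ?L = "length (bb.path 1 0)"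
 show thesis proof (rule bb.reach_box[OF P order_refl rh(1)])
 fix c1 r1 assume c1: "0 < c1" "0 < r1" "r1 < ta" "B * real ?L * r1 <= R / 2"
  and reach: "\<And>p r y. p \<in> ?P ==> 0 < r ==> r < r1 ==> (\<And>j. \<bar>y $ j\<bar> <= (c1 * r) ^ hf.w j) ==>
   \<exists>ps. length ps = ?L \<and> (\<forall>s\<in>set ps. \<bar>snd s\<bar> <= r) \<and>
    endp fi ps p \<in> cball p rh \<and> hf.F p (endp fi ps p) = y"
 show thesis proof (rule short_curves[OF cc hf.op Om(3) R])
 fix C3 assume C3: "0 < C3"
  and stay: "\<And>p gm l t. p \<in> ?P ==> adm 0 1 gm ==> gm 0 = chart_inv c p ==> len 0 1 gm <= ennreal l ==> 0 <= l ==>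
   C3 * l < R / 2 ==> t \<in> {0..1} ==> gm t \<in> fst c \<and> snd c (gm t) \<in> cball p (C3 * l)"
  and change: "\<And>p gm l t g M. p \<in> ?P ==> adm 0 1 gm ==> gm 0 = chart_inv c p ==> len 0 1 gm <= ennreal l ==> 0 <= l ==>
   C3 * l < R / 2 ==> smooth_on Om g ==> (\<And>t i. t \<in> {0..1} ==> \<bar>der (Xc c i) g (snd c (gm t))\<bar> <= M) ==>
   t \<in> {0..1} ==> \<bar>g (snd c (gm t)) - g p\<bar> <= C3 * l * M"
 have Kim: "cball ?x0 R \<subseteq> chart_image c" using R(2) Om(3) by blast
 show thesis proof (rule N_compact_bounds[OF cc compact_cball Kim])
 fix C0 assume C0: "0 < C0" "\<And>x w. x \<in> cball ?x0 R ==> N (chart_inv c x) w <= C0 * norm w"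
 have C0': "N (chart_inv c x) (axis i 1) <= C0" if "x \<in> cball ?x0 R" for x i
  using C0(2)[OF that, of "axis i 1"] by simp
 \<comment> \<open>A path with \<open>?L\<close> segments of time at most \<open>s\<close> has
   length at most \<open>C0 * ?L * s\<close>; the extra 1 makes the comparison with
   \<open>r = C4 * s\<close> strict.\<close>
 define C4 where "C4 = C0 * (real ?L + 1)"
 \<comment> \<open>Curves of length \<open>r\<close> act with scale \<open>C3 * r\<close>. Since
   every weight is at least 1, enlarging the scale by \<open>max 1 C2\<close> absorbs the factor
   \<open>C2\<close> in all coordinates.\<close>
 define C5 where "C5 = max 1 C2 * C3"
 define r0 where "r0 = min (C4 * r1) (min (R / 2 / C3) (rh / C3))"
 define C where "C = max (max 1 C3) (max (K * C5 ^ ?Q) (K * (C4 / c1) ^ ?Q))"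
 have C4: "0 < C4" using C0 by (simp add: C4_def)
 have C5: "0 < C5" using C3 by (simp add: C5_def)
 have r0: "0 < r0" using C4 c1 R C3 rh by (simp add: r0_def)
 have Qr: "r powr homogeneous_dim \<A> \<xi> q0 = r ^ ?Q" if "0 < r" for r
  using that unfolding Q hf.Qdim_def by (rule powr_realpow)
 have pK: "cball p (R / 2) \<subseteq> cball ?x0 R" if "p \<in> ?P" for p proof
  fix x assume "x \<in> cball p (R / 2)"
  then show "x \<in> cball ?x0 R" using that dist_triangle[of ?x0 x p] by (simp add: mem_cball)
 qed
 show thesis proof (rule that[of "R / 2" r0 C])
  fix p r assume p: "p \<in> ?P" and r: "0 < r" "r < r0"
  define s where "s = r / C4"
  have s: "0 < s" "s < r1" "r = C4 * s" using r C4 by (auto simp: s_def r0_def pos_divide_less_eq mult.commute)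
  let ?A = "hf.Fbox p rh (c1 * s)"
  have near: "dE (chart_inv c p) (chart_inv c x) < ennreal r" if x: "x \<in> ?A" for x proof -
   have xb: "x \<in> cball p rh" "\<And>j. \<bar>hf.F p x $ j\<bar> <= (c1 * s) ^ hf.w j"
    using x by (auto simp: hf.Fbox_def hf.F_def)
   obtain ps where ps: "length ps = ?L" "\<forall>z\<in>set ps. \<bar>snd z\<bar> <= s" "endp fi ps p \<in> cball p rh" "hf.F p (endp fi ps p) = hf.F p x"
    using reach[OF p s(1,2) xb(2)] by blast
   have xe: "endp fi ps p = x" using inj[OF p] ps(3,4) xb(1) by (auto dest: inj_onD)
   have "dE (chart_inv c p) (chart_inv c (endp fi ps p)) <= ennreal (C0 * real (length ps) * s)"
   proof (rule endp_dE[OF cc Om(3) fl C0(1) C0'])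
    have "B * real ?L * s <= B * real ?L * r1" using s fl.B by (intro mult_left_mono) auto
    then show "norm (p - ?x0) + B * real (length ps) * s <= R"
     using c1(4) p by (simp add: ps(1) dist_norm norm_minus_commute)
   qed (use ps s c1 in auto)
   also have "... < ennreal r" proof (rule ennreal_lessI[OF r(1)])
    have "0 < C0 * s" using C0(1) s(1) by simp
    then show "C0 * real (length ps) * s < r" unfolding s(3) C4_def ps(1) by (simp add: algebra_simps)
   qed
   finally show ?thesis unfolding xe .
  qed
  have sub: "?A \<subseteq> chart_image c" proof -
   have "?A \<subseteq> cball p (R / 2)" using rh(2) by (auto simp: hf.Fbox_def)
   then show ?thesis using pK[OF p] Kim by blast
  qed
  \<comment> \<open>Reachability shows that the coordinate map covers the box, as the lower volume
    bound demands.\<close>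
  have "cbox (- (\<chi> j. (c1 * s) ^ hf.w j)) (\<chi> j. (c1 * s) ^ hf.w j) \<subseteq> hf.F p ` cball p rh" proof
   fix v assume "v \<in> cbox (- (\<chi> j. (c1 * s) ^ hf.w j)) (\<chi> j. (c1 * s) ^ hf.w j)"
   then have "\<And>j. \<bar>v $ j\<bar> <= (c1 * s) ^ hf.w j" unfolding hf.mem_weighted_box by blast
   from reach[OF p s(1,2) this] show "v \<in> hf.F p ` cball p rh" by blast
  qed
  then have "(c1 * s) ^ ?Q <= K * measure lebesgue ?A" using c1 s by (intro mge p) auto
  moreover have "r ^ ?Q = (C4 / c1) ^ ?Q * (c1 * s) ^ ?Q" using c1 s(3) by (simp flip: power_mult_distrib)
  ultimately have "r ^ ?Q <= (C4 / c1) ^ ?Q * (K * measure lebesgue ?A)"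
   using C4 c1 by (simp add: mult_left_mono)
  also have "... = K * (C4 / c1) ^ ?Q * measure lebesgue ?A" by simp
  also have "... <= C * measure lebesgue ?A" by (intro mult_right_mono) (auto simp: C_def)
  finally have "r powr homogeneous_dim \<A> \<xi> q0 <= C * measure lebesgue ?A" using Qr r by simp
  then show "inner_box c C (homogeneous_dim \<A> \<xi> q0) p r"
   using cpt[OF p] sub near int[OF p, of "c1 * s"] c1 s unfolding inner_box_def by (intro exI[of _ ?A]) auto
 next
  fix p r assume p: "p \<in> ?P" and r: "0 < r" "r < r0"
  have rr: "C3 * r < R / 2" "C3 * r < rh" using r(2) C3 by (auto simp: r0_def pos_less_divide_eq mult_ac)
  let ?A = "hf.Fbox p rh (C5 * r) \<inter> cball p (C * r)"
  have in_A: "q \<in> fst c \<and> snd c q \<in> ?A" if q: "dE (chart_inv c p) q < ennreal r" for q proof -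
   obtain gm where gm: "adm 0 1 gm" "gm 0 = chart_inv c p" "gm 1 = q" "len 0 1 gm < ennreal r" using dE_lessE[OF q] by metis
   have le: "len 0 1 gm <= ennreal r" using gm(4) by simp
   note st = stay[OF p gm(1,2) le less_imp_le[OF r(1)] rr(1)]
   have 1: "q \<in> fst c" "snd c q \<in> cball p (C3 * r)" using st[of 1] gm(3) by auto
   have "cball p (C3 * r) \<subseteq> cball p rh" "cball p (C3 * r) \<subseteq> cball p (C * r)"
    using rr(2) r(1) by (auto simp: C_def intro!: subset_cball mult_right_mono)
   then have 2: "snd c q \<in> cball p rh" "snd c q \<in> cball p (C * r)" using 1 by blast+
   have "\<bar>hf.pf j p hf.smax (snd c (gm 1))\<bar> <= (C5 * r) ^ hf.w j" for j proof -
    have "\<bar>hf.pf j p hf.smax (snd c (gm 1))\<bar> <= C2 * (C3 * r) ^ hf.w j"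
    proof (rule hor[OF p, of "C3 * r" "\<lambda>t. snd c (gm t)"])
     fix t :: real assume t: "t \<in> {0..1}"
     have "cball p (C3 * r) \<subseteq> cball p (R / 2)" using rr(1) by (intro subset_cball) simp
     then show "snd c (gm t) \<in> cball ?x0 R" using st[OF t] pK[OF p] by blast
    next
     fix g and M t :: real assume "smooth_on Om g" "\<And>t i. t \<in> {0..1} ==> \<bar>der (Xc c i) g (snd c (gm t))\<bar> <= M" "t \<in> {0..1}"
     then show "\<bar>g (snd c (gm t)) - g p\<bar> <= C3 * r * M"
      by (rule change[OF p gm(1,2) le less_imp_le[OF r(1)] rr(1)])
    qed (use C3 r in auto)
    also have "C2 <= max 1 C2 ^ hf.w j" proof -
     have "C2 <= max 1 C2 ^ 1" by simp
     also have "... <= max 1 C2 ^ hf.w j" proof (rule power_increasing)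
      show "1 <= hf.w j" using hf.wpos[of j] by linarith
     qed simp
     finally show ?thesis .
    qed
    then have "C2 * (C3 * r) ^ hf.w j <= max 1 C2 ^ hf.w j * (C3 * r) ^ hf.w j"
     using C3 r by (intro mult_right_mono) auto
    also have "... = (C5 * r) ^ hf.w j" by (simp add: C5_def mult.assoc flip: power_mult_distrib)
    finally show ?thesis .
   qed
   then show ?thesis using 1 2 gm(3) by (simp add: hf.Fbox_def)
  qed
  have cA: "compact ?A" using cpt[OF p] by (intro compact_Int) auto
  have "measure lebesgue ?A <= measure lebesgue (hf.Fbox p rh (C5 * r))"
   using cpt[OF p] lmeasurable_compact[OF cA]
   by (intro measure_mono_fmeasurable lmeasurable_compact) (auto dest: fmeasurableD)
  also have "... <= K * (C5 * r) ^ ?Q" using C5 r by (intro mle p) auto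
  also have "... = K * C5 ^ ?Q * r ^ ?Q" by (simp add: power_mult_distrib)
  also have "... <= C * r ^ ?Q" using r by (intro mult_right_mono) (auto simp: C_def)
  finally have "measure lebesgue ?A <= C * r powr homogeneous_dim \<A> \<xi> q0" using Qr r by simp
  with cA show "outer_box c C (homogeneous_dim \<A> \<xi> q0) p r"
   using in_A unfolding outer_box_def by (intro exI[of _ ?A]) auto
 qed (use R r0 PK Om Kim in \<open>auto simp: C_def\<close>)
 qed
 qed
 qed
 qed
 qed
qed

end

section \<open>The metric topology and the measure of balls\<close>

text \<open>A ball of largest radius is selected and all balls that meet it are discarded; these lie
  in its threefold enlargement. The remaining balls are treated by induction.\<close>

lemma vitali_finite:
 fixes d :: "'a => 'a => real" and a :: "'i => 'a"
 assumes sym: "\<And>x y. d x y = d y x" and tri: "\<And>x y z. d x z <= d x y + d y z"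
 shows "finite I ==> \<exists>J\<subseteq>I. (\<forall>i\<in>J. \<forall>j\<in>J. i \<noteq> j --> {y. d (a i) y < r i} \<inter> {y. d (a j) y < r j} = {}) \<and>
  (\<Union>i\<in>I. {y. d (a i) y < r i}) \<subseteq> (\<Union>i\<in>J. {y. d (a i) y < 3 * r i})"
proof (induction "card I" arbitrary: I rule: less_induct)
 case less
 let ?B = "\<lambda>i. {y. d (a i) y < r i}"
 have d0: "0 <= d x y" for x y using tri[of x x y] tri[of x y x] tri[of x y y] sym[of x y] by linarith
 show ?case proof (cases "I = {}")
  case True then show ?thesis by auto
 next
  case False
  have fin: "finite (r ` I)" using less.prems by simp
  then have "Max (r ` I) \<in> r ` I" using False by (intro Max_in) auto
  then obtain i where i': "i \<in> I" "Max (r ` I) = r i" by blast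
  then have i: "i \<in> I" "\<And>j. j \<in> I ==> r j <= r i" using Max_ge[OF fin] by auto
  define I' where "I' = {j \<in> I. j \<noteq> i \<and> ?B j \<inter> ?B i = {}}"
  have lt: "card I' < card I" using i(1) less.prems by (intro psubset_card_mono) (auto simp: I'_def)
  have "finite I'" using less.prems by (simp add: I'_def)
  from less.hyps[OF lt this] obtain J where "J \<subseteq> I' \<and> (\<forall>i\<in>J. \<forall>j\<in>J. i \<noteq> j --> ?B i \<inter> ?B j = {}) \<and>
   (\<Union>i\<in>I'. ?B i) \<subseteq> (\<Union>i\<in>J. {y. d (a i) y < 3 * r i})" by (elim exE)
  then have J: "J \<subseteq> I'" "\<And>i j. i \<in> J ==> j \<in> J ==> i \<noteq> j ==> ?B i \<inter> ?B j = {}"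
   "(\<Union>i\<in>I'. ?B i) \<subseteq> (\<Union>i\<in>J. {y. d (a i) y < 3 * r i})" by simp_all
  have "y \<in> (\<Union>i\<in>insert i J. {y. d (a i) y < 3 * r i})" if j: "j \<in> I" "d (a j) y < r j" for j y
  proof (cases "j \<in> I'")
   case True
   then show ?thesis using J(3) j(2) by blast
  next
   case False
   have rj: "r j <= r i" using i(2) j(1) .
   have "d (a i) y < 3 * r i" proof (cases "j = i")
    case True
    then show ?thesis using j(2) d0[of "a j" y] by simp
   next
    case False
    with \<open>j \<notin> I'\<close> j(1) obtain z where z: "d (a j) z < r j" "d (a i) z < r i" by (auto simp: I'_def)
    have "d (a i) y <= d (a i) z + (d z (a j) + d (a j) y)" using tri[of "a i" y z] tri[of z y "a j"] by linarith
    then show ?thesis using z j(2) rj sym[of z "a j"] by linarith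
   qed
   then show ?thesis by simp
  qed
  then have "(\<Union>i\<in>I. ?B i) \<subseteq> (\<Union>i\<in>insert i J. {y. d (a i) y < 3 * r i})" by blast
  moreover have "?B k \<inter> ?B l = {}" if "k \<in> insert i J" "l \<in> insert i J" "k \<noteq> l" for k l
   using that J(1,2) by (auto simp: I'_def)
  moreover have "insert i J \<subseteq> I" using i(1) J(1) by (auto simp: I'_def)
  ultimately show ?thesis by (intro exI[of _ "insert i J"]) blast
 qed
qed

locale equireg = sub_finsler \<A> \<xi> N
 for \<A> :: "('a::{t2_space, second_countable_topology}, 'n::finite) chart set"
  and \<xi> :: "'a => real ^ 'k => ('a, 'n) tangent" and N :: "'a => real ^ 'k => real" +
 fixes Q :: real
 assumes eqr: "equiregular \<A> \<xi>" and Q: "homogeneous_dim \<A> \<xi> q = Q"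
begin

section \<open>Distance balls and the topology of the manifold\<close>

definition db :: "'a => real => 'a set" where "db p r = {q. dE p q < ennreal r}"

lemma db_mono: "r <= s ==> db p r \<subseteq> db p s"
 unfolding db_def using ennreal_leI[of r s] less_le_trans by blast

text \<open>The inner box of a small ball is a neighbourhood of the centre in coordinates.\<close>

lemma db_contains_open:
 assumes r: "0 < r"
 shows "\<exists>U. open U \<and> q \<in> U \<and> U \<subseteq> db q r" proof -
 obtain a where a: "a \<in> charts_at \<A> q" using charts_at_nonempty by blast
 then have ac: "a \<in> charts \<A>" "q \<in> fst a" by (auto simp: charts_at_def)
 show ?thesis proof (rule local_ballbox[OF eqr a chartsD(2)[OF ac(1)] chartsD(6)[OF ac]])
  fix R r0 C
  assume *: "0 < R" "0 < r0" and A: "\<And>p r. p \<in> cball (snd a q) R ==> 0 < r ==> r < r0 ==> inner_box a C (homogeneous_dim \<A> \<xi> q) p r"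
  have "snd a q \<in> cball (snd a q) R" "0 < min r (r0 / 2)" "min r (r0 / 2) < r0" using * r by auto
  from A[OF this, unfolded inner_box_def] obtain A where A: "A \<subseteq> chart_image a"
   "\<And>x. x \<in> A ==> dE (chart_inv a (snd a q)) (chart_inv a x) < ennreal (min r (r0 / 2))" "snd a q \<in> interior A" by blast
  have iq: "chart_inv a (snd a q) = q" by (rule chartsD(5)[OF ac])
  let ?U = "fst a \<inter> snd a -` interior A"
  have "open ?U" by (rule continuous_open_preimage[OF chartsD(3,1)[OF ac(1)] open_interior])
  moreover have "q \<in> ?U" using A(3) ac by simp
  moreover have "?U \<subseteq> db q r" proof
   fix p assume "p \<in> ?U"
   then have "snd a p \<in> A" "p \<in> fst a" using interior_subset by auto
   then have "dE q p < ennreal (min r (r0 / 2))" using A(2)[of "snd a p"] chartsD(5)[OF ac(1), of p] iq by simp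
   also have "... <= ennreal r" by (rule ennreal_leI) simp
   finally show "p \<in> db q r" by (simp add: db_def)
  qed
  ultimately show ?thesis by blast
 qed
qed

text \<open>The outer box lies in a Euclidean ball of radius proportional to \<open>r\<close>, which
  fits into the chart image of \<open>U\<close>.\<close>

lemma open_contains_db:
 assumes U: "open U" "q \<in> U"
 shows "\<exists>r>0. db q r \<subseteq> U" proof -
 obtain a where a: "a \<in> charts_at \<A> q" using charts_at_nonempty by blast
 then have ac: "a \<in> charts \<A>" "q \<in> fst a" by (auto simp: charts_at_def)
 let ?V = "snd a ` (U \<inter> fst a)"
 have V: "open ?V" by (rule open_chart_subset[OF ac(1)]) (use U chartsD(1)[OF ac(1)] in auto)
 have xV: "snd a q \<in> ?V" using U ac by blast
 show ?thesis proof (rule local_ballbox[OF eqr a V xV])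
  fix R r0 C
  assume *: "0 < R" "0 < r0" "1 <= C" "cball (snd a q) R \<subseteq> ?V" and
   A: "\<And>p r. p \<in> cball (snd a q) R ==> 0 < r ==> r < r0 ==> outer_box a C (homogeneous_dim \<A> \<xi> q) p r"
  let ?r = "min (r0 / 2) (R / C)"
  have "snd a q \<in> cball (snd a q) R" "0 < ?r" "?r < r0" using * by auto
  from A[OF this, unfolded outer_box_def] obtain A where A: "A \<subseteq> cball (snd a q) (C * ?r)"
   "\<And>p. dE (chart_inv a (snd a q)) p < ennreal ?r ==> p \<in> fst a \<and> snd a p \<in> A" by blast
  have "C * ?r <= C * (R / C)" using * by (intro mult_left_mono) auto
  then have "C * ?r <= R" using * by simp
  then have AV: "A \<subseteq> ?V" using A(1) *(4) subset_cball[of "C * ?r" R "snd a q"] by blast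
  have "db q ?r \<subseteq> U" proof
   fix p assume "p \<in> db q ?r"
   then have p: "p \<in> fst a" "snd a p \<in> ?V" using A(2)[of p] AV chartsD(5)[OF ac] by (auto simp: db_def)
   then obtain p' where "p' \<in> U" "p' \<in> fst a" "snd a p = snd a p'" by blast
   then show "p \<in> U" using chartsD(5)[OF ac(1), of p] chartsD(5)[OF ac(1), of p'] p by metis
  qed
  then show ?thesis using \<open>0 < ?r\<close> by blast
 qed
qed

text \<open>Chow-Rashevskii: distances are finite near every point, so the set of points at finite
  distance from \<open>p\<close> is open and closed in a connected space.\<close>

lemma dE_finite: "dE p q < top" proof -
 have nb: "\<exists>U. open U \<and> q \<in> U \<and> (\<forall>x\<in>U. dE q x < top)" for q proof -
  obtain U where "open U" "q \<in> U" "U \<subseteq> db q 1" using db_contains_open[of 1 q] by auto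
  then show ?thesis by (intro exI[of _ U]) (auto simp: db_def intro: less_trans)
 qed
 let ?S = "{q. dE p q < top}"
 have "open ?S" proof (subst open_subopen, intro ballI)
  fix q assume q: "q \<in> ?S"
  obtain U where U: "open U" "q \<in> U" "\<And>x. x \<in> U ==> dE q x < top" using nb[of q] by blast
  have "x \<in> ?S" if "x \<in> U" for x
   using q U(3)[OF that] dE_triangle[of p x q] le_less_trans[of "dE p x" "dE p q + dE q x" top] by (simp add: ennreal_add_less_top)
  then show "\<exists>T. open T \<and> q \<in> T \<and> T \<subseteq> ?S" using U by blast
 qed
 moreover have "open (- ?S)" proof (subst open_subopen, intro ballI)
  fix q assume q: "q \<in> - ?S"
  obtain U where U: "open U" "q \<in> U" "\<And>x. x \<in> U ==> dE q x < top" using nb[of q] by blast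
  have "x \<in> - ?S" if "x \<in> U" for x
   using q U(3)[OF that] dE_triangle[of p q x] dE_sym[of x q] le_less_trans[of "dE p q" "dE p x + dE x q" top] by (auto simp: ennreal_add_less_top)
  then show "\<exists>T. open T \<and> q \<in> T \<and> T \<subseteq> - ?S" using U by blast
 qed
 moreover have "connected (UNIV :: 'a set)" using sfm by (simp add: sub_finsler_manifold_def)
 moreover have "p \<in> ?S" by (simp add: dE_refl)
 ultimately have "?S = UNIV" unfolding connected_clopen by (auto simp: closed_def)
 then show ?thesis by blast
qed

abbreviation d where "d \<equiv> sf_dist \<A> \<xi> N"

lemma dE_d: "dE p q = ennreal (d p q)" unfolding sf_dist_eq using dE_finite[of p q] by simp

lemma d_nonneg: "0 <= d p q" by (simp add: sf_dist_eq)

lemma db_eq: "db p r = {q. d p q < r}"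
 unfolding db_def dE_d by (auto simp: ennreal_less_iff d_nonneg)

lemma d_sym: "d p q = d q p" by (simp add: sf_dist_eq dE_sym[of p])

lemma d_triangle: "d p r <= d p q + d q r" proof -
 have "ennreal (d p r) <= ennreal (d p q + d q r)"
  using dE_triangle[of p r q] unfolding dE_d ennreal_plus[OF d_nonneg d_nonneg] .
 then show ?thesis by (rule ennreal_le_iff[THEN iffD1, rotated]) (simp add: d_nonneg)
qed

sublocale ms: Metric_space UNIV d proof
 fix p q r
 show "0 <= d p q" "d p q = d q p" "d p r <= d p q + d q r" by (rule d_nonneg d_sym d_triangle)+
 show "d p q = 0 \<longleftrightarrow> p = q" proof
  assume 0: "d p q = 0"
  show "p = q" proof (rule ccontr)
   assume "p \<noteq> q"
   then obtain U where "open U" "p \<in> U" "q \<notin> U" using hausdorff by (metis disjoint_iff)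
   then obtain r where "r > 0" "db p r \<subseteq> U" "q \<notin> U" using open_contains_db by blast
   moreover have "q \<in> db p r" using 0 \<open>r > 0\<close> by (simp add: db_eq)
   ultimately show False by blast
  qed
 qed (simp add: sf_dist_eq dE_refl)
qed

lemma mball_db: "ms.mball p r = db p r" by (auto simp: db_eq)

text \<open>Lets compactness in the metric space be read in the manifold topology, and makes
  distance balls Borel sets.\<close>

lemma mtopology_euclidean: "ms.mtopology = euclidean"
proof (rule topology_eq[THEN iffD2], intro allI)
 fix U
 show "openin ms.mtopology U \<longleftrightarrow> openin euclidean U" proof
  assume U: "openin ms.mtopology U"
  have "open U" proof (subst open_subopen, intro ballI)
   fix q assume "q \<in> U"
   then obtain r where "r > 0" "db q r \<subseteq> U" using U unfolding ms.openin_mtopology mball_db by blast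
   then show "\<exists>T. open T \<and> q \<in> T \<and> T \<subseteq> U" using db_contains_open[of r q] by blast
  qed
  then show "openin euclidean U" by simp
 next
  assume "openin euclidean U"
  then show "openin ms.mtopology U"
   unfolding ms.openin_mtopology mball_db using open_contains_db by auto
 qed
qed

lemma open_db: "open (db p r)"
 using ms.openin_mball[of p r] unfolding mtopology_euclidean mball_db by simp

lemma center_in_db: "0 < r ==> p \<in> db p r" by (simp add: db_def dE_refl)

text \<open>The dimension is positive, so a chart image contains two points. The definition of
  Ahlfors regularity asks for radii bounded by the diameter.\<close>

lemma diam_pos: "\<exists>D>0. ennreal D <= (SUP x\<in>UNIV. SUP y\<in>UNIV. ennreal (d x y))" proof -
 obtain a where a: "a \<in> charts \<A>" "undefined \<in> fst a" using charts_at_nonempty[of undefined] by (auto simp: charts_at_def)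
 obtain e where e: "0 < e" "ball (snd a undefined) e \<subseteq> chart_image a"
  using chartsD(2)[OF a(1)] chartsD(6)[OF a] open_contains_ball by blast
 obtain b :: "real ^ 'n" where b: "norm b = e / 2" using vector_choose_size[of "e / 2"] e by auto
 let ?x = "snd a undefined" and ?y = "snd a undefined + b"
 have xy: "?x \<in> chart_image a" "?y \<in> chart_image a" "?x \<noteq> ?y" using e b by (auto simp: dist_norm)
 then have "chart_inv a ?x \<noteq> chart_inv a ?y" using chartsD(8)[OF a(1)] by metis
 then have "0 < d (chart_inv a ?x) (chart_inv a ?y)" by simp
 moreover have "ennreal (d (chart_inv a ?x) (chart_inv a ?y)) <= (SUP x\<in>UNIV. SUP y\<in>UNIV. ennreal (d x y))"
 proof -
  have "ennreal (d (chart_inv a ?x) (chart_inv a ?y)) <= (SUP y\<in>UNIV. ennreal (d (chart_inv a ?x) y))"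
   by (rule SUP_upper) simp
  also have "... <= (SUP x\<in>UNIV. SUP y\<in>UNIV. ennreal (d x y))" by (rule SUP_upper) simp
  finally show ?thesis .
 qed
 ultimately show ?thesis by blast
qed

text \<open>The open image of a ball lies between the compact inner and outer boxes, whose volumes
  are comparable to \<open>r powr Q\<close>.\<close>

lemma ball_measure:
 assumes c: "c \<in> charts_at \<A> q0" and V: "open V" "snd c q0 \<in> V"
 obtains R r0 C where "0 < R" "0 < r0" "1 <= C" "cball (snd c q0) R \<subseteq> V" "cball (snd c q0) R \<subseteq> chart_image c"
  "\<And>p r. p \<in> cball (snd c q0) R ==> 0 < r ==> r < r0 ==> db (chart_inv c p) r \<subseteq> fst c"
  "\<And>p r. p \<in> cball (snd c q0) R ==> 0 < r ==> r < r0 ==> snd c ` db (chart_inv c p) r \<subseteq> cball p (C * r)"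
  "\<And>p r. p \<in> cball (snd c q0) R ==> 0 < r ==> r < r0 ==>
    ennreal (r powr Q / C) <= emeasure lborel (snd c ` db (chart_inv c p) r)"
  "\<And>p r. p \<in> cball (snd c q0) R ==> 0 < r ==> r < r0 ==>
    emeasure lborel (snd c ` db (chart_inv c p) r) <= ennreal (C * r powr Q)"
proof (rule local_ballbox[OF eqr c V])
 fix R r0 C
 assume *: "0 < R" "0 < r0" "1 <= C" "cball (snd c q0) R \<subseteq> V" "cball (snd c q0) R \<subseteq> chart_image c"
  and lo: "\<And>p r. p \<in> cball (snd c q0) R ==> 0 < r ==> r < r0 ==> inner_box c C (homogeneous_dim \<A> \<xi> q0) p r"
  and up: "\<And>p r. p \<in> cball (snd c q0) R ==> 0 < r ==> r < r0 ==> outer_box c C (homogeneous_dim \<A> \<xi> q0) p r"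
 have cc: "c \<in> charts \<A>" using c by (simp add: charts_at_def)
 have em: "emeasure lborel A = ennreal (measure lebesgue A)" if "compact A" for A :: "(real ^ 'n) set"
  using emeasure_eq_measure2[OF lmeasurable_compact[OF that]] borel_compact[OF that] by simp
 have B: "db (chart_inv c p) r \<subseteq> fst c \<and> snd c ` db (chart_inv c p) r \<subseteq> cball p (C * r) \<and>
   ennreal (r powr Q / C) <= emeasure lborel (snd c ` db (chart_inv c p) r) \<and>
   emeasure lborel (snd c ` db (chart_inv c p) r) <= ennreal (C * r powr Q)"
  if p: "p \<in> cball (snd c q0) R" "0 < r" "r < r0" for p r proof -
  let ?B = "db (chart_inv c p) r"
  obtain A where A: "compact A" "A \<subseteq> chart_image c" "\<And>x. x \<in> A ==> dE (chart_inv c p) (chart_inv c x) < ennreal r"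
   "r powr Q <= C * measure lebesgue A" using lo[OF p] unfolding inner_box_def Q by blast
  obtain A' where A': "compact A'" "A' \<subseteq> cball p (C * r)" "\<And>q. dE (chart_inv c p) q < ennreal r ==> q \<in> fst c \<and> snd c q \<in> A'"
   "measure lebesgue A' <= C * r powr Q" using up[OF p] unfolding outer_box_def Q by blast
  have Bc: "?B \<subseteq> fst c" "snd c ` ?B \<subseteq> A'" using A'(3) by (auto simp: db_def)
  have "open (snd c ` ?B)" by (rule open_chart_subset[OF cc open_db Bc(1)])
  then have Bb: "snd c ` ?B \<in> sets lborel" by simp
  have AB: "A \<subseteq> snd c ` ?B" proof
   fix x assume x: "x \<in> A"
   then have "x = snd c (chart_inv c x)" using A(2) chartsD(8)[OF cc] by auto
   moreover have "chart_inv c x \<in> ?B" using A(3)[OF x] by (simp add: db_def)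
   ultimately show "x \<in> snd c ` ?B" by blast
  qed
  have "r powr Q / C <= measure lebesgue A" using A(4) *(3) by (simp add: pos_divide_le_eq mult.commute)
  then have "ennreal (r powr Q / C) <= emeasure lborel A" unfolding em[OF A(1)] by (rule ennreal_leI)
  also have "... <= emeasure lborel (snd c ` ?B)" by (rule emeasure_mono[OF AB Bb])
  finally have 1: "ennreal (r powr Q / C) <= emeasure lborel (snd c ` ?B)" .
  have "emeasure lborel (snd c ` ?B) <= emeasure lborel A'"
   by (rule emeasure_mono[OF Bc(2)]) (use borel_compact[OF A'(1)] in simp)
  also have "... <= ennreal (C * r powr Q)" unfolding em[OF A'(1)] by (rule ennreal_leI[OF A'(4)])
  finally show ?thesis using 1 Bc A'(2) by blast
 qed
 show thesis by (rule that[OF *]) (use B in blast)+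
qed

end

section \<open>Comparison of measures\<close>

text \<open>Exhausting an open set by compact ones gives the inequality for open sets; outer
  regularity of the finite measure \<open>nv\<close> then gives it for Borel sets.\<close>

lemma emeasure_le_of_compact_open:
 fixes my nv :: "'e::euclidean_space measure"
 assumes s: "sets my = sets borel" "sets nv = sets borel" and fin: "emeasure nv (space nv) \<noteq> \<infinity>"
  and W: "open W" and C: "0 < C"
  and KU: "\<And>K U. compact K ==> open U ==> K \<subseteq> U ==> U \<subseteq> W ==> emeasure my K <= ennreal C * emeasure nv U"
  and E: "E \<in> sets borel" "E \<subseteq> W"
 shows "emeasure my E <= ennreal C * emeasure nv E" proof -
 have op: "emeasure my U <= ennreal C * emeasure nv U" if U: "open U" "U \<subseteq> W" for U proof -
  obtain K where K: "\<And>n. compact (K n)" "\<And>n. K n \<subseteq> U" "\<And>n. K n \<subseteq> interior (K (Suc n))" "\<Union> (range K) = U"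
   using open_Union_compact_subsets[OF U(1)] by metis
  have "incseq K" using K(3) interior_subset by (intro incseq_SucI) blast
  then have "emeasure my U = (SUP n. emeasure my (K n))"
   using K(1,4) s borel_compact by (subst SUP_emeasure_incseq) auto
  also have "... <= ennreal C * emeasure nv U" by (rule SUP_least) (rule KU[OF K(1) U(1) K(2) U(2)])
  finally show ?thesis .
 qed
 have "ennreal (1 / C) * emeasure my E <= (INF U\<in>{U. E \<subseteq> U \<and> open U}. emeasure nv U)"
 proof (rule INF_greatest)
  fix U assume "U \<in> {U. E \<subseteq> U \<and> open U}"
  then have U: "E \<subseteq> U" "open U" by auto
  have "emeasure my E <= emeasure my (U \<inter> W)" using U E W s by (intro emeasure_mono) auto
  also have "... <= ennreal C * emeasure nv (U \<inter> W)" using U W by (intro op) auto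
  also have "... <= ennreal C * emeasure nv U" using U s by (intro mult_left_mono emeasure_mono) auto
  finally have "ennreal (1 / C) * emeasure my E <= ennreal (1 / C) * (ennreal C * emeasure nv U)" by (intro mult_left_mono) auto
  also have "... = emeasure nv U" using C by (simp flip: mult.assoc ennreal_mult)
  finally show "ennreal (1 / C) * emeasure my E <= emeasure nv U" .
 qed
 also have "... = emeasure nv E" using outer_regular[OF s(2) fin E(1)] by simp
 finally have "ennreal C * (ennreal (1 / C) * emeasure my E) <= ennreal C * emeasure nv E" by (intro mult_left_mono) auto
 then show ?thesis using C by (simp flip: mult.assoc ennreal_mult)
qed

text \<open>On the set where the density exceeds \<open>2 * C\<close> the hypothesis gives
  \<open>2 * emeasure M E <= emeasure M E\<close>, and a finite measure admits this only for null
  sets. The same holds below \<open>1 / (2 * C)\<close>; the factor 2 provides the gap.\<close>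

lemma density_bounds:
 fixes C :: real
 assumes fin: "emeasure M (space M) \<noteq> \<infinity>" and s: "sets N = sets M" and C: "0 < C"
  and NM: "\<And>E. E \<in> sets M ==> emeasure N E <= ennreal C * emeasure M E"
  and MN: "\<And>E. E \<in> sets M ==> emeasure M E <= ennreal C * emeasure N E"
 shows "absolutely_continuous M N \<and> (\<exists>rh\<in>borel_measurable M. N = density M (\<lambda>x. ennreal (rh x)) \<and>
  (\<exists>c0 C0 :: real. 0 < c0 \<and> c0 <= C0 \<and> (AE x in M. c0 <= rh x \<and> rh x <= C0)))" proof -
 interpret finite_measure M using fin by (intro finite_measureI)
 have ac: "absolutely_continuous M N"
  unfolding absolutely_continuous_def using NM s by (force simp: null_sets_def)
 obtain f where f: "f \<in> borel_measurable M" "density M f = N" using Radon_Nikodym[OF ac s] by blast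
 have Nf: "emeasure N E = (\<integral>\<^sup>+x. f x * indicator E x \<partial>M)" if "E \<in> sets M" for E
  using f by (auto simp: emeasure_density[OF f(1) that])
 have null: "E \<in> null_sets M" if E: "E \<in> sets M" and le: "2 * emeasure M E <= emeasure M E" for E
 proof -
  obtain r where r: "emeasure M E = ennreal r" "0 <= r" using emeasure_eq_measure[of E] by auto
  have "2 * ennreal r = ennreal (2 * r)" using r(2) by (simp add: ennreal_mult)
  then have "ennreal (2 * r) <= ennreal r" using le r by simp
  then have "r = 0" using r(2) by (simp add: ennreal_le_iff)
  then show ?thesis using E r by (simp add: null_sets_def)
 qed
 let ?H = "{x \<in> space M. ennreal (2 * C) < f x}" and ?L = "{x \<in> space M. f x < ennreal (1 / (2 * C))}"
 have HL: "?H \<in> sets M" "?L \<in> sets M" using f(1) by measurable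
 have "ennreal (2 * C) * emeasure M ?H = (\<integral>\<^sup>+x. ennreal (2 * C) * indicator ?H x \<partial>M)"
  using HL by (simp add: nn_integral_cmult_indicator)
 also have "... <= emeasure N ?H" unfolding Nf[OF HL(1)]
  by (intro nn_integral_mono) (auto simp: indicator_def less_imp_le)
 also have "... <= ennreal C * emeasure M ?H" by (rule NM[OF HL(1)])
 finally have "ennreal (1 / C) * (ennreal (2 * C) * emeasure M ?H) <= ennreal (1 / C) * (ennreal C * emeasure M ?H)"
  by (intro mult_left_mono) auto
 then have H0: "?H \<in> null_sets M" using C by (intro null HL) (simp flip: mult.assoc ennreal_mult)
 have "emeasure M ?L <= ennreal C * emeasure N ?L" by (rule MN[OF HL(2)])
 also have "emeasure N ?L <= (\<integral>\<^sup>+x. ennreal (1 / (2 * C)) * indicator ?L x \<partial>M)" unfolding Nf[OF HL(2)]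
  by (intro nn_integral_mono) (auto simp: indicator_def less_imp_le)
 also have "... = ennreal (1 / (2 * C)) * emeasure M ?L" using HL by (simp add: nn_integral_cmult_indicator)
 finally have "2 * emeasure M ?L <= 2 * (ennreal C * (ennreal (1 / (2 * C)) * emeasure M ?L))"
  by (simp add: mult_left_mono)
 also have "... = (ennreal 2 * ennreal C * ennreal (1 / (2 * C))) * emeasure M ?L" by (simp add: mult.assoc)
 also have "ennreal 2 * ennreal C * ennreal (1 / (2 * C)) = 1" proof -
  have "ennreal (2 * C) = ennreal 2 * ennreal C" "ennreal (2 * C * (1 / (2 * C))) = ennreal (2 * C) * ennreal (1 / (2 * C))"
   by (rule ennreal_mult; use C in simp)+
  moreover have "2 * C * (1 / (2 * C)) = 1" using C by simp
  ultimately show ?thesis by (metis ennreal_1)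
 qed
 finally have L0: "?L \<in> null_sets M" by (intro null HL) simp
 have AE: "AE x in M. ennreal (1 / (2 * C)) <= f x \<and> f x <= ennreal (2 * C)"
  using AE_not_in[OF H0] AE_not_in[OF L0] AE_space by eventually_elim (auto simp: not_less)
 have r1: "N = density M (\<lambda>x. ennreal (enn2real (f x)))" unfolding f(2)[symmetric]
 proof (rule density_cong)
  show "AE x in M. f x = ennreal (enn2real (f x))" using AE proof eventually_elim
   case (elim x)
   then have "f x < top" using le_less_trans ennreal_less_top by blast
   then show ?case by simp
  qed
 qed (use f in auto)
 have r2: "(\<lambda>x. enn2real (f x)) \<in> borel_measurable M" using f(1) by measurable
 have r3: "AE x in M. 1 / (2 * C) <= enn2real (f x) \<and> enn2real (f x) <= 2 * C" using AE
 proof eventually_elim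
  case (elim x)
  then have t: "f x < top" using le_less_trans ennreal_less_top by blast
  have "enn2real (ennreal (1 / (2 * C))) <= enn2real (f x)" by (rule enn2real_mono) (use elim t in auto)
  moreover have "enn2real (f x) <= enn2real (ennreal (2 * C))" by (rule enn2real_mono) (use elim in auto)
  ultimately show ?case using C by simp
 qed
 have r4: "0 < 1 / (2 * C)" using C by simp
 \<comment> \<open>The lower constant is added to the upper one, so the two are ordered for every
   positive \<open>C\<close>.\<close>
 have r5: "1 / (2 * C) <= 1 / (2 * C) + 2 * C" using C by simp
 have r6: "AE x in M. 1 / (2 * C) <= enn2real (f x) \<and> enn2real (f x) <= 1 / (2 * C) + 2 * C"
  using r3 by eventually_elim (use r4 in linarith)
 show ?thesis proof (intro conjI bexI[OF _ r2] exI)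
 qed (rule ac r1 r4 r5 r6)+
qed

context equireg
begin

section \<open>Measures read in charts\<close>

lemma restrict_chart:
 assumes c: "c \<in> charts \<A>" and W: "open W" "W \<subseteq> fst c"
 shows "(W, snd c) \<in> charts \<A>" "\<And>x. x \<in> snd c ` W ==> chart_inv (W, snd c) x = chart_inv c x" proof -
 let ?r = "(W, snd c)"
 have im: "chart_image ?r = snd c ` W" by (simp add: chart_image_def)
 have inj: "inj_on (snd c) W" by (rule inj_onI) (use chartsD(5)[OF c] W in \<open>metis subsetD\<close>)
 show inv: "chart_inv ?r x = chart_inv c x" if x: "x \<in> snd c ` W" for x proof -
  obtain q where q: "q \<in> W" "x = snd c q" using x by blast
  have "chart_inv ?r x = q" unfolding chart_inv_def using the_inv_into_f_f[OF inj q(1)] q(2) by simp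
  then show ?thesis using chartsD(5)[OF c, of q] q W by auto
 qed
 have opW: "open (snd c ` W)" by (rule open_chart_subset[OF c W])
 have "homeomorphism (fst c) (chart_image c) (snd c) (chart_inv c)"
  using c by (simp add: charts_def is_chart_def)
 then have "homeomorphism W (snd c ` W) (snd c) (chart_inv c)"
  by (rule homeomorphism_of_subsets) (use W in auto)
 then have "homeomorphism W (snd c ` W) (snd c) (chart_inv ?r)"
  by (rule homeomorphism_cong) (use inv in auto)
 then have ch: "is_chart ?r" using W opW by (simp add: is_chart_def im)
 have "compatible ?r a" if a: "a \<in> \<A>" for a proof -
  have ca: "smooth_on (snd c ` (fst c \<inter> fst a)) (transition c a)" "smooth_on (snd a ` (fst c \<inter> fst a)) (transition a c)"
   using c a by (auto simp: charts_def compatible_def)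
  have oa: "open (fst a)" using a atlas by (simp add: smooth_atlas_def is_chart_def)
  have o: "open (snd c ` (W \<inter> fst a))" by (rule open_chart_subset[OF c]) (use W oa in auto)
  have "smooth_on (snd c ` (W \<inter> fst a)) (transition c a)" by (rule smooth_on_subset[OF ca(1)]) (use W in auto)
  then have "smooth_on (snd c ` (W \<inter> fst a)) (transition ?r a)"
   by (rule smooth_on_cong[OF o, rotated]) (use inv in \<open>auto simp: transition_def\<close>)
  moreover have "smooth_on (snd a ` (W \<inter> fst a)) (transition a c)" by (rule smooth_on_subset[OF ca(2)]) (use W in auto)
  then have "smooth_on (snd a ` (W \<inter> fst a)) (transition a ?r)" by (simp add: transition_def)
  ultimately show ?thesis by (simp add: compatible_def)
 qed
 with ch show "?r \<in> charts \<A>" by (simp add: charts_def)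
qed

lemma chart_inv_image:
 assumes c: "c \<in> charts \<A>" and E: "E \<subseteq> chart_image c"
 shows "chart_inv c ` E = fst c \<inter> snd c -` E" proof
 show "chart_inv c ` E \<subseteq> fst c \<inter> snd c -` E" using chartsD(7,8)[OF c] E by auto
 show "fst c \<inter> snd c -` E \<subseteq> chart_inv c ` E" using chartsD(5)[OF c] by (force simp: image_iff)
qed

lemma chart_measurable:
 assumes c: "c \<in> charts \<A>" and s: "sets m = sets borel" and D: "D \<in> sets borel" "D \<subseteq> fst c"
 shows "snd c \<in> restrict_space m D \<rightarrow>\<^sub>M borel" proof -
 have "snd c \<in> borel_measurable (restrict_space borel D)"
  by (rule borel_measurable_continuous_on_restrict[OF continuous_on_subset[OF chartsD(3)[OF c] D(2)]])
 then show ?thesis using measurable_cong_sets[OF sets_restrict_space_cong[OF s] refl] by blast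
qed

lemma vimage_borel:
 assumes c: "c \<in> charts \<A>" and E: "E \<in> sets borel"
 shows "fst c \<inter> snd c -` E \<in> sets borel" proof -
 have "snd c \<in> restrict_space borel (fst c) \<rightarrow>\<^sub>M borel"
  by (rule chart_measurable[OF c refl]) (use chartsD(1)[OF c] in auto)
 then have "snd c -` E \<inter> space (restrict_space borel (fst c)) \<in> sets (restrict_space borel (fst c))"
  using E by (rule measurable_sets)
 then show ?thesis using chartsD(1)[OF c]
  by (auto simp: sets_restrict_space_iff space_restrict_space Int_commute)
qed

definition pushf :: "'a measure => ('a, 'n) chart => (real ^ 'n) measure"
 where "pushf m c = distr (restrict_space m (fst c)) (restrict_space borel (chart_image c)) (snd c)"

lemma emeasure_pushf:
 assumes c: "c \<in> charts \<A>" and s: "sets m = sets borel" and E: "E \<in> sets borel" "E \<subseteq> chart_image c"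
 shows "emeasure (pushf m c) E = emeasure m (chart_inv c ` E)" proof -
 have sp: "space m = UNIV" using sets_eq_imp_space_eq[OF s] by simp
 have fm: "fst c \<in> sets m" using chartsD(1)[OF c] s by simp
 have meas: "snd c \<in> restrict_space m (fst c) \<rightarrow>\<^sub>M restrict_space borel (chart_image c)"
  by (rule measurable_restrict_space2)
    (use chart_measurable[OF c s, of "fst c"] chartsD(1)[OF c] sp in \<open>auto simp: space_restrict_space chart_image_def\<close>)
 have "E \<in> sets (restrict_space borel (chart_image c))"
  using E chartsD(2)[OF c] by (simp add: sets_restrict_space_iff)
 then have "emeasure (pushf m c) E = emeasure (restrict_space m (fst c)) (snd c -` E \<inter> space (restrict_space m (fst c)))"
  unfolding pushf_def by (rule emeasure_distr[OF meas])
 also have "snd c -` E \<inter> space (restrict_space m (fst c)) = chart_inv c ` E"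
  unfolding chart_inv_image[OF c E(2)] by (auto simp: space_restrict_space sp)
 also have "emeasure (restrict_space m (fst c)) (chart_inv c ` E) = emeasure m (chart_inv c ` E)"
  using fm chartsD(7)[OF c] E(2) by (intro emeasure_restrict_space) auto
 finally show ?thesis .
qed

text \<open>Lebesgue measure of the chart image, carried back to a Borel measure on the whole
  manifold that is concentrated on the chart domain.\<close>

definition leb :: "('a, 'n) chart => 'a measure"
 where "leb c = distr (restrict_space lborel (chart_image c)) borel (chart_inv c)"

lemma sets_leb: "sets (leb c) = sets borel" by (simp add: leb_def)

lemma emeasure_leb:
 assumes c: "c \<in> charts \<A>" and F: "F \<in> sets borel" "F \<subseteq> fst c"
 shows "emeasure (leb c) F = emeasure lborel (snd c ` F)" "snd c ` F \<in> sets borel" proof -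
 have "chart_inv c \<in> borel_measurable (restrict_space borel (chart_image c))"
  by (rule borel_measurable_continuous_on_restrict[OF chartsD(4)[OF c]])
 then have meas: "chart_inv c \<in> restrict_space lborel (chart_image c) \<rightarrow>\<^sub>M borel"
  using measurable_cong_sets[OF sets_restrict_space_cong[OF sets_lborel] refl] by blast
 have eq: "chart_inv c -` F \<inter> space (restrict_space lborel (chart_image c)) = snd c ` F" proof
  show "chart_inv c -` F \<inter> space (restrict_space lborel (chart_image c)) \<subseteq> snd c ` F"
   using chartsD(8)[OF c] by (force simp: space_restrict_space image_iff)
  show "snd c ` F \<subseteq> chart_inv c -` F \<inter> space (restrict_space lborel (chart_image c))"
   using chartsD(5)[OF c] F(2) by (auto simp: space_restrict_space chart_image_def)
 qed
 have "emeasure (leb c) F = emeasure (restrict_space lborel (chart_image c)) (snd c ` F)"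
  unfolding leb_def emeasure_distr[OF meas F(1)] eq ..
 also have "... = emeasure lborel (snd c ` F)"
  using chartsD(2)[OF c] F(2) by (intro emeasure_restrict_space) (auto simp: chart_image_def)
 finally show "emeasure (leb c) F = emeasure lborel (snd c ` F)" .
 have "snd c ` F \<in> sets (restrict_space lborel (chart_image c))"
  using measurable_sets[OF meas F(1)] unfolding eq .
 then show "snd c ` F \<in> sets borel" using chartsD(2)[OF c] by (simp add: sets_restrict_space_iff)
qed

text \<open>The disjoint balls lie in \<open>U\<close> and their triples cover \<open>K\<close>. One
  factor \<open>C\<close> comes from each of the two mass bounds, and the power of 3 from the
  enlargement.\<close>

lemma vitali_compare:
 assumes s: "sets aa = sets borel" "sets bt = sets borel" and C: "0 < C" and r1: "0 < r1"
  and up: "\<And>p r. p \<in> K ==> 0 < r ==> r < r1 ==> emeasure aa (db p r) <= ennreal (C * r powr Q)"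
  and lo: "\<And>p r. p \<in> K ==> 0 < r ==> r < r1 ==> ennreal (r powr Q / C) <= emeasure bt (db p r)"
  and K: "compact K" "K \<subseteq> U" and U: "open U"
 shows "emeasure aa K <= ennreal (C * C * 3 powr Q) * emeasure bt U" proof -
 have "\<exists>r>0. 3 * r < r1 \<and> db p r \<subseteq> U" if "p \<in> K" for p proof -
  obtain r where r: "0 < r" "db p r \<subseteq> U" using open_contains_db[OF U] K(2) \<open>p \<in> K\<close> by blast
  then show ?thesis using r1 db_mono[of "min r (r1 / 4)" r p] by (intro exI[of _ "min r (r1 / 4)"]) auto
 qed
 then obtain r where r: "\<And>p. p \<in> K ==> 0 < r p \<and> 3 * r p < r1 \<and> db p (r p) \<subseteq> U" by metis
 have "K \<subseteq> (\<Union>p\<in>K. db p (r p))" using r center_in_db by blast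
 then obtain I where I: "I \<subseteq> K" "finite I" "K \<subseteq> (\<Union>p\<in>I. db p (r p))"
  using compactE_image[OF K(1), of K "\<lambda>p. db p (r p)"] open_db by blast
 obtain J where "J \<subseteq> I \<and> (\<forall>i\<in>J. \<forall>j\<in>J. i \<noteq> j --> {y. d i y < r i} \<inter> {y. d j y < r j} = {}) \<and>
  (\<Union>i\<in>I. {y. d i y < r i}) \<subseteq> (\<Union>i\<in>J. {y. d i y < 3 * r i})"
  using vitali_finite[of d I "\<lambda>p. p" r, OF d_sym d_triangle I(2)] by blast
 then have J: "J \<subseteq> I" "\<And>i j. i \<in> J ==> j \<in> J ==> i \<noteq> j ==> db i (r i) \<inter> db j (r j) = {}"
  "K \<subseteq> (\<Union>p\<in>J. db p (3 * r p))" using I(3) by (auto simp: db_eq)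
 have Jf: "finite J" using J(1) I(2) finite_subset by blast
 have JK: "J \<subseteq> K" using J(1) I(1) by blast
 have meas: "db p r \<in> sets aa" "db p r \<in> sets bt" for p r using open_db s by auto
 have "emeasure aa K <= emeasure aa (\<Union>p\<in>J. db p (3 * r p))"
  using J(3) meas Jf by (intro emeasure_mono sets.finite_UN) auto
 also have "... <= (\<Sum>p\<in>J. emeasure aa (db p (3 * r p)))"
  using meas Jf by (intro emeasure_subadditive_finite) auto
 also have "... <= (\<Sum>p\<in>J. ennreal (C * C * 3 powr Q) * emeasure bt (db p (r p)))" proof (rule sum_mono)
  fix p assume "p \<in> J"
  then have p: "p \<in> K" "0 < r p" "3 * r p < r1" using JK r by auto
  have "emeasure aa (db p (3 * r p)) <= ennreal (C * (3 * r p) powr Q)" using up[of p "3 * r p"] p by simp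
  also have "... = ennreal (C * C * 3 powr Q) * ennreal (r p powr Q / C)"
   using C p by (subst ennreal_mult[symmetric]) (auto simp: powr_mult)
  also have "... <= ennreal (C * C * 3 powr Q) * emeasure bt (db p (r p))" using lo[of p "r p"] p by (intro mult_left_mono) auto
  finally show "emeasure aa (db p (3 * r p)) <= ennreal (C * C * 3 powr Q) * emeasure bt (db p (r p))" .
 qed
 also have "... = ennreal (C * C * 3 powr Q) * emeasure bt (\<Union>p\<in>J. db p (r p))" proof -
  have "disjoint_family_on (\<lambda>p. db p (r p)) J" using J(2) by (auto simp: disjoint_family_on_def)
  then have "(\<Sum>p\<in>J. emeasure bt (db p (r p))) = emeasure bt (\<Union>p\<in>J. db p (r p))"
   using meas Jf by (intro sum_emeasure) auto
  then show ?thesis by (simp flip: sum_distrib_left)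
 qed
 also have "... <= ennreal (C * C * 3 powr Q) * emeasure bt U"
  using r JK U s by (intro mult_left_mono emeasure_mono) auto
 finally show ?thesis .
qed

text \<open>Both measures are transported to Euclidean space, where approximation by compact and by
  open sets is available; only the comparison of a compact set with an open neighbourhood is made on
  the manifold.\<close>

lemma local_compare:
 assumes c: "c \<in> charts \<A>" and W: "open W" "W \<subseteq> chart_image c"
  and s: "sets aa = sets borel" "sets bt = sets borel" and C: "0 < C" and r1: "0 < r1"
  and up: "\<And>x r. x \<in> W ==> 0 < r ==> r < r1 ==> emeasure aa (db (chart_inv c x) r) <= ennreal (C * r powr Q)"
  and lo: "\<And>x r. x \<in> W ==> 0 < r ==> r < r1 ==> ennreal (r powr Q / C) <= emeasure bt (db (chart_inv c x) r)"
  and fin: "emeasure bt (chart_inv c ` W) \<noteq> \<infinity>" and F: "F \<in> sets borel" "F \<subseteq> chart_inv c ` W"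
 shows "emeasure aa F <= ennreal (C * C * 3 powr Q) * emeasure bt F" proof -
 let ?D = "chart_inv c ` W"
 have De: "?D = fst c \<inter> snd c -` W" by (rule chart_inv_image[OF c W(2)])
 have D: "open ?D" unfolding De by (rule continuous_open_preimage[OF chartsD(3,1)[OF c] W(1)])
 then have Db: "?D \<in> sets borel" "?D \<subseteq> fst c" using De by auto
 define P where "P m = distr (restrict_space m ?D) borel (snd c)" for m
 have P: "emeasure (P m) E = emeasure m (chart_inv c ` (E \<inter> W))" if m: "sets m = sets borel" and E: "E \<in> sets borel" for m E
 proof -
  have sp: "space m = UNIV" using sets_eq_imp_space_eq[OF m] by simp
  have "emeasure (P m) E = emeasure (restrict_space m ?D) (snd c -` E \<inter> space (restrict_space m ?D))"
   unfolding P_def by (rule emeasure_distr[OF chart_measurable[OF c m Db] E])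
  also have "snd c -` E \<inter> space (restrict_space m ?D) = chart_inv c ` (E \<inter> W)"
   using W(2) by (subst chart_inv_image[OF c]) (auto simp: space_restrict_space sp De)
  also have "emeasure (restrict_space m ?D) (chart_inv c ` (E \<inter> W)) = emeasure m (chart_inv c ` (E \<inter> W))"
   using Db m by (intro emeasure_restrict_space) auto
  finally show ?thesis .
 qed
 let ?C = "C * C * 3 powr Q"
 have key: "emeasure (P aa) E <= ennreal ?C * emeasure (P bt) E" if E: "E \<in> sets borel" "E \<subseteq> W" for E
 proof (rule emeasure_le_of_compact_open[OF _ _ _ W(1) _ _ E])
  show "emeasure (P bt) (space (P bt)) \<noteq> \<infinity>" using P[OF s(2), of UNIV] fin by (simp add: P_def)
  show "0 < ?C" using C by simp
  fix K U :: "(real ^ 'n) set" assume KU: "compact K" "open U" "K \<subseteq> U" "U \<subseteq> W"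
  have KW: "K \<inter> W = K" "U \<inter> W = U" using KU by auto
  have "emeasure aa (chart_inv c ` K) <= ennreal ?C * emeasure bt (chart_inv c ` U)"
  proof (rule vitali_compare[OF s C r1])
   show "compact (chart_inv c ` K)"
    by (rule compact_continuous_image[OF continuous_on_subset[OF chartsD(4)[OF c]] KU(1)]) (use KU W in auto)
   have "chart_inv c ` U = fst c \<inter> snd c -` U" by (rule chart_inv_image[OF c]) (use KU W in auto)
   then show "open (chart_inv c ` U)" using continuous_open_preimage[OF chartsD(3,1)[OF c] KU(2)] by simp
  qed (use up lo KU in auto)
  then show "emeasure (P aa) K <= ennreal ?C * emeasure (P bt) U"
   using P[OF s(1) borel_compact[OF KU(1)]] P[OF s(2), of U] KU(2) KW by simp
 qed (simp_all add: P_def)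
 have sF: "snd c ` F \<in> sets borel" "snd c ` F \<subseteq> W" "chart_inv c ` (snd c ` F \<inter> W) = F" proof -
  show "snd c ` F \<in> sets borel" by (rule emeasure_leb(2)[OF c F(1)]) (use F Db in auto)
  show 1: "snd c ` F \<subseteq> W" using F(2) De by auto
  have "chart_inv c ` snd c ` F = (\<lambda>q. q) ` F"
   unfolding image_image by (rule image_cong) (use F(2) De chartsD(5)[OF c] in auto)
  then show "chart_inv c ` (snd c ` F \<inter> W) = F" using 1 by (simp add: Int_absorb2)
 qed
 show ?thesis using key[OF sF(1,2)] P[OF s(1) sF(1)] P[OF s(2) sF(1)] by (simp add: sF(3))
qed

lemma image_of_chart_inv:
 assumes c: "c \<in> charts \<A>" and F: "F \<subseteq> fst c"
 shows "chart_inv c ` snd c ` F = F" "snd c ` F \<subseteq> chart_image c" proof -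
 have "chart_inv c ` snd c ` F = (\<lambda>q. q) ` F"
  unfolding image_image by (rule image_cong) (use F chartsD(5)[OF c] in auto)
 then show "chart_inv c ` snd c ` F = F" by simp
 show "snd c ` F \<subseteq> chart_image c" using F chartsD(6)[OF c] by blast
qed

lemma bounded_chart:
 assumes b: "bounded_measure \<A> m" and s: "sets m = sets borel" and pc: "c \<in> precompact_charts \<A>"
 shows "\<exists>C>0. \<forall>F\<in>sets borel. F \<subseteq> fst c -->
  emeasure m F <= ennreal C * emeasure (leb c) F \<and> emeasure (leb c) F <= ennreal C * emeasure m F"
proof -
 have c: "c \<in> charts \<A>" using pc by (simp add: precompact_charts_def)
 let ?L = "restrict_space lborel (chart_image c)"
 obtain rh c0 C0 where rh: "rh \<in> borel_measurable ?L" "pushf m c = density ?L (\<lambda>x. ennreal (rh x))"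
  and cC: "0 < c0" "c0 <= C0" "AE x in ?L. c0 <= rh x \<and> rh x <= C0"
  using b pc unfolding bounded_measure_def Let_def pushf_def by blast
 define C where "C = max C0 (1 / c0)"
 have C: "0 < C" "C0 <= C" "1 <= C * c0" using cC by (auto simp: C_def max_def field_simps)
 show ?thesis proof (intro exI[of _ C] conjI ballI impI C)
  fix F assume F: "F \<in> sets borel" "F \<subseteq> fst c"
  let ?E = "snd c ` F"
  have E: "?E \<in> sets borel" "?E \<subseteq> chart_image c" "chart_inv c ` ?E = F"
   using emeasure_leb(2)[OF c F] image_of_chart_inv[OF c F(2)] by auto
  have EL: "?E \<in> sets ?L" using E chartsD(2)[OF c] by (simp add: sets_restrict_space_iff)
  have m: "emeasure m F = (\<integral>\<^sup>+x. ennreal (rh x) * indicator ?E x \<partial>?L)"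
   using emeasure_pushf[OF c s E(1,2)] rh EL by (simp add: E(3) emeasure_density)
  have l: "emeasure (leb c) F = emeasure ?L ?E"
   unfolding emeasure_leb(1)[OF c F] using E chartsD(2)[OF c] by (intro emeasure_restrict_space[symmetric]) auto
  have i: "(\<integral>\<^sup>+x. ennreal t * indicator ?E x \<partial>?L) = ennreal t * emeasure (leb c) F" for t
   unfolding l using EL by (rule nn_integral_cmult_indicator)
  have "emeasure m F <= (\<integral>\<^sup>+x. ennreal C0 * indicator ?E x \<partial>?L)"
   unfolding m by (intro nn_integral_mono_AE, use cC(3) in eventually_elim) (auto simp: indicator_def ennreal_leI)
  also have "... <= ennreal C * emeasure (leb c) F" unfolding i by (intro mult_right_mono ennreal_leI C) simp
  finally show "emeasure m F <= ennreal C * emeasure (leb c) F" .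
  have "ennreal c0 * emeasure (leb c) F <= emeasure m F"
   unfolding m i[symmetric] by (intro nn_integral_mono_AE, use cC(3) in eventually_elim) (auto simp: indicator_def ennreal_leI)
  then have "ennreal C * (ennreal c0 * emeasure (leb c) F) <= ennreal C * emeasure m F" by (intro mult_left_mono) auto
  moreover have "ennreal 1 * emeasure (leb c) F <= ennreal (C * c0) * emeasure (leb c) F"
   by (intro mult_right_mono ennreal_leI C) simp
  ultimately show "emeasure (leb c) F <= ennreal C * emeasure m F"
   using C cC by (simp add: ennreal_mult mult.assoc)
 qed
qed

lemma chart_bounded:
 assumes c: "c \<in> charts \<A>" and s: "sets m = sets borel" and fin: "emeasure (leb c) (fst c) \<noteq> \<infinity>" and C: "0 < C"
  and cmp: "\<And>F. F \<in> sets borel ==> F \<subseteq> fst c ==>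
   emeasure m F <= ennreal C * emeasure (leb c) F \<and> emeasure (leb c) F <= ennreal C * emeasure m F"
 shows "let pushforward = distr (restrict_space m (fst c)) (restrict_space borel (chart_image c)) (snd c);
      leb = restrict_space lborel (chart_image c) in absolutely_continuous leb pushforward \<and>
     (\<exists>rh \<in> borel_measurable leb. pushforward = density leb (\<lambda>x. ennreal (rh x)) \<and>
       (\<exists>c0 C0 :: real. 0 < c0 \<and> c0 <= C0 \<and> (AE x in leb. c0 <= rh x \<and> rh x <= C0)))"
 unfolding Let_def pushf_def[symmetric] proof (rule density_bounds[OF _ _ C])
 let ?L = "restrict_space lborel (chart_image c)"
 have op: "open (chart_image c)" by (rule chartsD(2)[OF c])
 have sL: "E \<in> sets borel \<and> E \<subseteq> chart_image c" if "E \<in> sets ?L" for E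
  using that op by (simp add: sets_restrict_space_iff)
 have key: "emeasure (pushf m c) E = emeasure m (chart_inv c ` E) \<and> emeasure ?L E = emeasure (leb c) (chart_inv c ` E) \<and>
  chart_inv c ` E \<in> sets borel \<and> chart_inv c ` E \<subseteq> fst c" if E: "E \<in> sets ?L" for E proof -
  have Eb: "E \<in> sets borel" "E \<subseteq> chart_image c" using sL[OF E] by auto
  have F: "chart_inv c ` E \<in> sets borel" "chart_inv c ` E \<subseteq> fst c"
   unfolding chart_inv_image[OF c Eb(2)] using vimage_borel[OF c Eb(1)] by auto
  have "snd c ` chart_inv c ` E = (\<lambda>x. x) ` E"
   unfolding image_image by (rule image_cong) (use Eb chartsD(8)[OF c] in auto)
  then have "emeasure (leb c) (chart_inv c ` E) = emeasure lborel E" using emeasure_leb(1)[OF c F] by simp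
  also have "... = emeasure ?L E" using op Eb by (intro emeasure_restrict_space[symmetric]) auto
  finally show ?thesis using emeasure_pushf[OF c s Eb] F by simp
 qed
 have "space ?L = chart_image c" by (simp add: space_restrict_space)
 moreover have "chart_inv c ` chart_image c = fst c"
  unfolding chart_inv_image[OF c order_refl] using chartsD(6)[OF c] by auto
 moreover have "space ?L \<in> sets ?L" by (rule sets.top)
 ultimately show "emeasure ?L (space ?L) \<noteq> \<infinity>" using key[of "space ?L"] fin by simp
 show "sets (pushf m c) = sets ?L"
  unfolding pushf_def sets_distr by (rule sets_restrict_space_cong) simp
 show "emeasure (pushf m c) E <= ennreal C * emeasure ?L E" "emeasure ?L E <= ennreal C * emeasure (pushf m c) E"
  if "E \<in> sets ?L" for E using key[OF that] cmp[of "chart_inv c ` E"] by simp_all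
qed

text \<open>Both \<open>m\<close> and the Lebesgue measure of the chart give mass comparable to
  \<open>r powr Q\<close> to small balls, so the covering comparison works in both
  directions.\<close>

lemma ahlfors_compare:
 assumes s: "sets m = sets borel" and ah: "locally_ahlfors_regular UNIV d Q m" and c: "c \<in> charts_at \<A> q"
 shows "\<exists>G C. open G \<and> q \<in> G \<and> 0 < C \<and> (\<forall>F\<in>sets borel. F \<subseteq> G -->
  emeasure m F <= ennreal C * emeasure (leb c) F \<and> emeasure (leb c) F <= ennreal C * emeasure m F)"
proof -
 have cc: "c \<in> charts \<A>" "q \<in> fst c" using c by (auto simp: charts_at_def)
 let ?x = "snd c q"
 show ?thesis proof (rule ball_measure[OF c chartsD(2)[OF cc(1)] chartsD(6)[OF cc]])
  fix R r0 CB
  assume *: "0 < R" "0 < r0" "1 <= CB" "cball ?x R \<subseteq> chart_image c"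
   and sub: "\<And>p r. p \<in> cball ?x R ==> 0 < r ==> r < r0 ==> db (chart_inv c p) r \<subseteq> fst c"
   and lo: "\<And>p r. p \<in> cball ?x R ==> 0 < r ==> r < r0 ==>
     ennreal (r powr Q / CB) <= emeasure lborel (snd c ` db (chart_inv c p) r)"
   and up: "\<And>p r. p \<in> cball ?x R ==> 0 < r ==> r < r0 ==>
     emeasure lborel (snd c ` db (chart_inv c p) r) <= ennreal (CB * r powr Q)"
  let ?A = "chart_inv c ` cball ?x R"
  have "compact ?A"
   by (rule compact_continuous_image[OF continuous_on_subset[OF chartsD(4)[OF cc(1)] *(4)] compact_cball])
  then have "compactin ms.mtopology ?A" unfolding mtopology_euclidean by simp
  then obtain CA rA where A: "1 <= CA" "0 < rA"
   "\<And>p r. p \<in> ?A ==> 0 < r ==> r < rA ==> ennreal (inverse CA * r powr Q) <= emeasure m (db p r) \<and>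
    emeasure m (db p r) <= ennreal (CA * r powr Q)"
   using ah unfolding locally_ahlfors_regular_def mball_db by blast
  define C where "C = max CA CB"
  have C: "0 < C" "CA <= C" "CB <= C" using A(1) by (auto simp: C_def)
  let ?W = "ball ?x R"
  have W: "open ?W" "?W \<subseteq> chart_image c" using *(4) ball_subset_cball by auto
  have mono: "ennreal (r powr Q / C) <= ennreal (r powr Q / t)" "ennreal (t * r powr Q) <= ennreal (C * r powr Q)"
   if "1 <= t" "t <= C" for r t using that C(1) by (intro ennreal_leI divide_left_mono mult_right_mono; simp)+
  have mb: "ennreal (r powr Q / C) <= emeasure m (db (chart_inv c x) r)" "emeasure m (db (chart_inv c x) r) <= ennreal (C * r powr Q)"
   if "x \<in> ?W" "0 < r" "r < min r0 rA" for x r proof -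
   have "chart_inv c x \<in> ?A" using that by auto
   from A(3)[OF this, of r] that have "ennreal (inverse CA * r powr Q) <= emeasure m (db (chart_inv c x) r)"
    "emeasure m (db (chart_inv c x) r) <= ennreal (CA * r powr Q)" by auto
   then show "ennreal (r powr Q / C) <= emeasure m (db (chart_inv c x) r)" "emeasure m (db (chart_inv c x) r) <= ennreal (C * r powr Q)"
    using mono[OF A(1) C(2)] by (auto simp: divide_inverse mult.commute intro: order_trans)
  qed
  have lb: "ennreal (r powr Q / C) <= emeasure (leb c) (db (chart_inv c x) r)" "emeasure (leb c) (db (chart_inv c x) r) <= ennreal (C * r powr Q)"
   if "x \<in> ?W" "0 < r" "r < min r0 rA" for x r proof -
   have x: "x \<in> cball ?x R" "r < r0" using that by auto
   have "emeasure (leb c) (db (chart_inv c x) r) = emeasure lborel (snd c ` db (chart_inv c x) r)"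
    using open_db by (intro emeasure_leb(1)[OF cc(1)] sub[OF x(1) that(2) x(2)]) auto
   then show "ennreal (r powr Q / C) <= emeasure (leb c) (db (chart_inv c x) r)" "emeasure (leb c) (db (chart_inv c x) r) <= ennreal (C * r powr Q)"
    using lo[OF x(1) that(2) x(2)] up[OF x(1) that(2) x(2)] mono[OF *(3) C(3)] by (auto intro: order_trans)
  qed
  have r1: "0 < min r0 rA" using * A by simp
  let ?D = "chart_inv c ` ?W" and ?C = "C * C * 3 powr Q"
  have De: "?D = fst c \<inter> snd c -` ?W" by (rule chart_inv_image[OF cc(1) W(2)])
  have D: "open ?D" unfolding De by (rule continuous_open_preimage[OF chartsD(3,1)[OF cc(1)] W(1)])
  have "snd c ` ?D = (\<lambda>x. x) ` ?W"
   unfolding image_image by (rule image_cong) (use W(2) chartsD(8)[OF cc(1)] in auto)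
  then have "emeasure (leb c) ?D = emeasure lborel ?W"
   using emeasure_leb(1)[OF cc(1), of ?D] D De by auto
  also have "... < \<infinity>" by (rule emeasure_bounded_finite) simp
  finally have fin: "emeasure (leb c) ?D \<noteq> \<infinity>" by simp
  have c1: "emeasure m F <= ennreal ?C * emeasure (leb c) F" if "F \<in> sets borel" "F \<subseteq> ?D" for F
   by (rule local_compare[OF cc(1) W s sets_leb C(1) r1 mb(2) lb(1) fin that])
  \<comment> \<open>The reverse comparison needs \<open>m\<close> to be finite on the domain, which
    is obtained from the first one.\<close>
  have "emeasure m ?D <= ennreal ?C * emeasure (leb c) ?D" by (rule c1) (use D in auto)
  also have "... < \<infinity>" using fin by (simp add: ennreal_mult_less_top less_top)
  finally have finm: "emeasure m ?D \<noteq> \<infinity>" by simp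
  have c2: "emeasure (leb c) F <= ennreal ?C * emeasure m F" if "F \<in> sets borel" "F \<subseteq> ?D" for F
   by (rule local_compare[OF cc(1) W sets_leb s C(1) r1 lb(2) mb(1) finm that])
  have "q \<in> ?D" unfolding De using cc *(1) by simp
  moreover have "0 < ?C" using C by simp
  ultimately show ?thesis using D c1 c2 by (intro exI[of _ ?D] exI[of _ ?C]) blast
 qed
qed

text \<open>Local comparisons are patched over the compact closure of the chart domain. Points of
  the boundary lie outside the chart \<open>c\<close>, hence the comparison is made with the larger
  chart \<open>c'\<close>, whose Lebesgue measure agrees with that of \<open>c\<close> on the
  domain.\<close>

lemma ahlfors_imp_bounded:
 assumes s: "sets m = sets borel" and ah: "locally_ahlfors_regular UNIV d Q m"
 shows "bounded_measure \<A> m" unfolding bounded_measure_def proof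
 fix c assume pc: "c \<in> precompact_charts \<A>"
 then obtain c' where c: "c \<in> charts \<A>" and K: "compact (closure (fst c))" and c': "c' \<in> charts \<A>"
  "closure (fst c) \<subseteq> fst c'" "\<And>q. q \<in> fst c ==> snd c q = snd c' q"
  unfolding precompact_charts_def by blast
 have lc: "emeasure (leb c) F = emeasure (leb c') F" if F: "F \<in> sets borel" "F \<subseteq> fst c" for F
 proof -
  have "F \<subseteq> fst c'" using F(2) closure_subset[of "fst c"] c'(2) by blast
  moreover have "snd c ` F = snd c' ` F" by (rule image_cong) (use F(2) c'(3) in auto)
  ultimately show ?thesis using emeasure_leb(1)[OF c F] emeasure_leb(1)[OF c'(1) F(1)] by simp
 qed
 have "\<exists>G C. open G \<and> q \<in> G \<and> 0 < C \<and> (\<forall>F\<in>sets borel. F \<subseteq> G -->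
  emeasure m F <= ennreal C * emeasure (leb c') F \<and> emeasure (leb c') F <= ennreal C * emeasure m F)"
  if "q \<in> closure (fst c)" for q
  by (rule ahlfors_compare[OF s ah]) (use that c' in \<open>auto simp: charts_at_def\<close>)
 then obtain G C where OC: "\<And>q. q \<in> closure (fst c) ==> open (G q) \<and> q \<in> G q \<and> 0 < C q \<and> (\<forall>F\<in>sets borel. F \<subseteq> G q -->
  emeasure m F <= ennreal (C q) * emeasure (leb c') F \<and> emeasure (leb c') F <= ennreal (C q) * emeasure m F)" by metis
 have G: "open (G q)" "q \<in> G q" "0 < C q" if "q \<in> closure (fst c)" for q
  using OC[OF that] by simp_all
 have mC: "emeasure m F <= ennreal (C q) * emeasure (leb c') F" "emeasure (leb c') F <= ennreal (C q) * emeasure m F"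
  if "q \<in> closure (fst c)" "F \<in> sets borel" "F \<subseteq> G q" for q F
  using OC[OF that(1)] that(2,3) by simp_all
 obtain I where I: "I \<subseteq> closure (fst c)" "finite I" "closure (fst c) \<subseteq> (\<Union>q\<in>I. G q)"
  using compactE_image[OF K, of "closure (fst c)" G] G(1,2) by blast
 \<comment> \<open>A set in the domain is split among the neighbourhoods, so the local constants are
   added; the summand 1 ensures positivity.\<close>
 define C' where "C' = 1 + (\<Sum>q\<in>I. C q)"
 have Cp: "0 <= C q" if "q \<in> I" for q using G(3)[of q] I(1) that by auto
 have C': "0 < C'" "ennreal (\<Sum>q\<in>I. C q) <= ennreal C'"
  using sum_nonneg[of I C, OF Cp] by (auto simp: C'_def intro: ennreal_leI)
 have cmp: "emeasure aa F <= ennreal C' * emeasure bt F"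
  if sab: "sets aa = sets borel" "sets bt = sets borel"
   and le: "\<And>q F. q \<in> I ==> F \<in> sets borel ==> F \<subseteq> G q ==> emeasure aa F <= ennreal (C q) * emeasure bt F"
   and F: "F \<in> sets borel" "F \<subseteq> fst c" for aa bt :: "'a measure" and F proof -
  have Ob: "G q \<in> sets borel" if "q \<in> I" for q using G(1)[of q] I(1) that by auto
  have "F \<subseteq> (\<Union>q\<in>I. F \<inter> G q)" using F(2) closure_subset[of "fst c"] I(3) by blast
  then have "emeasure aa F <= emeasure aa (\<Union>q\<in>I. F \<inter> G q)"
   using Ob F(1) I(2) sab by (intro emeasure_mono sets.finite_UN) auto
  also have "... <= (\<Sum>q\<in>I. emeasure aa (F \<inter> G q))"
   using Ob F(1) I(2) sab by (intro emeasure_subadditive_finite) auto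
  also have "... <= (\<Sum>q\<in>I. ennreal (C q) * emeasure bt F)" proof (rule sum_mono)
   fix q assume q: "q \<in> I"
   have "emeasure aa (F \<inter> G q) <= ennreal (C q) * emeasure bt (F \<inter> G q)" using Ob[OF q] F(1) by (intro le q) auto
   also have "... <= ennreal (C q) * emeasure bt F" using F(1) sab by (intro mult_left_mono emeasure_mono) auto
   finally show "emeasure aa (F \<inter> G q) <= ennreal (C q) * emeasure bt F" .
  qed
  also have "... = ennreal (\<Sum>q\<in>I. C q) * emeasure bt F"
   using Cp by (simp add: sum_distrib_right[symmetric] sum_ennreal)
  also have "... <= ennreal C' * emeasure bt F" by (intro mult_right_mono C') simp
  finally show ?thesis .
 qed
 show "let pushforward = distr (restrict_space m (fst c)) (restrict_space borel (chart_image c)) (snd c);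
      leb = restrict_space lborel (chart_image c) in absolutely_continuous leb pushforward \<and>
     (\<exists>rh \<in> borel_measurable leb. pushforward = density leb (\<lambda>x. ennreal (rh x)) \<and>
       (\<exists>c0 C0 :: real. 0 < c0 \<and> c0 <= C0 \<and> (AE x in leb. c0 <= rh x \<and> rh x <= C0)))"
 proof (rule chart_bounded[OF c s _ C'(1)])
  have fb: "fst c \<in> sets borel" using chartsD(1)[OF c] by simp
  have cK: "compact (snd c' ` closure (fst c))"
   by (rule compact_continuous_image[OF continuous_on_subset[OF chartsD(3)[OF c'(1)] c'(2)] K])
  have "emeasure (leb c) (fst c) = emeasure lborel (snd c ` fst c)" by (rule emeasure_leb(1)[OF c fb order_refl])
  also have "... <= emeasure lborel (snd c' ` closure (fst c))" proof (rule emeasure_mono)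
   show "snd c ` fst c \<subseteq> snd c' ` closure (fst c)" using c'(3) closure_subset[of "fst c"] by auto
  qed (use borel_compact[OF cK] in simp)
  also have "... < \<infinity>" by (rule emeasure_bounded_finite[OF compact_imp_bounded[OF cK]])
  finally show "emeasure (leb c) (fst c) \<noteq> \<infinity>" by simp
  fix F assume F: "F \<in> sets borel" "F \<subseteq> fst c"
  show "emeasure m F <= ennreal C' * emeasure (leb c) F \<and> emeasure (leb c) F <= ennreal C' * emeasure m F"
   unfolding lc[OF F] proof
   show "emeasure m F <= ennreal C' * emeasure (leb c') F"
    by (rule cmp[OF s sets_leb _ F]) (rule mC(1)[OF subsetD[OF I(1)]])
   show "emeasure (leb c') F <= ennreal C' * emeasure m F"
    by (rule cmp[OF sets_leb s _ F]) (rule mC(2)[OF subsetD[OF I(1)]])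
  qed
 qed
qed

text \<open>Shrinking a chart to the preimage of a small ball produces a precompact chart, to which
  boundedness applies. The lower bound is stated with the constant on the right, so that it survives
  an enlargement of the constant.\<close>

lemma bounded_ahlfors_local:
 assumes s: "sets m = sets borel" and b: "bounded_measure \<A> m"
 shows "\<exists>G C r1. open G \<and> q \<in> G \<and> 0 <= C \<and> 0 < r1 \<and> (\<forall>p\<in>G. \<forall>r. 0 < r --> r < r1 -->
   ennreal (r powr Q) <= ennreal C * emeasure m (db p r) \<and> emeasure m (db p r) <= ennreal (C * r powr Q))"
proof -
 obtain a where a: "a \<in> charts_at \<A> q" using charts_at_nonempty by blast
 then have ac: "a \<in> charts \<A>" "q \<in> fst a" by (auto simp: charts_at_def)
 let ?x = "snd a q"
 obtain e where e: "0 < e" "cball ?x e \<subseteq> chart_image a"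
  using chartsD(2)[OF ac(1)] chartsD(6)[OF ac] open_contains_cball by blast
 let ?W = "fst a \<inter> snd a -` ball ?x e"
 define c where "c = (?W, snd a)"
 have W: "open ?W" by (rule continuous_open_preimage[OF chartsD(3,1)[OF ac(1)] open_ball])
 have cc: "c \<in> charts \<A>" unfolding c_def by (rule restrict_chart(1)[OF ac(1) W]) auto
 let ?K = "chart_inv a ` cball ?x e"
 have K: "compact ?K"
  by (rule compact_continuous_image[OF continuous_on_subset[OF chartsD(4)[OF ac(1)] e(2)] compact_cball])
 have "?W \<subseteq> ?K" unfolding chart_inv_image[OF ac(1) e(2)] by auto
 then have clW: "closure ?W \<subseteq> ?K" by (rule closure_minimal[OF _ compact_imp_closed[OF K]])
 have Ka: "?K \<subseteq> fst a" unfolding chart_inv_image[OF ac(1) e(2)] by auto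
 have "compact (closure ?W)" using compact_Int_closed[OF K closed_closure[of ?W]] clW by (simp add: Int_absorb1)
 then have pc: "c \<in> precompact_charts \<A>"
  unfolding precompact_charts_def using cc clW Ka ac(1) by (auto simp: c_def intro!: bexI[of _ a])
 obtain C1 where C1: "0 < C1" "\<And>F. F \<in> sets borel ==> F \<subseteq> fst c ==>
  emeasure m F <= ennreal C1 * emeasure (leb c) F \<and> emeasure (leb c) F <= ennreal C1 * emeasure m F"
  using bounded_chart[OF b s pc] by blast
 have xe: "?x \<in> ball ?x e" using e by simp
 show ?thesis proof (rule ball_measure[OF a open_ball xe])
  fix R r0 C
  assume *: "0 < R" "0 < r0" "1 <= C" "cball ?x R \<subseteq> ball ?x e"
   and sub: "\<And>p r. p \<in> cball ?x R ==> 0 < r ==> r < r0 ==> db (chart_inv a p) r \<subseteq> fst a"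
   and im: "\<And>p r. p \<in> cball ?x R ==> 0 < r ==> r < r0 ==> snd a ` db (chart_inv a p) r \<subseteq> cball p (C * r)"
   and lo: "\<And>p r. p \<in> cball ?x R ==> 0 < r ==> r < r0 ==>
     ennreal (r powr Q / C) <= emeasure lborel (snd a ` db (chart_inv a p) r)"
   and up: "\<And>p r. p \<in> cball ?x R ==> 0 < r ==> r < r0 ==>
     emeasure lborel (snd a ` db (chart_inv a p) r) <= ennreal (C * r powr Q)"
  \<comment> \<open>Centres in the half ball and the second bound on the radius keep the coordinate
    image of the ball inside the domain of the precompact chart.\<close>
  let ?G = "fst a \<inter> snd a -` ball ?x (R / 2)" and ?r = "min r0 (R / 2 / C)"
  have G: "open ?G" by (rule continuous_open_preimage[OF chartsD(3,1)[OF ac(1)] open_ball])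
  have bd: "ennreal (r powr Q) <= ennreal (C1 * C) * emeasure m (db p r) \<and> emeasure m (db p r) <= ennreal (C1 * C * r powr Q)"
   if p: "p \<in> ?G" and r: "0 < r" "r < ?r" for p r proof -
   have rr: "r < r0" "C * r <= R / 2" using r *(3) by (auto simp: pos_less_divide_eq mult_ac)
   have x: "snd a p \<in> cball ?x R" "chart_inv a (snd a p) = p" using p *(1) chartsD(5)[OF ac(1), of p] by auto
   note B = sub[OF x(1) r(1) rr(1), unfolded x(2)] im[OF x(1) r(1) rr(1), unfolded x(2)]
    lo[OF x(1) r(1) rr(1), unfolded x(2)] up[OF x(1) r(1) rr(1), unfolded x(2)]
   have "cball (snd a p) (C * r) \<subseteq> cball ?x R" proof
    fix z assume "z \<in> cball (snd a p) (C * r)"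
    then show "z \<in> cball ?x R" using p rr(2) dist_triangle[of ?x z "snd a p"] by simp
   qed
   then have "snd a ` db p r \<subseteq> ball ?x e" using B(2) *(4) by blast
   then have dW: "db p r \<subseteq> fst c" using B(1) by (auto simp: c_def)
   have dB: "db p r \<in> sets borel" using open_db by simp
   have l: "emeasure (leb c) (db p r) = emeasure lborel (snd a ` db p r)"
    using emeasure_leb(1)[OF cc dB dW] by (simp add: c_def)
   have "ennreal (r powr Q) = ennreal C * ennreal (r powr Q / C)" using *(3) by (simp flip: ennreal_mult)
   also have "... <= ennreal C * (ennreal C1 * emeasure m (db p r))"
    using B(3) C1(2)[OF dB dW] l by (intro mult_left_mono) (auto intro: order_trans)
   also have "... = ennreal (C1 * C) * emeasure m (db p r)"
    using *(3) C1(1) by (simp add: ennreal_mult mult_ac)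
   finally have 1: "ennreal (r powr Q) <= ennreal (C1 * C) * emeasure m (db p r)" .
   have "emeasure m (db p r) <= ennreal C1 * ennreal (C * r powr Q)"
    using B(4) C1(2)[OF dB dW] l by (metis mult_left_mono order_trans zero_le)
   also have "... = ennreal (C1 * C * r powr Q)" using *(3) C1(1) by (simp add: ennreal_mult mult.assoc)
   finally show ?thesis using 1 by blast
  qed
  have "q \<in> ?G" "0 <= C1 * C" "0 < ?r" using ac * C1(1) by auto
  then show ?thesis using G bd by (intro exI[of _ ?G] exI[of _ "C1 * C"] exI[of _ ?r]) auto
 qed
qed

lemma bounded_imp_ahlfors:
 assumes s: "sets m = sets borel" and b: "bounded_measure \<A> m"
 shows "locally_ahlfors_regular UNIV d Q m" unfolding locally_ahlfors_regular_def
proof (intro allI impI)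
 fix A assume "compactin ms.mtopology A"
 then have A: "compact A" by (simp add: mtopology_euclidean)
 have "\<exists>G C r1. open G \<and> q \<in> G \<and> 0 <= C \<and> 0 < r1 \<and> (\<forall>p\<in>G. \<forall>r. 0 < r --> r < r1 -->
   ennreal (r powr Q) <= ennreal C * emeasure m (db p r) \<and> emeasure m (db p r) <= ennreal (C * r powr Q))" for q
  using bounded_ahlfors_local[OF s b, of q] by simp
 then obtain G C r1 where G: "\<And>q. open (G q) \<and> q \<in> G q \<and> 0 <= C q \<and> 0 < r1 q \<and> (\<forall>p\<in>G q. \<forall>r. 0 < r --> r < r1 q -->
   ennreal (r powr Q) <= ennreal (C q) * emeasure m (db p r) \<and> emeasure m (db p r) <= ennreal (C q * r powr Q))" by metis
 obtain I where I: "I \<subseteq> A" "finite I" "A \<subseteq> (\<Union>q\<in>I. G q)"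
  using compactE_image[OF A, of A G] G by blast
 obtain D where D: "0 < D" "ennreal D <= (SUP x\<in>UNIV. SUP y\<in>UNIV. ennreal (d x y))" using diam_pos by blast
 define C' where "C' = 1 + (\<Sum>q\<in>I. C q)"
 \<comment> \<open>Including \<open>D\<close> keeps the radius below the diameter and the set
   nonempty even if \<open>A\<close> is empty.\<close>
 define r0 where "r0 = Min (insert D (r1 ` I))"
 have C': "1 <= C'" "\<And>q. q \<in> I ==> C q <= C'" proof -
  show "1 <= C'" using G by (auto simp: C'_def intro: sum_nonneg)
  show "C q <= C'" if "q \<in> I" for q using member_le_sum[of q I C] that I(2) G by (simp add: C'_def)
 qed
 have r0: "0 < r0" "r0 <= D" "\<And>q. q \<in> I ==> r0 <= r1 q" using I(2) D(1) G by (auto simp: r0_def)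
 show "\<exists>C\<ge>1. \<exists>r\<^sub>0>0. ennreal r\<^sub>0 <= (SUP x\<in>UNIV. SUP y\<in>UNIV. ennreal (d x y)) \<and>
     (\<forall>p\<in>A. \<forall>r. 0 < r \<and> r < r\<^sub>0 --> ennreal (inverse C * r powr Q) <= emeasure m (ms.mball p r) \<and>
       emeasure m (ms.mball p r) <= ennreal (C * r powr Q))"
 proof (rule exI[of _ C'], rule conjI[OF C'(1)], rule exI[of _ r0], intro conjI ballI allI impI)
  show "ennreal r0 <= (SUP x\<in>UNIV. SUP y\<in>UNIV. ennreal (d x y))"
   by (rule order_trans[OF ennreal_leI[OF r0(2)] D(2)])
  fix p r assume p: "p \<in> A" and r: "0 < r \<and> r < r0"
  obtain q where q: "q \<in> I" "p \<in> G q" using p I(3) by blast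
  have rq: "r < r1 q" using r r0(3)[OF q(1)] by simp
  have B: "ennreal (r powr Q) <= ennreal (C q) * emeasure m (db p r)" "emeasure m (db p r) <= ennreal (C q * r powr Q)"
   using G[of q] q(2) r rq by auto
  have "ennreal (r powr Q) <= ennreal C' * emeasure m (db p r)"
   by (rule order_trans[OF B(1)]) (intro mult_right_mono ennreal_leI C'(2) q(1); simp)
  then have "ennreal (inverse C') * ennreal (r powr Q) <= ennreal (inverse C') * (ennreal C' * emeasure m (db p r))"
   by (intro mult_left_mono) auto
  then show "ennreal (inverse C' * r powr Q) <= emeasure m (ms.mball p r)"
   using C'(1) by (simp add: mball_db ennreal_mult flip: mult.assoc) (simp flip: ennreal_mult)
  have "C q * r powr Q <= C' * r powr Q" by (intro mult_right_mono C'(2) q(1)) simp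
  then show "emeasure m (ms.mball p r) <= ennreal (C' * r powr Q)"
   unfolding mball_db using B(2) ennreal_leI order_trans by blast
 qed (rule r0)
qed

end

theorem corollary4p8:
  fixes \<A> :: "('a::{t2_space, second_countable_topology}, 'n::finite) chart set"
    and \<xi> :: "'a \<Rightarrow> real ^ 'k \<Rightarrow> ('a, 'n) tangent" and N :: "'a \<Rightarrow> real ^ 'k \<Rightarrow> real" and Q :: real
    and m :: "'a measure"
  assumes "sub_finsler_manifold \<A> \<xi> N" and "sf_complete \<A> \<xi> N" and "equiregular \<A> \<xi>"
    and "\<And>q. homogeneous_dim \<A> \<xi> q = Q" and "sets m = sets borel"
  shows "bounded_measure \<A> m \<longleftrightarrow> locally_ahlfors_regular UNIV (sf_dist \<A> \<xi> N) Q m" proof -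
 interpret equireg \<A> \<xi> N Q by unfold_locales (rule assms)+
 show ?thesis using ahlfors_imp_bounded[OF assms(5)] bounded_imp_ahlfors[OF assms(5)] by blast
qed

end
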